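(* Let $\nu=\min_{s\in\mathbb{R}}\frac{\sin s}{s}$. For $d>0$ let $A_d:L^2(\mathbb{H})\to L^2(\mathbb{H})$ be the operator averaging a function over hyperbolic circles of radius $d$, and let $M(A_d)=\sup_{\|f\|_2=1}\langle A_d f,f\rangle$ and $m(A_d)=\inf_{\|f\|_2=1}\langle A_d f,f\rangle$. Then $$\lim_{d\to\infty}\left(1-\frac{M(A_d)}{m(A_d)}\right)=1-\frac{1}{\nu}\approx 5.6.$$
   Context: $\mathbb{H}$ is the hyperbolic plane of constant curvature $-1$, modelled on the Poincaré disk $D=\{z=x+iy\in\mathbb{C}:|z|<1\}$ with Riemannian measure $dz=4(1-x^2-y^2)^{-2}\,dx\,dy$; $L^2(\mathbb{H})$ is the space of complex-valued square-integrable functions with respect to this measure, with its usual inner product. For $f\in L^2(\mathbb{H})$, $d>0$ and $x\in\mathbb{H}$, $(A_d f)(x)$ is the average of $f$ over the hyperbolic circle of radius $d$ centred at $x$ (with respect to the rotation-invariant probability measure on that circle). The operator $A_d$ is bounded and self-adjoint on $L^2(\mathbb{H})$, so the numbers $\langle A_d f,f\rangle$ are real. The expression $\frac{\sin s}{s}$ is understood to equal $1$ at $s=0$. *)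

theory Defs
  imports "HOL-Complex_Analysis.Complex_Analysis" "HOL-Probability.Probability"
begin

section \<open>The Poincare disk\<close>

abbreviation poincare_disk :: "complex set" where
  "poincare_disk \<equiv> ball 0 1"

definition hyp_area :: "complex measure" where
  "hyp_area = density (restrict_space lborel poincare_disk)
                (\<lambda>z. ennreal (4 / (1 - (norm z)\<^sup>2)\<^sup>2))"

text \<open>The distance of curvature \<open>-1\<close>, i.e. the one induced by the line element
  \<open>2 |dz| / (1 - |z|^2)\<close>.\<close>

definition hyp_dist :: "complex \<Rightarrow> complex \<Rightarrow> real" where
  "hyp_dist x y = arcosh (1 + 2 * (norm (x - y))\<^sup>2 / ((1 - (norm x)\<^sup>2) * (1 - (norm y)\<^sup>2)))"

definition hyp_circle :: "complex \<Rightarrow> real \<Rightarrow> complex set" where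
  "hyp_circle x d = {y \<in> poincare_disk. hyp_dist x y = d}"

text \<open>\<open>Moebius_function 0 x\<close> is an isometry of the disk taking \<open>x\<close> to \<open>0\<close>, with inverse
  \<open>Moebius_function 0 (- x)\<close>; conjugating the Euclidean rotations about \<open>0\<close> by it gives the
  hyperbolic rotations about \<open>x\<close>.\<close>

definition hyp_rotation :: "complex \<Rightarrow> real \<Rightarrow> complex \<Rightarrow> complex" where
  "hyp_rotation x t z = Moebius_function 0 (- x) (cis t * Moebius_function 0 x z)"

text \<open>The circle of hyperbolic radius \<open>d\<close> about \<open>0\<close> has Euclidean radius \<open>tanh (d / 2)\<close>. The
  lemmas below confirm that this is a probability measure concentrated on \<open>hyp_circle x d\<close> and
  invariant under the rotations about \<open>x\<close>. Its sigma-algebra lives on the disk, so that it fits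
  functions that are measurable with respect to \<open>hyp_area\<close>, which need not be Borel on all
  of the complex plane.\<close>

definition circle_param :: "complex \<Rightarrow> real \<Rightarrow> real \<Rightarrow> complex" where
  "circle_param x d t = Moebius_function 0 (- x) (of_real (tanh (d / 2)) * cis t)"

definition circle_measure :: "complex \<Rightarrow> real \<Rightarrow> complex measure" where
  "circle_measure x d =
     distr (uniform_measure lborel {0..2 * pi}) (restrict_space borel poincare_disk)
       (circle_param x d)"


section \<open>Square-integrable functions and the averaging operators\<close>

text \<open>Elements of the \<open>L^2\<close> space are represented by functions rather than by almost-everywhere
  classes; values outside the disk are irrelevant.\<close>

definition L2_hyp :: "(complex \<Rightarrow> complex) set" where
  "L2_hyp = {f \<in> borel_measurable hyp_area. integrable hyp_area (\<lambda>z. (norm (f z))\<^sup>2)}"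

definition hyp_inner :: "(complex \<Rightarrow> complex) \<Rightarrow> (complex \<Rightarrow> complex) \<Rightarrow> complex" where
  "hyp_inner f g = (LINT z|hyp_area. f z * cnj (g z))"

definition hyp_norm :: "(complex \<Rightarrow> complex) \<Rightarrow> real" where
  "hyp_norm f = sqrt (LINT z|hyp_area. (norm (f z))\<^sup>2)"

text \<open>For \<open>f\<close> in \<open>L2_hyp\<close> the circle integral exists for almost every \<open>x\<close>, and its class
  depends only on the class of \<open>f\<close>.\<close>

definition avg_op :: "real \<Rightarrow> (complex \<Rightarrow> complex) \<Rightarrow> complex \<Rightarrow> complex" where
  "avg_op d f x = (LINT y|circle_measure x d. f y)"

text \<open>The supremum and infimum of the numerical range of a bounded self-adjoint operator, for
  which \<open>hyp_inner (T f) f\<close> is real.\<close>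

definition num_sup :: "((complex \<Rightarrow> complex) \<Rightarrow> complex \<Rightarrow> complex) \<Rightarrow> real" where
  "num_sup T = (SUP f \<in> {f \<in> L2_hyp. hyp_norm f = 1}. Re (hyp_inner (T f) f))"

definition num_inf :: "((complex \<Rightarrow> complex) \<Rightarrow> complex \<Rightarrow> complex) \<Rightarrow> real" where
  "num_inf T = (INF f \<in> {f \<in> L2_hyp. hyp_norm f = 1}. Re (hyp_inner (T f) f))"

definition sinc_min :: real where
  "sinc_min = (LEAST v. v \<in> range sinc)"


section \<open>Consistency of the definitions\<close>

lemma sinc_min_attained: "sinc_min \<in> range sinc" "sinc_min \<le> sinc s"
proof -
  let ?K = "{- 3 * pi .. 3 * pi}"
  define g where "g = sinc"
  have "continuous_on ?K g"
    unfolding g_def by (intro continuous_at_imp_continuous_on ballI isCont_sinc)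
  moreover have "compact ?K" "?K \<noteq> {}" by auto
  ultimately obtain a where a: "\<And>y. y \<in> ?K \<Longrightarrow> g a \<le> g y"
    using continuous_attains_inf[of ?K g] by blast
  have "3 / 2 * pi \<in> ?K" using pi_gt_zero by auto
  then have a1: "g a \<le> - 1 / (3 / 2 * pi)"
    using a[of "3 / 2 * pi"] sin_3over2_pi by (simp add: g_def)
  have min: "g a \<le> g y" for y
  proof (cases "y \<in> ?K")
    case False
    then have y: "\<bar>y\<bar> > 3 * pi" by (auto simp: abs_if)
    then have y0: "y \<noteq> 0" using pi_gt_zero by linarith
    have "\<bar>g y\<bar> \<le> 1 / \<bar>y\<bar>"
      using y0 by (simp add: g_def abs_divide divide_right_mono)
    also have "\<dots> \<le> 1 / (3 / 2 * pi)"
      using y pi_gt_zero by (intro divide_left_mono mult_pos_pos) linarith+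
    finally show ?thesis using a1 by linarith
  qed (rule a)
  then have "sinc_min = g a"
    unfolding sinc_min_def g_def[symmetric] by (intro Least_equality) auto
  with min have "sinc_min \<in> range g" "sinc_min \<le> g s" by auto
  then show "sinc_min \<in> range sinc" "sinc_min \<le> sinc s"
    unfolding g_def by blast+
qed

lemma norm_tanh_cis_less_1: "norm (complex_of_real (tanh r) * cis t) < 1"
  using tanh_real_lt_1[of r] tanh_real_gt_neg1[of r]
  by (simp add: norm_mult abs_less_iff)

lemma circle_param_in_disk: "norm x < 1 \<Longrightarrow> norm (circle_param x d t) < 1"
  unfolding circle_param_def
  by (rule Moebius_function_norm_lt_1) (simp_all only: norm_tanh_cis_less_1 norm_minus_cancel)

lemma circle_param_measurable:
  assumes "norm x < 1"
  shows "circle_param x d \<in> borel \<rightarrow>\<^sub>M restrict_space borel poincare_disk"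
proof (rule measurable_restrict_space2)
  show "circle_param x d \<in> space borel \<rightarrow> poincare_disk"
    using circle_param_in_disk[OF assms] by auto
  show "circle_param x d \<in> borel \<rightarrow>\<^sub>M borel"
    unfolding circle_param_def Moebius_function_def cis_conv_exp by measurable
qed

lemma prob_space_circle_measure:
  assumes "norm x < 1"
  shows "prob_space (circle_measure x d)"
proof -
  have "prob_space (uniform_measure lborel {0..2 * pi})"
    by (rule prob_space_uniform_measure) auto
  then show ?thesis unfolding circle_measure_def
    by (rule prob_space.prob_space_distr) (use circle_param_measurable[OF assms] in simp)
qed

lemma Moebius_circle_param:
  assumes "norm x < 1"
  shows "Moebius_function 0 x (circle_param x d t) = of_real (tanh (d / 2)) * cis t"
  unfolding circle_param_def
  by (rule Moebius_function_compose) (use assms norm_tanh_cis_less_1 in auto)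

lemma hyp_rotation_circle_param:
  assumes "norm x < 1"
  shows "hyp_rotation x s (circle_param x d t) = circle_param x d (s + t)"
  unfolding hyp_rotation_def Moebius_circle_param[OF assms]
  by (simp only: circle_param_def mult.left_commute[of "cis s"] cis_mult)

lemma tanh_artanh_real:
  assumes "0 \<le> w" "w < 1"
  shows "tanh (artanh w) = (w :: real)"
proof -
  have "exp (- 2 * artanh w) = (1 - w) / (1 + w)"
    using assms by (simp add: artanh_def exp_minus)
  then have "tanh (artanh w) = (1 - (1 - w) / (1 + w)) / (1 + (1 - w) / (1 + w))"
    using tanh_real_altdef[of "artanh w"] by simp
  also have "\<dots> = w"
    using assms by (simp add: divide_simps)
  finally show ?thesis .
qed

lemma artanh_real_nonneg:
  assumes "0 \<le> w" "w < 1"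
  shows "artanh (w :: real) \<ge> 0"
  using assms by (simp add: artanh_def)

lemma hyp_dist_Moebius:
  assumes "norm x < 1" "norm y < 1"
  shows "hyp_dist x y = 2 * artanh (norm (Moebius_function 0 x y))"
proof -
  define w where "w = norm (Moebius_function 0 x y)"
  define Q where "Q = (1 - (norm x)\<^sup>2) * (1 - (norm y)\<^sup>2)"
  have Q: "Q > 0"
    using assms by (simp add: Q_def power_less_one_iff abs_square_less_1)
  have N: "(norm (1 - cnj x * y))\<^sup>2 = (norm (x - y))\<^sup>2 + Q"
    unfolding Q_def cmod_power2 by (simp add: algebra_simps power2_eq_square)
  have w: "0 \<le> w" "w < 1"
    unfolding w_def using Moebius_function_norm_lt_1[OF assms] by auto
  have w2: "w\<^sup>2 = (norm (x - y))\<^sup>2 / ((norm (x - y))\<^sup>2 + Q)"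
    unfolding w_def Moebius_function_simple norm_divide power_divide N
    by (simp add: norm_minus_commute)
  define a where "a = (norm (x - y))\<^sup>2"
  have a: "a \<ge> 0" by (simp add: a_def)
  define u where "u = artanh w"
  have u: "u \<ge> 0" "tanh u = w"
    unfolding u_def using w tanh_artanh_real artanh_real_nonneg by auto
  have "a + Q > 0" using Q a by linarith
  then have "1 + w\<^sup>2 = (2 * a + Q) / (a + Q)" "1 - w\<^sup>2 = Q / (a + Q)"
    unfolding w2 a_def[symmetric] by (simp_all add: field_simps)
  then have "(1 + w\<^sup>2) / (1 - w\<^sup>2) = (2 * a + Q) / Q"
    using \<open>a + Q > 0\<close> by (simp only: divide_divide_eq_left divide_divide_eq_right) simp
  also have "\<dots> = 1 + 2 * a / Q"
    using Q by (simp add: add_divide_distrib)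
  finally have "1 + 2 * a / Q = (1 + w\<^sup>2) / (1 - w\<^sup>2)" ..
  also have "\<dots> = cosh (2 * u)"
  proof -
    have c: "cosh u \<noteq> 0" using cosh_real_pos[of u] by linarith
    have "1 + w\<^sup>2 = ((cosh u)\<^sup>2 + (sinh u)\<^sup>2) / (cosh u)\<^sup>2"
      "1 - w\<^sup>2 = ((cosh u)\<^sup>2 - (sinh u)\<^sup>2) / (cosh u)\<^sup>2"
      unfolding u(2)[symmetric] tanh_def using c
      by (simp_all add: power_divide add_divide_distrib diff_divide_distrib)
    then show ?thesis
      using c by (simp add: cosh_double hyperbolic_pythagoras)
  qed
  finally have "hyp_dist x y = arcosh (cosh (2 * u))"
    by (simp add: hyp_dist_def a_def Q_def)
  then show ?thesis using u by (simp add: arcosh_cosh_real u_def w_def)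
qed

lemma hyp_circle_eq:
  assumes x: "norm x < 1" and d: "d > 0"
  shows "hyp_circle x d = circle_param x d ` {0..2 * pi}"
proof (intro equalityI subsetI)
  fix y assume "y \<in> hyp_circle x d"
  then have y: "norm y < 1" and dist: "hyp_dist x y = d" by (auto simp: hyp_circle_def)
  define w where "w = Moebius_function 0 x y"
  have "norm w < 1" unfolding w_def by (rule Moebius_function_norm_lt_1[OF x y])
  then have nw: "norm w = tanh (d / 2)"
    using dist hyp_dist_Moebius[OF x y] by (auto simp: w_def[symmetric] tanh_artanh_real)
  have "(Re w / norm w)\<^sup>2 + (Im w / norm w)\<^sup>2 = 1"
    using nw d by (simp add: power_divide add_divide_distrib[symmetric] cmod_power2[symmetric])
  then obtain t where t: "0 \<le> t" "t < 2 * pi" "Re w / norm w = cos t" "Im w / norm w = sin t"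
    by (rule sincos_total_2pi)
  have "w = of_real (tanh (d / 2)) * cis t"
    using t nw d by (auto simp: complex_eq_iff field_simps)
  moreover have "y = Moebius_function 0 (- x) w"
    unfolding w_def by (rule Moebius_function_compose[symmetric]) (use x y in auto)
  ultimately have "y = circle_param x d t" by (simp add: circle_param_def)
  then show "y \<in> circle_param x d ` {0..2 * pi}" using t by auto
next
  fix y assume "y \<in> circle_param x d ` {0..2 * pi}"
  then obtain t where t: "y = circle_param x d t" by auto
  have "hyp_dist x y = 2 * artanh (norm (complex_of_real (tanh (d / 2)) * cis t))"
    unfolding t hyp_dist_Moebius[OF x circle_param_in_disk[OF x]] Moebius_circle_param[OF x] ..
  also have "\<dots> = d" using d by (simp add: norm_mult artanh_tanh_real)
  finally show "y \<in> hyp_circle x d"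
    using circle_param_in_disk[OF x] by (simp add: hyp_circle_def t)
qed

lemma circle_measure_hyp_circle:
  assumes x: "norm x < 1" and d: "d > 0"
  shows "emeasure (circle_measure x d) (hyp_circle x d) = 1"
proof -
  have cont: "continuous_on {0..2 * pi} (circle_param x d)"
  proof -
    have c: "continuous_on UNIV (\<lambda>t. complex_of_real (tanh (d / 2)) * cis t)"
      by (intro continuous_intros)
    have m: "continuous_on poincare_disk (Moebius_function 0 (- x))"
      by (intro holomorphic_on_imp_continuous_on Moebius_function_holomorphic) (use x in simp)
    have "continuous_on UNIV (circle_param x d)"
      unfolding circle_param_def
      by (rule continuous_on_compose2[OF m c]) (use norm_tanh_cis_less_1 in auto)
    then show ?thesis by (rule continuous_on_subset) simp
  qed
  then have "compact (hyp_circle x d)"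
    unfolding hyp_circle_eq[OF assms] by (rule compact_continuous_image) simp
  then have S: "hyp_circle x d \<in> sets (restrict_space borel poincare_disk)"
    by (subst sets_restrict_space_iff) (auto simp: hyp_circle_def borel_compact)
  have U: "emeasure lborel {0..2 * pi} \<noteq> 0" "emeasure lborel {0..2 * pi} \<noteq> \<infinity>" by auto
  have sub: "{0..2 * pi} \<subseteq> circle_param x d -` hyp_circle x d"
    unfolding hyp_circle_eq[OF assms] by auto
  have B: "circle_param x d -` hyp_circle x d \<in> sets borel"
    using measurable_sets[OF circle_param_measurable[OF x] S] by simp
  have "emeasure (circle_measure x d) (hyp_circle x d)
      = emeasure (uniform_measure lborel {0..2 * pi}) (circle_param x d -` hyp_circle x d)"
    unfolding circle_measure_def
    using circle_param_measurable[OF x] S by (subst emeasure_distr) auto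
  also have "\<dots> = emeasure lborel {0..2 * pi} / emeasure lborel {0..2 * pi}"
    using B sub by (subst emeasure_uniform_measure) (auto simp: Int_absorb2)
  also have "\<dots> = 1" using U by (simp add: ennreal_divide_self)
  finally show ?thesis .
qed

lemma emeasure_lborel_vimage_plus:
  fixes A :: "real set"
  assumes "A \<in> sets borel"
  shows "emeasure lborel ((\<lambda>t. c + t) -` A) = emeasure lborel A"
proof -
  have "emeasure lborel A = emeasure (distr lborel borel ((+) c)) A"
    by (simp only: lborel_distr_plus)
  also have "\<dots> = emeasure lborel ((+) c -` A)"
    using assms by (subst emeasure_distr) auto
  finally show ?thesis by simp
qed

lemma circle_measure_rotation_invariant:
  assumes x: "norm x < 1"
  shows "distr (circle_measure x d) (circle_measure x d) (hyp_rotation x s) = circle_measure x d"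
proof -
  let ?D = "restrict_space borel poincare_disk" and ?U = "uniform_measure lborel {0..2 * pi}"
  let ?p = "circle_param x d"
  have "(cos s)\<^sup>2 + (sin s)\<^sup>2 = 1" by simp
  then obtain r where r: "0 \<le> r" "r < 2 * pi" "cos s = cos r" "sin s = sin r"
    by (rule sincos_total_2pi)
  then have "cis s = cis r" by (simp add: complex_eq_iff)
  then have rot: "hyp_rotation x s = hyp_rotation x r" by (simp add: hyp_rotation_def fun_eq_iff)
  have p: "?p \<in> borel \<rightarrow>\<^sub>M ?D" by (rule circle_param_measurable[OF x])
  have per: "?p (t + 2 * pi) = ?p t" for t
    by (simp add: circle_param_def cis_mult[symmetric])
  have R: "hyp_rotation x r \<in> ?D \<rightarrow>\<^sub>M ?D"
  proof (rule measurable_restrict_space2)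
    show "hyp_rotation x r \<in> space ?D \<rightarrow> poincare_disk"
      unfolding hyp_rotation_def
      using x by (auto simp: norm_mult space_restrict_space intro!: Moebius_function_norm_lt_1)
    have "hyp_rotation x r \<in> borel \<rightarrow>\<^sub>M borel"
      unfolding hyp_rotation_def Moebius_function_def by measurable
    then show "hyp_rotation x r \<in> ?D \<rightarrow>\<^sub>M borel" by (rule measurable_restrict_space1)
  qed
  have sets_cm: "sets (circle_measure x d) = sets ?D" by (simp add: circle_measure_def)
  have "distr (circle_measure x d) (circle_measure x d) (hyp_rotation x s)
      = distr (distr ?U ?D ?p) ?D (hyp_rotation x r)"
    unfolding rot by (rule distr_cong) (simp_all add: circle_measure_def)
  also have "\<dots> = distr ?U ?D (hyp_rotation x r \<circ> ?p)"
    by (rule distr_distr) (use R p in auto)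
  also have "hyp_rotation x r \<circ> ?p = (\<lambda>t. ?p (r + t))"
    using hyp_rotation_circle_param[OF x] by (simp add: fun_eq_iff)
  also have "distr ?U ?D (\<lambda>t. ?p (r + t)) = distr ?U ?D ?p"
  proof (rule measure_eqI)
    fix A assume "A \<in> sets (distr ?U ?D (\<lambda>t. ?p (r + t)))"
    then have A: "A \<in> sets ?D" by simp
    define B where "B = ?p -` A"
    have B: "B \<in> sets borel" unfolding B_def using measurable_sets[OF p A] by simp
    have perB: "t + 2 * pi \<in> B \<longleftrightarrow> t \<in> B" for t by (simp add: B_def per)
    have shift: "(\<lambda>t. r + t) \<in> borel_measurable borel" by simp
    have pr: "(\<lambda>t. ?p (r + t)) \<in> borel \<rightarrow>\<^sub>M ?D"
      by (rule measurable_compose[OF shift p])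
    have Bv: "(\<lambda>t. r + t) -` B \<in> sets borel" using measurable_sets[OF shift B] by simp
    have "emeasure lborel ({0..2 * pi} \<inter> (\<lambda>t. r + t) -` B)
        = emeasure lborel ((\<lambda>t. r + t) -` ({r..r + 2 * pi} \<inter> B))"
      by (rule arg_cong[where f = "emeasure lborel"]) auto
    also have "\<dots> = emeasure lborel ({r..r + 2 * pi} \<inter> B)"
      by (rule emeasure_lborel_vimage_plus) (use B in simp)
    also have "{r..r + 2 * pi} \<inter> B = ({r..2 * pi} \<inter> B) \<union> ({2 * pi<..2 * pi + r} \<inter> B)"
      using r by auto
    also have "emeasure lborel \<dots>
        = emeasure lborel ({r..2 * pi} \<inter> B) + emeasure lborel ({2 * pi<..2 * pi + r} \<inter> B)"
      by (rule plus_emeasure[symmetric]) (use B in auto)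
    also have "emeasure lborel ({2 * pi<..2 * pi + r} \<inter> B)
        = emeasure lborel ((\<lambda>t. 2 * pi + t) -` ({2 * pi<..2 * pi + r} \<inter> B))"
      by (rule emeasure_lborel_vimage_plus[symmetric]) (use B in simp)
    also have "(\<lambda>t. 2 * pi + t) -` ({2 * pi<..2 * pi + r} \<inter> B) = {0<..r} \<inter> B"
      using perB by (auto simp: add.commute)
    also have "emeasure lborel ({0<..r} \<inter> B) = emeasure lborel ({0..<r} \<inter> B)"
    proof (rule emeasure_eq_AE)
      show "AE t in lborel. t \<in> {0<..r} \<inter> B \<longleftrightarrow> t \<in> {0..<r} \<inter> B"
        using AE_lborel_singleton[of 0] AE_lborel_singleton[of r] by eventually_elim auto
    qed (use B in auto)
    also have "emeasure lborel ({r..2 * pi} \<inter> B) + emeasure lborel ({0..<r} \<inter> B)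
        = emeasure lborel (({r..2 * pi} \<inter> B) \<union> ({0..<r} \<inter> B))"
      by (rule plus_emeasure) (use B in auto)
    also have "({r..2 * pi} \<inter> B) \<union> ({0..<r} \<inter> B) = {0..2 * pi} \<inter> B"
      using r by auto
    finally have "emeasure ?U ((\<lambda>t. r + t) -` B) = emeasure ?U B"
      using B Bv by simp
    then show "emeasure (distr ?U ?D (\<lambda>t. ?p (r + t))) A = emeasure (distr ?U ?D ?p) A"
      using p pr A by (simp add: emeasure_distr B_def vimage_def)
  qed simp
  finally show ?thesis by (simp add: circle_measure_def)
qed

end

theory Submission
  imports Defs "HOL-Real_Asymp.Real_Asymp"
begin

text \<open>Put \<open>a = sinh (d / 2)\<close>. The powers \<open>P\<^bsup>1/2 + il\<^esup>\<close> of the Poisson kernel are eigenfunctions of \<open>A\<^sub>d\<close>; the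
  eigenvalue is the value \<open>spherical l a\<close> of a spherical function. The radial eigenfunctions just fail to be
  square-integrable: cut off to a disk, they have a mass that grows polynomially in the radius of the disk, so for
  suitable radii the boundary layer is negligible and the numerical range comes arbitrarily close to
  \<open>spherical l a\<close>. Conversely, if \<open>c1 * spherical l a + c2 \<ge> 0\<close> for all \<open>l\<close>, then
  \<open>c1 * A\<^sub>d + c2\<close> is a nonnegative form: for continuous \<open>f\<close> of compact support, the correlation of \<open>f\<close> with the
  circle means of \<open>c1 * A\<^sub>d f + c2 * f\<close>, as a function of their radius, has nonnegative
  spherical transform, which forces its value at radius \<open>0\<close> to be nonnegative. This replaces the Plancherel theorem.
  Hence \<open>M(A\<^sub>d)\<close> and \<open>m(A\<^sub>d)\<close> are the supremum, attained at \<open>l = 0\<close>, and the infimum of \<open>spherical l a\<close> over \<open>l\<close>.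
  Finally \<open>spherical l a\<close> is \<open>d / (pi * a) * sinc (l * d)\<close> up to an error \<open>O(1 / a)\<close>, uniformly in \<open>l\<close>, so that
  \<open>M(A\<^sub>d) / m(A\<^sub>d)\<close> tends to \<open>1 / \<nu>\<close>.\<close>

section \<open>Spherical functions and their asymptotics\<close>

text \<open>Everything turns on the planar form of the spherical function:
  \<open>spherical l a\<close> is the mean, along the Euclidean circle of radius \<open>a\<close>,
  of a function of the height \<open>b = a * sin t\<close> alone, namely
  \<open>cos (2 * l * arsinh b) / sqrt (1 + b^2)\<close>. So the asymptotics in \<open>a\<close>
  reduce to a one-dimensional integral, and the spherical transform of a radial function becomes
  integration over parallel lines in the plane followed by a cosine transform. The value of a
  correlation at radius 0 makes sense only for continuous functions, while the numerical range runs
  over all of L^2. The gap is closed by density. Continuity of the form in L^2 holds because, when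
  the centre is distributed by area and the angle uniformly, the point on the circle is again
  distributed by area. The factor d / (pi * a) is common to M and m and cancels in the quotient.
  Only the relative error counts, and it is of order 1 / d although both M and m decay
  exponentially.\<close>

text \<open>The argument \<open>a\<close> is \<open>sinh (d / 2)\<close> for a circle of radius \<open>d\<close>. The usual integral of
  \<open>P\<^bsup>1/2 + il\<^esup>\<close>, \<open>P\<close> the Poisson kernel, takes this form after a substitution on the circle; see
  \<open>integral_poisson_pow\<close>.\<close>

definition spherical :: "real \<Rightarrow> real \<Rightarrow> real" where
  "spherical l a = integral {0..2 * pi} (\<lambda>t. cos (2 * l * arsinh (a * sin t)) / sqrt (1 + (a * sin t)\<^sup>2)) / (2 * pi)"

lemma one_plus_square_pos: "0 < 1 + x\<^sup>2" for x :: real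
  by (simp add: add_pos_nonneg)

lemma continuous_on_spherical_integrand:
  "continuous_on A (\<lambda>t. cos (2 * l * arsinh (a * sin t)) / sqrt (1 + (a * sin t)\<^sup>2))" for a l :: real
  by (intro continuous_intros) (use less_imp_neq[OF one_plus_square_pos] in \<open>auto simp: eq_commute[of 0]\<close>)

text \<open>The point \<open>sin t\<close> moves from 0 to 1, down to -1 and back to 0, so it sweeps
  [-1, 1] twice; the absolute value makes both passes count with the same sign. On each of the three
  monotone pieces this is the substitution \<open>b = sin t\<close>.\<close>

lemma has_integral_abs_cos:
  fixes K G :: "real \<Rightarrow> real"
  assumes "\<And>b. \<bar>b\<bar> \<le> 1 \<Longrightarrow> (K has_field_derivative G b) (at b)"
  shows "((\<lambda>t. \<bar>cos t\<bar> * G (sin t)) has_integral 2 * (K 1 - K (- 1))) {0..2 * pi}"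
proof -
  have d: "((\<lambda>t. K (sin t)) has_field_derivative cos t * G (sin t)) (at t)" for t
  proof -
    have "(K has_field_derivative G (sin t)) (at (sin t))" by (rule assms) simp
    from DERIV_chain2[OF this DERIV_sin] show ?thesis by (simp add: mult.commute)
  qed
  have 1: "((\<lambda>t. cos t * G (sin t)) has_integral K (sin (pi/2)) - K (sin 0)) {0..pi/2}"
    by (intro fundamental_theorem_of_calculus)
      (auto intro!: has_field_derivative_at_within[OF d] simp: has_real_derivative_iff_has_vector_derivative[symmetric])
  have 2: "((\<lambda>t. cos t * G (sin t)) has_integral K (sin (3/2*pi)) - K (sin (pi/2))) {pi/2..3/2*pi}"
    by (intro fundamental_theorem_of_calculus)
      (auto intro!: has_field_derivative_at_within[OF d] simp: has_real_derivative_iff_has_vector_derivative[symmetric])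
  have 3: "((\<lambda>t. cos t * G (sin t)) has_integral K (sin (2*pi)) - K (sin (3/2*pi))) {3/2*pi..2*pi}"
    by (intro fundamental_theorem_of_calculus)
      (auto intro!: has_field_derivative_at_within[OF d] simp: has_real_derivative_iff_has_vector_derivative[symmetric])
  have s: "sin (3/2*pi) = - 1" using sin_3over2_pi by simp
  have c1: "0 \<le> cos t" if "t \<in> {0..pi/2}" for t using that by (auto intro!: cos_ge_zero)
  have c2: "cos t \<le> 0" if "t \<in> {pi/2..3/2*pi}" for t
  proof -
    have "0 \<le> cos (t - pi)" using that by (intro cos_ge_zero) auto
    then show ?thesis by simp
  qed
  have c3: "0 \<le> cos t" if "t \<in> {3/2*pi..2*pi}" for t
  proof -
    have "0 \<le> cos (t - 2*pi)" using that by (intro cos_ge_zero) auto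
    then show ?thesis by (simp add: cos_diff)
  qed
  have 1: "((\<lambda>t. \<bar>cos t\<bar> * G (sin t)) has_integral K 1 - K 0) {0..pi/2}"
    using 1 by (rule has_integral_eq_rhs[OF has_integral_eq[rotated]]) (use c1 in auto)
  have 2: "((\<lambda>t. \<bar>cos t\<bar> * G (sin t)) has_integral K 1 - K (-1)) {pi/2..3/2*pi}"
    using has_integral_neg[OF 2] by (rule has_integral_eq_rhs[OF has_integral_eq[rotated]]) (use c2 s in auto)
  have 3: "((\<lambda>t. \<bar>cos t\<bar> * G (sin t)) has_integral K 0 - K (-1)) {3/2*pi..2*pi}"
    using 3 by (rule has_integral_eq_rhs[OF has_integral_eq[rotated]]) (use c3 s in auto)
  have 12: "((\<lambda>t. \<bar>cos t\<bar> * G (sin t)) has_integral (K 1 - K 0) + (K 1 - K (-1))) {0..3/2*pi}"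
    by (rule has_integral_combine[OF _ _ 1 2]) auto
  have "((\<lambda>t. \<bar>cos t\<bar> * G (sin t)) has_integral ((K 1 - K 0) + (K 1 - K (-1))) + (K 0 - K (-1))) {0..2*pi}"
    by (rule has_integral_combine[OF _ _ 12 3]) auto
  then show ?thesis by (simp add: algebra_simps)
qed

text \<open>With \<open>\<bar>cos t\<bar>\<close> in place of \<open>1\<close> in the numerator, the integrand has an elementary antiderivative.\<close>

lemma spherical_asymp:
  assumes a: "a > 0"
  shows "\<bar>spherical l a - 2 * arsinh a / (pi * a) * sinc (2 * l * arsinh a)\<bar> \<le> 1 / a"
proof -
  define G where "G = (\<lambda>b. cos (2 * l * arsinh (a * b)) / sqrt (1 + (a * b)\<^sup>2))"
  \<comment> \<open>\<open>arsinh (a * b)\<close> has derivative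
    \<open>a / sqrt (1 + (a * b)^2)\<close>, so \<open>K\<close> is an antiderivative of
    \<open>G\<close>; for \<open>l = 0\<close> the sine divided by its frequency is replaced by its
    limit.\<close>
  define K where "K = (\<lambda>b. if l = 0 then arsinh (a * b) / a else sin (2 * l * arsinh (a * b)) / (2 * l * a))"
  have K: "(K has_field_derivative G b) (at b)" for b
  proof -
    have ar: "((\<lambda>b. arsinh (a * b)) has_field_derivative (a / sqrt (1 + (a * b)\<^sup>2))) (at b)"
    proof -
      have "((\<lambda>b. a * b) has_field_derivative a) (at b)" by (auto intro!: derivative_eq_intros)
      from DERIV_chain2[OF arsinh_real_has_field_derivative this] show ?thesis by (simp add: add.commute)
    qed
    show ?thesis
    proof (cases "l = 0")
      case True
      then show ?thesis unfolding K_def G_def using a DERIV_cdivide[OF ar, of a] by simp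
    next
      case False
      have "((\<lambda>b. sin (2 * l * arsinh (a * b)) / (2 * l * a)) has_field_derivative
          (cos (2 * l * arsinh (a * b)) * (2 * l * (a / sqrt (1 + (a * b)\<^sup>2)))) / (2 * l * a)) (at b)"
        by (rule DERIV_cdivide[OF DERIV_fun_sin[OF DERIV_cmult[OF ar]]])
      then show ?thesis unfolding K_def G_def using False a by simp
    qed
  qed
  have K1: "2 * (K 1 - K (-1)) / (2 * pi) = 2 * arsinh a / (pi * a) * sinc (2 * l * arsinh a)"
    using a by (cases "l = 0") (auto simp: K_def field_simps arsinh_minus_real)
  have int1: "((\<lambda>t. \<bar>cos t\<bar> * G (sin t)) has_integral 2 * (K 1 - K (- 1))) {0..2 * pi}"
    by (rule has_integral_abs_cos[OF K])
  have int2: "((\<lambda>t. G (sin t)) has_integral integral {0..2*pi} (\<lambda>t. G (sin t))) {0..2 * pi}"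
    unfolding G_def by (intro integrable_integral integrable_continuous_real continuous_on_spherical_integrand)
  \<comment> \<open>\<open>G\<close> is large only where \<open>sin t\<close> is small, and there
    \<open>1 - |cos t| \<le> |sin t|\<close> cancels the bound \<open>1 / (a * |sin t|)\<close> on
    \<open>G\<close>. The result does not involve \<open>l\<close>, which is what makes the
    asymptotics uniform.\<close>
  have bd: "norm (G (sin t) - \<bar>cos t\<bar> * G (sin t)) \<le> 1 / a" for t
  proof (cases "sin t = 0")
    case True
    then have "(cos t)\<^sup>2 = 1" using sin_cos_squared_add[of t] by simp
    then have "\<bar>cos t\<bar> = 1" by (simp add: power2_eq_1_iff abs_if) auto
    then show ?thesis using a by simp
  next
    case False
    have c: "\<bar>cos t\<bar> \<le> 1" by simp
    have "1 - \<bar>cos t\<bar> \<le> 1 - (cos t)\<^sup>2"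
      using mult_left_mono[OF c abs_ge_zero[of "cos t"]] by (simp add: power2_eq_square)
    also have "\<dots> = \<bar>sin t\<bar> * \<bar>sin t\<bar>" using sin_squared_eq[of t] by (simp add: power2_eq_square)
    also have "\<dots> \<le> \<bar>sin t\<bar>" using mult_left_le[OF abs_sin_le_one abs_ge_zero] .
    finally have 1: "1 - \<bar>cos t\<bar> \<le> \<bar>sin t\<bar>" .
    have "a * \<bar>sin t\<bar> = sqrt ((a * sin t)\<^sup>2)" using a by (simp add: abs_mult)
    also have "\<dots> \<le> sqrt (1 + (a * sin t)\<^sup>2)" by (intro real_sqrt_le_mono) simp
    finally have 2: "a * \<bar>sin t\<bar> \<le> sqrt (1 + (a * sin t)\<^sup>2)" .
    have "norm (G (sin t) - \<bar>cos t\<bar> * G (sin t)) = (1 - \<bar>cos t\<bar>) * \<bar>G (sin t)\<bar>"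
    proof -
      have "G (sin t) - \<bar>cos t\<bar> * G (sin t) = (1 - \<bar>cos t\<bar>) * G (sin t)" by (simp add: left_diff_distrib)
      then show ?thesis using c by (simp only: real_norm_def abs_mult)
    qed
    also have "\<dots> \<le> \<bar>sin t\<bar> * (1 / (a * \<bar>sin t\<bar>))"
    proof (rule mult_mono[OF 1])
      have "\<bar>G (sin t)\<bar> \<le> 1 / sqrt (1 + (a * sin t)\<^sup>2)"
        unfolding G_def by (simp add: abs_divide abs_of_pos one_plus_square_pos divide_right_mono)
      also have "\<dots> \<le> 1 / (a * \<bar>sin t\<bar>)" using 2 a False by (intro divide_left_mono) (auto intro!: mult_pos_pos one_plus_square_pos)
      finally show "\<bar>G (sin t)\<bar> \<le> 1 / (a * \<bar>sin t\<bar>)" .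
    qed auto
    also have "\<dots> = 1 / a" using False by simp
    finally show ?thesis .
  qed
  have "norm (integral {0..2*pi} (\<lambda>t. G (sin t)) - 2 * (K 1 - K (- 1))) \<le> (1 / a) * measure lborel (cbox 0 (2 * pi))"
    using has_integral_bound[of "1 / a" "\<lambda>t. G (sin t) - \<bar>cos t\<bar> * G (sin t)" _ 0 "2 * pi"]
      has_integral_diff[OF int2 int1] a bd by (simp only: cbox_interval) simp
  then have "\<bar>integral {0..2*pi} (\<lambda>t. G (sin t)) - 2 * (K 1 - K (- 1))\<bar> / (2 * pi) \<le> 1 / a"
    using a by (simp add: field_simps)
  then show ?thesis unfolding K1[symmetric] spherical_def G_def
    by (simp add: diff_divide_distrib[symmetric])
qed

text \<open>The cosine is at most 1 and the remaining factor is positive. This places the top of the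
  numerical range at \<open>l = 0\<close> and bounds the infimum over \<open>l\<close> from
  below.\<close>

lemma spherical_abs_le_0: "\<bar>spherical l a\<bar> \<le> spherical 0 a"
proof -
  have "\<bar>integral {0..2 * pi} (\<lambda>t. cos (2 * l * arsinh (a * sin t)) / sqrt (1 + (a * sin t)\<^sup>2))\<bar>
     \<le> integral {0..2 * pi} (\<lambda>t. cos (2 * 0 * arsinh (a * sin t)) / sqrt (1 + (a * sin t)\<^sup>2))"
    unfolding real_norm_def[symmetric]
  proof (rule integral_norm_bound_integral)
    show "norm (cos (2 * l * arsinh (a * sin t)) / sqrt (1 + (a * sin t)\<^sup>2))
        \<le> cos (2 * 0 * arsinh (a * sin t)) / sqrt (1 + (a * sin t)\<^sup>2)" for t
      using one_plus_square_pos[of "a * sin t"] by (simp add: abs_divide abs_of_pos divide_right_mono)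
  qed (intro integrable_continuous_real continuous_on_spherical_integrand)+
  then show ?thesis by (simp add: spherical_def abs_divide divide_right_mono)
qed

text \<open>Multiplication by \<open>pi * a / d\<close> normalizes the main term to
  \<open>sinc\<close> and turns the error \<open>1 / a\<close> into \<open>pi / d\<close>. The error
  vanishes in the limit because the main term exceeds it by a factor of order
  \<open>d\<close>.\<close>

lemma spherical_approx:
  assumes d: "d > 0"
  shows "\<bar>pi * sinh (d / 2) / d * spherical l (sinh (d / 2)) - sinc (l * d)\<bar> \<le> pi / d"
proof -
  define a where "a = sinh (d / 2)"
  have a: "a > 0" using d by (simp add: a_def)
  have d2: "2 * arsinh a = d" by (simp add: a_def arsinh_sinh_real)
  define c where "c = pi * a / d"
  have c: "c > 0" using a d by (simp add: c_def)
  define S where "S = sinc (l * d)"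
  have e: "2 * l * arsinh a = l * d" by (simp add: d2[symmetric])
  have "\<bar>spherical l a - d / (pi * a) * S\<bar> \<le> 1 / a"
    using spherical_asymp[OF a, of l] unfolding e d2 S_def .
  then have "c * \<bar>spherical l a - d / (pi * a) * S\<bar> \<le> c * (1 / a)"
    using c by (intro mult_left_mono) auto
  moreover have "c * \<bar>spherical l a - d / (pi * a) * S\<bar> = \<bar>c * (spherical l a - d / (pi * a) * S)\<bar>"
    using c by (simp add: abs_mult)
  moreover have "c * (spherical l a - d / (pi * a) * S) = c * spherical l a - S"
    using a d by (simp add: c_def field_simps)
  moreover have "c * (1 / a) = pi / d" using a by (simp add: c_def)
  ultimately have "\<bar>c * spherical l a - S\<bar> \<le> pi / d" by simp
  then show ?thesis unfolding c_def a_def S_def .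
qed

lemma spherical_bdd_below: "bdd_below (range (\<lambda>l. spherical l a))"
proof (rule bdd_belowI)
  fix x assume "x \<in> range (\<lambda>l. spherical l a)"
  then show "- spherical 0 a \<le> x" using spherical_abs_le_0[of _ a] by (auto simp: abs_le_iff) (metis add.inverse_inverse neg_le_iff_le)
qed

text \<open>The normalizing factor \<open>c d\<close> cancels in the quotient. With it the numerator
  tends to \<open>sinc 0 = 1\<close>; the infimum tends to the minimum of \<open>sinc\<close>, since
  an error uniform in \<open>l\<close> passes to the infimum.\<close>

lemma spherical_ratio_limit:
  assumes "sinc_min \<noteq> 0"
  shows "((\<lambda>d. 1 - spherical 0 (sinh (d / 2)) / (INF l. spherical l (sinh (d / 2)))) \<longlongrightarrow> 1 - 1 / sinc_min) at_top"
proof -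
  define c where "c = (\<lambda>d. pi * sinh (d / 2) / d)"
  define I where "I = (\<lambda>d. INF l. spherical l (sinh (d / 2)))"
  have c: "c d > 0" if "d > 0" for d using that by (simp add: c_def)
  have app: "\<bar>c d * spherical l (sinh (d / 2)) - sinc (l * d)\<bar> \<le> pi / d" if d: "d > 0" for d l
    using spherical_approx[OF d] by (simp only: c_def)
  have lim0: "((\<lambda>d::real. pi / d) \<longlongrightarrow> 0) at_top" by real_asymp
  have "((\<lambda>d. c d * spherical 0 (sinh (d / 2)) - 1) \<longlongrightarrow> 0) at_top"
  proof (rule Lim_null_comparison[OF _ lim0])
    show "\<forall>\<^sub>F d in at_top. norm (c d * spherical 0 (sinh (d / 2)) - 1) \<le> pi / d"
      using eventually_gt_at_top[of 0] by eventually_elim (use app[of _ 0] in simp)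
  qed
  from tendsto_add[OF this tendsto_const[of 1]]
  have A: "((\<lambda>d. c d * spherical 0 (sinh (d / 2))) \<longlongrightarrow> 1) at_top" by simp
  have "((\<lambda>d. c d * I d - sinc_min) \<longlongrightarrow> 0) at_top"
  proof (rule Lim_null_comparison[OF _ lim0])
    show "\<forall>\<^sub>F d in at_top. norm (c d * I d - sinc_min) \<le> pi / d"
      using eventually_gt_at_top[of 0]
    proof eventually_elim
      case (elim d)
      obtain s where s: "sinc_min = sinc s" using sinc_min_attained(1) by blast
      \<comment> \<open>The minimum of \<open>sinc\<close> is attained at \<open>s\<close>, and the
        parameter \<open>l = s / d\<close> places the main term exactly there.\<close>
      have "I d \<le> spherical (s / d) (sinh (d / 2))"
        unfolding I_def by (rule cINF_lower[OF spherical_bdd_below]) simp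
      then have "c d * I d \<le> c d * spherical (s / d) (sinh (d / 2))"
        using c[OF elim] by (intro mult_left_mono) auto
      also have "\<dots> \<le> sinc_min + pi / d"
        using app[OF elim, of "s / d"] elim unfolding s by (auto simp: abs_le_iff split: if_splits)
      finally have 1: "c d * I d \<le> sinc_min + pi / d" .
      have "(sinc_min - pi / d) / c d \<le> I d"
        unfolding I_def
      proof (rule cINF_greatest)
        fix l
        have "sinc_min \<le> sinc (l * d)" by (rule sinc_min_attained(2))
        moreover have "sinc (l * d) - pi / d \<le> c d * spherical l (sinh (d / 2))"
          using app[OF elim, of l] by (simp only: abs_le_iff) linarith
        ultimately have "sinc_min - pi / d \<le> c d * spherical l (sinh (d / 2))" by linarith
        then show "(sinc_min - pi / d) / c d \<le> spherical l (sinh (d / 2))"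
          using c[OF elim] by (simp add: field_simps)
      qed simp
      then have 2: "sinc_min - pi / d \<le> c d * I d"
        using c[OF elim] by (simp add: field_simps)
      from 1 2 show ?case by (simp add: abs_le_iff)
    qed
  qed
  from tendsto_add[OF this tendsto_const[of sinc_min]]
  have B: "((\<lambda>d. c d * I d) \<longlongrightarrow> sinc_min) at_top" by simp
  have "((\<lambda>d. 1 - (c d * spherical 0 (sinh (d / 2))) / (c d * I d)) \<longlongrightarrow> 1 - 1 / sinc_min) at_top"
    by (intro tendsto_intros A B assms)
  then show ?thesis
  proof (rule Lim_transform_eventually)
    show "\<forall>\<^sub>F d in at_top. 1 - (c d * spherical 0 (sinh (d / 2))) / (c d * I d)
        = 1 - spherical 0 (sinh (d / 2)) / (INF l. spherical l (sinh (d / 2)))"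
      using eventually_gt_at_top[of 0]
      by eventually_elim (use c in \<open>force simp: I_def\<close>)
  qed
qed

section \<open>Numerical bounds for pi and for the minimum of sinc\<close>

lemma cos_le_quartic: "cos x \<le> 1 - x\<^sup>2 / 2 + x ^ 4 / 24" for x :: real
proof -
  obtain t where t: "cos x = (\<Sum>m<4. cos_coeff m * x ^ m) + (cos (t + 1/2 * real 4 * pi) / fact 4) * x ^ 4"
    using Maclaurin_cos_expansion[of x 4] by auto
  have "cos (t + 1/2 * real 4 * pi) * x ^ 4 \<le> 1 * x ^ 4"
    by (intro mult_right_mono) auto
  with t show ?thesis by (simp add: cos_coeff_def lessThan_nat_numeral lessThan_Suc fact_numeral field_simps)
qed

text \<open>The sign of \<open>cos\<close> at 1.565 and at 1.575 tells on which side of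
  \<open>pi / 2\<close> these numbers lie; a Maclaurin polynomial with remainder of order 6,
  respectively 8, decides it.\<close>

lemma pi_bounds_coarse: "3.13 < pi" "pi < 3.15"
proof -
  obtain t where t: "cos 1.565 = (\<Sum>m<6. cos_coeff m * 1.565 ^ m) + (cos (t + 1/2 * real 6 * pi) / fact 6) * (1.565::real) ^ 6"
    using Maclaurin_cos_expansion[of "1.565" 6] by auto
  define k where "k = cos (t + 1/2 * real 6 * pi)"
  have k: "k \<ge> - 1" by (simp add: k_def)
  from t[folded k_def] have "cos (1.565::real) > 0"
    using k by (simp add: cos_coeff_def lessThan_nat_numeral lessThan_Suc fact_numeral field_simps power_divide)
  moreover have "cos (1.565::real) \<le> 0" if "pi \<le> 3.13"
  proof -
    have "cos (pi / 2 + (1.565 - pi / 2)) = - sin (1.565 - pi / 2)"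
      by (simp only: cos_add cos_pi_half sin_pi_half)
    moreover have "sin (1.565 - pi / 2) \<ge> 0" using that pi_ge_two by (intro sin_ge_zero) auto
    ultimately show ?thesis by simp
  qed
  ultimately show "3.13 < pi" by linarith
next
  obtain t where t: "cos 1.575 = (\<Sum>m<8. cos_coeff m * 1.575 ^ m) + (cos (t + 1/2 * real 8 * pi) / fact 8) * (1.575::real) ^ 8"
    using Maclaurin_cos_expansion[of "1.575" 8] by auto
  define k where "k = cos (t + 1/2 * real 8 * pi)"
  have k: "k \<le> 1" by (simp add: k_def)
  from t[folded k_def] have "cos (1.575::real) < 0"
    using k by (simp add: cos_coeff_def lessThan_nat_numeral lessThan_Suc fact_numeral field_simps power_divide)
  then show "pi < 3.15"
    using cos_ge_zero[of "1.575"] by (cases "pi < 3.15") auto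
qed

text \<open>The constants are dictated by the tolerance 0.05 around 5.6, that is 4.55 < - 1 /
  \<open>sinc_min\<close> < 4.65: one has 0.2197 < 1 / 4.55 and 1 / 4.65 < 0.2151. The minimum lies
  a little to the left of \<open>3 / 2 * pi\<close>, so the distance \<open>v\<close> to that point
  is the natural variable, in which \<open>sin\<close> becomes \<open>- cos\<close>.\<close>

lemma sinc_min_bounds: "- 0.2197 \<le> sinc_min" "sinc_min < - 0.2151"
proof -
  have pos: "- 0.2197 \<le> sinc s" if s: "s \<ge> 0" for s
  proof (cases "s \<le> pi")
    case True
    then have "sinc s \<ge> 0" using s sin_ge_zero[of s] by auto
    moreover have "- 0.2197 \<le> (0::real)" by simp
    ultimately show ?thesis by (rule order_trans[rotated])
  next
    case False
    define v where "v = 3 / 2 * pi - s"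
    have "sin s = sin (3 / 2 * pi - v)" by (simp add: v_def)
    also have "\<dots> = - cos v" using cos_3over2_pi sin_3over2_pi by (simp add: sin_diff)
    finally have ss: "sin s = - cos v" .
    have vl: "v \<le> pi / 2" using False by (simp add: v_def)
    have "cos v \<le> 0.2197 * s"
    proof (cases "v \<le> 0")
      case True
      then have "1 \<le> 0.2197 * s" using pi_bounds_coarse by (simp add: v_def)
      then show ?thesis using cos_le_one[of v] by linarith
    next
      \<comment> \<open>Here \<open>0 < v \<le> pi / 2 < 1.575\<close> and
        \<open>1.575^2 < 2.5\<close>, so the quartic term of the bound on \<open>cos v\<close> is
        absorbed into the quadratic one, leaving
        \<open>cos v \<le> 1 - (1/2 - 2.5/24) * v^2\<close>.\<close>
      case v: False
      have "v\<^sup>2 \<le> 1.575\<^sup>2" using v vl pi_bounds_coarse by (intro power_mono) auto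
      then have "v\<^sup>2 * v\<^sup>2 \<le> 1.575\<^sup>2 * v\<^sup>2" by (intro mult_right_mono) auto
      also have "1.575\<^sup>2 * v\<^sup>2 \<le> 2.5 * v\<^sup>2" by (intro mult_right_mono) (auto simp: power2_eq_square)
      finally have "v ^ 4 \<le> 2.5 * v\<^sup>2" by (simp add: power2_eq_square power4_eq_xxxx algebra_simps)
      \<comment> \<open>0.28 is close to the point where
        \<open>0.2197 * v - (1/2 - 2.5/24) * v^2\<close> is largest; the square linearizes
        there.\<close>
      moreover have "0 \<le> (v - 0.28)\<^sup>2" by simp
      then have "0.56 * v \<le> v\<^sup>2 + 0.0784" by (simp add: power2_eq_square algebra_simps)
      ultimately have "1 - v\<^sup>2 / 2 + v ^ 4 / 24 + 0.2197 * v \<le> 0.2197 * (3 / 2 * 3.13)"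
        by simp (use zero_le_power2[of v] in linarith)
      moreover have "0.2197 * (3 / 2 * 3.13) \<le> 0.2197 * (3 / 2 * pi)" using pi_bounds_coarse by simp
      moreover have "s = 3 / 2 * pi - v" by (simp add: v_def)
      ultimately show ?thesis using cos_le_quartic[of v] by (simp add: algebra_simps)
    qed
    moreover have "s > 0" using False pi_gt_zero by linarith
    ultimately show ?thesis by (simp add: ss field_simps)
  qed
  obtain s where s: "sinc_min = sinc s" using sinc_min_attained(1) by blast
  have "sinc s = sinc \<bar>s\<bar>" by (auto simp: abs_if)
  then show "- 0.2197 \<le> sinc_min" using pos[of "\<bar>s\<bar>"] unfolding s by simp
  \<comment> \<open>A point close to the minimizer of \<open>sinc\<close>, which is about
    4.49.\<close>
  define w where "w = 3 / 2 * pi - 0.22"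
  have w: "w > 0" "w < 4.52" using pi_bounds_coarse by (auto simp: w_def)
  have "sin w = - cos (0.22)" unfolding w_def using cos_3over2_pi sin_3over2_pi by (simp add: sin_diff)
  moreover have "cos (0.22::real) \<ge> 0.9758"
  proof -
    have "(sin (0.11::real))\<^sup>2 \<le> 0.11\<^sup>2"
      using sin_x_le_x[of "0.11"] sin_ge_zero[of "0.11"] pi_bounds_coarse by (intro power_mono) auto
    moreover have "cos (2 * (0.11::real)) = 1 - 2 * (sin 0.11)\<^sup>2" by (simp only: cos_double_sin)
    ultimately show ?thesis by (simp add: power2_eq_square)
  qed
  ultimately have "sin w < - 0.2151 * w" using w by simp
  then have "sinc w < - 0.2151" using w by (simp add: field_simps)
  then show "sinc_min < - 0.2151" using sinc_min_attained(2)[of w] by linarith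
qed

lemma sinc_min_value: "\<bar>(1 - 1 / sinc_min) - 5.6\<bar> < 0.05"
proof -
  define y where "y = 1 / sinc_min"
  have "sinc_min < 0" using sinc_min_bounds by (rule_tac less_trans[of _ "- 0.2151"]) auto
  then have "y < - 4.55" "- 4.65 < y"
    using sinc_min_bounds by (auto simp: y_def neg_divide_less_eq neg_less_divide_eq)
  then show ?thesis unfolding y_def[symmetric] abs_less_iff by (intro conjI) simp_all
qed

section \<open>Change of variables in the complex plane\<close>

text \<open>Change of variables with a determinant is formulated on \<open>real ^ 'n\<close>; this
  linear bijection, which preserves Lebesgue measure, carries it over to
  \<open>complex\<close>.\<close>

definition vec2_complex :: "real ^ 2 \<Rightarrow> complex" where
  "vec2_complex v = Complex (v $ 1) (v $ 2)"

definition complex_vec2 :: "complex \<Rightarrow> real ^ 2" where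
  "complex_vec2 z = (\<chi> i. if i = 1 then Re z else Im z)"

lemma vec2_complex_inverse [simp]: "vec2_complex (complex_vec2 z) = z" "complex_vec2 (vec2_complex v) = v"
  by (auto simp: vec2_complex_def complex_vec2_def vec_eq_iff forall_2)

lemma bounded_linear_vec2_complex: "bounded_linear vec2_complex"
  unfolding linear_conv_bounded_linear[symmetric]
  by (auto intro!: linearI simp: vec2_complex_def complex_eq_iff)

lemma bounded_linear_complex_vec2: "bounded_linear complex_vec2"
  unfolding linear_conv_bounded_linear[symmetric]
  by (auto intro!: linearI simp: complex_vec2_def vec_eq_iff)

lemma vec2_complex_measurable [measurable]: "vec2_complex \<in> borel_measurable borel"
  using bounded_linear_vec2_complex linear_continuous_on borel_measurable_continuous_onI by blast

lemma lborel_distr_vec2_complex: "distr lborel borel vec2_complex = lborel"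
proof (rule lborel_eqI[symmetric])
  fix l u :: complex assume le: "\<And>b. b \<in> Basis \<Longrightarrow> l \<bullet> b \<le> u \<bullet> b"
  have "vec2_complex -` box l u = box (complex_vec2 l) (complex_vec2 u)"
    by (auto simp: vec2_complex_def complex_vec2_def in_box_complex_iff mem_box_cart forall_2)
  moreover have "emeasure lborel (box (complex_vec2 l) (complex_vec2 u)) = (\<Prod>b\<in>Basis. (complex_vec2 u - complex_vec2 l) \<bullet> b)"
    using le[of 1] le[of \<i>]
    by (intro emeasure_lborel_box) (auto simp: Basis_vec_def complex_vec2_def inner_axis Basis_complex_def)
  moreover have "(\<Prod>b\<in>Basis. (complex_vec2 u - complex_vec2 l) \<bullet> b) = (\<Prod>b\<in>Basis. (u - l) \<bullet> b)"
  proof -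
    have "axis (1::2) (1::real) \<noteq> axis 2 1" by (simp add: axis_eq_axis)
    moreover have B: "(Basis :: (real^2) set) = {axis 1 1, axis 2 1}"
      by (auto simp: Basis_vec_def UNIV_2)
    ultimately show ?thesis unfolding B by (simp add: Basis_complex_def complex_vec2_def inner_axis)
  qed
  ultimately show "emeasure (distr lborel borel vec2_complex) (box l u) = ennreal (\<Prod>b\<in>Basis. (u - l) \<bullet> b)"
    by (simp add: emeasure_distr)
qed simp

lemma lborel_distr_Complex:
  "distr (lborel \<Otimes>\<^sub>M lborel) borel (\<lambda>(x, y). Complex x y) = (lborel :: complex measure)"
proof (rule lborel_eqI[symmetric])
  have [measurable]: "(\<lambda>(x, y). Complex x y) \<in> borel \<Otimes>\<^sub>M borel \<rightarrow>\<^sub>M borel"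
    unfolding borel_prod by (intro borel_measurable_continuous_onI) (auto intro!: continuous_intros simp: split_beta)
  fix l u :: complex assume le: "\<And>b. b \<in> Basis \<Longrightarrow> l \<bullet> b \<le> u \<bullet> b"
  have "(\<lambda>(x, y). Complex x y) -` box l u \<inter> space (lborel \<Otimes>\<^sub>M lborel) = {Re l<..<Re u} \<times> {Im l<..<Im u}"
    by (auto simp: in_box_complex_iff space_pair_measure)
  then have "emeasure (distr (lborel \<Otimes>\<^sub>M lborel) borel (\<lambda>(x, y). Complex x y)) (box l u)
      = emeasure (lborel \<Otimes>\<^sub>M lborel) ({Re l<..<Re u} \<times> {Im l<..<Im u})"
    by (subst emeasure_distr) auto
  also have "\<dots> = ennreal (Re u - Re l) * ennreal (Im u - Im l)"
    using le[of 1] le[of \<i>] by (subst lborel.emeasure_pair_measure_Times) (auto simp: Basis_complex_def)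
  also have "\<dots> = ennreal (\<Prod>b\<in>Basis. (u - l) \<bullet> b)"
    using le[of 1] le[of \<i>] by (simp add: Basis_complex_def ennreal_mult)
  finally show "emeasure (distr (lborel \<Otimes>\<^sub>M lborel) borel (\<lambda>(x, y). Complex x y)) (box l u) = ennreal (\<Prod>b\<in>Basis. (u - l) \<bullet> b)" .
qed simp

text \<open>A real-linear derivative is recorded by the images \<open>p z\<close> of 1 and
  \<open>q z\<close> of i, and \<open>Im (cnj p * q)\<close> is its determinant. Both sides may be
  infinite.\<close>

lemma emeasure_complex_differentiable_image:
  fixes g p q :: "complex \<Rightarrow> complex"
  assumes T: "T \<in> sets borel"
    and g: "\<And>z. z \<in> T \<Longrightarrow> (g has_derivative (\<lambda>h. of_real (Re h) * p z + of_real (Im h) * q z)) (at z)"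
    and inj: "inj_on g T"
    and gT: "g ` T \<in> sets borel"
    and J [measurable]: "(\<lambda>z. Im (cnj (p z) * q z)) \<in> borel_measurable borel"
  shows "emeasure lborel (g ` T) = (\<integral>\<^sup>+z. ennreal \<bar>Im (cnj (p z) * q z)\<bar> * indicator T z \<partial>lborel)"
proof -
  define T2 where "T2 = vec2_complex -` T"
  define g2 where "g2 = complex_vec2 \<circ> g \<circ> vec2_complex"
  define D where "D = (\<lambda>v h. complex_vec2 (of_real (Re (vec2_complex h)) * p (vec2_complex v) + of_real (Im (vec2_complex h)) * q (vec2_complex v)))"
  define K where "K = (\<lambda>v. \<bar>Im (cnj (p (vec2_complex v)) * q (vec2_complex v))\<bar>)"
  have T2: "T2 \<in> sets borel"
    unfolding T2_def using measurable_sets[OF vec2_complex_measurable T] by simp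
  have Kmeas [measurable]: "K \<in> borel_measurable borel" unfolding K_def 
    using measurable_compose[OF vec2_complex_measurable J] by measurable
  have der: "(g2 has_derivative D v) (at v within T2)" if "v \<in> T2" for v
  proof -
    have 1: "(g has_derivative (\<lambda>h. of_real (Re h) * p (vec2_complex v) + of_real (Im h) * q (vec2_complex v))) (at (vec2_complex v))"
      using g that by (auto simp: T2_def)
    have "(g \<circ> vec2_complex has_derivative ((\<lambda>h. of_real (Re h) * p (vec2_complex v) + of_real (Im h) * q (vec2_complex v)) \<circ> vec2_complex)) (at v)"
      by (rule diff_chain_at[OF bounded_linear_imp_has_derivative[OF bounded_linear_vec2_complex] 1])
    from diff_chain_at[OF this bounded_linear_imp_has_derivative[OF bounded_linear_complex_vec2]]
    show ?thesis unfolding g2_def D_def o_def by (rule has_derivative_at_withinI)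
  qed
  have inj2: "inj_on g2 T2"
    using inj unfolding inj_on_def g2_def T2_def o_def by (metis vec2_complex_inverse vimage_eq)
  have det: "\<bar>det (matrix (D v))\<bar> = K v" for v
    by (simp add: det_2 matrix_def D_def K_def vec2_complex_def complex_vec2_def axis_def algebra_simps)
  have im: "g2 ` T2 = vec2_complex -` (g ` T)"
    unfolding g2_def T2_def o_def by (auto simp: image_iff) (metis vec2_complex_inverse vimage_eq)+
  have imb: "g2 ` T2 \<in> sets borel"
    unfolding im using measurable_sets[OF vec2_complex_measurable gT] by simp
  have key: "g2 ` T2 \<in> lmeasurable \<and> measure lebesgue (g2 ` T2) = m \<longleftrightarrow> (K has_integral m) T2" for m
    using has_measure_differentiable_image[OF _ der inj2, of m] T2 unfolding det by auto
  have km: "(\<lambda>v. K v * indicator T2 v) \<in> borel_measurable borel" using T2 by measurable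
  have Kpos: "0 \<le> K v * indicator T2 v" for v by (simp add: K_def)
  have Kif: "(\<lambda>v. K v * indicator T2 v) = (\<lambda>v. if v \<in> T2 then K v else 0)" by auto
  have e1: "emeasure lborel (g ` T) = emeasure lborel (g2 ` T2)"
    unfolding im by (subst lborel_distr_vec2_complex[symmetric]) (use gT in \<open>simp add: emeasure_distr\<close>)
  have e2: "(\<integral>\<^sup>+z. ennreal \<bar>Im (cnj (p z) * q z)\<bar> * indicator T z \<partial>lborel) = (\<integral>\<^sup>+v. ennreal (K v) * indicator T2 v \<partial>lborel)"
  proof -
    define j where "j = (\<lambda>z. ennreal \<bar>Im (cnj (p z) * q z)\<bar> * indicator T z)"
    have "j \<in> borel_measurable borel" using T unfolding j_def by measurable
    then have "integral\<^sup>N (distr lborel borel vec2_complex) j = (\<integral>\<^sup>+v. j (vec2_complex v) \<partial>lborel)"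
      by (intro nn_integral_distr) auto
    then show ?thesis unfolding lborel_distr_vec2_complex
      by (simp only: j_def K_def T2_def indicator_vimage)
  qed
  have "emeasure lborel (g2 ` T2) = (\<integral>\<^sup>+v. ennreal (K v) * indicator T2 v \<partial>lborel)"
  proof (cases "emeasure lborel (g2 ` T2) < \<infinity>")
    case True
    then have "g2 ` T2 \<in> lmeasurable" using imb by (auto simp: fmeasurable_def emeasure_completion)
    then have "(K has_integral measure lebesgue (g2 ` T2)) T2" using key by blast
    then have "((\<lambda>v. K v * indicator T2 v) has_integral measure lebesgue (g2 ` T2)) UNIV"
      unfolding Kif has_integral_restrict_UNIV .
    then have "(\<integral>\<^sup>+v. ennreal (K v * indicator T2 v) \<partial>lborel) = ennreal (measure lebesgue (g2 ` T2))"
      by (rule nn_integral_has_integral_lborel[OF km Kpos])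
    also have "\<dots> = emeasure lborel (g2 ` T2)"
      using True imb by (simp add: emeasure_eq_ennreal_measure)
    finally show ?thesis by (simp add: ennreal_mult' ennreal_indicator K_def)
  next
    case False
    have "(\<integral>\<^sup>+v. ennreal (K v) * indicator T2 v \<partial>lborel) = \<infinity>"
    proof (rule ccontr)
      assume fin: "(\<integral>\<^sup>+v. ennreal (K v) * indicator T2 v \<partial>lborel) \<noteq> \<infinity>"
      have "integrable lborel (\<lambda>v. K v * indicator T2 v)"
        using fin km Kpos by (intro integrableI_nonneg) (auto simp: K_def ennreal_mult' ennreal_indicator less_top)
      then have "(\<lambda>v. K v * indicator T2 v) integrable_on UNIV"
        by (rule integrable_on_lborel)
      then have "K integrable_on T2"
        unfolding Kif integrable_restrict_UNIV .
      then have "g2 ` T2 \<in> lmeasurable" using key by (auto simp: integrable_on_def)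
      then have "emeasure lborel (g2 ` T2) < \<infinity>" using imb by (auto simp: fmeasurable_def emeasure_completion)
      with False show False by simp
    qed
    with False show ?thesis by (metis infinity_ennreal_def top.not_eq_extremum)
  qed
  then show ?thesis unfolding e1 e2 .
qed

text \<open>An equality of measures: the Jacobian density on \<open>S\<close>, pushed forward by
  \<open>g\<close>, is Lebesgue measure on the image of \<open>S\<close>. Evaluated on a Borel set
  \<open>B\<close>, it is the preceding formula for the part of \<open>S\<close> that
  \<open>g\<close> maps into \<open>B\<close>.\<close>

lemma nn_integral_complex_change_of_variables:
  fixes g p q :: "complex \<Rightarrow> complex" and f :: "complex \<Rightarrow> ennreal"
  assumes S: "open S"
    and g: "\<And>z. z \<in> S \<Longrightarrow> (g has_derivative (\<lambda>h. of_real (Re h) * p z + of_real (Im h) * q z)) (at z)"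
    and inj: "inj_on g S"
    and J [measurable]: "(\<lambda>z. Im (cnj (p z) * q z)) \<in> borel_measurable borel"
    and f [measurable]: "f \<in> borel_measurable borel"
  shows "(\<integral>\<^sup>+w. f w * indicator (g ` S) w \<partial>lborel)
      = (\<integral>\<^sup>+z. f (g z) * (ennreal \<bar>Im (cnj (p z) * q z)\<bar> * indicator S z) \<partial>lborel)"
proof -
  define k where "k = (\<lambda>z. ennreal \<bar>Im (cnj (p z) * q z)\<bar> * indicator S z)"
  have Sb [measurable]: "S \<in> sets borel" using S by simp
  have k [measurable]: "k \<in> borel_measurable borel" unfolding k_def by measurable
  \<comment> \<open>\<open>g\<close> is controlled on \<open>S\<close> only. The value 0 elsewhere
    gives a Borel map of the plane, and the density \<open>k\<close> vanishes there.\<close>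
  define g0 where "g0 = (\<lambda>z. if z \<in> S then g z else 0)"
  have contg: "continuous_on S g"
    by (intro continuous_at_imp_continuous_on ballI has_derivative_continuous[OF g])
  have g0 [measurable]: "g0 \<in> borel_measurable borel"
    unfolding g0_def by (rule borel_measurable_continuous_on_if[OF Sb contg]) auto
  \<comment> \<open>Invariance of domain: the image is open, and this is where its measurability
    comes from.\<close>
  have gS: "open (g ` S)" by (rule invariance_of_domain[OF contg S inj])
  then have gSb [measurable]: "g ` S \<in> sets borel" by simp
  have "distr (density lborel k) borel g0 = density lborel (indicator (g ` S))"
  proof (rule measure_eqI)
    fix B assume "B \<in> sets (distr (density lborel k) borel g0)"
    then have B [measurable]: "B \<in> sets borel" by simp
    define T where "T = S \<inter> g0 -` B"
    have T: "T \<in> sets borel" unfolding T_def using measurable_sets[OF g0 B] by simp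
    have gT: "g ` T = g ` S \<inter> B" by (auto simp: T_def g0_def)
    have "emeasure (distr (density lborel k) borel g0) B = (\<integral>\<^sup>+z. k z * indicator (g0 -` B) z \<partial>lborel)"
      using measurable_sets[OF g0 B] by (simp add: emeasure_distr emeasure_density)
    also have "\<dots> = (\<integral>\<^sup>+z. ennreal \<bar>Im (cnj (p z) * q z)\<bar> * indicator T z \<partial>lborel)"
      by (intro nn_integral_cong) (auto simp: k_def T_def indicator_def)
    also have "\<dots> = emeasure lborel (g ` T)"
      by (rule emeasure_complex_differentiable_image[symmetric, OF T g inj_on_subset[OF inj]])
        (simp_all only: gT J, use gSb in \<open>auto simp: T_def\<close>)
    also have "\<dots> = emeasure (density lborel (indicator (g ` S))) B"
      unfolding gT by (subst emeasure_density) (auto simp: indicator_inter_arith[symmetric])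
    finally show "emeasure (distr (density lborel k) borel g0) B = emeasure (density lborel (indicator (g ` S))) B" .
  qed simp
  then have "(\<integral>\<^sup>+w. f w \<partial>density lborel (indicator (g ` S))) = (\<integral>\<^sup>+w. f w \<partial>distr (density lborel k) borel g0)"
    by simp
  also have "\<dots> = (\<integral>\<^sup>+z. f (g0 z) \<partial>density lborel k)"
    by (rule nn_integral_distr) (use g0 f in auto)
  finally have "(\<integral>\<^sup>+w. f w \<partial>density lborel (indicator (g ` S))) = (\<integral>\<^sup>+z. f (g0 z) \<partial>density lborel k)" .
  then have "(\<integral>\<^sup>+w. indicator (g ` S) w * f w \<partial>lborel) = (\<integral>\<^sup>+z. k z * f (g0 z) \<partial>lborel)"
    by (simp add: nn_integral_density)
  moreover have "(\<integral>\<^sup>+z. k z * f (g0 z) \<partial>lborel) = (\<integral>\<^sup>+z. f (g z) * k z \<partial>lborel)"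
    by (intro nn_integral_cong) (auto simp: k_def g0_def indicator_def mult.commute)
  ultimately show ?thesis by (simp add: k_def mult.commute)
qed

section \<open>The Poisson kernel\<close>

definition poisson :: "complex \<Rightarrow> complex \<Rightarrow> real" where
  "poisson z b = (1 - (norm z)\<^sup>2) / (norm (z - b))\<^sup>2"

lemma one_minus_norm_sq_pos: "norm z < 1 \<Longrightarrow> 0 < 1 - (norm z)\<^sup>2" for z :: complex
  by (simp add: power_less_one_iff abs_square_less_1)

lemma one_minus_cnj_mult_nonzero: "norm x < 1 \<Longrightarrow> norm z \<le> 1 \<Longrightarrow> 1 - cnj x * z \<noteq> 0"
proof
  assume "norm x < 1" "norm z \<le> 1" "1 - cnj x * z = 0"
  then have "cnj x * z = 1" by simp
  then have "norm x * norm z = 1" by (metis complex_mod_cnj norm_mult norm_one)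
  moreover have "norm x * norm z \<le> norm x * 1" using \<open>norm z \<le> 1\<close> by (intro mult_left_mono) auto
  ultimately show False using \<open>norm x < 1\<close> by linarith
qed

lemma one_plus_cnj_mult_nonzero: "norm x < 1 \<Longrightarrow> norm z \<le> 1 \<Longrightarrow> 1 + cnj x * z \<noteq> 0"
  using one_minus_cnj_mult_nonzero[of "- x" z] by simp

lemma poisson_pos: "norm z < 1 \<Longrightarrow> norm b = 1 \<Longrightarrow> 0 < poisson z b"
  unfolding poisson_def by (intro divide_pos_pos one_minus_norm_sq_pos) auto

lemma Moebius_norm_identity:
  assumes "norm x < 1" "norm z \<le> 1"
  shows "1 - (norm (Moebius_function 0 x z))\<^sup>2 = (1 - (norm x)\<^sup>2) * (1 - (norm z)\<^sup>2) / (norm (1 - cnj x * z))\<^sup>2"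
proof -
  have nz: "norm (1 - cnj x * z) \<noteq> 0" using one_minus_cnj_mult_nonzero[OF assms] by simp
  have "(norm (1 - cnj x * z))\<^sup>2 - (norm (z - x))\<^sup>2 = (1 - (norm x)\<^sup>2) * (1 - (norm z)\<^sup>2)"
    unfolding cmod_power2 by (simp add: algebra_simps power2_eq_square)
  then show ?thesis using nz
    unfolding Moebius_function_simple norm_divide power_divide by (simp add: field_simps)
qed

lemma Moebius_norm_1:
  assumes "norm x < 1" "norm b = 1"
  shows "norm (Moebius_function 0 x b) = 1"
proof -
  have "1 - (norm (Moebius_function 0 x b))\<^sup>2 = 0"
    using Moebius_norm_identity[of x b] assms by simp
  then show ?thesis by (simp add: power2_eq_1_iff) (smt (verit) norm_ge_zero)
qed

lemma Moebius_diff: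
  assumes "norm x < 1" "norm z \<le> 1" "norm b \<le> 1"
  shows "Moebius_function 0 x z - Moebius_function 0 x b
      = (1 - cnj x * x) * (z - b) / ((1 - cnj x * z) * (1 - cnj x * b))"
  using one_minus_cnj_mult_nonzero[OF assms(1,2)] one_minus_cnj_mult_nonzero[OF assms(1,3)]
  unfolding Moebius_function_simple by (simp add: divide_simps) (simp add: algebra_simps)

text \<open>The cocycle identity of the Poisson kernel: \<open>poisson x\<close> is the derivative
  of the boundary action of \<open>Moebius_function 0 x\<close>, so this is a chain rule. It moves
  every computation about \<open>x\<close> to the centre 0, at the price of a factor that depends on
  \<open>x\<close> and \<open>b\<close> only.\<close>

lemma poisson_Moebius:
  assumes "norm x < 1" "norm z < 1" "norm b = 1"
  shows "poisson z b = poisson (Moebius_function 0 x z) (Moebius_function 0 x b) * poisson x b"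
proof -
  define X where "X = 1 - (norm x)\<^sup>2"
  define Z where "Z = 1 - (norm z)\<^sup>2"
  define A where "A = (norm (1 - cnj x * z))\<^sup>2"
  define B where "B = (norm (1 - cnj x * b))\<^sup>2"
  define C where "C = (norm (z - b))\<^sup>2"
  have X: "X > 0" using assms one_minus_norm_sq_pos by (simp add: X_def)
  have nz: "A \<noteq> 0" "B \<noteq> 0" "C \<noteq> 0"
    using one_minus_cnj_mult_nonzero[of x z] one_minus_cnj_mult_nonzero[of x b] assms by (auto simp: A_def B_def C_def)
  have "norm (x - b) = norm (1 - cnj x * b)"
  proof -
    have "(norm (1 - cnj x * b))\<^sup>2 - (norm (x - b))\<^sup>2 = (1 - (norm x)\<^sup>2) * (1 - (norm b)\<^sup>2)"
      unfolding cmod_power2 by (simp add: algebra_simps power2_eq_square)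
    then have "(norm (1 - cnj x * b))\<^sup>2 = (norm (x - b))\<^sup>2" using assms by simp
    then show ?thesis by simp
  qed
  then have xb: "poisson x b = X / B" by (simp add: poisson_def X_def B_def)
  have x2: "1 - cnj x * x = of_real X"
    by (simp add: X_def complex_norm_square mult.commute flip: of_real_power)
  have "norm (1 - cnj x * x) = X" unfolding x2 using X by simp
  then have d: "(norm (Moebius_function 0 x z - Moebius_function 0 x b))\<^sup>2 = X\<^sup>2 * C / (A * B)"
    using assms by (subst Moebius_diff) (auto simp: norm_mult norm_divide power_mult_distrib power_divide A_def B_def C_def)
  have n: "1 - (norm (Moebius_function 0 x z))\<^sup>2 = X * Z / A"
    using assms by (subst Moebius_norm_identity) (auto simp: X_def Z_def A_def)
  show ?thesis unfolding xb poisson_def[of "Moebius_function 0 x z"] d n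
    using X nz by (simp add: poisson_def Z_def C_def field_simps power2_eq_square)
qed

lemma integral_periodic_shift:
  fixes u :: "real \<Rightarrow> 'a :: euclidean_space"
  assumes cont: "continuous_on UNIV u" and per: "\<And>t. u (t + p) = u t" and p: "p \<ge> 0"
  shows "integral {c..c + p} u = integral {0..p} u"
proof -
  have int: "u integrable_on {a..b}" for a b
    by (intro integrable_continuous_real continuous_on_subset[OF cont]) auto
  have sh: "integral {a + p..b + p} u = integral {a..b} u" for a b
    using integral_shift[of a p b u] continuous_on_subset[OF cont] by (simp add: o_def per)
  have 1: "integral {a..b} u + integral {b..c} u = integral {a..c} u" if "a \<le> b" "b \<le> c" for a b c
    using that by (intro Henstock_Kurzweil_Integration.integral_combine int)
  show ?thesis
  proof (cases "c \<ge> 0")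
    case True
    have "integral {0..c} u + integral {c..c + p} u = integral {0..p} u + integral {0 + p..c + p} u"
      using 1[of 0 c "c + p"] 1[of 0 p "c + p"] True p by simp
    then show ?thesis unfolding sh by simp
  next
    case False
    have "integral {c..c+p} u + integral {c + p..0 + p} u = integral {c..0} u + integral {0..p} u"
      using 1[of c "c + p" p] 1[of c 0 p] False p by simp
    then show ?thesis unfolding sh by simp
  qed
qed

text \<open>Substitution on the boundary circle. The map lifts to a function \<open>\<alpha>\<close>
  of the angle whose derivative is the Poisson kernel and which advances by \<open>2 * pi\<close> in
  one turn.\<close>

lemma integral_circle_Moebius:
  fixes u :: "complex \<Rightarrow> 'a :: euclidean_space"
  assumes x: "norm x < 1" and u: "continuous_on (sphere 0 1) u"
  shows "integral {0..2 * pi} (\<lambda>t. poisson x (cis t) *\<^sub>R u (Moebius_function 0 x (cis t)))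
       = integral {0..2 * pi} (\<lambda>t. u (cis t))"
proof -
  \<comment> \<open>The numerator \<open>cis t - x\<close> of the Moebius map is
    \<open>cis t * w t\<close> and its denominator is \<open>cnj (w t)\<close>, so the image has
    angle \<open>t + 2 * Im (Ln (w t))\<close>. As \<open>Re (w t) > 0\<close>, the principal
    logarithm is smooth along the circle.\<close>
  define w where "w = (\<lambda>t. 1 - x * cis (- t))"
  define \<alpha> where "\<alpha> = (\<lambda>t. t + 2 * Im (Ln (w t)))"
  have wre: "Re (w t) > 0" for t
  proof -
    have "Re (x * cis (- t)) \<le> norm (x * cis (- t))" by (rule complex_Re_le_cmod)
    then show ?thesis using x by (simp add: w_def norm_mult)
  qed
  have wnz: "w t \<noteq> 0" for t using wre[of t] by (cases "w t = 0") auto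
  have wnn: "w t \<notin> \<real>\<^sub>\<le>\<^sub>0" for t using wre[of t] by (simp add: complex_nonpos_Reals_iff)
  have Mob: "Moebius_function 0 x (cis t) = cis (\<alpha> t)" for t
  proof -
    have wp: "w t = of_real (norm (w t)) * cis (Im (Ln (w t)))"
      using exp_Ln[OF wnz[of t]] wnz[of t] by (metis exp_eq_polar Re_Ln exp_ln of_real_exp zero_less_norm_iff norm_exp_eq_Re rcis_def)
    have "cis t - x = cis t * w t" by (simp add: w_def algebra_simps cis_mult flip: mult.assoc)
    moreover have "1 - cnj x * cis t = cnj (w t)" by (simp add: w_def cis_cnj)
    ultimately have "Moebius_function 0 x (cis t) = cis t * (w t / cnj (w t))"
      unfolding Moebius_function_simple by simp
    also have "w t / cnj (w t) = cis (Im (Ln (w t))) / cis (- Im (Ln (w t)))"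
      using wnz[of t] by (subst (1 2) wp) (simp add: cis_cnj)
    also have "\<dots> = cis (2 * Im (Ln (w t)))" by (simp add: cis_divide)
    finally show ?thesis by (simp add: \<alpha>_def cis_mult)
  qed
  have der: "(\<alpha> has_field_derivative poisson x (cis t)) (at t within A)" for t A
  proof -
    have 1: "(w has_vector_derivative (\<i> * x * cis (- t))) (at t within A)"
      unfolding w_def has_vector_derivative_def
      by (auto intro!: derivative_eq_intros simp: scaleR_conv_of_real)
    have "((Ln \<circ> w) has_vector_derivative (\<i> * x * cis (- t)) * (1 / w t)) (at t within A)"
      by (rule field_vector_diff_chain_within[OF 1]) (use wnn has_field_derivative_Ln[of "w t"] in \<open>auto intro: has_field_derivative_at_within simp: inverse_eq_divide\<close>)
    then have "((\<lambda>t. Im (Ln (w t))) has_vector_derivative Im ((\<i> * x * cis (- t)) * (1 / w t))) (at t within A)"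
      unfolding o_def using bounded_linear.has_vector_derivative[OF bounded_linear_Im] by blast
    then have d: "(\<alpha> has_field_derivative (1 + 2 * Im ((\<i> * x * cis (- t)) * (1 / w t)))) (at t within A)"
      unfolding \<alpha>_def has_real_derivative_iff_has_vector_derivative[symmetric]
      by (intro DERIV_add DERIV_ident DERIV_cmult)
    have "1 + 2 * Im ((\<i> * x * cis (- t)) * (1 / w t)) = poisson x (cis t)"
    proof -
      \<comment> \<open>In terms of \<open>y\<close> the claim is the classical formula for the
        Poisson kernel as \<open>1 + 2 * Re (y / (1 - y)) = Re ((1 + y) / (1 - y))\<close>.\<close>
      define y where "y = x * cis (- t)"
      have ny: "norm y = norm x" by (simp add: y_def norm_mult)
      have "x - cis t = cis t * (y - 1)" by (simp add: y_def algebra_simps cis_mult flip: mult.assoc)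
      then have "norm (x - cis t) = norm (y - 1)" by (simp add: norm_mult)
      then have P: "poisson x (cis t) = (1 - (norm y)\<^sup>2) / (norm (y - 1))\<^sup>2" by (simp add: poisson_def ny)
      have yz: "(norm (y - 1))\<^sup>2 \<noteq> 0" using wnz[of t] by (auto simp: w_def y_def)
      have "(\<i> * x * cis (- t)) * (1 / w t) = \<i> * (y / (1 - y))" by (simp add: w_def y_def)
      then have "Im ((\<i> * x * cis (- t)) * (1 / w t)) = Re (y / (1 - y))" by (simp only: Im_i_times)
      also have "\<dots> = (Re y - (norm y)\<^sup>2) / (norm (y - 1))\<^sup>2"
        unfolding Re_divide cmod_power2 by (simp add: algebra_simps power2_eq_square)
      finally have I: "Im ((\<i> * x * cis (- t)) * (1 / w t)) = (Re y - (norm y)\<^sup>2) / (norm (y - 1))\<^sup>2" .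
      have N: "(norm (y - 1))\<^sup>2 = (norm y)\<^sup>2 - 2 * Re y + 1"
        unfolding cmod_power2 by (simp add: power2_eq_square algebra_simps)
      show ?thesis unfolding P I using yz unfolding N by (simp add: divide_simps) 
    qed
    with d show ?thesis by simp
  qed
  have per: "\<alpha> (2 * pi) = \<alpha> 0 + 2 * pi"
  proof -
    have "w (2 * pi) = w 0" by (simp add: w_def complex_eq_iff)
    then show ?thesis by (simp add: \<alpha>_def)
  qed
  have P: "\<alpha> 0 \<le> \<alpha> (2 * pi)" unfolding per by simp
  have uc: "continuous_on B (\<lambda>t. u (cis t))" for B
    by (rule continuous_on_compose2[OF u]) (auto intro!: continuous_intros)
  have cont\<alpha>: "continuous_on {0..2 * pi} \<alpha>" by (rule DERIV_continuous_on[OF der])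
  obtain c d where cd: "\<alpha> ` {0..2 * pi} \<subseteq> {c..d}"
    using compact_continuous_image[OF cont\<alpha>] compact_imp_bounded[THEN bounded_subset_cbox_symmetric] 
    by (metis cbox_interval compact_Icc)
  have "((\<lambda>t. poisson x (cis t) *\<^sub>R u (cis (\<alpha> t))) has_integral integral {\<alpha> 0..\<alpha> (2 * pi)} (\<lambda>t. u (cis t))) {0..2 * pi}"
    by (rule has_integral_substitution[OF _ P cd uc der]) auto
  then have "integral {0..2 * pi} (\<lambda>t. poisson x (cis t) *\<^sub>R u (Moebius_function 0 x (cis t))) = integral {\<alpha> 0..\<alpha> 0 + 2 * pi} (\<lambda>t. u (cis t))"
    unfolding Mob per[symmetric] by (rule integral_unique)
  also have "\<dots> = integral {0..2 * pi} (\<lambda>t. u (cis t))"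
    by (rule integral_periodic_shift[OF uc]) (auto simp: complex_eq_iff intro!: arg_cong[of _ _ u])
  finally show ?thesis .
qed

text \<open>P^(1/2 + i l) in polar form. On the line with real part 1/2 the squared modulus is the
  Poisson kernel itself, hence the Jacobian of the boundary action.\<close>

definition poisson_pow :: "real \<Rightarrow> complex \<Rightarrow> complex \<Rightarrow> complex" where
  "poisson_pow l z b = of_real (sqrt (poisson z b)) * cis (l * ln (poisson z b))"

lemma poisson_pow_mult:
  assumes "norm z < 1" "norm b = 1" "norm x < 1" 
  shows "poisson_pow l z b = poisson_pow l (Moebius_function 0 x z) (Moebius_function 0 x b) * poisson_pow l x b"
proof -
  define Z where "Z = poisson (Moebius_function 0 x z) (Moebius_function 0 x b)"
  have "Z > 0" "poisson x b > 0"
    unfolding Z_def using assms by (auto intro!: poisson_pos Moebius_norm_1 Moebius_function_norm_lt_1)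
  then show ?thesis
    unfolding poisson_pow_def poisson_Moebius[OF assms(3,1,2)] Z_def[symmetric]
    by (simp add: real_sqrt_mult ln_mult distrib_left cis_mult[symmetric])
qed

lemma poisson_circle:
  fixes d :: real
  shows "poisson (of_real (tanh (d / 2))) (cis t) = 1 / (cosh d - sinh d * cos t)"
proof -
  define c where "c = cosh (d / 2)"
  define s where "s = sinh (d / 2)"
  have c: "c > 0" by (simp add: c_def)
  have cs: "c\<^sup>2 = s\<^sup>2 + 1" by (simp add: c_def s_def cosh_square_eq)
  have cd: "cosh d = c\<^sup>2 + s\<^sup>2" using cosh_double[of "d / 2"] by (simp add: c_def s_def)
  have sinh_hdist: "sinh d = 2 * s * c" using sinh_double[of "d / 2"] by (simp add: c_def s_def)
  have th: "tanh (d / 2) = s / c" by (simp add: tanh_def c_def s_def)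
  have n: "(norm (complex_of_real (s / c) - cis t))\<^sup>2 = (cosh d - sinh d * cos t) / c\<^sup>2"
  proof -
    have "(norm (complex_of_real (s / c) - cis t))\<^sup>2 = (s / c)\<^sup>2 - 2 * (s / c) * cos t + ((cos t)\<^sup>2 + (sin t)\<^sup>2)"
      unfolding cmod_power2 by (simp add: power2_eq_square algebra_simps)
    also have "\<dots> = (cosh d - sinh d * cos t) / c\<^sup>2"
      unfolding cd sinh_hdist using c by (simp add: field_simps power2_eq_square)
    finally show ?thesis .
  qed
  have m: "1 - (norm (complex_of_real (s / c)))\<^sup>2 = 1 / c\<^sup>2"
  proof -
    have "(norm (complex_of_real (s / c)))\<^sup>2 = (c\<^sup>2 - 1) / c\<^sup>2" using cs by (simp add: norm_divide power_divide)
    then show ?thesis using c by (simp add: diff_divide_distrib)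
  qed
  show ?thesis unfolding poisson_def th n m using c by simp
qed

lemma cosh_sinh_cos_pos: "0 < cosh d - sinh d * cos t" for d t :: real
proof -
  have 1: "sinh d * cos t \<le> \<bar>sinh d\<bar> * \<bar>cos t\<bar>" by (metis abs_ge_self abs_mult)
  have 2: "\<bar>sinh d\<bar> * \<bar>cos t\<bar> \<le> \<bar>sinh d\<bar>" by (simp add: mult_left_le)
  have 3: "\<bar>sinh d\<bar> < cosh d"
    using cosh_minus_sinh[of d] cosh_plus_sinh[of d] exp_gt_zero[of d] exp_gt_zero[of "- d"]
    by (simp only: abs_less_iff) linarith
  from 1 2 3 show ?thesis by linarith
qed

text \<open>The substitution is \<open>a * sin u = sinh (ln R)\<close>, where \<open>R\<close> is
  the square root of the Poisson kernel on the circle of radius \<open>d\<close>. On the half circle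
  \<open>ln R\<close> decreases from \<open>d / 2\<close> to \<open>- d / 2\<close>; as
  \<open>a = sinh (d / 2)\<close>, the angle \<open>u\<close> runs from \<open>pi / 2\<close> to
  \<open>- (pi / 2)\<close>. The oscillation \<open>2 * l * ln R\<close> thus becomes
  \<open>2 * l * arsinh (a * sin u)\<close>.\<close>

lemma integral_poisson_pow_half:
  fixes d l :: real
  assumes d: "d > 0"
  defines "a \<equiv> sinh (d / 2)"
  defines "G \<equiv> (\<lambda>u. cis (2 * l * arsinh (a * sin u)) / of_real (sqrt (1 + (a * sin u)\<^sup>2)))"
  shows "integral {0..pi} (\<lambda>t. poisson_pow l (of_real (tanh (d / 2))) (cis t)) = integral {- (pi / 2)..pi / 2} G"
proof -
  have a: "a > 0" using d by (simp add: a_def)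
  define Q where "Q = (\<lambda>t. cosh d - sinh d * cos t)"
  have Q: "Q t > 0" for t by (simp only: Q_def cosh_sinh_cos_pos)
  have Qt: "cosh d - sinh d * cos t = Q t" for t by (simp add: Q_def)
  define R where "R = (\<lambda>t. 1 / sqrt (Q t))"
  have R: "R t > 0" for t using Q[of t] by (simp add: R_def)
  define \<sigma> where "\<sigma> = (\<lambda>t. (R t - 1 / R t) / (2 * a))"
  define \<psi> where "\<psi> = (\<lambda>t. arcsin (\<sigma> t))"
  have cd: "cosh d = 1 + 2 * a\<^sup>2" using cosh_double[of "d / 2"] by (simp add: a_def cosh_square_eq)
  have RQ: "(R t)\<^sup>2 = 1 / Q t" for t using Q[of t] by (simp add: R_def power_divide)
  \<comment> \<open>The square of \<open>cos u\<close> comes out as a perfect square that vanishes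
    on the half circle only at its ends. It gives both \<open>|\<sigma>| \<le> 1\<close> and the
    derivative of \<open>arcsin \<sigma>\<close>.\<close>
  have s2: "1 - (\<sigma> t)\<^sup>2 = (sinh d * sin t * R t / (2 * a))\<^sup>2" for t
  proof -
    have q: "Q t \<noteq> 0" using Q[of t] by simp
    have r: "R t \<noteq> 0" using R[of t] by simp
    have "(R t - 1 / R t)\<^sup>2 = 1 / Q t - 2 + Q t"
      using r by (simp add: power2_diff power_divide RQ)
    then have "4 * a\<^sup>2 * (1 - (\<sigma> t)\<^sup>2) = 2 * cosh d - 1 / Q t - Q t"
      using a by (simp add: \<sigma>_def power_divide power_mult_distrib cd algebra_simps)
    also have "\<dots> = ((sinh d)\<^sup>2 - (Q t - cosh d)\<^sup>2) / Q t"
    proof -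
      have "(sinh d)\<^sup>2 = (cosh d)\<^sup>2 - 1" by (simp add: cosh_square_eq)
      then show ?thesis using q by (simp add: field_simps power2_eq_square)
    qed
    also have "(Q t - cosh d)\<^sup>2 = (sinh d)\<^sup>2 * (cos t)\<^sup>2" by (simp add: Q_def power_mult_distrib)
    also have "(sinh d)\<^sup>2 - (sinh d)\<^sup>2 * (cos t)\<^sup>2 = (sinh d)\<^sup>2 * (sin t)\<^sup>2" by (simp add: sin_squared_eq algebra_simps)
    finally have E: "4 * a\<^sup>2 * (1 - (\<sigma> t)\<^sup>2) = (sinh d)\<^sup>2 * (sin t)\<^sup>2 / Q t" .
    have "(sinh d * sin t * R t / (2 * a))\<^sup>2 = ((sinh d)\<^sup>2 * (sin t)\<^sup>2 / Q t) / (4 * a\<^sup>2)"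
      by (simp add: power_mult_distrib power_divide RQ)
    also have "\<dots> = 1 - (\<sigma> t)\<^sup>2" unfolding E[symmetric] using a by simp
    finally show ?thesis by simp
  qed
  have sle: "\<bar>\<sigma> t\<bar> \<le> 1" for t
  proof -
    have "(\<sigma> t)\<^sup>2 \<le> 1" using s2[of t] zero_le_power2[of "sinh d * sin t * R t / (2 * a)"] by linarith
    then show ?thesis by (simp add: abs_square_le_1)
  qed
  have sin\<psi>: "sin (\<psi> t) = \<sigma> t" for t using sle[of t] by (simp add: \<psi>_def abs_le_iff)
  have as: "a * \<sigma> t = (R t - 1 / R t) / 2" for t using a by (simp add: \<sigma>_def)
  have sh: "a * \<sigma> t = sinh (ln (R t))" for t
    unfolding as using R[of t] by (simp add: sinh_ln_real inverse_eq_divide)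
  have ar: "arsinh (a * \<sigma> t) = ln (R t)" for t unfolding sh by (rule arsinh_sinh_real)
  have sq: "sqrt (1 + (a * \<sigma> t)\<^sup>2) = (R t + 1 / R t) / 2" for t
  proof -
    have "1 + (a * \<sigma> t)\<^sup>2 = ((R t + 1 / R t) / 2)\<^sup>2"
      unfolding as using R[of t] by (simp add: power2_eq_square field_simps)
    then show ?thesis using R[of t] by simp
  qed
  have pp: "poisson_pow l (of_real (tanh (d / 2))) (cis t) = of_real (R t) * cis (2 * l * ln (R t))" for t
    unfolding poisson_pow_def poisson_circle Qt using Q[of t]
    by (simp add: R_def real_sqrt_divide ln_div ln_sqrt field_simps)
  have contQ: "continuous_on A Q" for A unfolding Q_def by (intro continuous_intros)
  have contR: "continuous_on A R" for A unfolding R_def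
    by (intro continuous_intros contQ) (use Q in \<open>auto simp: less_imp_neq[OF Q, symmetric]\<close>)
  have conts: "continuous_on A \<sigma>" for A unfolding \<sigma>_def
    by (intro continuous_intros contR) (use a less_imp_neq[OF R] in \<open>auto simp: eq_commute[of 0]\<close>)
  have cont\<psi>: "continuous_on A \<psi>" for A unfolding \<psi>_def
    by (rule continuous_on_arcsin[OF conts]) (use sle in \<open>simp add: abs_le_iff minus_le_iff\<close>)
  \<comment> \<open>At \<open>t = 0\<close> and \<open>t = pi\<close> the value of
    \<open>\<sigma>\<close> is 1 or -1, where \<open>arcsin\<close> is not differentiable; the
    substitution rule used below admits this finite exceptional set.\<close>
  have der: "(\<psi> has_field_derivative (- (((R t)\<^sup>2 + 1) / 2))) (at t within {0..pi})" if t: "t \<in> {0..pi} - {0, pi}" for t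
  proof -
    have sint: "sin t > 0" using t by (intro sin_gt_zero) auto
    have shd: "sinh d > 0" using d by simp
    have w: "sqrt (1 - (\<sigma> t)\<^sup>2) = sinh d * sin t * R t / (2 * a)"
      unfolding s2 using sint shd R[of t] a by simp
    have wpos: "sinh d * sin t * R t / (2 * a) > 0" using sint shd R[of t] a by simp
    have "(\<sigma> t)\<^sup>2 < 1" using s2[of t] wpos by (smt (verit) zero_less_power)
    then have sl: "- 1 < \<sigma> t" "\<sigma> t < 1" by (auto simp: abs_square_less_1 abs_less_iff)
    have dQ: "(Q has_field_derivative sinh d * sin t) (at t)"
      unfolding Q_def by (auto intro!: derivative_eq_intros)
    have dsQ: "((\<lambda>t. sqrt (Q t)) has_field_derivative (sinh d * sin t) * R t / 2) (at t)"
      using DERIV_chain2[OF DERIV_real_sqrt[OF Q[of t]] dQ] by (simp add: R_def inverse_eq_divide field_simps)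
    have dR: "(R has_field_derivative - ((sinh d * sin t) * R t / 2 * (R t)\<^sup>2)) (at t)"
    proof -
      have "((\<lambda>t. inverse (sqrt (Q t))) has_field_derivative - (inverse (sqrt (Q t)) * ((sinh d * sin t) * R t / 2) * inverse (sqrt (Q t)))) (at t)"
        by (rule DERIV_inverse'[OF dsQ]) (use Q[of t] in simp)
      moreover have "(\<lambda>t. inverse (sqrt (Q t))) = R" by (simp add: R_def inverse_eq_divide fun_eq_iff)
      moreover have "inverse (sqrt (Q t)) * ((sinh d * sin t) * R t / 2) * inverse (sqrt (Q t)) = (sinh d * sin t) * R t / 2 * (R t)\<^sup>2"
        by (simp only: R_def inverse_eq_divide power2_eq_square mult_ac)
      ultimately show ?thesis by (simp only:)
    qed
    have R1: "1 / R t = sqrt (Q t)" for t by (simp add: R_def)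
    have ds: "(\<sigma> has_field_derivative (- ((sinh d * sin t) * R t / 2 * (R t)\<^sup>2) - (sinh d * sin t) * R t / 2) / (2 * a)) (at t)"
      unfolding \<sigma>_def R1 by (intro DERIV_cdivide DERIV_diff dR dsQ)
    have "(\<psi> has_field_derivative inverse (sqrt (1 - (\<sigma> t)\<^sup>2)) * ((- ((sinh d * sin t) * R t / 2 * (R t)\<^sup>2) - (sinh d * sin t) * R t / 2) / (2 * a))) (at t)"
      unfolding \<psi>_def by (rule DERIV_chain2[OF DERIV_arcsin[OF sl] ds])
    moreover have "inverse (sqrt (1 - (\<sigma> t)\<^sup>2)) * ((- ((sinh d * sin t) * R t / 2 * (R t)\<^sup>2) - (sinh d * sin t) * R t / 2) / (2 * a)) = - (((R t)\<^sup>2 + 1) / 2)"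
      unfolding w using sint shd R[of t] a by (simp add: field_simps)
    ultimately show ?thesis by (auto intro: has_field_derivative_at_within)
  qed
  have e1: "sqrt (exp d) = exp (d / 2)"
    by (intro real_sqrt_unique) (auto simp: power2_eq_square exp_add[symmetric])
  have e2: "sqrt (exp (- d)) = exp (- (d / 2))"
    by (intro real_sqrt_unique) (auto simp: power2_eq_square exp_add[symmetric])
  have "Q 0 = exp (- d)" by (simp add: Q_def cosh_minus_sinh)
  then have "R 0 = 1 / exp (- (d / 2))" by (simp only: R_def e2)
  then have "R 0 = exp (d / 2)" by (simp add: exp_minus inverse_eq_divide)
  then have "\<sigma> 0 = 1" using a by (simp add: \<sigma>_def a_def sinh_field_def exp_minus inverse_eq_divide)
  then have p0: "\<psi> 0 = pi / 2" by (simp add: \<psi>_def)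
  have "Q pi = exp d" by (simp add: Q_def cosh_plus_sinh)
  then have "R pi = 1 / exp (d / 2)" by (simp only: R_def e1)
  then have "R pi = exp (- (d / 2))" by (simp add: exp_minus inverse_eq_divide)
  then have "R pi - 1 / R pi = exp (- (d / 2)) - exp (d / 2)" by (simp add: exp_minus inverse_eq_divide)
  also have "\<dots> = - (2 * a)" by (simp add: a_def sinh_field_def field_simps)
  finally have "\<sigma> pi = - 1" using a by (simp add: \<sigma>_def)
  then have p1: "\<psi> pi = - (pi / 2)" by (simp add: \<psi>_def)
  have contG: "continuous_on A G" for A
    unfolding G_def by (intro continuous_intros) (use less_imp_neq[OF one_plus_square_pos] in \<open>auto simp: eq_commute[of 0]\<close>)
  have sub: "\<psi> ` {0..pi} \<subseteq> {- (pi / 2)..pi / 2}"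
    using arcsin_bounded sle by (auto simp: \<psi>_def abs_le_iff)
  have "((\<lambda>t. (- (((R t)\<^sup>2 + 1) / 2)) *\<^sub>R G (\<psi> t)) has_integral (integral {\<psi> 0..\<psi> pi} G - integral {\<psi> pi..\<psi> 0} G)) {0..pi}"
    by (rule has_integral_substitution_general[of "{0, pi}", OF _ _ sub contG cont\<psi> der]) auto
  moreover have "(- (((R t)\<^sup>2 + 1) / 2)) *\<^sub>R G (\<psi> t) = - poisson_pow l (of_real (tanh (d / 2))) (cis t)" for t
  proof -
    define Y where "Y = (R t + 1 / R t) / 2"
    have Y: "Y \<noteq> 0" using R[of t] by (simp add: Y_def add_pos_pos less_imp_neq[symmetric])
    \<comment> \<open>The Jacobian \<open>(R^2 + 1) / 2\<close> equals \<open>R\<close> times the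
      denominator of \<open>G\<close>, so precisely \<open>R\<close> times the phase, which is
      \<open>poisson_pow\<close>, remains.\<close>
    have h: "((R t)\<^sup>2 + 1) / 2 = R t * Y" using R[of t] by (simp add: Y_def power2_eq_square field_simps)
    show ?thesis unfolding pp G_def sin\<psi> ar sq Y_def[symmetric] h
      using Y by (simp add: scaleR_conv_of_real)
  qed
  moreover have "integral {\<psi> 0..\<psi> pi} G = 0" unfolding p0 p1 by simp
  ultimately have "((\<lambda>t. - poisson_pow l (of_real (tanh (d / 2))) (cis t)) has_integral - integral {- (pi / 2)..pi / 2} G) {0..pi}"
    unfolding p0 p1 by simp
  from has_integral_neg[OF this] show ?thesis by (simp add: integral_unique)
qed

text \<open>The two half circles contribute equally since the kernel is even in the angle. After the
  substitution the phase is odd in \<open>u\<close>, so the imaginary part cancels; the real part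
  \<open>H\<close> has period \<open>pi\<close>, which doubles the half range to a full
  circle.\<close>

lemma integral_poisson_pow:
  fixes d l :: real
  assumes d: "d \<ge> 0"
  shows "integral {0..2 * pi} (\<lambda>t. poisson_pow l (of_real (tanh (d / 2))) (cis t)) = of_real (2 * pi * spherical l (sinh (d / 2)))"
proof (cases "d = 0")
  case True
  have "poisson_pow l 0 (cis t) = 1" for t by (simp add: poisson_pow_def poisson_def)
  then show ?thesis using True by (simp add: spherical_def scaleR_conv_of_real)
next
  case False
  with d have d: "d > 0" by simp
  define a where "a = sinh (d / 2)"
  define G where "G = (\<lambda>u. cis (2 * l * arsinh (a * sin u)) / of_real (sqrt (1 + (a * sin u)\<^sup>2)))"
  define H where "H = (\<lambda>u. cos (2 * l * arsinh (a * sin u)) / sqrt (1 + (a * sin u)\<^sup>2))"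
  define p where "p = (\<lambda>t. poisson_pow l (of_real (tanh (d / 2))) (cis t))"
  have nz: "cosh d \<noteq> sinh d * cos t" for t using cosh_sinh_cos_pos[of d t] by linarith
  have contp: "continuous_on A p" for A
    unfolding p_def poisson_pow_def poisson_circle
    by (intro continuous_intros) (use nz in auto)
  have contG: "continuous_on A G" for A
    unfolding G_def by (intro continuous_intros) (use less_imp_neq[OF one_plus_square_pos] in \<open>auto simp: eq_commute[of 0]\<close>)
  have contH: "continuous_on A H" for A unfolding H_def by (rule continuous_on_spherical_integrand)
  have intp: "p integrable_on {u..v}" and intG: "G integrable_on {u..v}" and intH: "H integrable_on {u..v}" for u v
    by (intro integrable_continuous_real contp contG contH)+
  have refl: "integral {0..pi} p = integral {pi..2 * pi} p"
  proof -
    have "integral {- pi..0} (\<lambda>t. p (- t)) = integral {0..pi} p"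
      using Henstock_Kurzweil_Integration.integral_reflect_real[where a = 0 and b = pi and f = p] by simp
    moreover have "p (- t) = p (t + 2 * pi)" for t
      unfolding p_def poisson_pow_def poisson_circle by simp
    moreover have "integral {- pi..0} (\<lambda>t. p (t + 2 * pi)) = integral {pi..2 * pi} p"
      using integral_shift[of "- pi" "2 * pi" 0 p] contp by (simp add: o_def)
    ultimately show ?thesis by simp
  qed
  have "integral {0..2 * pi} p = integral {0..pi} p + integral {pi..2 * pi} p"
    by (rule Henstock_Kurzweil_Integration.integral_combine[symmetric]) (auto intro: intp)
  then have 1: "integral {0..2 * pi} p = 2 * integral {- (pi / 2)..pi / 2} G"
    unfolding refl[symmetric] using integral_poisson_pow_half[OF d, of l] by (simp add: p_def G_def a_def)
  have 2: "integral {- (pi / 2)..pi / 2} G = of_real (integral {- (pi / 2)..pi / 2} H)"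
  proof -
    have "integral {- (pi / 2)..pi / 2} (\<lambda>u. G (- u)) = integral {- (pi / 2)..pi / 2} G"
      using Henstock_Kurzweil_Integration.integral_reflect_real[where a = "- (pi / 2)" and b = "pi / 2" and f = G] by simp
    then have "2 * integral {- (pi / 2)..pi / 2} G = integral {- (pi / 2)..pi / 2} (\<lambda>u. G u + G (- u))"
      by (subst Henstock_Kurzweil_Integration.integral_add)
        (auto intro!: intG integrable_continuous_real continuous_on_compose2[OF contG[of UNIV]] continuous_intros)
    also have "(\<lambda>u. G u + G (- u)) = (\<lambda>u. of_real (2 * H u))"
      by (auto simp: G_def H_def complex_eq_iff fun_eq_iff Re_divide_of_real Im_divide_of_real)
    also have "integral {- (pi / 2)..pi / 2} (\<lambda>u. complex_of_real (2 * H u)) = of_real (2 * integral {- (pi / 2)..pi / 2} H)"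
    proof -
      have "((of_real \<circ> H) has_integral complex_of_real (integral {- (pi / 2)..pi / 2} H)) {- (pi / 2)..pi / 2}"
        by (rule has_integral_linear[OF integrable_integral[OF intH] bounded_linear_of_real])
      from has_integral_mult_right[OF this, of 2] show ?thesis by (intro integral_unique) (simp add: o_def)
    qed
    finally show ?thesis by simp
  qed
  have 3: "integral {0..2 * pi} H = 2 * integral {- (pi / 2)..pi / 2} H"
  proof -
    have "integral {- (pi / 2)..- (pi / 2) + 2 * pi} H = integral {0..2 * pi} H"
      by (rule integral_periodic_shift[OF contH]) (auto simp: H_def)
    moreover have "integral {- (pi / 2)..- (pi / 2) + 2 * pi} H = integral {- (pi / 2)..pi / 2} H + integral {pi / 2..3 / 2 * pi} H"
      by (subst Henstock_Kurzweil_Integration.integral_combine) (auto intro: intH)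
    moreover have "integral {pi / 2..3 / 2 * pi} H = integral {- (pi / 2)..pi / 2} (\<lambda>t. H (t + pi))"
      using integral_shift[of "- (pi / 2)" pi "pi / 2" H] contH by (simp add: o_def)
    moreover have "H (t + pi) = H t" for t by (simp add: H_def)
    ultimately show ?thesis by simp
  qed
  show ?thesis using 1 2 3 by (simp add: p_def spherical_def H_def a_def)
qed

section \<open>Hyperbolic circles and polar coordinates\<close>

text \<open>\<open>circle_param\<close> in the radial coordinate \<open>a = sinh (d / 2)\<close>,
  for which \<open>tanh (d / 2) = a / sqrt (1 + a^2)\<close>. It is defined for every real
  \<open>a\<close>; a negative value parametrizes the same circle as its absolute value.\<close>

definition hcirc :: "complex \<Rightarrow> real \<Rightarrow> real \<Rightarrow> complex" where
  "hcirc x a t = Moebius_function 0 (- x) (of_real (a / sqrt (1 + a\<^sup>2)) * cis t)"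

lemma circle_param_eq_hcirc: "circle_param x d = hcirc x (sinh (d / 2))"
proof -
  have "cosh (d / 2) = sqrt (1 + (sinh (d / 2))\<^sup>2)"
    using cosh_square_eq[of "d / 2"] by (intro real_sqrt_unique[symmetric]) (auto simp: add.commute)
  then show ?thesis by (simp add: fun_eq_iff circle_param_def hcirc_def tanh_def)
qed

lemma tanh_ratio_less_1: "\<bar>a / sqrt (1 + a\<^sup>2)\<bar> < 1" for a :: real
proof -
  have "sqrt (a\<^sup>2) < sqrt (1 + a\<^sup>2)" by (intro real_sqrt_less_mono) simp
  then show ?thesis using one_plus_square_pos[of a] by (simp add: abs_divide divide_less_eq)
qed

lemma norm_rho_cis: "norm (complex_of_real (a / sqrt (1 + a\<^sup>2)) * cis t) < 1"
  using tanh_ratio_less_1[of a] by (simp only: norm_mult norm_of_real norm_cis mult_1_right)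

lemma hcirc_in_disk: "norm x < 1 \<Longrightarrow> norm (hcirc x a t) < 1"
  unfolding hcirc_def by (rule Moebius_function_norm_lt_1) (simp_all only: norm_rho_cis norm_minus_cancel)

lemma nn_integral_hyp_area:
  assumes f [measurable]: "f \<in> borel_measurable (restrict_space borel poincare_disk)"
  shows "(\<integral>\<^sup>+z. f z \<partial>hyp_area) = (\<integral>\<^sup>+z. (f z * indicator poincare_disk z) * ennreal (4 / (1 - (norm z)\<^sup>2)\<^sup>2) \<partial>lborel)"
proof -
  have [measurable]: "f \<in> borel_measurable (restrict_space lborel poincare_disk)"
    using f by (simp cong: measurable_cong_sets sets_restrict_space_cong)
  have "(\<integral>\<^sup>+z. f z \<partial>hyp_area) = (\<integral>\<^sup>+z. ennreal (4 / (1 - (norm z)\<^sup>2)\<^sup>2) * f z \<partial>restrict_space lborel poincare_disk)"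
  proof -
    have "(\<lambda>z. ennreal (4 / (1 - (cmod z)\<^sup>2)\<^sup>2)) \<in> borel_measurable (restrict_space lborel poincare_disk)"
      by (rule measurable_restrict_space1) measurable
    then show ?thesis unfolding hyp_area_def by (rule nn_integral_density) measurable
  qed
  also have "\<dots> = (\<integral>\<^sup>+z. (f z * indicator poincare_disk z) * ennreal (4 / (1 - (norm z)\<^sup>2)\<^sup>2) \<partial>lborel)"
    by (subst nn_integral_restrict_space) (auto intro!: nn_integral_cong simp: ac_simps)
  finally show ?thesis .
qed

section \<open>Invariance of the area under Moebius maps\<close>

lemma Moebius_uminus_has_derivative:
  assumes "norm x < 1" "norm z < 1"
  shows "(Moebius_function 0 (- x) has_field_derivative of_real (1 - (norm x)\<^sup>2) / (1 + cnj x * z)\<^sup>2) (at z)"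
proof -
  have nz: "1 + cnj x * z \<noteq> 0" using one_plus_cnj_mult_nonzero[of x z] assms by simp
  have eq: "complex_of_real (1 - (norm x)\<^sup>2) = 1 - x * cnj x"
    by (simp add: complex_norm_square flip: of_real_power)
  have 1: "((\<lambda>z. z + x) has_field_derivative 1) (at z)" by (auto intro!: derivative_eq_intros)
  have 2: "((\<lambda>z. 1 + cnj x * z) has_field_derivative cnj x) (at z)" by (auto intro!: derivative_eq_intros)
  have "((\<lambda>z. (z + x) / (1 + cnj x * z)) has_field_derivative
      (1 * (1 + cnj x * z) - (z + x) * cnj x) / ((1 + cnj x * z) * (1 + cnj x * z))) (at z)"
    by (rule DERIV_divide[OF 1 2 nz])
  moreover have "Moebius_function 0 (- x) = (\<lambda>z. (z + x) / (1 + cnj x * z))"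
    by (simp add: Moebius_function_simple fun_eq_iff)
  moreover have "1 * (1 + cnj x * z) - (z + x) * cnj x = 1 - x * cnj x" by (simp add: algebra_simps)
  ultimately show ?thesis unfolding eq by (simp only: power2_eq_square)
qed

lemma Moebius_uminus_norm_identity:
  assumes "norm x < 1" "norm z < 1"
  shows "1 - (norm (Moebius_function 0 (- x) z))\<^sup>2 = (1 - (norm x)\<^sup>2) * (1 - (norm z)\<^sup>2) / (norm (1 + cnj x * z))\<^sup>2"
  using Moebius_norm_identity[of "- x" z] assms by simp

lemma Moebius_measurable: 
  assumes "norm x < 1"
  shows "Moebius_function 0 x \<in> restrict_space borel poincare_disk \<rightarrow>\<^sub>M restrict_space borel poincare_disk"
proof (rule measurable_restrict_space2)
  show "Moebius_function 0 x \<in> space (restrict_space borel poincare_disk) \<rightarrow> poincare_disk"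
    using Moebius_function_norm_lt_1[OF assms] by (auto simp: space_restrict_space)
  show "Moebius_function 0 x \<in> restrict_space borel poincare_disk \<rightarrow>\<^sub>M borel"
    unfolding Moebius_function_def by (rule measurable_restrict_space1) measurable
qed

text \<open>A holomorphic map with derivative \<open>p\<close> has Jacobian \<open>|p|^2\<close>. By
  the identity for \<open>1 - |T z|^2\<close> the modulus of \<open>p\<close> is the ratio of the
  heights of image and point, and this cancels the change in the density.\<close>

lemma nn_integral_hyp_area_Moebius:
  assumes x: "norm x < 1" and f [measurable]: "f \<in> borel_measurable (restrict_space borel poincare_disk)"
  shows "(\<integral>\<^sup>+z. f (Moebius_function 0 (- x) z) \<partial>hyp_area) = (\<integral>\<^sup>+z. f z \<partial>hyp_area)"
proof -
  let ?T = "Moebius_function 0 (- x)"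
  define p where "p = (\<lambda>z. complex_of_real (1 - (norm x)\<^sup>2) / (1 + cnj x * z)\<^sup>2)"
  define F where "F = (\<lambda>z. (f z * indicator poincare_disk z) * ennreal (4 / (1 - (norm z)\<^sup>2)\<^sup>2))"
  have F [measurable]: "F \<in> borel_measurable borel"
    unfolding F_def using f by (subst (asm) borel_measurable_restrict_space_iff_ennreal) auto
  have x': "norm (- x) < 1" using x by simp
  have der: "(?T has_derivative (\<lambda>h. of_real (Re h) * p z + of_real (Im h) * (\<i> * p z))) (at z)"
    if "z \<in> poincare_disk" for z
  proof -
    have "(?T has_derivative (*) (p z)) (at z)"
      using Moebius_uminus_has_derivative[OF x, of z] that unfolding p_def has_field_derivative_def by simp
    moreover have "of_real (Re h) * p z + of_real (Im h) * (\<i> * p z) = p z * h" for h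
      by (simp add: complex_eq_iff algebra_simps)
    ultimately show ?thesis by (simp add: fun_eq_iff)
  qed
  have inv: "Moebius_function 0 x (?T z) = z" "?T (Moebius_function 0 x z) = z" if "norm z < 1" for z
    using that x by (auto intro!: Moebius_function_compose)
  have inj: "inj_on ?T poincare_disk"
    by (rule inj_on_inverseI[of _ "Moebius_function 0 x"]) (use inv in auto)
  have img: "?T ` poincare_disk = poincare_disk"
  proof (intro equalityI subsetI)
    fix z assume "z \<in> poincare_disk"
    then have "z = ?T (Moebius_function 0 x z)" "Moebius_function 0 x z \<in> poincare_disk"
      using inv Moebius_function_norm_lt_1[OF x] by auto
    then show "z \<in> ?T ` poincare_disk" by blast
  qed (use Moebius_function_norm_lt_1[OF x'] in auto)
  have J: "\<bar>Im (cnj (p z) * (\<i> * p z))\<bar> = (norm (p z))\<^sup>2" for z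
    unfolding cmod_power2 by (simp add: power2_eq_square)
  have Jm: "(\<lambda>z. Im (cnj (p z) * (\<i> * p z))) \<in> borel_measurable borel"
  proof -
    have "(\<lambda>z. Im (cnj (p z) * (\<i> * p z))) = (\<lambda>z. (norm (p z))\<^sup>2)"
      unfolding cmod_power2 by (simp add: power2_eq_square)
    then show ?thesis unfolding p_def by simp
  qed
  have "(\<integral>\<^sup>+z. f z \<partial>hyp_area) = (\<integral>\<^sup>+z. F z * indicator poincare_disk z \<partial>lborel)"
    unfolding nn_integral_hyp_area[OF f] F_def by (intro nn_integral_cong) (auto simp: indicator_def)
  also have "\<dots> = (\<integral>\<^sup>+w. F w * indicator (?T ` poincare_disk) w \<partial>lborel)"
    unfolding img ..
  also have "\<dots> = (\<integral>\<^sup>+z. F (?T z) * (ennreal \<bar>Im (cnj (p z) * (\<i> * p z))\<bar> * indicator poincare_disk z) \<partial>lborel)"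
    by (rule nn_integral_complex_change_of_variables[OF open_ball der inj Jm F])
  also have "\<dots> = (\<integral>\<^sup>+z. (f (?T z) * indicator poincare_disk z) * ennreal (4 / (1 - (norm z)\<^sup>2)\<^sup>2) \<partial>lborel)"
  proof (rule nn_integral_cong)
    fix z
    show "F (?T z) * (ennreal \<bar>Im (cnj (p z) * (\<i> * p z))\<bar> * indicator poincare_disk z)
      = (f (?T z) * indicator poincare_disk z) * ennreal (4 / (1 - (norm z)\<^sup>2)\<^sup>2)"
    proof (cases "norm z < 1")
      case z: True
      have X: "1 - (norm x)\<^sup>2 > 0" "1 - (norm z)\<^sup>2 > 0" using x z one_minus_norm_sq_pos by auto
      have nz: "norm (1 + cnj x * z) \<noteq> 0" using one_plus_cnj_mult_nonzero[of x z] x z by simp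
      have np: "(norm (p z))\<^sup>2 = ((1 - (norm x)\<^sup>2) / (norm (1 + cnj x * z))\<^sup>2)\<^sup>2"
        using X by (simp add: p_def norm_divide norm_power del: of_real_diff of_real_power)
      have "4 / (1 - (norm (?T z))\<^sup>2)\<^sup>2 * (norm (p z))\<^sup>2 = 4 / (1 - (norm z)\<^sup>2)\<^sup>2"
        unfolding Moebius_uminus_norm_identity[OF x z] np using X nz
        by (simp add: power_divide power_mult_distrib)
      then have "ennreal (4 / (1 - (norm (?T z))\<^sup>2)\<^sup>2) * ennreal ((norm (p z))\<^sup>2) = ennreal (4 / (1 - (norm z)\<^sup>2)\<^sup>2)"
        by (simp add: ennreal_mult[symmetric])
      then show ?thesis
        unfolding J F_def using z Moebius_function_norm_lt_1[OF x' z]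
        by (simp add: mult.assoc)
    qed simp
  qed
  also have "\<dots> = (\<integral>\<^sup>+z. f (?T z) \<partial>hyp_area)"
    by (rule nn_integral_hyp_area[symmetric]) (rule measurable_compose[OF Moebius_measurable[OF x'] f])
  finally show ?thesis ..
qed

text \<open>Pairs of a radial parameter and an angle, encoded as complex numbers so that polar
  coordinates become a map between subsets of \<open>complex\<close>. The strip is open and the map
  injective on it; the price is a slit along the nonnegative real axis.\<close>

definition polar_strip :: "complex set" where
  "polar_strip = {z. 0 < Re z \<and> 0 < Im z \<and> Im z < 2 * pi}"

lemma open_polar_strip [simp]: "open polar_strip"
  unfolding polar_strip_def by (intro open_Collect_conj open_Collect_less continuous_intros)

lemma polar_image:
  assumes r: "\<And>a. a > 0 \<Longrightarrow> r a > 0"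
  shows "(\<lambda>z. complex_of_real (r (Re z)) * cis (Im z)) ` polar_strip
    = {w. norm w \<in> r ` {0<..}} - {w. 0 \<le> Re w \<and> Im w = 0}" (is "?g ` _ = ?D")
proof (intro equalityI subsetI)
  fix w assume "w \<in> ?g ` polar_strip"
  then obtain z where z: "0 < Re z" "0 < Im z" "Im z < 2 * pi" and w: "w = ?g z" by (auto simp: polar_strip_def)
  have pos: "r (Re z) > 0" by (rule r[OF z(1)])
  have "\<not> (0 \<le> Re w \<and> Im w = 0)"
  proof
    assume *: "0 \<le> Re w \<and> Im w = 0"
    then have "sin (Im z) = 0" "0 \<le> cos (Im z)"
      using pos by (auto simp: w zero_le_mult_iff)
    then obtain n :: int where n: "Im z = of_int n * pi" by (auto simp: sin_zero_iff_int2)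
    with z have "0 < n" "n < 2" by (auto simp: zero_less_mult_iff)
    then have "n = 1" by simp
    with n \<open>0 \<le> cos (Im z)\<close> show False by simp
  qed
  moreover have "norm w = r (Re z)" using pos by (simp add: w norm_mult)
  ultimately show "w \<in> ?D" using z by auto
next
  fix w assume w: "w \<in> ?D"
  then obtain a where a: "a > 0" "norm w = r a" by auto
  have "w = of_real (norm w) * cis (Arg2pi w)"
    using Arg2pi_eq[of w] by (simp add: cis_conv_exp)
  moreover have "0 < Arg2pi w"
    using w Arg2pi_ge_0[of w] Arg2pi_eq_0[of w] by (auto simp: complex_is_Real_iff less_le)
  ultimately have "w = ?g (Complex a (Arg2pi w))" "Complex a (Arg2pi w) \<in> polar_strip"
    using a Arg2pi_lt_2pi[of w] by (auto simp: polar_strip_def)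
  then show "w \<in> ?g ` polar_strip" by blast
qed

text \<open>Polar coordinates with an arbitrary radial parametrization \<open>r\<close>, to serve
  both the Euclidean case \<open>r a = a\<close> and the hyperbolic case
  \<open>r a = a / sqrt (1 + a^2)\<close>. The condition \<open>F0\<close> takes care of circles
  that \<open>r\<close> does not reach.\<close>

lemma nn_integral_polar_general:
  fixes r r' :: "real \<Rightarrow> real" and F :: "complex \<Rightarrow> ennreal"
  assumes r: "\<And>a. a > 0 \<Longrightarrow> r a > 0" and inj: "inj_on r {0<..}"
    and der: "\<And>a. (r has_field_derivative r' a) (at a)"
    and r' [measurable]: "r' \<in> borel_measurable borel"
    and F [measurable]: "F \<in> borel_measurable borel"
    and F0: "\<And>w. w \<noteq> 0 \<Longrightarrow> norm w \<notin> r ` {0<..} \<Longrightarrow> F w = 0"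
  shows "(\<integral>\<^sup>+w. F w \<partial>lborel)
    = (\<integral>\<^sup>+z. F (of_real (r (Re z)) * cis (Im z)) * (ennreal \<bar>r' (Re z) * r (Re z)\<bar> * indicator polar_strip z) \<partial>lborel)"
proof -
  let ?g = "\<lambda>z. complex_of_real (r (Re z)) * cis (Im z)"
  define p where "p = (\<lambda>z. of_real (r' (Re z)) * cis (Im z))"
  define q where "q = (\<lambda>z. of_real (r (Re z)) * (\<i> * cis (Im z)))"
  have gder: "(?g has_derivative (\<lambda>h. of_real (Re h) * p z + of_real (Im h) * q z)) (at z)" for z
  proof -
    have rd: "(r has_derivative (*) (r' a)) (at a)" for a
      using der unfolding has_field_derivative_def .
    have 1: "((\<lambda>z. complex_of_real (r (Re z))) has_derivative (\<lambda>h. of_real (r' (Re z) * Re h))) (at z)"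
      by (intro has_derivative_of_real has_derivative_compose[OF bounded_linear_imp_has_derivative[OF bounded_linear_Re] rd])
    have 2: "((\<lambda>z. cis (Im z)) has_derivative (\<lambda>h. of_real (Im h) * (\<i> * cis (Im z)))) (at z)"
    proof -
      have "((\<lambda>z. cis (Im z)) has_derivative (\<lambda>h. Im h *\<^sub>R (\<i> * cis (Im z)))) (at z)"
        by (rule has_derivative_cis) (rule bounded_linear_imp_has_derivative[OF bounded_linear_Im])
      then show ?thesis by (simp add: scaleR_conv_of_real)
    qed
    show ?thesis
      using has_derivative_mult[OF 1 2] by (simp add: p_def q_def algebra_simps)
  qed
  have inj': "inj_on ?g polar_strip"
  proof (rule inj_onI)
    fix z w assume z: "z \<in> polar_strip" and w: "w \<in> polar_strip" and eq: "?g z = ?g w"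
    have pos: "r (Re z) > 0" "r (Re w) > 0" using z w r by (auto simp: polar_strip_def)
    have "norm (?g z) = norm (?g w)" using eq by simp
    then have rr: "r (Re z) = r (Re w)" using pos by (simp add: norm_mult)
    then have R: "Re z = Re w" using inj z w by (auto simp: polar_strip_def inj_on_def)
    have "cis (Im z) = cis (Im w)" using eq pos rr by simp
    then have "sin (Im z) = sin (Im w) \<and> cos (Im z) = cos (Im w)" by (simp add: complex_eq_iff)
    then obtain n :: int where n: "Im z = Im w + 2 * pi * of_int n" by (subst (asm) sin_cos_eq_iff) auto
    then have "\<bar>2 * pi * of_int n\<bar> < 2 * pi * 1" using z w by (auto simp: polar_strip_def)
    then have "n = 0" by (simp add: abs_mult)
    with n have "Im z = Im w" by simp
    with R show "z = w" by (simp add: complex_eq_iff)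
  qed
  have [measurable]: "r \<in> borel_measurable borel"
    by (intro borel_measurable_continuous_onI continuous_at_imp_continuous_on ballI DERIV_isCont[OF der])
  have J: "Im (cnj (p z) * q z) = r' (Re z) * r (Re z)" for z
  proof -
    have "Im (cnj (p z) * q z) = ((cos (Im z))\<^sup>2 + (sin (Im z))\<^sup>2) * (r' (Re z) * r (Re z))"
    proof -
      define c s where "c = cos (Im z)" and "s = sin (Im z)"
      have "cis (Im z) = Complex c s" by (simp add: cis.ctr c_def s_def)
      then show ?thesis unfolding p_def q_def c_def[symmetric] s_def[symmetric]
        by (simp add: algebra_simps power2_eq_square)
    qed
    then show ?thesis by simp
  qed
  have "(\<integral>\<^sup>+w. F w \<partial>lborel) = (\<integral>\<^sup>+w. F w * indicator (?g ` polar_strip) w \<partial>lborel)"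
  proof (rule nn_integral_cong_AE)
    \<comment> \<open>The slit that polar coordinates omit lies on a line, which is a null
      set.\<close>
    have "negligible {z. Im z = 0}"
      using negligible_hyperplane[of "\<i>" 0] by (simp add: inner_complex_def)
    then have "{z. Im z = 0} \<in> null_sets lebesgue" by (simp add: negligible_iff_null_sets)
    then have "AE z in lebesgue. z \<notin> {z. Im z = 0}" by (rule AE_not_in)
    then have "AE z in lborel. Im z \<noteq> 0" by (subst (asm) AE_completion_iff) auto
    then show "AE w in lborel. F w = F w * indicator (?g ` polar_strip) w"
    proof eventually_elim
      case (elim w)
      then have "w \<noteq> 0" by auto
      have im: "?g ` polar_strip = {w. norm w \<in> r ` {0<..}} - {w. 0 \<le> Re w \<and> Im w = 0}"
        by (rule polar_image) (rule r)
      show ?case unfolding im using F0[OF \<open>w \<noteq> 0\<close>] elim by (auto simp: indicator_def)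
    qed
  qed
  also have "\<dots> = (\<integral>\<^sup>+z. F (?g z) * (ennreal \<bar>Im (cnj (p z) * q z)\<bar> * indicator polar_strip z) \<partial>lborel)"
    by (rule nn_integral_complex_change_of_variables[OF open_polar_strip gder inj']) (simp_all only: J, measurable)
  finally show ?thesis unfolding J .
qed

lemma nn_integral_complex_polar:
  assumes F [measurable]: "F \<in> borel_measurable borel"
  shows "(\<integral>\<^sup>+w. F w \<partial>lborel) = (\<integral>\<^sup>+z. F (of_real (Re z) * cis (Im z)) * (ennreal (Re z) * indicator polar_strip z) \<partial>lborel)"
proof -
  have "(\<integral>\<^sup>+w. F w \<partial>lborel)
    = (\<integral>\<^sup>+z. F (of_real (Re z) * cis (Im z)) * (ennreal \<bar>1 * Re z\<bar> * indicator polar_strip z) \<partial>lborel)"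
    by (rule nn_integral_polar_general[where r = "\<lambda>a. a" and r' = "\<lambda>_. 1"]) (auto intro!: derivative_eq_intros)
  also have "\<dots> = (\<integral>\<^sup>+z. F (of_real (Re z) * cis (Im z)) * (ennreal (Re z) * indicator polar_strip z) \<partial>lborel)"
    by (intro nn_integral_cong) (auto simp: indicator_def polar_strip_def)
  finally show ?thesis .
qed

lemma rho_has_derivative:
  "((\<lambda>a. a / sqrt (1 + a\<^sup>2)) has_field_derivative (1 / ((1 + a\<^sup>2) * sqrt (1 + a\<^sup>2)))) (at a)" for a :: real
proof -
  have p: "1 + a\<^sup>2 > 0" by (rule one_plus_square_pos)
  have s: "sqrt (1 + a\<^sup>2) * sqrt (1 + a\<^sup>2) = 1 + a\<^sup>2" using p by simp
  have d: "((\<lambda>a. sqrt (1 + a\<^sup>2)) has_field_derivative (a / sqrt (1 + a\<^sup>2))) (at a)"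
    using p by (auto intro!: derivative_eq_intros simp: divide_simps)
  have "((\<lambda>a. a / sqrt (1 + a\<^sup>2)) has_field_derivative
     ((1 * sqrt (1 + a\<^sup>2) - a * (a / sqrt (1 + a\<^sup>2))) / (sqrt (1 + a\<^sup>2) * sqrt (1 + a\<^sup>2)))) (at a)"
    by (rule DERIV_divide[OF DERIV_ident d]) (use p in simp)
  moreover have "1 * sqrt (1 + a\<^sup>2) - a * (a / sqrt (1 + a\<^sup>2)) = 1 / sqrt (1 + a\<^sup>2)"
    using p by (simp add: field_simps power2_eq_square)
  ultimately show ?thesis unfolding s by (simp add: mult.commute)
qed

text \<open>For \<open>r = a / sqrt (1 + a^2)\<close> one has \<open>1 - r^2 = 1 / (1 + a^2)\<close>
  and \<open>r * r' = a / (1 + a^2)^2\<close>, so the area density times the Jacobian collapses to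
  \<open>4 * a\<close>. This linear density is the gain of the coordinate
  \<open>sinh (d / 2)\<close>.\<close>

lemma nn_integral_hyp_area_polar_0:
  assumes f [measurable]: "f \<in> borel_measurable (restrict_space borel poincare_disk)"
  shows "(\<integral>\<^sup>+z. f z \<partial>hyp_area)
    = (\<integral>\<^sup>+z. f (hcirc 0 (Re z) (Im z)) * (ennreal (4 * Re z) * indicator polar_strip z) \<partial>lborel)"
proof -
  define r where "r = (\<lambda>a::real. a / sqrt (1 + a\<^sup>2))"
  define r' where "r' = (\<lambda>a::real. 1 / ((1 + a\<^sup>2) * sqrt (1 + a\<^sup>2)))"
  define F where "F = (\<lambda>z. (f z * indicator poincare_disk z) * ennreal (4 / (1 - (norm z)\<^sup>2)\<^sup>2))"
  have F [measurable]: "F \<in> borel_measurable borel"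
    unfolding F_def using f by (subst (asm) borel_measurable_restrict_space_iff_ennreal) auto
  have gr: "complex_of_real (r (Re z)) * cis (Im z) = hcirc 0 (Re z) (Im z)" for z
    by (simp add: hcirc_def Moebius_function_simple r_def)
  have sq: "1 - (r a)\<^sup>2 = 1 / (1 + a\<^sup>2)" for a
    using one_plus_square_pos[of a] by (simp add: r_def power_divide field_simps)
  have r: "r a > 0" if "a > 0" for a using that one_plus_square_pos[of a] by (simp add: r_def)
  have inj: "inj_on r {0<..}"
  proof (rule inj_onI)
    fix a b :: real assume ab: "a \<in> {0<..}" "b \<in> {0<..}" "r a = r b"
    have "1 / (1 + a\<^sup>2) = 1 / (1 + b\<^sup>2)" unfolding sq[symmetric] ab(3) ..
    then have "a\<^sup>2 = b\<^sup>2" by simp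
    then show "a = b" using ab by (simp add: power2_eq_iff)
  qed
  have img: "norm w \<in> r ` {0<..}" if w: "w \<noteq> 0" "norm w < 1" for w :: complex
  proof -
    define a where "a = norm w / sqrt (1 - (norm w)\<^sup>2)"
    have n: "1 - (norm w)\<^sup>2 > 0" using w one_minus_norm_sq_pos by simp
    have a: "a > 0" using n w by (simp add: a_def)
    have "1 + a\<^sup>2 = 1 / (1 - (norm w)\<^sup>2)" using n by (simp add: a_def power_divide field_simps)
    then have "r a = norm w" using n by (simp add: r_def a_def real_sqrt_divide)
    then show ?thesis using a by (auto intro!: image_eqI[of _ _ a])
  qed
  have "(\<integral>\<^sup>+z. f z \<partial>hyp_area) = (\<integral>\<^sup>+z. F z \<partial>lborel)"
    unfolding nn_integral_hyp_area[OF f] F_def ..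
  also have "\<dots> = (\<integral>\<^sup>+z. F (of_real (r (Re z)) * cis (Im z)) * (ennreal \<bar>r' (Re z) * r (Re z)\<bar> * indicator polar_strip z) \<partial>lborel)"
  proof (rule nn_integral_polar_general[OF r inj])
    show "(r has_field_derivative r' a) (at a)" for a unfolding r_def r'_def by (rule rho_has_derivative)
    show "F w = 0" if "w \<noteq> 0" "norm w \<notin> r ` {0<..}" for w
    proof -
      have "w \<notin> poincare_disk" using img[OF that(1)] that(2) by auto
      then show ?thesis by (simp add: F_def)
    qed
  qed (simp_all add: r'_def)
  also have "\<dots> = (\<integral>\<^sup>+z. f (hcirc 0 (Re z) (Im z)) * (ennreal (4 * Re z) * indicator polar_strip z) \<partial>lborel)"
  proof (rule nn_integral_cong)
    fix z
    show "F (of_real (r (Re z)) * cis (Im z)) * (ennreal \<bar>r' (Re z) * r (Re z)\<bar> * indicator polar_strip z)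
      = f (hcirc 0 (Re z) (Im z)) * (ennreal (4 * Re z) * indicator polar_strip z)"
    proof (cases "z \<in> polar_strip")
      case True
      define a where "a = Re z"
      have a: "a > 0" using True by (simp add: a_def polar_strip_def)
      have p: "1 + a\<^sup>2 > 0" by (rule one_plus_square_pos)
      have n: "(norm (complex_of_real (r (Re z)) * cis (Im z)))\<^sup>2 = (r a)\<^sup>2" by (simp add: norm_mult a_def)
      have "4 / (1 - (norm (complex_of_real (r (Re z)) * cis (Im z)))\<^sup>2)\<^sup>2 = 4 * (1 + a\<^sup>2)\<^sup>2"
        unfolding n sq by (simp add: power_divide)
      moreover have "r' a * r a = a / (1 + a\<^sup>2)\<^sup>2"
        using p by (simp add: r_def r'_def power2_eq_square field_simps)
      ultimately have "4 / (1 - (norm (complex_of_real (r (Re z)) * cis (Im z)))\<^sup>2)\<^sup>2 * \<bar>r' (Re z) * r (Re z)\<bar> = 4 * a"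
        using a p by (simp add: a_def[symmetric])
      then have "ennreal (4 / (1 - (norm (hcirc 0 (Re z) (Im z)))\<^sup>2)\<^sup>2) * ennreal \<bar>r' (Re z) * r (Re z)\<bar> = ennreal (4 * a)"
        unfolding gr by (simp add: ennreal_mult[symmetric])
      then show ?thesis unfolding gr using True hcirc_in_disk[of 0 "Re z" "Im z"]
        by (simp add: F_def mult.assoc a_def)
    qed simp
  qed
  finally show ?thesis .
qed

section \<open>Circle means\<close>

abbreviation disk_borel :: "complex measure" where "disk_borel \<equiv> restrict_space borel poincare_disk"
abbreviation unif_angle :: "real measure" where "unif_angle \<equiv> uniform_measure lborel {0..2 * pi}"

text \<open>The hyperbolic area in terms of the radial coordinate \<open>a = sinh (d / 2)\<close>: a disk of radius \<open>d\<close> has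
  area \<open>4 * pi * a\<^sup>2\<close>.\<close>

definition radial_area :: "real measure" where
  "radial_area = density lborel (\<lambda>a. ennreal (8 * pi * a) * indicator {0<..} a)"

lemma sets_hyp_area [measurable_cong]: "sets hyp_area = sets disk_borel"
  unfolding hyp_area_def sets_density by (rule sets_restrict_space_cong) simp

lemma space_hyp_area [simp]: "space hyp_area = poincare_disk"
  by (simp add: hyp_area_def space_restrict_space)

lemma sets_radial_area [measurable_cong, simp]: "sets radial_area = sets borel" by (simp add: radial_area_def)
lemma space_radial_area [simp]: "space radial_area = UNIV" by (simp add: radial_area_def)

lemma prob_space_unif_angle: "prob_space unif_angle"
  by (rule prob_space_uniform_measure) auto

interpretation unif_angle: prob_space unif_angle by (rule prob_space_unif_angle)

lemma sets_unif_angle [measurable_cong, simp]: "sets unif_angle = sets borel" by simp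
lemma space_unif_angle [simp]: "space unif_angle = UNIV" by simp

lemma sigma_finite_hyp_area: "sigma_finite_measure hyp_area"
proof -
  have "finite_measure (restrict_space lborel poincare_disk)"
    by (rule finite_measureI) (use emeasure_bounded_finite[OF bounded_ball, of "0 :: complex" 1] in \<open>auto simp: emeasure_restrict_space space_restrict_space\<close>)
  then interpret R: finite_measure "restrict_space lborel poincare_disk" .
  have "(\<lambda>z. ennreal (4 / (1 - (cmod z)\<^sup>2)\<^sup>2)) \<in> borel_measurable (restrict_space lborel poincare_disk)"
    by (rule measurable_restrict_space1) measurable
  from R.sigma_finite_iff_density_finite[OF this] show ?thesis
    unfolding hyp_area_def by simp
qed

lemma sigma_finite_radial_area: "sigma_finite_measure radial_area"
  unfolding radial_area_def
  by (subst sigma_finite_measure.sigma_finite_iff_density_finite[OF sigma_finite_lborel]) (auto simp: indicator_def)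

interpretation hyp: sigma_finite_measure hyp_area by (rule sigma_finite_hyp_area)
interpretation radial_area: sigma_finite_measure radial_area by (rule sigma_finite_radial_area)
interpretation HU: pair_sigma_finite hyp_area unif_angle ..
interpretation HA: pair_sigma_finite hyp_area radial_area ..
interpretation AU: pair_sigma_finite radial_area unif_angle ..
interpretation HH: pair_sigma_finite hyp_area hyp_area ..

lemma cis_measurable [measurable]: "cis \<in> borel_measurable borel"
  by (intro borel_measurable_continuous_onI continuous_intros)

lemma cnj_measurable [measurable]: "cnj \<in> borel_measurable borel"
  by (intro borel_measurable_continuous_onI continuous_intros)

lemma hcirc_joint_measurable:
  "(\<lambda>(x, a, t). hcirc x a t) \<in> disk_borel \<Otimes>\<^sub>M (borel \<Otimes>\<^sub>M borel) \<rightarrow>\<^sub>M disk_borel"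
proof (rule measurable_restrict_space2)
  show "(\<lambda>(x, a, t). hcirc x a t) \<in> space (disk_borel \<Otimes>\<^sub>M (borel \<Otimes>\<^sub>M borel)) \<rightarrow> poincare_disk"
    using hcirc_in_disk by (auto simp: space_pair_measure space_restrict_space)
  have [measurable]: "(\<lambda>x. x) \<in> disk_borel \<rightarrow>\<^sub>M borel" by (rule measurable_restrict_space1) simp
  have [measurable]: "fst \<in> disk_borel \<Otimes>\<^sub>M (borel \<Otimes>\<^sub>M borel) \<rightarrow>\<^sub>M borel"
    using measurable_compose[OF measurable_fst \<open>(\<lambda>x. x) \<in> disk_borel \<rightarrow>\<^sub>M borel\<close>] by simp
  show "(\<lambda>(x, a, t). hcirc x a t) \<in> disk_borel \<Otimes>\<^sub>M (borel \<Otimes>\<^sub>M borel) \<rightarrow>\<^sub>M borel"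
    unfolding hcirc_def Moebius_function_simple split_beta' by measurable
qed

lemma hcirc_measurable:
  assumes [measurable]: "X \<in> M \<rightarrow>\<^sub>M disk_borel" "A \<in> borel_measurable M" "T \<in> borel_measurable M"
  shows "(\<lambda>w. hcirc (X w) (A w) (T w)) \<in> M \<rightarrow>\<^sub>M disk_borel"
proof -
  have "(\<lambda>w. (X w, A w, T w)) \<in> M \<rightarrow>\<^sub>M disk_borel \<Otimes>\<^sub>M (borel \<Otimes>\<^sub>M borel)" by measurable
  from measurable_compose[OF this hcirc_joint_measurable] show ?thesis by simp
qed

lemma disk_borel_const_measurable: "norm x < 1 \<Longrightarrow> (\<lambda>_. x) \<in> M \<rightarrow>\<^sub>M disk_borel"
  by (rule measurable_const) (simp add: space_restrict_space)

lemma hcirc_pair_measurable: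
  assumes "norm x < 1"
  shows "(\<lambda>(a, t). hcirc x a t) \<in> borel \<Otimes>\<^sub>M borel \<rightarrow>\<^sub>M disk_borel"
  unfolding split_beta' by (rule hcirc_measurable[OF disk_borel_const_measurable[OF assms]]) measurable

lemma Moebius_hcirc_0: "norm x < 1 \<Longrightarrow> Moebius_function 0 (- x) (hcirc 0 a t) = hcirc x a t"
  by (simp add: hcirc_def Moebius_function_simple)

text \<open>Invariance of the area moves the centre from 0 to \<open>x\<close>. The density
  \<open>8 * pi * a\<close> is \<open>4 * a\<close> times \<open>2 * pi\<close>, the latter because
  the angle is normalized to a probability.\<close>

lemma nn_integral_hyp_area_polar:
  assumes x: "norm x < 1" and f [measurable]: "f \<in> borel_measurable disk_borel"
  shows "(\<integral>\<^sup>+z. f z \<partial>hyp_area) = (\<integral>\<^sup>+a. (\<integral>\<^sup>+t. f (hcirc x a t) \<partial>unif_angle) \<partial>radial_area)"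
proof -
  have Tm: "Moebius_function 0 (- x) \<in> disk_borel \<rightarrow>\<^sub>M disk_borel" by (rule Moebius_measurable) (use x in simp)
  have h [measurable]: "(\<lambda>(a, t). f (hcirc x a t)) \<in> borel_measurable (borel \<Otimes>\<^sub>M borel)"
    using measurable_compose[OF hcirc_pair_measurable[OF x] f] by (simp add: split_beta')
  have ind [measurable]: "(\<lambda>(a, t). indicator polar_strip (Complex a t) :: ennreal) \<in> borel_measurable (borel \<Otimes>\<^sub>M borel)"
  proof -
    have "(\<lambda>(a, t). indicator polar_strip (Complex a t) :: ennreal) = (\<lambda>(a, t). indicator {0<..} a * indicator {0<..<2*pi} t)"
      by (auto simp: polar_strip_def indicator_def fun_eq_iff)
    then show ?thesis by simp
  qed
  have Cm [measurable]: "(\<lambda>(a, t). Complex a t) \<in> borel \<Otimes>\<^sub>M borel \<rightarrow>\<^sub>M borel"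
    unfolding borel_prod by (intro borel_measurable_continuous_onI) (auto intro!: continuous_intros simp: split_beta)
  define G where "G = (\<lambda>z. f (hcirc x (Re z) (Im z)) * (ennreal (4 * Re z) * indicator polar_strip z))"
  have G: "G \<in> borel_measurable borel"
  proof -
    have "(\<lambda>z. f (hcirc x (Re z) (Im z))) \<in> borel_measurable borel"
      by (rule measurable_compose[OF hcirc_measurable[OF disk_borel_const_measurable[OF x]] f]) auto
    then show ?thesis unfolding G_def by measurable
  qed
  have "(\<integral>\<^sup>+z. f z \<partial>hyp_area) = (\<integral>\<^sup>+z. f (Moebius_function 0 (- x) z) \<partial>hyp_area)"
    by (rule nn_integral_hyp_area_Moebius[symmetric, OF x f])
  also have "\<dots> = (\<integral>\<^sup>+z. G z \<partial>lborel)"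
    unfolding G_def using nn_integral_hyp_area_polar_0[OF measurable_compose[OF Tm f]] by (simp add: Moebius_hcirc_0[OF x])
  also have "\<dots> = (\<integral>\<^sup>+p. G (case p of (a, t) \<Rightarrow> Complex a t) \<partial>(lborel \<Otimes>\<^sub>M lborel))"
    by (subst lborel_distr_Complex[symmetric], rule nn_integral_distr) (use G in auto)
  also have "\<dots> = (\<integral>\<^sup>+a. (\<integral>\<^sup>+t. G (Complex a t) \<partial>lborel) \<partial>lborel)"
    using G by (subst lborel.nn_integral_fst[symmetric]) (auto simp: split_beta')
  also have "\<dots> = (\<integral>\<^sup>+a. (ennreal (8 * pi * a) * indicator {0<..} a) * (\<integral>\<^sup>+t. f (hcirc x a t) \<partial>unif_angle) \<partial>lborel)"
  proof (rule nn_integral_cong)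
    fix a :: real
    have ft [measurable]: "(\<lambda>t. f (hcirc x a t)) \<in> borel_measurable borel"
      by (rule measurable_compose[OF hcirc_measurable[OF disk_borel_const_measurable[OF x]] f]) auto
    show "(\<integral>\<^sup>+t. G (Complex a t) \<partial>lborel) = (ennreal (8 * pi * a) * indicator {0<..} a) * (\<integral>\<^sup>+t. f (hcirc x a t) \<partial>unif_angle)"
    proof (cases "a > 0")
      case True
      have "(\<integral>\<^sup>+t. G (Complex a t) \<partial>lborel) = (\<integral>\<^sup>+t. ennreal (4 * a) * (f (hcirc x a t) * indicator {0..2*pi} t) \<partial>lborel)"
      proof (rule nn_integral_cong_AE)
        show "AE t in lborel. G (Complex a t) = ennreal (4 * a) * (f (hcirc x a t) * indicator {0..2*pi} t)"
          using AE_lborel_singleton[of 0] AE_lborel_singleton[of "2 * pi"]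
          by eventually_elim (use True in \<open>auto simp: G_def polar_strip_def indicator_def mult.commute\<close>)
      qed
      also have "\<dots> = ennreal (4 * a) * (\<integral>\<^sup>+t. f (hcirc x a t) * indicator {0..2*pi} t \<partial>lborel)"
        by (rule nn_integral_cmult) measurable
      also have "(\<integral>\<^sup>+t. f (hcirc x a t) * indicator {0..2*pi} t \<partial>lborel) = ennreal (2 * pi) * (\<integral>\<^sup>+t. f (hcirc x a t) \<partial>unif_angle)"
        by (subst nn_integral_uniform_measure) (auto simp: ennreal_divide_times ennreal_mult_divide_eq mult.commute[of "ennreal (2 * pi)"])
      also have "ennreal (4 * a) * (ennreal (2 * pi) * (\<integral>\<^sup>+t. f (hcirc x a t) \<partial>unif_angle)) = ennreal (8 * pi * a) * (\<integral>\<^sup>+t. f (hcirc x a t) \<partial>unif_angle)"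
      proof -
        have "ennreal (4 * a) * ennreal (2 * pi) = ennreal (4 * a * (2 * pi))"
          using True by (intro ennreal_mult[symmetric]) auto
        also have "4 * a * (2 * pi) = 8 * pi * a" by simp
        finally show ?thesis by (simp only: mult.assoc[symmetric])
      qed
      finally show ?thesis using True by simp
    qed (auto simp: G_def polar_strip_def)
  qed
  also have "\<dots> = (\<integral>\<^sup>+a. (\<integral>\<^sup>+t. f (hcirc x a t) \<partial>unif_angle) \<partial>radial_area)"
    unfolding radial_area_def by (rule nn_integral_density[symmetric]) measurable
  finally show ?thesis .
qed

text \<open>The same formula as an identity of measures, so that it also applies to signed
  integrands and to integrability.\<close>

lemma distr_hcirc:
  assumes x: "norm x < 1"
  shows "distr (radial_area \<Otimes>\<^sub>M unif_angle) hyp_area (\<lambda>(a, t). hcirc x a t) = hyp_area"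
proof (rule measure_eqI)
  have hm: "(\<lambda>(a, t). hcirc x a t) \<in> radial_area \<Otimes>\<^sub>M unif_angle \<rightarrow>\<^sub>M hyp_area"
    using hcirc_pair_measurable[OF x] by (simp cong: measurable_cong_sets add: sets_hyp_area)
  fix B assume "B \<in> sets (distr (radial_area \<Otimes>\<^sub>M unif_angle) hyp_area (\<lambda>(a, t). hcirc x a t))"
  then have B: "B \<in> sets hyp_area" by simp
  have "emeasure (distr (radial_area \<Otimes>\<^sub>M unif_angle) hyp_area (\<lambda>(a, t). hcirc x a t)) B
      = (\<integral>\<^sup>+z. indicator B z \<partial>distr (radial_area \<Otimes>\<^sub>M unif_angle) hyp_area (\<lambda>(a, t). hcirc x a t))"
    using B by simp
  also have "\<dots> = (\<integral>\<^sup>+p. indicator B (case p of (a, t) \<Rightarrow> hcirc x a t) \<partial>(radial_area \<Otimes>\<^sub>M unif_angle))"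
    by (rule nn_integral_distr[OF hm]) (use B in simp)
  also have "\<dots> = (\<integral>\<^sup>+a. (\<integral>\<^sup>+t. indicator B (hcirc x a t) \<partial>unif_angle) \<partial>radial_area)"
    using measurable_compose[OF hm, of "indicator B" borel] B
    by (subst unif_angle.nn_integral_fst[symmetric]) (auto simp: split_beta')
  also have "\<dots> = (\<integral>\<^sup>+z. indicator B z \<partial>hyp_area)"
    by (rule nn_integral_hyp_area_polar[symmetric, OF x]) (use B sets_hyp_area in simp)
  also have "\<dots> = emeasure hyp_area B" using B by simp
  finally show "emeasure (distr (radial_area \<Otimes>\<^sub>M unif_angle) hyp_area (\<lambda>(a, t). hcirc x a t)) B = emeasure hyp_area B" .
qed simp

text \<open>This is \<open>sinh (hyp_dist x y / 2)\<close>.\<close>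

definition sinh_hdist :: "complex \<Rightarrow> complex \<Rightarrow> real" where
  "sinh_hdist x y = norm (x - y) / sqrt ((1 - (norm x)\<^sup>2) * (1 - (norm y)\<^sup>2))"

lemma sinh_hdist_commute: "sinh_hdist x y = sinh_hdist y x"
  by (simp add: sinh_hdist_def norm_minus_commute mult.commute)

lemma sinh_hdist_Moebius:
  assumes "norm x < 1" "norm y < 1"
  shows "norm (Moebius_function 0 x y) = sinh_hdist x y / sqrt (1 + (sinh_hdist x y)\<^sup>2)"
proof -
  define w where "w = norm (Moebius_function 0 x y)"
  define Q where "Q = (1 - (norm x)\<^sup>2) * (1 - (norm y)\<^sup>2)"
  have Q: "Q > 0" using assms one_minus_norm_sq_pos by (simp add: Q_def)
  have nz: "norm (1 - cnj x * y) \<noteq> 0" using one_minus_cnj_mult_nonzero[of x y] assms by simp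
  have N: "(norm (1 - cnj x * y))\<^sup>2 = (norm (x - y))\<^sup>2 + Q"
    unfolding Q_def cmod_power2 by (simp add: algebra_simps power2_eq_square)
  have s: "sqrt (1 + (sinh_hdist x y)\<^sup>2) = norm (1 - cnj x * y) / sqrt Q"
  proof (rule real_sqrt_unique)
    have "1 + (sinh_hdist x y)\<^sup>2 = (Q + (norm (x - y))\<^sup>2) / Q"
      using Q by (simp add: sinh_hdist_def Q_def[symmetric] power_divide add_divide_distrib)
    then show "(norm (1 - cnj x * y) / sqrt Q)\<^sup>2 = 1 + (sinh_hdist x y)\<^sup>2"
      using Q by (simp add: power_divide N add.commute)
  qed (use Q in simp)
  show ?thesis unfolding s using Q nz
    by (simp add: sinh_hdist_def Q_def[symmetric] Moebius_function_simple norm_divide norm_minus_commute)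
qed

lemma sinh_hdist_hcirc:
  assumes x: "norm x < 1"
  shows "sinh_hdist x (hcirc x a t) = \<bar>a\<bar>"
proof -
  define y where "y = hcirc x a t"
  have y: "norm y < 1" unfolding y_def by (rule hcirc_in_disk[OF x])
  have "Moebius_function 0 x y = of_real (a / sqrt (1 + a\<^sup>2)) * cis t"
    unfolding y_def hcirc_def by (rule Moebius_function_compose) (use x norm_rho_cis[of a t] in simp_all)
  then have n: "norm (Moebius_function 0 x y) = \<bar>a\<bar> / sqrt (1 + a\<^sup>2)"
    using one_plus_square_pos[of a] by (simp add: norm_mult norm_divide)
  have "sinh_hdist x y \<ge> 0" using x y one_minus_norm_sq_pos by (simp add: sinh_hdist_def less_imp_le)
  have sq: "1 - (b / sqrt (1 + b\<^sup>2))\<^sup>2 = 1 / (1 + b\<^sup>2)" for b :: real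
    using one_plus_square_pos[of b] by (simp add: power_divide field_simps)
  have "sinh_hdist x y / sqrt (1 + (sinh_hdist x y)\<^sup>2) = \<bar>a\<bar> / sqrt (1 + \<bar>a\<bar>\<^sup>2)"
    using sinh_hdist_Moebius[OF x y] n by simp
  then have "1 / (1 + (sinh_hdist x y)\<^sup>2) = 1 / (1 + \<bar>a\<bar>\<^sup>2)" by (simp only: sq[symmetric])
  then have "(sinh_hdist x y)\<^sup>2 = a\<^sup>2" by simp
  then show ?thesis using \<open>sinh_hdist x y \<ge> 0\<close> unfolding y_def[symmetric] by (metis abs_of_nonneg power2_eq_iff abs_minus_cancel)
qed

lemma sinh_hdist_measurable: "(\<lambda>(x, y). sinh_hdist x y) \<in> borel_measurable (hyp_area \<Otimes>\<^sub>M hyp_area)"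
proof -
  have [measurable]: "(\<lambda>x. x) \<in> disk_borel \<rightarrow>\<^sub>M borel" by (rule measurable_restrict_space1) simp
  have [measurable]: "fst \<in> disk_borel \<Otimes>\<^sub>M disk_borel \<rightarrow>\<^sub>M borel" "snd \<in> disk_borel \<Otimes>\<^sub>M disk_borel \<rightarrow>\<^sub>M borel"
    using measurable_compose[OF measurable_fst \<open>(\<lambda>x. x) \<in> disk_borel \<rightarrow>\<^sub>M borel\<close>]
      measurable_compose[OF measurable_snd \<open>(\<lambda>x. x) \<in> disk_borel \<rightarrow>\<^sub>M borel\<close>] by simp_all
  have "(\<lambda>(x, y). sinh_hdist x y) \<in> borel_measurable (disk_borel \<Otimes>\<^sub>M disk_borel)"
    unfolding sinh_hdist_def split_beta' by measurable
  then show ?thesis by (simp cong: measurable_cong_sets)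
qed

text \<open>The averaging operator on real functions in the coordinate \<open>a\<close>. Complex
  functions are treated through their real and imaginary parts.\<close>

definition cmean :: "real \<Rightarrow> (complex \<Rightarrow> real) \<Rightarrow> complex \<Rightarrow> real" where
  "cmean a f x = (\<integral>t. f (hcirc x a t) \<partial>unif_angle)"

lemma cmean_measurable:
  assumes [measurable]: "f \<in> borel_measurable disk_borel"
  shows "(\<lambda>(x, a). cmean a f x) \<in> borel_measurable (hyp_area \<Otimes>\<^sub>M borel)"
proof -
  have "(\<lambda>p. hcirc (fst (fst p)) (snd (fst p)) (snd p)) \<in> (hyp_area \<Otimes>\<^sub>M borel) \<Otimes>\<^sub>M unif_angle \<rightarrow>\<^sub>M disk_borel"
    by (rule hcirc_measurable) measurable
  from measurable_compose[OF this assms]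
  have "(\<lambda>(p, t). f (hcirc (fst p) (snd p) t)) \<in> borel_measurable ((hyp_area \<Otimes>\<^sub>M borel) \<Otimes>\<^sub>M unif_angle)"
    by (simp add: split_beta')
  from unif_angle.borel_measurable_lebesgue_integral[OF this] show ?thesis
    by (simp add: cmean_def split_beta')
qed

lemma cmean_measurable_center:
  assumes "f \<in> borel_measurable disk_borel"
  shows "cmean a f \<in> borel_measurable hyp_area"
  using measurable_compose[OF _ cmean_measurable[OF assms], of "\<lambda>x. (x, a)" hyp_area] by simp

text \<open>A kernel that depends only on the distance to \<open>x\<close> is constant on circles
  about \<open>x\<close>, so only the circle means of \<open>f\<close> enter. The third part
  supplies the absolute bound for the exchange of integrals in
  \<open>hyp_kernel_fubini\<close>.\<close>

lemma hyp_integral_polar: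
  fixes f :: "complex \<Rightarrow> real"
  assumes x: "norm x < 1" and f: "integrable hyp_area f" and k: "k \<in> borel_measurable borel" and kb: "\<And>a. \<bar>k a\<bar> \<le> B"
  shows "integrable radial_area (\<lambda>a. k a * cmean a f x)"
    and "(\<integral>y. f y * k (sinh_hdist x y) \<partial>hyp_area) = (\<integral>a. k a * cmean a f x \<partial>radial_area)"
    and "(\<integral>\<^sup>+a. ennreal \<bar>cmean a f x\<bar> \<partial>radial_area) \<le> (\<integral>\<^sup>+y. ennreal \<bar>f y\<bar> \<partial>hyp_area)"
proof -
  have fm: "f \<in> borel_measurable hyp_area" using f by simp
  then have fm' [measurable]: "f \<in> borel_measurable disk_borel" by (simp cong: measurable_cong_sets)
  have hm [measurable]: "(\<lambda>(a, t). hcirc x a t) \<in> radial_area \<Otimes>\<^sub>M unif_angle \<rightarrow>\<^sub>M hyp_area"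
    using hcirc_pair_measurable[OF x] by (simp cong: measurable_cong_sets add: sets_hyp_area)
  have sdm: "(\<lambda>y. sinh_hdist x y) \<in> borel_measurable hyp_area"
    using measurable_compose[OF _ sinh_hdist_measurable, of "\<lambda>y. (x, y)" hyp_area] x by simp
  have km: "(\<lambda>y. f y * k (sinh_hdist x y)) \<in> borel_measurable hyp_area"
    using fm measurable_compose[OF sdm k] by simp
  have ki: "integrable hyp_area (\<lambda>y. f y * k (sinh_hdist x y))"
  proof (rule Bochner_Integration.integrable_bound[of _ "\<lambda>y. B * f y"])
    show "AE y in hyp_area. norm (f y * k (sinh_hdist x y)) \<le> norm (B * f y)"
      using kb by (intro AE_I2) (auto simp: abs_mult mult.commute[of "\<bar>f _\<bar>"] intro!: mult_right_mono order_trans[OF kb abs_ge_self])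
  qed (use f km in auto)
  have int: "integrable (radial_area \<Otimes>\<^sub>M unif_angle) (\<lambda>(a, t). f (hcirc x a t) * k (sinh_hdist x (hcirc x a t)))"
    using integrable_distr[OF hm, of "\<lambda>y. f y * k (sinh_hdist x y)"] ki unfolding distr_hcirc[OF x] by (simp add: split_beta')
  have pos: "AE a in radial_area. a > 0"
    unfolding radial_area_def by (subst AE_density) (auto simp: indicator_def)
  have kk: "integrable radial_area (\<lambda>a. \<integral>t. f (hcirc x a t) * k \<bar>a\<bar> \<partial>unif_angle)"
    "(\<integral>a. (\<integral>t. f (hcirc x a t) * k \<bar>a\<bar> \<partial>unif_angle) \<partial>radial_area) = (\<integral>p. (case p of (a, t) \<Rightarrow> f (hcirc x a t) * k (sinh_hdist x (hcirc x a t))) \<partial>(radial_area \<Otimes>\<^sub>M unif_angle))"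
    using AU.integrable_fst'[OF int] AU.integral_fst'[OF int] by (simp_all add: sinh_hdist_hcirc[OF x])
  have e: "(\<integral>t. f (hcirc x a t) * k \<bar>a\<bar> \<partial>unif_angle) = k \<bar>a\<bar> * cmean a f x" for a
    by (simp add: cmean_def mult.commute)
  have amx: "(\<lambda>a. cmean a f x) \<in> borel_measurable borel"
    using measurable_compose[OF _ cmean_measurable[OF fm'], of "\<lambda>a. (x, a)" borel] x by simp
  show i: "integrable radial_area (\<lambda>a. k a * cmean a f x)"
    using kk(1) unfolding e
    by (rule integrable_cong_AE_imp) (use amx k pos in \<open>auto elim!: eventually_mono\<close>)
  have "(\<integral>y. f y * k (sinh_hdist x y) \<partial>hyp_area) = (\<integral>y. f y * k (sinh_hdist x y) \<partial>distr (radial_area \<Otimes>\<^sub>M unif_angle) hyp_area (\<lambda>(a, t). hcirc x a t))"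
    unfolding distr_hcirc[OF x] ..
  also have "\<dots> = (\<integral>p. f (case p of (a, t) \<Rightarrow> hcirc x a t) * k (sinh_hdist x (case p of (a, t) \<Rightarrow> hcirc x a t)) \<partial>(radial_area \<Otimes>\<^sub>M unif_angle))"
    by (rule integral_distr[OF hm km])
  also have "\<dots> = (\<integral>a. k \<bar>a\<bar> * cmean a f x \<partial>radial_area)"
    using kk(2) unfolding e by (simp add: split_beta')
  also have "\<dots> = (\<integral>a. k a * cmean a f x \<partial>radial_area)"
    by (rule integral_cong_AE) (use amx k pos in \<open>auto elim!: eventually_mono\<close>)
  finally show "(\<integral>y. f y * k (sinh_hdist x y) \<partial>hyp_area) = (\<integral>a. k a * cmean a f x \<partial>radial_area)" .
  have "(\<integral>\<^sup>+a. ennreal \<bar>cmean a f x\<bar> \<partial>radial_area) \<le> (\<integral>\<^sup>+a. (\<integral>\<^sup>+t. ennreal \<bar>f (hcirc x a t)\<bar> \<partial>unif_angle) \<partial>radial_area)"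
  proof (rule nn_integral_mono)
    fix a
    \<comment> \<open>On a circle where \<open>f\<close> is not integrable, \<open>cmean\<close> has
      the default value 0 and the bound is trivial.\<close>
    show "ennreal \<bar>cmean a f x\<bar> \<le> (\<integral>\<^sup>+t. ennreal \<bar>f (hcirc x a t)\<bar> \<partial>unif_angle)"
      using integral_norm_bound_ennreal[of unif_angle "\<lambda>t. f (hcirc x a t)"]
      by (cases "integrable unif_angle (\<lambda>t. f (hcirc x a t))") (auto simp: cmean_def not_integrable_integral_eq)
  qed
  also have "\<dots> = (\<integral>\<^sup>+y. ennreal \<bar>f y\<bar> \<partial>hyp_area)"
    by (rule nn_integral_hyp_area_polar[symmetric, OF x]) measurable
  finally show "(\<integral>\<^sup>+a. ennreal \<bar>cmean a f x\<bar> \<partial>radial_area) \<le> (\<integral>\<^sup>+y. ennreal \<bar>f y\<bar> \<partial>hyp_area)" .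
qed

section \<open>Positivity of the spherical transform\<close>

lemma integral_std_normal_cos:
  "(\<integral>z. cos (u * z) \<partial>std_normal_distribution) = exp (- u\<^sup>2 / 2)"
proof -
  interpret real_distribution std_normal_distribution by (rule real_dist_normal_dist)
  have int: "integrable std_normal_distribution (\<lambda>z. iexp (u * z))"
    by (rule integrable_iexp) auto
  have "complex_of_real (exp (- u\<^sup>2 / 2)) = (CLINT z|std_normal_distribution. iexp (u * z))"
    using fun_cong[OF char_std_normal_distribution, of u] by (simp add: char_def)
  then have "exp (- u\<^sup>2 / 2) = Re (CLINT z|std_normal_distribution. iexp (u * z))" by (metis Re_complex_of_real)
  also have "\<dots> = (\<integral>z. Re (iexp (u * z)) \<partial>std_normal_distribution)"
    using int by (rule integral_Re[symmetric])
  finally show ?thesis by (simp add: Re_exp)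
qed

text \<open>The transform is not assumed integrable, so Fourier inversion is replaced by averaging against
  narrow Gaussians.\<close>

lemma cos_transform_nonneg_imp_max_at_0:
  fixes h :: "real \<Rightarrow> real"
  assumes cont: "continuous_on UNIV h" and supp: "\<And>t. \<bar>t\<bar> > B \<Longrightarrow> h t = 0"
    and even: "\<And>t. h (- t) = h t"
    and nonneg: "\<And>l. 0 \<le> (\<integral>t. h t * cos (l * t) \<partial>lborel)"
  shows "h s \<le> h 0"
proof -
  let ?N = "std_normal_distribution"
  interpret N: real_distribution ?N by (rule real_dist_normal_dist)
  have hm [measurable]: "h \<in> borel_measurable borel" by (rule borel_measurable_continuous_onI[OF cont])
  obtain M where M: "\<And>t. \<bar>h t\<bar> \<le> M"
  proof -
    have "compact (h ` {-B..B})" by (rule compact_continuous_image[OF continuous_on_subset[OF cont]]) auto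
    then obtain M where "\<forall>x\<in>{-B..B}. \<bar>h x\<bar> \<le> M" by (metis bounded_real compact_imp_bounded imageI)
    then have "\<bar>h t\<bar> \<le> max M 0" for t using supp[of t] by (cases "\<bar>t\<bar> > B") (auto simp: abs_le_iff not_less intro: le_max_iff_disj[THEN iffD2])
    then show ?thesis by (rule that)
  qed
  have hint: "integrable lborel h"
  proof -
    have "t \<in> {-B..B}" if "h t \<noteq> 0" for t
    proof -
      have "\<bar>t\<bar> \<le> B" using supp[of t] that by (cases "\<bar>t\<bar> > B") auto
      then show ?thesis by (auto simp: abs_le_iff)
    qed
    then have "h = (\<lambda>t. indicator {-B..B} t *\<^sub>R h t)" by (auto simp: fun_eq_iff indicator_def)
    moreover have "set_integrable lborel {-B..B} h"
      by (rule borel_integrable_compact[OF _ continuous_on_subset[OF cont], unfolded set_integrable_def[symmetric]]) auto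
    ultimately show ?thesis unfolding set_integrable_def by simp
  qed
  \<comment> \<open>The mean of \<open>h\<close> against a Gaussian of width \<open>\<sigma>\<close>
    about \<open>p\<close>; it tends to \<open>h p\<close> as \<open>\<sigma>\<close> goes to
    0.\<close>
  define A where "A = (\<lambda>\<sigma> p. \<integral>z. h (p + \<sigma> * z) \<partial>?N)"
  have gauss: "(\<integral>t. h t * exp (- ((t - p) / \<sigma>)\<^sup>2 / 2) \<partial>lborel) = \<sigma> * sqrt (2 * pi) * A \<sigma> p"
    if s: "\<sigma> > 0" for \<sigma> p
  proof -
    have "(\<integral>t. h t * exp (- ((t - p) / \<sigma>)\<^sup>2 / 2) \<partial>lborel)
      = \<bar>\<sigma>\<bar> *\<^sub>R (\<integral>z. h (p + \<sigma> * z) * exp (- ((p + \<sigma> * z - p) / \<sigma>)\<^sup>2 / 2) \<partial>lborel)"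
      by (rule lborel_integral_real_affine) (use s in simp)
    also have "\<dots> = \<sigma> * (\<integral>z. h (p + \<sigma> * z) * exp (- z\<^sup>2 / 2) \<partial>lborel)"
      using s by simp
    also have "(\<integral>z. h (p + \<sigma> * z) * exp (- z\<^sup>2 / 2) \<partial>lborel) = sqrt (2 * pi) * A \<sigma> p"
    proof -
      have "A \<sigma> p = (\<integral>z. std_normal_density z *\<^sub>R h (p + \<sigma> * z) \<partial>lborel)"
        unfolding A_def by (rule integral_density) auto
      also have "\<dots> = (\<integral>z. (h (p + \<sigma> * z) * exp (- z\<^sup>2 / 2)) / sqrt (2 * pi) \<partial>lborel)"
        by (simp add: std_normal_density_def mult.commute)
      also have "\<dots> = (\<integral>z. h (p + \<sigma> * z) * exp (- z\<^sup>2 / 2) \<partial>lborel) / sqrt (2 * pi)"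
        by (rule integral_divide_zero)
      finally show ?thesis by simp
    qed
    finally show ?thesis by simp
  qed
  have ineq: "A \<sigma> s / 2 + A \<sigma> (- s) / 2 \<le> A \<sigma> 0" if s: "\<sigma> > 0" for \<sigma>
  proof -
    \<comment> \<open>\<open>1 - cos (z / \<sigma> * s)\<close> is a nonnegative weight on the
      frequency \<open>z / \<sigma>\<close>, so integrating the transform of \<open>h\<close>
      against it keeps the sign. Integrating over the Gaussian variable \<open>z\<close> first
      instead produces the means of \<open>h\<close> about 0, \<open>s\<close> and
      \<open>- s\<close>, with weights 1, -1/2 and -1/2.\<close>
    define k where "k = (\<lambda>z t. (1 - cos (z / \<sigma> * s)) * (h t * cos (z / \<sigma> * t)))"
    interpret P: pair_sigma_finite ?N lborel ..
    have kint: "integrable (?N \<Otimes>\<^sub>M lborel) (\<lambda>(z, t). k z t)"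
    proof (rule Bochner_Integration.integrable_bound)
      show "integrable (?N \<Otimes>\<^sub>M lborel) (\<lambda>(z, t). 2 * \<bar>h t\<bar>)"
        by (rule P.Fubini_integrable) (use hint in \<open>auto\<close>)
      show "AE x in ?N \<Otimes>\<^sub>M lborel. norm (case x of (z, t) \<Rightarrow> k z t) \<le> norm (case x of (z, t) \<Rightarrow> 2 * \<bar>h t\<bar>)"
      proof (intro AE_I2, clarsimp)
        fix z t
        have "\<bar>1 - cos (z / \<sigma> * s)\<bar> \<le> 2"
          using cos_ge_minus_one[of "z / \<sigma> * s"] cos_le_one[of "z / \<sigma> * s"] by (simp only: abs_le_iff) linarith
        moreover have "\<bar>h t * cos (z / \<sigma> * t)\<bar> \<le> \<bar>h t\<bar>" by (simp add: abs_mult mult_left_le)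
        ultimately show "\<bar>k z t\<bar> \<le> 2 * \<bar>h t\<bar>" unfolding k_def abs_mult by (intro mult_mono) (auto simp: abs_mult)
      qed
      show "(\<lambda>(z, t). k z t) \<in> borel_measurable (?N \<Otimes>\<^sub>M lborel)" unfolding k_def by measurable
    qed
    have "(\<integral>z. (\<integral>t. k z t \<partial>lborel) \<partial>?N) \<ge> 0"
    proof (rule integral_nonneg_AE, rule AE_I2)
      fix z
      show "0 \<le> (\<integral>t. k z t \<partial>lborel)" unfolding k_def using nonneg[of "z / \<sigma>"]
        by (simp add: mult_nonneg_nonneg)
    qed
    also have "(\<integral>z. (\<integral>t. k z t \<partial>lborel) \<partial>?N) = (\<integral>t. (\<integral>z. k z t \<partial>?N) \<partial>lborel)"
      using P.Fubini_integral[of k] kint by simp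
    also have "\<dots> = (\<integral>t. h t * exp (- ((t - 0) / \<sigma>)\<^sup>2 / 2) - (h t * exp (- ((t - s) / \<sigma>)\<^sup>2 / 2) / 2 + h t * exp (- ((t - (- s)) / \<sigma>)\<^sup>2 / 2) / 2) \<partial>lborel)"
    proof (rule Bochner_Integration.integral_cong[OF refl])
      fix t
      have ci: "integrable ?N (\<lambda>z. cos (u * z))" for u by (rule N.integrable_const_bound[of _ 1]) auto
      have e: "k z t = h t * (cos (t / \<sigma> * z) - (cos ((t - s) / \<sigma> * z) / 2 + cos ((t + s) / \<sigma> * z) / 2))" for z
        using s by (simp add: k_def cos_diff cos_add field_simps)
          (simp add: diff_divide_distrib add_divide_distrib cos_diff cos_add algebra_simps)
      show "(\<integral>z. k z t \<partial>?N) = h t * exp (- ((t - 0) / \<sigma>)\<^sup>2 / 2) - (h t * exp (- ((t - s) / \<sigma>)\<^sup>2 / 2) / 2 + h t * exp (- ((t - (- s)) / \<sigma>)\<^sup>2 / 2) / 2)"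
      proof -
        have E: "(\<integral>z. cos (u1 * z) - (cos (u2 * z) / 2 + cos (u3 * z) / 2) \<partial>?N)
          = exp (- u1\<^sup>2 / 2) - (exp (- u2\<^sup>2 / 2) / 2 + exp (- u3\<^sup>2 / 2) / 2)" for u1 u2 u3
          by (simp add: ci integral_std_normal_cos)
        show ?thesis unfolding e integral_mult_right_zero E by (simp add: algebra_simps)
      qed
    qed
    also have "\<dots> = \<sigma> * sqrt (2 * pi) * A \<sigma> 0 - (\<sigma> * sqrt (2 * pi) * A \<sigma> s / 2 + \<sigma> * sqrt (2 * pi) * A \<sigma> (- s) / 2)"
    proof -
      have gi: "integrable lborel (\<lambda>t. h t * exp (- ((t - p) / \<sigma>)\<^sup>2 / 2))" for p
        by (rule Bochner_Integration.integrable_bound[OF hint]) (auto simp: abs_mult mult_left_le)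
      show ?thesis
        using gi[of 0] gi[of s] gi[of "- s"] gauss[OF s, of 0] gauss[OF s, of s] gauss[OF s, of "- s"] by simp
    qed
    also have "\<dots> = \<sigma> * sqrt (2 * pi) * (A \<sigma> 0 - (A \<sigma> s / 2 + A \<sigma> (- s) / 2))" by (simp add: algebra_simps)
    finally have "0 \<le> \<sigma> * sqrt (2 * pi) * (A \<sigma> 0 - (A \<sigma> s / 2 + A \<sigma> (- s) / 2))" .
    moreover have "\<sigma> * sqrt (2 * pi) > 0" using s by simp
    ultimately show ?thesis by (simp only: zero_le_mult_iff) linarith
  qed
  have lim: "(\<lambda>n. A (1 / Suc n) p) \<longlonglongrightarrow> h p" for p
  proof -
    have "(\<lambda>n. A (1 / Suc n) p) \<longlonglongrightarrow> (\<integral>z. h p \<partial>?N)"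
      unfolding A_def
    proof (rule integral_dominated_convergence[where w = "\<lambda>_. M"])
      show "AE z in ?N. (\<lambda>n. h (p + 1 / real (Suc n) * z)) \<longlonglongrightarrow> h p"
      proof (rule AE_I2)
        fix z
        have "(\<lambda>n. p + 1 / real (Suc n) * z) \<longlonglongrightarrow> p + 0 * z"
          by (intro tendsto_intros LIMSEQ_Suc lim_1_over_n)
        then show "(\<lambda>n. h (p + 1 / real (Suc n) * z)) \<longlonglongrightarrow> h p"
          using cont by (intro continuous_on_tendsto_compose[OF cont]) auto
      qed
    qed (use M in auto)
    then show ?thesis using N.prob_space by simp
  qed
  have "(\<lambda>n. A (1 / Suc n) s / 2 + A (1 / Suc n) (- s) / 2) \<longlonglongrightarrow> h s / 2 + h (- s) / 2"
    by (intro tendsto_intros lim) auto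
  moreover have "(\<lambda>n. A (1 / Suc n) 0) \<longlonglongrightarrow> h 0" by (rule lim)
  ultimately have "h s / 2 + h (- s) / 2 \<le> h 0"
    by (rule LIMSEQ_le) (use ineq in auto)
  then show ?thesis by (simp add: even)
qed

section \<open>Integration over lines and circles in the Euclidean plane\<close>

lemma integrable_continuous_compact_support:
  fixes f :: "'a::euclidean_space \<Rightarrow> 'b::{banach, second_countable_topology}"
  assumes "continuous_on UNIV f" and "\<And>x. norm x > B \<Longrightarrow> f x = 0"
  shows "integrable lborel f"
proof -
  have "norm x \<le> B" if "f x \<noteq> 0" for x using assms(2)[of x] that by (cases "norm x > B") auto
  then have "f = (\<lambda>x. indicator (cball 0 B) x *\<^sub>R f x)" by (auto simp: fun_eq_iff indicator_def)
  moreover have "integrable lborel (\<lambda>x. indicator (cball 0 B) x *\<^sub>R f x)"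
    by (rule borel_integrable_compact[OF _ continuous_on_subset[OF assms(1)]]) auto
  ultimately show ?thesis by simp
qed

lemma integral_open_period:
  fixes u :: "real \<Rightarrow> real"
  assumes "continuous_on UNIV u"
  shows "(\<integral>t. indicator {0<..<2 * pi} t * u t \<partial>lborel) = integral {0..2 * pi} u"
proof -
  have um [measurable]: "u \<in> borel_measurable borel" by (rule borel_measurable_continuous_onI[OF assms])
  have i: "set_integrable lborel {0..2 * pi} u"
    unfolding set_integrable_def by (rule borel_integrable_compact[OF _ continuous_on_subset[OF assms]]) auto
  have "(\<integral>t. indicator {0<..<2 * pi} t * u t \<partial>lborel) = (\<integral>t. indicator {0..2 * pi} t * u t \<partial>lborel)"
  proof (rule integral_cong_AE)
    show "AE t in lborel. indicator {0<..<2 * pi} t * u t = indicator {0..2 * pi} t * u t"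
      using AE_lborel_singleton[of 0] AE_lborel_singleton[of "2 * pi"]
      by eventually_elim (auto simp: indicator_def)
  qed auto
  also have "\<dots> = integral {0..2 * pi} u"
    using set_borel_integral_eq_integral(2)[OF i] by (simp add: set_lebesgue_integral_def)
  finally show ?thesis .
qed

lemma lborel_distr_complex_polar:
  "distr (density lborel (\<lambda>z. ennreal (Re z) * indicator polar_strip z)) borel (\<lambda>z. of_real (Re z) * cis (Im z)) = lborel"
proof (rule measure_eqI)
  have [measurable]: "polar_strip \<in> sets borel" by simp
  let ?M = "density lborel (\<lambda>z. ennreal (Re z) * indicator polar_strip z)"
  have m [measurable]: "(\<lambda>z. complex_of_real (Re z) * cis (Im z)) \<in> borel_measurable borel" by measurable
  fix B assume "B \<in> sets (distr ?M borel (\<lambda>z. of_real (Re z) * cis (Im z)))"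
  then have B [measurable]: "B \<in> sets borel" by simp
  have "emeasure (distr ?M borel (\<lambda>z. of_real (Re z) * cis (Im z))) B
      = (\<integral>\<^sup>+z. indicator B z \<partial>distr ?M borel (\<lambda>z. of_real (Re z) * cis (Im z)))" by simp
  also have "\<dots> = (\<integral>\<^sup>+z. indicator B (of_real (Re z) * cis (Im z)) \<partial>?M)"
    by (rule nn_integral_distr) auto
  also have "\<dots> = (\<integral>\<^sup>+z. (ennreal (Re z) * indicator polar_strip z) * indicator B (of_real (Re z) * cis (Im z)) \<partial>lborel)"
    by (rule nn_integral_density) measurable
  also have "\<dots> = (\<integral>\<^sup>+z. indicator B z \<partial>lborel)"
    by (subst nn_integral_complex_polar) (auto simp: mult.commute)
  finally show "emeasure (distr ?M borel (\<lambda>z. of_real (Re z) * cis (Im z))) B = emeasure lborel B" by simp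
qed simp

text \<open>Both sides are the integral over the plane of \<open>c (Im z) * F (norm z)\<close>, once
  along horizontal lines and once in polar coordinates. With
  \<open>c b = cos (2 * l * arsinh b) / sqrt (1 + b^2)\<close> the inner angular integral is
  \<open>2 * pi * spherical l a\<close>.\<close>

lemma planar_radial_integral:
  fixes F c :: "real \<Rightarrow> real"
  assumes F: "continuous_on UNIV F" and supp: "\<And>a. a > B \<Longrightarrow> F a = 0" and c: "continuous_on UNIV c"
  shows "integrable lborel (\<lambda>b. c b * (\<integral>w. F (sqrt (w\<^sup>2 + b\<^sup>2)) \<partial>lborel))"
    and "(\<integral>b. c b * (\<integral>w. F (sqrt (w\<^sup>2 + b\<^sup>2)) \<partial>lborel) \<partial>lborel)
      = (\<integral>a. indicator {0<..} a * (a * F a * integral {0..2 * pi} (\<lambda>t. c (a * sin t))) \<partial>lborel)"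
proof -
  define X where "X = (\<lambda>z. c (Im z) * F (norm z))"
  have Xc: "continuous_on UNIV X" unfolding X_def
    by (intro continuous_intros continuous_on_compose2[OF c] continuous_on_compose2[OF F]) auto
  have Xi: "integrable lborel X"
    by (rule integrable_continuous_compact_support[OF Xc, of B]) (simp add: X_def supp)
  have Xm [measurable]: "X \<in> borel_measurable borel" by (rule borel_measurable_continuous_onI[OF Xc])
  have Cm [measurable]: "(\<lambda>(x, y). Complex x y) \<in> lborel \<Otimes>\<^sub>M lborel \<rightarrow>\<^sub>M borel"
  proof -
    have "(\<lambda>(x, y). Complex x y) \<in> borel \<Otimes>\<^sub>M borel \<rightarrow>\<^sub>M borel"
      unfolding borel_prod by (intro borel_measurable_continuous_onI) (auto intro!: continuous_intros simp: split_beta)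
    then show ?thesis by (simp cong: measurable_cong_sets)
  qed
  have XC: "X (Complex w b) = c b * F (sqrt (w\<^sup>2 + b\<^sup>2))" for w b by (simp add: X_def complex_norm)
  have i1: "integrable (lborel \<Otimes>\<^sub>M lborel) (\<lambda>(w, b). X (Complex w b))"
    using integrable_distr[OF Cm, of X] Xi unfolding lborel_distr_Complex by (simp add: split_beta')
  have "integrable lborel (\<lambda>b. \<integral>w. X (Complex w b) \<partial>lborel)"
    by (rule lborel_pair.integrable_snd[OF i1])
  then show "integrable lborel (\<lambda>b. c b * (\<integral>w. F (sqrt (w\<^sup>2 + b\<^sup>2)) \<partial>lborel))"
    by (simp add: XC)
  have "(\<integral>b. c b * (\<integral>w. F (sqrt (w\<^sup>2 + b\<^sup>2)) \<partial>lborel) \<partial>lborel) = (\<integral>b. (\<integral>w. X (Complex w b) \<partial>lborel) \<partial>lborel)"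
    by (simp add: XC)
  also have "\<dots> = (\<integral>p. (case p of (w, b) \<Rightarrow> X (Complex w b)) \<partial>(lborel \<Otimes>\<^sub>M lborel))"
    by (rule lborel_pair.integral_snd[OF i1])
  also have "\<dots> = (\<integral>z. X z \<partial>distr (lborel \<Otimes>\<^sub>M lborel) borel (\<lambda>(x, y). Complex x y))"
    by (subst integral_distr[OF Cm]) (auto simp: split_beta')
  also have "\<dots> = (\<integral>z. X z \<partial>lborel)" unfolding lborel_distr_Complex ..
  finally have L: "(\<integral>b. c b * (\<integral>w. F (sqrt (w\<^sup>2 + b\<^sup>2)) \<partial>lborel) \<partial>lborel) = (\<integral>z. X z \<partial>lborel)" .
  have [measurable]: "polar_strip \<in> sets borel" by simp
  define d where "d = (\<lambda>z. Re z * indicator polar_strip z)"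
  have d0: "d z \<ge> 0" for z by (auto simp: d_def polar_strip_def indicator_def)
  have dm [measurable]: "d \<in> borel_measurable borel" unfolding d_def by measurable
  have de: "ennreal (Re z) * indicator polar_strip z = ennreal (d z)" for z
    by (auto simp: d_def indicator_def)
  have pm [measurable]: "(\<lambda>z. complex_of_real (Re z) * cis (Im z)) \<in> borel_measurable borel" by measurable
  have pol: "distr (density lborel (\<lambda>z. ennreal (d z))) borel (\<lambda>z. of_real (Re z) * cis (Im z)) = lborel"
    using lborel_distr_complex_polar unfolding de .
  have pm': "(\<lambda>z. complex_of_real (Re z) * cis (Im z)) \<in> density lborel (\<lambda>z. ennreal (d z)) \<rightarrow>\<^sub>M borel" by simp
  define Y where "Y = (\<lambda>z. d z *\<^sub>R X (of_real (Re z) * cis (Im z)))"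
  have Ym [measurable]: "Y \<in> borel_measurable borel" unfolding Y_def by measurable
  have "integrable (density lborel (\<lambda>z. ennreal (d z))) (\<lambda>z. X (of_real (Re z) * cis (Im z)))"
    using integrable_distr[OF pm', of X] Xi unfolding pol .
  then have Yi: "integrable lborel Y" unfolding Y_def
    by (subst (asm) integrable_density) (auto simp: d0)
  have "(\<integral>z. X z \<partial>lborel) = (\<integral>z. X (of_real (Re z) * cis (Im z)) \<partial>density lborel (\<lambda>z. ennreal (d z)))"
    by (subst pol[symmetric], rule integral_distr[OF pm']) simp
  also have "\<dots> = (\<integral>z. Y z \<partial>lborel)" unfolding Y_def by (rule integral_density) (auto simp: d0)
  also have "\<dots> = (\<integral>p. (case p of (a, t) \<Rightarrow> Y (Complex a t)) \<partial>(lborel \<Otimes>\<^sub>M lborel))"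
    by (subst lborel_distr_Complex[symmetric], subst integral_distr[OF Cm]) (auto simp: split_beta')
  also have "\<dots> = (\<integral>a. (\<integral>t. Y (Complex a t) \<partial>lborel) \<partial>lborel)"
  proof (rule lborel_pair.integral_fst'[symmetric, THEN trans])
    show "integrable (lborel \<Otimes>\<^sub>M lborel) (\<lambda>(a, t). Y (Complex a t))"
      using integrable_distr[OF Cm, of Y] Yi unfolding lborel_distr_Complex by (simp add: split_beta')
  qed simp
  also have "\<dots> = (\<integral>a. indicator {0<..} a * (a * F a * integral {0..2 * pi} (\<lambda>t. c (a * sin t))) \<partial>lborel)"
  proof (rule Bochner_Integration.integral_cong[OF refl])
    fix a :: real
    have "Y (Complex a t) = (indicator {0<..} a * (a * F a)) * (indicator {0<..<2 * pi} t * c (a * sin t))" for t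
      by (auto simp: Y_def d_def X_def polar_strip_def indicator_def norm_mult)
    then have "(\<integral>t. Y (Complex a t) \<partial>lborel) = (indicator {0<..} a * (a * F a)) * (\<integral>t. indicator {0<..<2 * pi} t * c (a * sin t) \<partial>lborel)"
      by simp
    also have "(\<integral>t. indicator {0<..<2 * pi} t * c (a * sin t) \<partial>lborel) = integral {0..2 * pi} (\<lambda>t. c (a * sin t))"
      by (rule integral_open_period) (intro continuous_on_compose2[OF c] continuous_intros, auto)
    finally show "(\<integral>t. Y (Complex a t) \<partial>lborel) = indicator {0<..} a * (a * F a * integral {0..2 * pi} (\<lambda>t. c (a * sin t)))"
      by (simp add: mult.assoc)
  qed
  finally show "(\<integral>b. c b * (\<integral>w. F (sqrt (w\<^sup>2 + b\<^sup>2)) \<partial>lborel) \<partial>lborel)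
      = (\<integral>a. indicator {0<..} a * (a * F a * integral {0..2 * pi} (\<lambda>t. c (a * sin t))) \<partial>lborel)"
    unfolding L .
qed

text \<open>After a quarter turn \<open>\<epsilon>^2 + (a * sin t)^2\<close> becomes
  \<open>E - (a * sin t)^2\<close> and the numerator becomes \<open>a * |cos t|\<close>, so
  \<open>has_integral_abs_cos\<close> applies with the elementary antiderivative \<open>K\<close>.
  That this circle integral is explicit is what singles out the kernel.\<close>

lemma integral_sin_kernel:
  fixes a \<epsilon> :: real
  assumes a: "a > 0" and e: "\<epsilon> > 0"
  shows "integral {0..2 * pi} (\<lambda>t. \<bar>a * sin t\<bar> / ((\<epsilon>\<^sup>2 + (a * sin t)\<^sup>2) * sqrt (\<epsilon>\<^sup>2 + (a * sin t)\<^sup>2))) = 4 * a / ((\<epsilon>\<^sup>2 + a\<^sup>2) * \<epsilon>)"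
proof -
  define E where "E = \<epsilon>\<^sup>2 + a\<^sup>2"
  have E: "E > 0" using a e by (simp add: E_def add_pos_pos)
  define G where "G = (\<lambda>x. a / ((E - (a * x)\<^sup>2) * sqrt (E - (a * x)\<^sup>2)))"
  define K where "K = (\<lambda>x. a / E * (x / sqrt (E - (a * x)\<^sup>2)))"
  have pos: "E - (a * x)\<^sup>2 > 0" if "\<bar>x\<bar> \<le> 1" for x
  proof -
    have "x\<^sup>2 \<le> 1" using that by (simp add: abs_square_le_1)
    then have "(a * x)\<^sup>2 \<le> a\<^sup>2" using a by (simp add: power_mult_distrib mult_left_le)
    moreover have "\<epsilon>\<^sup>2 > 0" using e by simp
    ultimately show ?thesis unfolding E_def by linarith
  qed
  have K: "(K has_field_derivative G x) (at x)" if x: "\<bar>x\<bar> \<le> 1" for x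
  proof -
    define S where "S = E - (a * x)\<^sup>2"
    have S: "S > 0" using pos[OF x] by (simp add: S_def)
    have d1: "((\<lambda>x. E - (a * x)\<^sup>2) has_field_derivative (- (2 * a\<^sup>2 * x))) (at x)"
      by (auto intro!: derivative_eq_intros simp: power2_eq_square)
    have d2: "((\<lambda>x. sqrt (E - (a * x)\<^sup>2)) has_field_derivative (- (a\<^sup>2 * x) / sqrt S)) (at x)"
      using DERIV_chain2[OF DERIV_real_sqrt[OF pos[OF x]] d1] by (simp add: S_def divide_simps)
    have "((\<lambda>x. x / sqrt (E - (a * x)\<^sup>2)) has_field_derivative
       ((1 * sqrt (E - (a * x)\<^sup>2) - x * (- (a\<^sup>2 * x) / sqrt S)) / (sqrt (E - (a * x)\<^sup>2) * sqrt (E - (a * x)\<^sup>2)))) (at x)"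
      by (rule DERIV_divide[OF DERIV_ident d2]) (use pos[OF x] in simp)
    from DERIV_cmult[OF this, of "a / E"]
    have "(K has_field_derivative a / E * ((1 * sqrt S - x * (- (a\<^sup>2 * x) / sqrt S)) / (sqrt S * sqrt S))) (at x)"
      unfolding K_def S_def .
    moreover have "a / E * ((1 * sqrt S - x * (- (a\<^sup>2 * x) / sqrt S)) / (sqrt S * sqrt S)) = G x"
    proof -
      have "1 * sqrt S - x * (- (a\<^sup>2 * x) / sqrt S) = (S + (a * x)\<^sup>2) / sqrt S"
        using S by (simp add: add_divide_distrib power2_eq_square real_div_sqrt)
      also have "S + (a * x)\<^sup>2 = E" by (simp add: S_def)
      finally show ?thesis using S E a unfolding G_def S_def[symmetric] by (simp add: mult.commute)
    qed
    ultimately show ?thesis by simp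
  qed
  have "sqrt (E - a\<^sup>2) = \<epsilon>" using e by (simp add: E_def)
  then have K1: "2 * (K 1 - K (- 1)) = 4 * a / (E * \<epsilon>)" by (simp add: K_def)
  define f where "f = (\<lambda>t. \<bar>cos t\<bar> * G (sin t))"
  have nz: "E - (a * sin t)\<^sup>2 \<noteq> 0" for t using pos[OF abs_sin_le_one, of t] by linarith
  have fc: "continuous_on A f" for A unfolding f_def G_def
    by (intro continuous_intros) (use nz in auto)
  have I: "integral {0..2 * pi} f = 4 * a / (E * \<epsilon>)"
    unfolding f_def K1[symmetric] by (rule integral_unique[OF has_integral_abs_cos[OF K]])
  have "integral {0..2 * pi} (\<lambda>t. f (t + pi / 2)) = integral {pi / 2..pi / 2 + 2 * pi} f"
    using integral_shift[of 0 "pi / 2" "2 * pi" f] fc by (simp add: o_def add.commute)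
  also have "\<dots> = integral {0..2 * pi} f"
    by (rule integral_periodic_shift[OF fc]) (auto simp: f_def)
  finally have "integral {0..2 * pi} (\<lambda>t. f (t + pi / 2)) = 4 * a / (E * \<epsilon>)" unfolding I .
  moreover have "f (t + pi / 2) = \<bar>a * sin t\<bar> / ((\<epsilon>\<^sup>2 + (a * sin t)\<^sup>2) * sqrt (\<epsilon>\<^sup>2 + (a * sin t)\<^sup>2))" for t
  proof -
    have "(a * cos t)\<^sup>2 = a\<^sup>2 - (a * sin t)\<^sup>2" by (simp add: power_mult_distrib cos_squared_eq algebra_simps)
    then have "E - (a * cos t)\<^sup>2 = \<epsilon>\<^sup>2 + (a * sin t)\<^sup>2" by (simp add: E_def)
    then show ?thesis using a by (simp add: f_def G_def cos_add sin_add abs_mult)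
  qed
  ultimately show ?thesis by (simp add: E_def)
qed

text \<open>Integrating \<open>F\<close> over horizontal lines, \<open>H b = \<integral>w. F (sqrt (w\<^sup>2 + b\<^sup>2))\<close>, turns the spherical transform into
  a cosine transform, so \<open>H\<close> is maximal at \<open>0\<close>. The integral of \<open>H 0 - H b\<close> against
  \<open>b / (\<epsilon>\<^sup>2 + b\<^sup>2)\<^bsup>3/2\<^esup>\<close> tends to \<open>pi * F 0\<close> as \<open>\<epsilon>\<close> goes to \<open>0\<close>.\<close>

lemma radial_nonneg_at_0:
  fixes F :: "real \<Rightarrow> real"
  assumes F: "continuous_on UNIV F" and supp: "\<And>a. a > B \<Longrightarrow> F a = 0" and B: "B > 0"
    and nonneg: "\<And>l. 0 \<le> (\<integral>a. indicator {0<..} a * (a * F a * spherical l a) \<partial>lborel)"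
  shows "0 \<le> F 0"
proof -
  define H where "H = (\<lambda>b. \<integral>w. F (sqrt (w\<^sup>2 + b\<^sup>2)) \<partial>lborel)"
  have Fc: "continuous_on A (\<lambda>x. F (g x))" if "continuous_on A g" for A :: "'a::topological_space set" and g
    by (rule continuous_on_compose2[OF F that]) auto
  have Hc: "continuous_on UNIV H"
  proof -
    have "H b = integral (cbox (- B) B) (\<lambda>w. F (sqrt (w\<^sup>2 + b\<^sup>2)))" for b
    proof -
      have i: "set_integrable lborel {- B..B} (\<lambda>w. F (sqrt (w\<^sup>2 + b\<^sup>2)))"
        unfolding set_integrable_def by (rule borel_integrable_compact) (auto intro!: Fc continuous_intros)
      have "w \<in> {- B..B}" if "F (sqrt (w\<^sup>2 + b\<^sup>2)) \<noteq> 0" for w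
      proof -
        have "sqrt (w\<^sup>2 + b\<^sup>2) \<le> B" using supp that by (meson not_le)
        moreover have "\<bar>w\<bar> \<le> sqrt (w\<^sup>2 + b\<^sup>2)" by (rule real_le_rsqrt) simp
        ultimately have "\<bar>w\<bar> \<le> B" by linarith
        then show ?thesis by (simp add: abs_le_iff minus_le_iff)
      qed
      then have "F (sqrt (w\<^sup>2 + b\<^sup>2)) = indicator {- B..B} w *\<^sub>R F (sqrt (w\<^sup>2 + b\<^sup>2))" for w
        by (auto simp: indicator_def)
      then have "H b = (\<integral>w. indicator {- B..B} w *\<^sub>R F (sqrt (w\<^sup>2 + b\<^sup>2)) \<partial>lborel)"
        unfolding H_def by presburger
      then show ?thesis using set_borel_integral_eq_integral(2)[OF i] by (simp add: set_lebesgue_integral_def)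
    qed
    moreover have "continuous_on UNIV (\<lambda>b. integral (cbox (- B) B) (\<lambda>w. F (sqrt (w\<^sup>2 + b\<^sup>2))))"
      by (rule integral_continuous_on_param) (auto simp: split_beta' intro!: Fc continuous_intros)
    ultimately show ?thesis by presburger
  qed
  have H0: "H b = 0" if "\<bar>b\<bar> > B" for b
  proof -
    have "F (sqrt (w\<^sup>2 + b\<^sup>2)) = 0" for w
    proof (rule supp)
      have "\<bar>b\<bar> \<le> sqrt (w\<^sup>2 + b\<^sup>2)" by (rule real_le_rsqrt) simp
      then show "B < sqrt (w\<^sup>2 + b\<^sup>2)" using that by linarith
    qed
    then show ?thesis by (simp add: H_def)
  qed
  have Heven: "H (- b) = H b" for b by (simp add: H_def)
  have transform: "0 \<le> (\<integral>b. cos (2 * l * arsinh b) / sqrt (1 + b\<^sup>2) * H b \<partial>lborel)" for l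
  proof -
    have c: "continuous_on UNIV (\<lambda>b. cos (2 * l * arsinh b) / sqrt (1 + b\<^sup>2))"
      by (intro continuous_intros) (use less_imp_neq[OF one_plus_square_pos] in \<open>auto simp: eq_commute[of 0]\<close>)
    have "(\<integral>b. cos (2 * l * arsinh b) / sqrt (1 + b\<^sup>2) * H b \<partial>lborel)
      = (\<integral>a. indicator {0<..} a * (a * F a * integral {0..2 * pi} (\<lambda>t. cos (2 * l * arsinh (a * sin t)) / sqrt (1 + (a * sin t)\<^sup>2))) \<partial>lborel)"
      unfolding H_def by (rule planar_radial_integral(2)[OF F supp c]) simp
    also have "\<dots> = (\<integral>a. (2 * pi) * (indicator {0<..} a * (a * F a * spherical l a)) \<partial>lborel)"
      by (intro Bochner_Integration.integral_cong refl) (simp add: spherical_def)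
    also have "\<dots> = 2 * pi * (\<integral>a. indicator {0<..} a * (a * F a * spherical l a) \<partial>lborel)" by (rule integral_mult_right_zero)
    finally show ?thesis using nonneg[of l] by simp
  qed
  \<comment> \<open>Under \<open>b = sinh (s / 2)\<close> the phase \<open>2 * l * arsinh b\<close>
    becomes \<open>l * s\<close>, and \<open>1 / sqrt (1 + b^2)\<close> cancels against the
    derivative up to a factor 2: an ordinary cosine transform.\<close>
  define h where "h = (\<lambda>s. H (sinh (s / 2)))"
  have hc: "continuous_on UNIV h" unfolding h_def
    by (rule continuous_on_compose2[OF Hc]) (auto intro!: continuous_intros)
  have h0: "h s = 0" if "\<bar>s\<bar> > 2 * arsinh B" for s
  proof -
    have "B < sinh (\<bar>s\<bar> / 2)"
    proof -
      have "sinh (arsinh B) < sinh (\<bar>s\<bar> / 2)" using that by (subst sinh_real_less_iff) auto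
      then show ?thesis by simp
    qed
    then have "\<bar>sinh (s / 2)\<bar> > B" by (cases "s \<ge> 0") (auto simp: abs_if)
    then show ?thesis unfolding h_def by (rule H0)
  qed
  have hcos: "0 \<le> (\<integral>s. h s * cos (l * s) \<partial>lborel)" for l
  proof -
    define f where "f = (\<lambda>b. 2 * (cos (2 * l * arsinh b) / sqrt (1 + b\<^sup>2) * H b))"
    have fcont: "continuous_on UNIV f" unfolding f_def
      by (intro continuous_intros Hc) (use less_imp_neq[OF one_plus_square_pos] in \<open>auto simp: eq_commute[of 0]\<close>)
    have fi: "integrable lborel f"
      by (rule integrable_continuous_compact_support[OF fcont, of B]) (auto simp: f_def H0)
    have gi: "integrable lborel (\<lambda>s. h s * cos (l * s))"
      by (rule integrable_continuous_compact_support[of _ "2 * arsinh B"]) (auto intro!: continuous_intros hc simp: h0)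
    have der: "((\<lambda>s. sinh (s / 2)) has_field_derivative (cosh (s / 2) / 2)) (at s within UNIV)" for s :: real
      by (auto intro!: derivative_eq_intros)
    have inj: "inj_on (\<lambda>s::real. sinh (s / 2)) UNIV"
      by (rule inj_on_inverseI[of _ "\<lambda>b. 2 * arsinh b"]) (simp add: arsinh_sinh_real)
    have surj: "range (\<lambda>s::real. sinh (s / 2)) = UNIV"
      by (rule surjI[of _ "\<lambda>b. 2 * arsinh b"]) simp
    have e: "\<bar>cosh (s / 2) / 2\<bar> *\<^sub>R f (sinh (s / 2)) = h s * cos (l * s)" for s
    proof -
      have "sqrt (1 + (sinh (s / 2))\<^sup>2) = cosh (s / 2)"
        using cosh_square_eq[of "s / 2"] by (intro real_sqrt_unique) (auto simp: add.commute)
      then show ?thesis using cosh_real_pos[of "s / 2"] by (simp add: f_def h_def arsinh_sinh_real abs_of_pos)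
    qed
    have fa: "f absolutely_integrable_on UNIV"
      using fi by (simp add: set_integrable_def integrable_completion)
    have "(\<lambda>s. \<bar>cosh (s / 2) / 2\<bar> *\<^sub>R f (sinh (s / 2))) absolutely_integrable_on UNIV \<and>
        integral UNIV (\<lambda>s. \<bar>cosh (s / 2) / 2\<bar> *\<^sub>R f (sinh (s / 2))) = integral UNIV f"
      using has_absolute_integral_change_of_variables_real[OF _ der inj, of f "integral UNIV f"] fa unfolding surj by simp
    then have "integral UNIV (\<lambda>s. h s * cos (l * s)) = integral UNIV f" unfolding e by simp
    then have "(\<integral>s. h s * cos (l * s) \<partial>lborel) = (\<integral>b. f b \<partial>lborel)"
      using integral_lborel[OF gi] integral_lborel[OF fi] by simp
    also have "\<dots> = 2 * (\<integral>b. cos (2 * l * arsinh b) / sqrt (1 + b\<^sup>2) * H b \<partial>lborel)" unfolding f_def by (rule integral_mult_right_zero)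
    finally show ?thesis using transform[of l] by simp
  qed
  have Hmax: "H b \<le> H 0" for b
  proof -
    have "h (2 * arsinh b) \<le> h 0"
      by (rule cos_transform_nonneg_imp_max_at_0[OF hc h0 _ hcos]) (auto simp: h_def Heven)
    then show ?thesis by (simp add: h_def)
  qed
  \<comment> \<open>Beyond the support \<open>H\<close> is 0, and its maximum is at 0.\<close>
  have HB: "H 0 \<ge> 0" using Hmax[of "B + 1"] H0[of "B + 1"] B by simp
  have Fi: "integrable lborel (\<lambda>a. indicator {0<..} a * F a)"
  proof -
    have "integrable lborel (\<lambda>a. F \<bar>a\<bar>)"
      by (rule integrable_continuous_compact_support[of _ B]) (auto intro!: Fc continuous_intros simp: supp)
    then have "integrable lborel (\<lambda>a. F \<bar>a\<bar> * indicator {0<..} a)" by (rule integrable_real_mult_indicator[rotated]) simp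
    moreover have "(\<lambda>a. F \<bar>a\<bar> * indicator {0<..} a) = (\<lambda>a. indicator {0<..} a * F a)" by (auto simp: indicator_def)
    ultimately show ?thesis by simp
  qed
  have H00: "H 0 = 2 * (\<integral>a. indicator {0<..} a * F a \<partial>lborel)"
  proof -
    have i2: "integrable lborel (\<lambda>a. indicator {0<..} (- a) * F (- a))"
      using lborel_integrable_real_affine[OF Fi, of "- 1" 0] by simp
    have "H 0 = (\<integral>a. F \<bar>a\<bar> \<partial>lborel)" by (simp add: H_def)
    also have "\<dots> = (\<integral>a. indicator {0<..} a * F a + indicator {0<..} (- a) * F (- a) \<partial>lborel)"
    proof (rule integral_cong_AE)
      have [measurable]: "F \<in> borel_measurable borel" by (rule borel_measurable_continuous_onI[OF F])
      show "(\<lambda>a. F \<bar>a\<bar>) \<in> borel_measurable lborel" "(\<lambda>a. indicator {0<..} a * F a + indicator {0<..} (- a) * F (- a)) \<in> borel_measurable lborel"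
        by measurable
      show "AE a in lborel. F \<bar>a\<bar> = indicator {0<..} a * F a + indicator {0<..} (- a) * F (- a)"
        using AE_lborel_singleton[of 0] by eventually_elim (auto simp: indicator_def abs_if)
    qed
    also have "\<dots> = (\<integral>a. indicator {0<..} a * F a \<partial>lborel) + (\<integral>a. indicator {0<..} (- a) * F (- a) \<partial>lborel)"
      using Fi i2 by simp
    also have "(\<integral>a. indicator {0<..} (- a) * F (- a) \<partial>lborel) = (\<integral>a. indicator {0<..} a * F a \<partial>lborel)"
      using lborel_integral_real_affine[of "- 1" "\<lambda>a. indicator {0<..} a * F a" 0] by simp
    finally show ?thesis by simp
  qed
  \<comment> \<open>The integral of \<open>c * H\<close> is estimated from above by the maximum
    \<open>H 0\<close> and computed exactly by circles. As \<open>H 0\<close> is twice the integral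
    of \<open>F\<close>, the two sides combine into 4 / \<epsilon> times the integral of
    \<open>F a * (1 - a^2 / (\<epsilon>^2 + a^2))\<close>, a Poisson-type mean concentrating at 0;
    scaling by \<epsilon> gives the stated form.\<close>
  have eps: "0 \<le> (\<integral>x. indicator {0<..} x * (F (\<epsilon> * x) / (1 + x\<^sup>2)) \<partial>lborel)" if e: "\<epsilon> > 0" for \<epsilon>
  proof -
    define c where "c = (\<lambda>b. \<bar>b\<bar> / ((\<epsilon>\<^sup>2 + b\<^sup>2) * sqrt (\<epsilon>\<^sup>2 + b\<^sup>2)))"
    have p: "\<epsilon>\<^sup>2 + b\<^sup>2 > 0" for b using e by (simp add: add_pos_nonneg)
    have nz: "\<epsilon>\<^sup>2 + b\<^sup>2 \<noteq> 0" for b using p[of b] by linarith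
    have cc: "continuous_on A c" for A unfolding c_def by (intro continuous_intros) (use nz in auto)
    have c0: "c b \<ge> 0" for b using p[of b] by (simp add: c_def)
    have ci: "integrable lborel (\<lambda>b. c b * H b)" and
      cH: "(\<integral>b. c b * H b \<partial>lborel) = (\<integral>a. indicator {0<..} a * (a * F a * integral {0..2 * pi} (\<lambda>t. c (a * sin t))) \<partial>lborel)"
      using planar_radial_integral[OF F supp cc] unfolding H_def by simp_all
    have "(\<integral>b. c b * H b \<partial>lborel) \<le> (\<integral>b. indicator {- B..B} b * (c b * H 0) \<partial>lborel)"
    proof (rule integral_mono[OF ci])
      show "integrable lborel (\<lambda>b. indicator {- B..B} b * (c b * H 0))"
      proof -
        have "continuous_on {- B..B} (\<lambda>b. c b * H 0)" by (intro continuous_intros cc)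
        from borel_integrable_compact[OF _ this] show ?thesis by simp
      qed
      show "c b * H b \<le> indicator {- B..B} b * (c b * H 0)" for b
        using mult_left_mono[OF Hmax[of b] c0[of b]] H0[of b] by (cases "\<bar>b\<bar> > B") (auto simp: indicator_def abs_if split: if_splits)
    qed
    also have "\<dots> = H 0 * (\<integral>b. indicator {- B..B} b *\<^sub>R c b \<partial>lborel)"
      by (subst integral_mult_right_zero[symmetric]) (intro Bochner_Integration.integral_cong refl, simp)
    also have "(\<integral>b. indicator {- B..B} b *\<^sub>R c b \<partial>lborel) = integral {- B..B} c"
    proof -
      have "set_integrable lborel {- B..B} c" unfolding set_integrable_def by (rule borel_integrable_compact[OF _ cc]) simp
      from set_borel_integral_eq_integral(2)[OF this] show ?thesis by (simp add: set_lebesgue_integral_def)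
    qed
    also have "integral {- B..B} c = 2 * (1 / \<epsilon> - 1 / sqrt (\<epsilon>\<^sup>2 + B\<^sup>2))"
    proof -
      define K where "K = (\<lambda>b. - 1 / sqrt (\<epsilon>\<^sup>2 + b\<^sup>2))"
      have dK: "(K has_field_derivative (b / ((\<epsilon>\<^sup>2 + b\<^sup>2) * sqrt (\<epsilon>\<^sup>2 + b\<^sup>2)))) (at b within A)" for b A
      proof -
        have ds: "((\<lambda>b. sqrt (\<epsilon>\<^sup>2 + b\<^sup>2)) has_field_derivative (b / sqrt (\<epsilon>\<^sup>2 + b\<^sup>2))) (at b within A)"
          using p[of b] by (auto intro!: derivative_eq_intros simp: divide_simps)
        have "((\<lambda>b. inverse (sqrt (\<epsilon>\<^sup>2 + b\<^sup>2))) has_field_derivative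
           - (inverse (sqrt (\<epsilon>\<^sup>2 + b\<^sup>2)) * (b / sqrt (\<epsilon>\<^sup>2 + b\<^sup>2)) * inverse (sqrt (\<epsilon>\<^sup>2 + b\<^sup>2)))) (at b within A)"
          by (rule DERIV_inverse'[OF ds]) (use nz[of b] in simp)
        from DERIV_minus[OF this]
        have "(K has_field_derivative (inverse (sqrt (\<epsilon>\<^sup>2 + b\<^sup>2)) * (b / sqrt (\<epsilon>\<^sup>2 + b\<^sup>2)) * inverse (sqrt (\<epsilon>\<^sup>2 + b\<^sup>2)))) (at b within A)"
          by (simp add: K_def inverse_eq_divide)
        moreover have "inverse S * (b / S) * inverse S = b / ((S * S) * S)" for S :: real by (simp add: divide_inverse)
        ultimately show ?thesis using p[of b] by simp
      qed
      have 1: "(c has_integral K B - K 0) {0..B}"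
      proof (rule has_integral_eq[rotated])
        show "((\<lambda>b. b / ((\<epsilon>\<^sup>2 + b\<^sup>2) * sqrt (\<epsilon>\<^sup>2 + b\<^sup>2))) has_integral K B - K 0) {0..B}"
          using dK B by (intro fundamental_theorem_of_calculus) (auto simp: has_real_derivative_iff_has_vector_derivative[symmetric])
      qed (auto simp: c_def)
      have 2: "(c has_integral - (K 0 - K (- B))) {- B..0}"
      proof (rule has_integral_eq[rotated])
        show "((\<lambda>b. - (b / ((\<epsilon>\<^sup>2 + b\<^sup>2) * sqrt (\<epsilon>\<^sup>2 + b\<^sup>2)))) has_integral - (K 0 - K (- B))) {- B..0}"
          using dK B by (intro has_integral_neg fundamental_theorem_of_calculus) (auto simp: has_real_derivative_iff_has_vector_derivative[symmetric])
      qed (auto simp: c_def)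
      have "(c has_integral (- (K 0 - K (- B)) + (K B - K 0))) {- B..B}"
        by (rule has_integral_combine[OF _ _ 2 1]) (use B in auto)
      then show ?thesis using e by (simp add: integral_unique K_def)
    qed
    \<comment> \<open>The total mass of \<open>c\<close> on the whole line is
      \<open>2 / \<epsilon>\<close>; dropping the deficit from the finite range is harmless because
      \<open>H 0\<close> is nonnegative.\<close>
    also have "H 0 * (2 * (1 / \<epsilon> - 1 / sqrt (\<epsilon>\<^sup>2 + B\<^sup>2))) \<le> H 0 * (2 * (1 / \<epsilon>))"
      using HB p[of B] by (intro mult_left_mono) auto
    finally have le: "(\<integral>b. c b * H b \<partial>lborel) \<le> 4 / \<epsilon> * (\<integral>a. indicator {0<..} a * F a \<partial>lborel)"
      unfolding H00 by simp
    define D where "D = (\<lambda>a. indicator {0<..} a * (a * F a * integral {0..2 * pi} (\<lambda>t. c (a * sin t))))"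
    have D: "D a = 4 / \<epsilon> * (indicator {0<..} a * F a) * (a\<^sup>2 / (\<epsilon>\<^sup>2 + a\<^sup>2))" for a
    proof (cases "a > 0")
      case True
      have I: "integral {0..2 * pi} (\<lambda>t. c (a * sin t)) = 4 * a / ((\<epsilon>\<^sup>2 + a\<^sup>2) * \<epsilon>)"
        unfolding c_def by (rule integral_sin_kernel[OF True e])
      show ?thesis unfolding D_def I by (simp add: power2_eq_square mult_ac)
    qed (simp add: D_def)
    have "0 \<le> 4 / \<epsilon> * (\<integral>a. indicator {0<..} a * F a \<partial>lborel) - (\<integral>a. D a \<partial>lborel)"
      using le cH unfolding D_def by simp
    also have "\<dots> = (\<integral>a. 4 / \<epsilon> * (indicator {0<..} a * F a) - D a \<partial>lborel)"
    proof -
      have "integrable lborel D"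
      proof (rule Bochner_Integration.integrable_bound[of _ "\<lambda>a. 4 / \<epsilon> * (indicator {0<..} a * F a)"])
        have [measurable]: "F \<in> borel_measurable borel" by (rule borel_measurable_continuous_onI[OF F])
        show "D \<in> borel_measurable lborel" unfolding D[abs_def] by measurable
        show "AE a in lborel. norm (D a) \<le> norm (4 / \<epsilon> * (indicator {0<..} a * F a))"
        proof (rule AE_I2)
          fix a
          have "\<bar>a\<^sup>2 / (\<epsilon>\<^sup>2 + a\<^sup>2)\<bar> \<le> 1" using p[of a] by (simp add: divide_le_eq)
          then show "norm (D a) \<le> norm (4 / \<epsilon> * (indicator {0<..} a * F a))"
            unfolding D real_norm_def abs_mult[of _ "a\<^sup>2 / (\<epsilon>\<^sup>2 + a\<^sup>2)"] by (intro mult_left_le) auto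
        qed
      qed (use Fi in simp)
      then show ?thesis using Fi by simp
    qed
    also have "(\<lambda>a. 4 / \<epsilon> * (indicator {0<..} a * F a) - D a) = (\<lambda>a. 4 * \<epsilon> * (indicator {0<..} a * (F a / (\<epsilon>\<^sup>2 + a\<^sup>2))))"
    proof
      fix a
      have q: "1 - a\<^sup>2 / (\<epsilon>\<^sup>2 + a\<^sup>2) = \<epsilon>\<^sup>2 / (\<epsilon>\<^sup>2 + a\<^sup>2)" using nz[of a] by (simp add: field_simps)
      have gen: "X - X * y = X * (1 - y)" for X y :: real by (simp add: right_diff_distrib)
      have "4 / \<epsilon> * (indicator {0<..} a * F a) - D a = 4 / \<epsilon> * (indicator {0<..} a * F a) * (\<epsilon>\<^sup>2 / (\<epsilon>\<^sup>2 + a\<^sup>2))"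
        unfolding D gen q ..
      then show "4 / \<epsilon> * (indicator {0<..} a * F a) - D a = 4 * \<epsilon> * (indicator {0<..} a * (F a / (\<epsilon>\<^sup>2 + a\<^sup>2)))"
        using e by (simp add: power2_eq_square)
    qed
    also have "(\<integral>a. 4 * \<epsilon> * (indicator {0<..} a * (F a / (\<epsilon>\<^sup>2 + a\<^sup>2))) \<partial>lborel) = 4 * \<epsilon> * (\<integral>a. indicator {0<..} a * (F a / (\<epsilon>\<^sup>2 + a\<^sup>2)) \<partial>lborel)"
      by (rule integral_mult_right_zero)
    also have "(\<integral>a. indicator {0<..} a * (F a / (\<epsilon>\<^sup>2 + a\<^sup>2)) \<partial>lborel) = \<epsilon> * (\<integral>x. indicator {0<..} (\<epsilon> * x) * (F (\<epsilon> * x) / (\<epsilon>\<^sup>2 + (\<epsilon> * x)\<^sup>2)) \<partial>lborel)"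
      using lborel_integral_real_affine[of \<epsilon> "\<lambda>a. indicator {0<..} a * (F a / (\<epsilon>\<^sup>2 + a\<^sup>2))" 0] e by simp
    also have "(\<lambda>x. indicator {0<..} (\<epsilon> * x) * (F (\<epsilon> * x) / (\<epsilon>\<^sup>2 + (\<epsilon> * x)\<^sup>2))) = (\<lambda>x. 1 / \<epsilon>\<^sup>2 * (indicator {0<..} x * (F (\<epsilon> * x) / (1 + x\<^sup>2))))"
    proof
      fix x
      have "\<epsilon>\<^sup>2 + (\<epsilon> * x)\<^sup>2 = \<epsilon>\<^sup>2 * (1 + x\<^sup>2)" by (simp add: power_mult_distrib algebra_simps)
      then show "indicator {0<..} (\<epsilon> * x) * (F (\<epsilon> * x) / (\<epsilon>\<^sup>2 + (\<epsilon> * x)\<^sup>2)) = 1 / \<epsilon>\<^sup>2 * (indicator {0<..} x * (F (\<epsilon> * x) / (1 + x\<^sup>2)))"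
        using e by (auto simp: indicator_def zero_less_mult_iff)
    qed
    also have "(\<integral>x. 1 / \<epsilon>\<^sup>2 * (indicator {0<..} x * (F (\<epsilon> * x) / (1 + x\<^sup>2))) \<partial>lborel) = 1 / \<epsilon>\<^sup>2 * (\<integral>x. indicator {0<..} x * (F (\<epsilon> * x) / (1 + x\<^sup>2)) \<partial>lborel)"
      by (rule integral_mult_right_zero)
    finally show ?thesis using e by (simp add: zero_le_mult_iff zero_le_divide_iff)
  qed
  have I1: "integrable lborel (\<lambda>x::real. indicator {0<..} x * (1 / (1 + x\<^sup>2)))"
  proof -
    have "integrable lborel (\<lambda>x::real. inverse (1 + x\<^sup>2))"
      using integrable_inverse_1_plus_square by (simp add: set_integrable_def)
    then have "integrable lborel (\<lambda>x::real. inverse (1 + x\<^sup>2) * indicator {0<..} x)" by (rule integrable_real_mult_indicator[rotated]) simp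
    then show ?thesis by (simp add: inverse_eq_divide mult.commute)
  qed
  obtain M where M: "\<And>a. a \<ge> 0 \<Longrightarrow> \<bar>F a\<bar> \<le> M"
  proof -
    have "compact (F ` {0..B})" by (rule compact_continuous_image[OF continuous_on_subset[OF F]]) auto
    then obtain M where M: "\<forall>x\<in>{0..B}. \<bar>F x\<bar> \<le> M" by (metis bounded_real compact_imp_bounded imageI)
    have "\<bar>F a\<bar> \<le> max M 0" if "a \<ge> 0" for a using supp[of a] M that by (cases "a > B") (auto simp: le_max_iff_disj)
    then show ?thesis by (rule that)
  qed
  have [measurable]: "F \<in> borel_measurable borel" by (rule borel_measurable_continuous_onI[OF F])
  have "(\<lambda>n. \<integral>x. indicator {0<..} x * (F (1 / real (Suc n) * x) / (1 + x\<^sup>2)) \<partial>lborel)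
      \<longlonglongrightarrow> (\<integral>x. indicator {0<..} x * (F 0 / (1 + x\<^sup>2)) \<partial>lborel)"
  proof (rule integral_dominated_convergence[where w = "\<lambda>x. M * (indicator {0<..} x * (1 / (1 + x\<^sup>2)))"])
    show "integrable lborel (\<lambda>x. M * (indicator {0<..} x * (1 / (1 + x\<^sup>2))))" by (intro integrable_mult_right I1)
    show "AE x in lborel. (\<lambda>n. indicator {0<..} x * (F (1 / real (Suc n) * x) / (1 + x\<^sup>2))) \<longlonglongrightarrow> indicator {0<..} x * (F 0 / (1 + x\<^sup>2))"
    proof (rule AE_I2)
      fix x :: real
      have "(\<lambda>n. 1 / real (Suc n) * x) \<longlonglongrightarrow> 0 * x" by (intro tendsto_intros LIMSEQ_Suc lim_1_over_n)
      then have "(\<lambda>n. F (1 / real (Suc n) * x)) \<longlonglongrightarrow> F (0 * x)" by (intro continuous_on_tendsto_compose[OF F]) auto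
      then show "(\<lambda>n. indicator {0<..} x * (F (1 / real (Suc n) * x) / (1 + x\<^sup>2))) \<longlonglongrightarrow> indicator {0<..} x * (F 0 / (1 + x\<^sup>2))"
        using one_plus_square_pos[of x] by (intro tendsto_intros) auto
    qed
    show "AE x in lborel. norm (indicator {0<..} x * (F (1 / real (Suc n) * x) / (1 + x\<^sup>2))) \<le> M * (indicator {0<..} x * (1 / (1 + x\<^sup>2)))" for n
    proof (rule AE_I2)
      fix x :: real
      show "norm (indicator {0<..} x * (F (1 / real (Suc n) * x) / (1 + x\<^sup>2))) \<le> M * (indicator {0<..} x * (1 / (1 + x\<^sup>2)))"
        using M[of "1 / real (Suc n) * x"] one_plus_square_pos[of x]
        by (cases "x > 0") (auto simp: abs_divide divide_right_mono)
    qed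
  qed auto
  then have "0 \<le> (\<integral>x. indicator {0<..} x * (F 0 / (1 + x\<^sup>2)) \<partial>lborel)"
    by (rule LIMSEQ_le_const) (intro exI allI impI eps, simp)
  also have "\<dots> = F 0 * (\<integral>x. indicator {0<..} x * (1 / (1 + x\<^sup>2)) \<partial>lborel)"
    by (subst integral_mult_right_zero[symmetric]) (intro Bochner_Integration.integral_cong refl, simp)
  finally have prod: "0 \<le> F 0 * (\<integral>x. indicator {0<..} x * (1 / (1 + x\<^sup>2)) \<partial>lborel)" .
  \<comment> \<open>Only the positivity of this integral is wanted; the interval (0, 1], where the
    integrand is at least 1/2, already shows it.\<close>
  have "(\<integral>x. indicator {0<..1} (x::real) * (1 / 2 :: real) \<partial>lborel) \<le> (\<integral>x. indicator {0<..} x * (1 / (1 + x\<^sup>2)) \<partial>lborel)"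
  proof (rule integral_mono[OF _ I1])
    show "integrable lborel (\<lambda>x::real. indicator {0<..1} x * (1 / 2 :: real))" by (intro integrable_mult_left integrable_real_indicator) auto
    fix x :: real
    show "indicator {0<..1} x * (1 / 2) \<le> indicator {0<..} x * (1 / (1 + x\<^sup>2))"
    proof (cases "0 < x \<and> x \<le> 1")
      case True
      then have "x\<^sup>2 \<le> 1" by (simp add: power_le_one)
      then have "1 / 2 \<le> 1 / (1 + x\<^sup>2)" using one_plus_square_pos[of x] by (intro divide_left_mono) auto
      then show ?thesis using True by simp
    qed (auto simp: indicator_def)
  qed
  then have "(\<integral>x. indicator {0<..} (x::real) * (1 / (1 + x\<^sup>2)) \<partial>lborel) > 0" by simp
  with prod show ?thesis by (simp add: zero_le_mult_iff)
qed

section \<open>Continuous functions of compact support\<close>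

lemma unif_angle_integral:
  fixes u :: "real \<Rightarrow> 'a::euclidean_space"
  assumes u: "continuous_on UNIV u"
  shows "(\<integral>t. u t \<partial>unif_angle) = integral {0..2 * pi} u /\<^sub>R (2 * pi)"
proof -
  have [measurable]: "u \<in> borel_measurable borel" by (rule borel_measurable_continuous_onI[OF u])
  have i: "set_integrable lborel {0..2 * pi} u"
    unfolding set_integrable_def by (rule borel_integrable_compact[OF _ continuous_on_subset[OF u]]) auto
  have "unif_angle = density lborel (\<lambda>t. ennreal (indicator {0..2 * pi} t / (2 * pi)))"
  proof -
    have "indicator {0..2 * pi} t / emeasure lborel {0..2 * pi} = ennreal (indicator {0..2 * pi} t / (2 * pi))" for t :: real
    proof (cases "t \<in> {0..2 * pi}")
      case True
      have "ennreal 1 / ennreal (2 * pi) = ennreal (1 / (2 * pi))" by (rule divide_ennreal) auto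
      then show ?thesis using True by simp
    qed simp
    then have "(\<lambda>t. indicator {0..2 * pi} t / emeasure lborel {0..2 * pi}) = (\<lambda>t. ennreal (indicator {0..2 * pi} t / (2 * pi)))"
      by (rule ext)
    then show ?thesis by (simp only: uniform_measure_def)
  qed
  then have "(\<integral>t. u t \<partial>unif_angle) = (\<integral>t. u t \<partial>density lborel (\<lambda>t. ennreal (indicator {0..2 * pi} t / (2 * pi))))"
    by (rule arg_cong)
  also have "\<dots> = (\<integral>t. (indicator {0..2 * pi} t / (2 * pi)) *\<^sub>R u t \<partial>lborel)"
    by (rule integral_density) auto
  also have "\<dots> = (\<integral>t. (1 / (2 * pi)) *\<^sub>R (indicator {0..2 * pi} t *\<^sub>R u t) \<partial>lborel)"
    by (intro Bochner_Integration.integral_cong refl) simp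
  also have "\<dots> = (1 / (2 * pi)) *\<^sub>R (\<integral>t. indicator {0..2 * pi} t *\<^sub>R u t \<partial>lborel)"
    by (rule integral_scaleR_right)
  also have "(\<integral>t. indicator {0..2 * pi} t *\<^sub>R u t \<partial>lborel) = integral {0..2 * pi} u"
    using set_borel_integral_eq_integral(2)[OF i] by (simp add: set_lebesgue_integral_def)
  finally show ?thesis by (simp add: inverse_eq_divide)
qed

text \<open>A Harnack-type bound. The height of the circle point is
  \<open>X / ((1 + a^2) * n^2)\<close> with \<open>n = |1 + cnj x * w|\<close>, and \<open>n\<close>
  lies between \<open>1 - |w|\<close>, which is at least \<open>1 / (2 * (1 + a^2))\<close>, and 2.
  It controls how far circle means spread a support, and later the width of the boundary
  layer.\<close>

lemma hcirc_height:
  assumes x: "norm x < 1"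
  shows "1 - (norm (hcirc x a t))\<^sup>2 \<le> 4 * (1 + a\<^sup>2) * (1 - (norm x)\<^sup>2)"
    and "1 - (norm x)\<^sup>2 \<le> 4 * (1 + a\<^sup>2) * (1 - (norm (hcirc x a t))\<^sup>2)"
proof -
  define \<rho> where "\<rho> = a / sqrt (1 + a\<^sup>2)"
  define w where "w = complex_of_real \<rho> * cis t"
  define X where "X = 1 - (norm x)\<^sup>2"
  define n where "n = norm (1 + cnj x * w)"
  have X: "X > 0" using x one_minus_norm_sq_pos by (simp add: X_def)
  have w: "norm w < 1" unfolding w_def \<rho>_def by (rule norm_rho_cis)
  have nw: "norm w = \<bar>\<rho>\<bar>" by (simp add: w_def norm_mult)
  have A: "1 + a\<^sup>2 > 0" by (rule one_plus_square_pos)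
  have sq: "1 - (norm w)\<^sup>2 = 1 / (1 + a\<^sup>2)"
    unfolding nw \<rho>_def using A by (simp add: power_divide field_simps)
  have H: "1 - (norm (hcirc x a t))\<^sup>2 = X * (1 / (1 + a\<^sup>2)) / n\<^sup>2"
    unfolding hcirc_def \<rho>_def[symmetric] w_def[symmetric] Moebius_uminus_norm_identity[OF x w] sq X_def n_def ..
  have xw: "norm (cnj x * w) \<le> norm w"
    using x by (simp add: norm_mult mult_left_le_one_le)
  have n2: "n \<le> 2" using norm_triangle_ineq[of 1 "cnj x * w"] xw w by (simp add: n_def)
  have n1: "1 - norm w \<le> n"
  proof -
    have "norm (1::complex) \<le> norm (1 + cnj x * w) + norm (cnj x * w)"
      using norm_triangle_ineq4[of "1 + cnj x * w" "cnj x * w"] by simp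
    then show ?thesis using xw by (simp add: n_def)
  qed
  have n0: "n > 0" using n1 w by linarith
  have "1 / (1 + a\<^sup>2) = (1 - norm w) * (1 + norm w)" unfolding sq[symmetric] by (simp add: power2_eq_square algebra_simps)
  also have "\<dots> \<le> n * 2" using n1 w by (intro mult_mono) auto
  finally have nA: "1 \<le> 2 * n * (1 + a\<^sup>2)" using A by (simp add: field_simps)
  have "1 * 1 \<le> (2 * n * (1 + a\<^sup>2)) * (2 * n * (1 + a\<^sup>2))" using nA by (intro mult_mono) auto
  then have P: "1 \<le> 4 * (1 + a\<^sup>2) * ((1 + a\<^sup>2) * n\<^sup>2)" by (simp add: power2_eq_square algebra_simps)
  have "1 / (1 + a\<^sup>2) / n\<^sup>2 = 1 / ((1 + a\<^sup>2) * n\<^sup>2)" by simp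
  also have "\<dots> \<le> 4 * (1 + a\<^sup>2)" using P A n0 by (subst pos_divide_le_eq) auto
  finally have "1 / (1 + a\<^sup>2) / n\<^sup>2 \<le> 4 * (1 + a\<^sup>2)" .
  then have "X * (1 / (1 + a\<^sup>2) / n\<^sup>2) \<le> X * (4 * (1 + a\<^sup>2))" using X by (intro mult_left_mono) auto
  then show "1 - (norm (hcirc x a t))\<^sup>2 \<le> 4 * (1 + a\<^sup>2) * (1 - (norm x)\<^sup>2)"
    unfolding H X_def[symmetric] by (simp add: mult.commute mult.left_commute)
  have "n\<^sup>2 \<le> 2\<^sup>2" using n2 n0 by (intro power_mono) auto
  then have "1 \<le> 4 / n\<^sup>2" using n0 by (simp add: field_simps)
  then have "X * 1 \<le> X * (4 / n\<^sup>2)" using X by (intro mult_left_mono) auto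
  also have "\<dots> = 4 * (1 + a\<^sup>2) * (X * (1 / (1 + a\<^sup>2)) / n\<^sup>2)"
  proof -
    have "X * (4 / n\<^sup>2) = 4 * b * (X * (1 / b) / n\<^sup>2)" if "b \<noteq> 0" for b using that by simp
    from this[of "1 + a\<^sup>2"] show ?thesis using A by simp
  qed
  finally show "1 - (norm x)\<^sup>2 \<le> 4 * (1 + a\<^sup>2) * (1 - (norm (hcirc x a t))\<^sup>2)"
    unfolding H X_def[symmetric] by simp
qed

lemma continuous_on_hcirc:
  assumes "continuous_on S X" "continuous_on S A" "continuous_on S T" "\<And>s. s \<in> S \<Longrightarrow> norm (X s) < 1"
  shows "continuous_on S (\<lambda>s. hcirc (X s) (A s) (T s))"
proof -
  have 1: "1 + cnj (X s) * (complex_of_real (A s / sqrt (1 + (A s)\<^sup>2)) * cis (T s)) \<noteq> 0" if "s \<in> S" for s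
    by (rule one_plus_cnj_mult_nonzero[OF assms(4)[OF that] less_imp_le[OF norm_rho_cis]])
  have 2: "sqrt (1 + (A s)\<^sup>2) \<noteq> 0" for s using one_plus_square_pos[of "A s"] by simp
  have "continuous_on S (\<lambda>s. (complex_of_real (A s / sqrt (1 + (A s)\<^sup>2)) * cis (T s) + X s)
      / (1 + cnj (X s) * (complex_of_real (A s / sqrt (1 + (A s)\<^sup>2)) * cis (T s))))"
    by (intro continuous_intros assms) (use 1 2 in auto)
  then show ?thesis by (simp add: hcirc_def Moebius_function_simple)
qed

lemma continuous_on_hcirc_t: "norm x < 1 \<Longrightarrow> continuous_on A (hcirc x a)"
  using continuous_on_hcirc[of A "\<lambda>_. x" "\<lambda>_. a" "\<lambda>t. t"] by (simp add: eta_contract_eq)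

lemma cmean_eq_integral:
  assumes f: "continuous_on poincare_disk f" and x: "norm x < 1"
  shows "cmean a f x = integral {0..2 * pi} (\<lambda>t. f (hcirc x a t)) / (2 * pi)"
proof -
  have "continuous_on UNIV (\<lambda>t. f (hcirc x a t))"
    by (rule continuous_on_compose2[OF f continuous_on_hcirc_t[OF x]]) (use hcirc_in_disk[OF x] in auto)
  from unif_angle_integral[OF this] show ?thesis by (simp add: cmean_def inverse_eq_divide)
qed

lemma continuous_on_cmean:
  assumes f: "continuous_on poincare_disk f" and "continuous_on S X" "continuous_on S A" "\<And>s. s \<in> S \<Longrightarrow> norm (X s) < 1"
  shows "continuous_on S (\<lambda>s. cmean (A s) f (X s))"
proof -
  have 1: "continuous_on (poincare_disk \<times> UNIV) (\<lambda>p. integral (cbox 0 (2 * pi)) (\<lambda>t. f (hcirc (fst p) (snd p) t)))"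
  proof (rule integral_continuous_on_param)
    have "continuous_on ((poincare_disk \<times> UNIV) \<times> cbox 0 (2 * pi)) (\<lambda>q. hcirc (fst (fst q)) (snd (fst q)) (snd q))"
      by (rule continuous_on_hcirc) (auto intro!: continuous_intros)
    then have "continuous_on ((poincare_disk \<times> UNIV) \<times> cbox 0 (2 * pi)) (\<lambda>q. f (hcirc (fst (fst q)) (snd (fst q)) (snd q)))"
      by (rule continuous_on_compose2[OF f]) (auto simp: hcirc_in_disk)
    then show "continuous_on ((poincare_disk \<times> UNIV) \<times> cbox 0 (2 * pi)) (\<lambda>(p, t). f (hcirc (fst p) (snd p) t))"
      by (simp add: split_beta')
  qed
  have 2: "continuous_on (poincare_disk \<times> UNIV) (\<lambda>p. cmean (snd p) f (fst p))"
  proof (rule continuous_on_eq)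
    show "continuous_on (poincare_disk \<times> UNIV) (\<lambda>p. integral (cbox 0 (2 * pi)) (\<lambda>t. f (hcirc (fst p) (snd p) t)) / (2 * pi))"
      by (intro continuous_intros 1) auto
    show "integral (cbox 0 (2 * pi)) (\<lambda>t. f (hcirc (fst p) (snd p) t)) / (2 * pi) = cmean (snd p) f (fst p)"
      if "p \<in> poincare_disk \<times> UNIV" for p
      using cmean_eq_integral[OF f, of "fst p" "snd p"] that by auto
  qed
  have "continuous_on S (\<lambda>s. (X s, A s))" by (intro continuous_intros assms)
  moreover have "(\<lambda>s. (X s, A s)) ` S \<subseteq> poincare_disk \<times> UNIV" using assms(4) by auto
  ultimately show ?thesis using continuous_on_compose2[OF 2] by fastforce
qed

lemma cmean_bound:
  assumes "\<And>t. \<bar>f (hcirc x a t)\<bar> \<le> M"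
  shows "\<bar>cmean a f x\<bar> \<le> M"
proof -
  have "\<bar>cmean a f x\<bar> \<le> (\<integral>t. \<bar>f (hcirc x a t)\<bar> \<partial>unif_angle)" unfolding cmean_def by (rule integral_abs_bound)
  also have "\<dots> \<le> (\<integral>t. M \<partial>unif_angle)"
    by (rule integral_mono') (use assms order_trans[OF abs_ge_zero assms] in auto)
  finally show ?thesis using unif_angle.prob_space by simp
qed

text \<open>As \<open>1 - \<bar>z\<bar>\<^sup>2\<close> is comparable to \<open>exp (- hyp_dist 0 z)\<close>, this bounds the hyperbolic size of the support.\<close>

definition hsupp :: "real \<Rightarrow> (complex \<Rightarrow> real) \<Rightarrow> bool" where
  "hsupp \<delta> f \<longleftrightarrow> (\<forall>z. norm z < 1 \<longrightarrow> 1 - (norm z)\<^sup>2 < \<delta> \<longrightarrow> f z = 0)"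

definition cont_cpt :: "(complex \<Rightarrow> real) \<Rightarrow> bool" where
  "cont_cpt f \<longleftrightarrow> continuous_on poincare_disk f \<and> (\<exists>\<delta>>0. hsupp \<delta> f)"

lemma continuous_on_disk_measurable:
  "continuous_on poincare_disk f \<Longrightarrow> f \<in> borel_measurable disk_borel"
  by (rule borel_measurable_continuous_on_restrict)

lemma compact_height: "\<delta> > 0 \<Longrightarrow> compact {z :: complex. 1 - (norm z)\<^sup>2 \<ge> \<delta>}"
proof -
  assume "\<delta> > 0"
  have "closed {z :: complex. 1 - (norm z)\<^sup>2 \<ge> \<delta>}" by (intro closed_Collect_le continuous_intros)
  moreover have "bounded {z :: complex. 1 - (norm z)\<^sup>2 \<ge> \<delta>}"
  proof (rule boundedI[where B = 1])
    fix z :: complex assume "z \<in> {z. 1 - (norm z)\<^sup>2 \<ge> \<delta>}"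
    then have "(norm z)\<^sup>2 \<le> 1\<^sup>2" using \<open>\<delta> > 0\<close> by simp
    then show "norm z \<le> 1" by (rule power2_le_imp_le) simp
  qed
  ultimately show ?thesis by (simp add: compact_eq_bounded_closed)
qed

lemma height_subset_disk: "\<delta> > 0 \<Longrightarrow> {z :: complex. 1 - (norm z)\<^sup>2 \<ge> \<delta>} \<subseteq> poincare_disk"
proof
  fix z :: complex assume "\<delta> > 0" "z \<in> {z. 1 - (norm z)\<^sup>2 \<ge> \<delta>}"
  then have "(norm z)\<^sup>2 < 1" by simp
  then show "z \<in> poincare_disk" by (simp add: abs_square_less_1)
qed

lemma continuous_bounded_height:
  assumes "continuous_on poincare_disk f" "\<delta> > 0"
  obtains M where "M \<ge> 0" "\<And>z. 1 - (norm z)\<^sup>2 \<ge> \<delta> \<Longrightarrow> \<bar>f z\<bar> \<le> (M :: real)"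
proof -
  have "compact (f ` {z. 1 - (norm z)\<^sup>2 \<ge> \<delta>})"
    by (rule compact_continuous_image[OF continuous_on_subset[OF assms(1) height_subset_disk[OF assms(2)]] compact_height[OF assms(2)]])
  then obtain M where M: "\<And>z. 1 - (norm z)\<^sup>2 \<ge> \<delta> \<Longrightarrow> \<bar>f z\<bar> \<le> M"
    by (metis (mono_tags, lifting) bounded_real compact_imp_bounded imageI mem_Collect_eq)
  show ?thesis by (rule that[of "max M 0"]) (use M in \<open>auto simp: le_max_iff_disj\<close>)
qed

lemma cont_cpt_bounded:
  assumes "cont_cpt f"
  obtains M where "M \<ge> 0" "\<And>z. norm z < 1 \<Longrightarrow> \<bar>f z\<bar> \<le> M"
proof -
  from assms obtain \<delta> where d: "\<delta> > 0" "hsupp \<delta> f" "continuous_on poincare_disk f" by (auto simp: cont_cpt_def)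
  obtain M where M: "M \<ge> 0" "\<And>z. 1 - (norm z)\<^sup>2 \<ge> \<delta> \<Longrightarrow> \<bar>f z\<bar> \<le> M"
    using continuous_bounded_height[OF d(3,1)] by blast
  show ?thesis by (rule that[OF M(1)]) (metis M d(2) abs_zero hsupp_def not_le)
qed

lemma emeasure_hyp_height: "\<delta> > 0 \<Longrightarrow> emeasure hyp_area {z. 1 - (norm z)\<^sup>2 \<ge> \<delta>} < \<infinity>"
  and sets_height: "\<delta> > 0 \<Longrightarrow> {z. 1 - (norm z)\<^sup>2 \<ge> \<delta>} \<in> sets hyp_area"
proof -
  assume d: "\<delta> > 0"
  let ?K = "{z :: complex. 1 - (norm z)\<^sup>2 \<ge> \<delta>}"
  have Kb: "?K \<in> sets borel" by (rule borel_compact[OF compact_height[OF d]])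
  show Ks: "?K \<in> sets hyp_area"
    unfolding sets_hyp_area by (subst sets_restrict_space_iff) (use Kb height_subset_disk[OF d] in auto)
  have "emeasure hyp_area ?K = (\<integral>\<^sup>+z. indicator ?K z \<partial>hyp_area)" using Ks by simp
  also have "\<dots> = (\<integral>\<^sup>+z. (indicator ?K z * indicator poincare_disk z) * ennreal (4 / (1 - (norm z)\<^sup>2)\<^sup>2) \<partial>lborel)"
    by (rule nn_integral_hyp_area) (use Ks sets_hyp_area in simp)
  also have "\<dots> \<le> (\<integral>\<^sup>+z. ennreal (4 / \<delta>\<^sup>2) * indicator ?K z \<partial>lborel)"
  proof (rule nn_integral_mono)
    fix z
    show "(indicator ?K z * indicator poincare_disk z) * ennreal (4 / (1 - (norm z)\<^sup>2)\<^sup>2) \<le> ennreal (4 / \<delta>\<^sup>2) * indicator ?K z"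
    proof (cases "z \<in> ?K")
      case True
      then have "\<delta>\<^sup>2 \<le> (1 - (norm z)\<^sup>2)\<^sup>2" using d by (intro power_mono) auto
      moreover have "\<delta>\<^sup>2 > 0" using d by simp
      ultimately have "4 / (1 - (norm z)\<^sup>2)\<^sup>2 \<le> 4 / \<delta>\<^sup>2" by (intro divide_left_mono mult_pos_pos) linarith+
      then show ?thesis using True by (auto simp: indicator_def intro: ennreal_leI)
    qed simp
  qed
  also have "\<dots> = ennreal (4 / \<delta>\<^sup>2) * emeasure lborel ?K" using Kb by (simp add: nn_integral_cmult_indicator)
  also have "\<dots> < \<infinity>"
    using emeasure_bounded_finite[OF compact_imp_bounded[OF compact_height[OF d]]] by (simp add: ennreal_mult_less_top)
  finally show "emeasure hyp_area ?K < \<infinity>" .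
qed

lemma integrable_bounded_hsupp:
  assumes f: "f \<in> borel_measurable hyp_area" and d: "\<delta> > 0" "hsupp \<delta> f" and M: "\<And>z. norm z < 1 \<Longrightarrow> \<bar>f z\<bar> \<le> M"
  shows "integrable hyp_area f"
proof (rule Bochner_Integration.integrable_bound[of _ "\<lambda>z. M * indicator {z. 1 - (norm z)\<^sup>2 \<ge> \<delta>} z"])
  show "integrable hyp_area (\<lambda>z. M * indicator {z. 1 - (norm z)\<^sup>2 \<ge> \<delta>} z)"
    using emeasure_hyp_height[OF d(1)] sets_height[OF d(1)] by (intro integrable_mult_right integrable_real_indicator) auto
  show "AE z in hyp_area. norm (f z) \<le> norm (M * indicator {z. 1 - (norm z)\<^sup>2 \<ge> \<delta>} z)"
  proof (rule AE_I2)
    fix z assume "z \<in> space hyp_area"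
    then have z: "norm z < 1" by simp
    show "norm (f z) \<le> norm (M * indicator {z. 1 - (norm z)\<^sup>2 \<ge> \<delta>} z)"
      using M[OF z] d(2) z by (cases "1 - (norm z)\<^sup>2 \<ge> \<delta>") (auto simp: hsupp_def not_le)
  qed
qed (rule f)

lemma cont_cpt_integrable:
  assumes "cont_cpt f" shows "integrable hyp_area f"
proof -
  from assms obtain \<delta> where d: "\<delta> > 0" "hsupp \<delta> f" "continuous_on poincare_disk f" by (auto simp: cont_cpt_def)
  obtain M where "M \<ge> 0" "\<And>z. norm z < 1 \<Longrightarrow> \<bar>f z\<bar> \<le> M" using cont_cpt_bounded[OF assms] by blast
  with d continuous_on_disk_measurable[OF d(3)] show ?thesis
    by (intro integrable_bounded_hsupp[of f \<delta> M]) (auto cong: measurable_cong_sets)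
qed

lemma cont_cpt_mult: 
  assumes "cont_cpt f" "continuous_on poincare_disk g"
  shows "cont_cpt (\<lambda>z. f z * g z)" "cont_cpt (\<lambda>z. g z * f z)"
  using assms unfolding cont_cpt_def hsupp_def by (auto intro!: continuous_intros)

lemma cmean_hsupp:
  assumes "hsupp \<delta> f" "\<delta> > 0"
  shows "hsupp (\<delta> / (4 * (1 + a\<^sup>2))) (cmean a f)"
  unfolding hsupp_def
proof (intro allI impI)
  fix x :: complex assume x: "norm x < 1" "1 - (norm x)\<^sup>2 < \<delta> / (4 * (1 + a\<^sup>2))"
  have A: "1 + a\<^sup>2 > 0" by (rule one_plus_square_pos)
  have "f (hcirc x a t) = 0" for t
  proof -
    have "4 * (1 + a\<^sup>2) * (1 - (norm x)\<^sup>2) < \<delta>" using x(2) A by (simp add: field_simps)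
    then have "1 - (norm (hcirc x a t))\<^sup>2 < \<delta>" using hcirc_height(1)[OF x(1), of a t] by linarith
    then show ?thesis using assms(1) hcirc_in_disk[OF x(1)] by (auto simp: hsupp_def)
  qed
  then show "cmean a f x = 0" by (simp add: cmean_def)
qed

lemma cont_cpt_cmean:
  assumes "cont_cpt f" shows "cont_cpt (cmean a f)"
proof -
  from assms obtain \<delta> where d: "\<delta> > 0" "hsupp \<delta> f" "continuous_on poincare_disk f" by (auto simp: cont_cpt_def)
  have "\<delta> / (4 * (1 + a\<^sup>2)) > 0" using d one_plus_square_pos[of a] by simp
  moreover have "continuous_on poincare_disk (\<lambda>x. cmean a f x)"
    by (rule continuous_on_cmean[OF d(3)]) (auto intro!: continuous_intros)
  ultimately show ?thesis using cmean_hsupp[OF d(2,1), of a] unfolding cont_cpt_def by (auto simp: eta_contract_eq)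
qed

text \<open>Dominated convergence in the radius. The bound is asked only on circles whose centre
  carries weight, which admits a continuous \<open>f\<close> that is unbounded near the boundary of
  the disk.\<close>

lemma continuous_on_cmean_pairing:
  assumes w: "integrable hyp_area w" and f: "continuous_on poincare_disk f"
    and M: "\<And>x a t. norm x < 1 \<Longrightarrow> w x \<noteq> 0 \<Longrightarrow> a \<in> A \<Longrightarrow> \<bar>f (hcirc x a t)\<bar> \<le> M"
  shows "continuous_on A (\<lambda>a. \<integral>x. w x * cmean a f x \<partial>hyp_area)"
  unfolding continuous_on_sequentially
proof (intro allI ballI impI, elim conjE)
  fix s a assume a: "a \<in> A" and s: "\<forall>n. s n \<in> A" and lim: "s \<longlonglongrightarrow> a"
  have wm: "w \<in> borel_measurable hyp_area" using w by simp
  have amm: "cmean b f \<in> borel_measurable hyp_area" for b by (rule cmean_measurable_center[OF continuous_on_disk_measurable[OF f]])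
  show "((\<lambda>a. \<integral>x. w x * cmean a f x \<partial>hyp_area) \<circ> s) \<longlonglongrightarrow> (\<integral>x. w x * cmean a f x \<partial>hyp_area)"
    unfolding o_def
  proof (rule integral_dominated_convergence[where w = "\<lambda>x. \<bar>w x\<bar> * M"])
    show "AE x in hyp_area. (\<lambda>n. w x * cmean (s n) f x) \<longlonglongrightarrow> w x * cmean a f x"
    proof (rule AE_I2)
      fix x assume "x \<in> space hyp_area"
      then have "continuous_on UNIV (\<lambda>a. cmean a f x)"
        by (intro continuous_on_cmean[OF f]) (auto intro!: continuous_intros)
      then have "(\<lambda>n. cmean (s n) f x) \<longlonglongrightarrow> cmean a f x"
        by (rule continuous_on_tendsto_compose[OF _ lim]) auto
      then show "(\<lambda>n. w x * cmean (s n) f x) \<longlonglongrightarrow> w x * cmean a f x" by (intro tendsto_intros)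
    qed
    show "AE x in hyp_area. norm (w x * cmean (s n) f x) \<le> \<bar>w x\<bar> * M" for n
    proof (rule AE_I2)
      fix x assume "x \<in> space hyp_area"
      then have x: "norm x < 1" by simp
      show "norm (w x * cmean (s n) f x) \<le> \<bar>w x\<bar> * M"
      proof (cases "w x = 0")
        case False
        have "\<bar>cmean (s n) f x\<bar> \<le> M" by (rule cmean_bound) (use M[OF x False] s in auto)
        then show ?thesis by (simp add: abs_mult mult_left_mono)
      qed simp
    qed
    show "integrable hyp_area (\<lambda>x. \<bar>w x\<bar> * M)" using w by simp
  qed (use wm amm in auto)
qed

text \<open>A double integral against a radial kernel is the integral, over the radius, of the
  pairing of \<open>g\<close> with the circle means of \<open>f\<close>. Indicators of disks as
  kernels give the symmetry of the means; the kernel \<open>spherical l\<close> gives the spherical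
  transform of the pairing.\<close>

lemma hyp_kernel_fubini:
  assumes f: "integrable hyp_area f" and g: "integrable hyp_area g"
    and k: "k \<in> borel_measurable borel" and kb: "\<And>a. \<bar>k a\<bar> \<le> B"
  shows "(\<integral>x. g x * (\<integral>y. f y * k (sinh_hdist x y) \<partial>hyp_area) \<partial>hyp_area) = (\<integral>a. k a * (\<integral>x. g x * cmean a f x \<partial>hyp_area) \<partial>radial_area)"
proof -
  have fm: "f \<in> borel_measurable disk_borel" using f by (simp cong: measurable_cong_sets)
  have gm [measurable]: "g \<in> borel_measurable hyp_area" using g by simp
  have amm [measurable]: "(\<lambda>(x, a). cmean a f x) \<in> borel_measurable (hyp_area \<Otimes>\<^sub>M radial_area)"
    using cmean_measurable[OF fm] by (simp cong: measurable_cong_sets)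
  have km [measurable]: "k \<in> borel_measurable radial_area" using k by simp
  have int: "integrable (hyp_area \<Otimes>\<^sub>M radial_area) (\<lambda>(x, a). g x * (k a * cmean a f x))"
  proof (rule integrableI_bounded)
    show "(\<lambda>(x, a). g x * (k a * cmean a f x)) \<in> borel_measurable (hyp_area \<Otimes>\<^sub>M radial_area)" by measurable
    have F: "(\<integral>\<^sup>+y. ennreal \<bar>f y\<bar> \<partial>hyp_area) < \<infinity>" "(\<integral>\<^sup>+y. ennreal \<bar>g y\<bar> \<partial>hyp_area) < \<infinity>"
      using f g by (auto simp: integrable_iff_bounded)
    have "(\<integral>\<^sup>+p. ennreal (norm (case p of (x, a) \<Rightarrow> g x * (k a * cmean a f x))) \<partial>(hyp_area \<Otimes>\<^sub>M radial_area))
       = (\<integral>\<^sup>+x. (\<integral>\<^sup>+a. ennreal (norm (g x * (k a * cmean a f x))) \<partial>radial_area) \<partial>hyp_area)"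
      by (subst radial_area.nn_integral_fst[symmetric]) (auto simp: split_beta')
    also have "\<dots> \<le> (\<integral>\<^sup>+x. ennreal \<bar>g x\<bar> * (ennreal B * (\<integral>\<^sup>+y. ennreal \<bar>f y\<bar> \<partial>hyp_area)) \<partial>hyp_area)"
    proof (rule nn_integral_mono)
      fix x assume "x \<in> space hyp_area"
      then have x: "norm x < 1" by simp
      have [measurable]: "(\<lambda>a. cmean a f x) \<in> borel_measurable radial_area"
        using measurable_compose[OF _ cmean_measurable[OF fm], of "\<lambda>a. (x, a)" radial_area] x by simp
      have "(\<integral>\<^sup>+a. ennreal (norm (g x * (k a * cmean a f x))) \<partial>radial_area) \<le> (\<integral>\<^sup>+a. (ennreal \<bar>g x\<bar> * ennreal B) * ennreal \<bar>cmean a f x\<bar> \<partial>radial_area)"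
      proof (rule nn_integral_mono)
        fix a
        have "B \<ge> 0" using kb[of 0] by linarith
        then show "ennreal (norm (g x * (k a * cmean a f x))) \<le> (ennreal \<bar>g x\<bar> * ennreal B) * ennreal \<bar>cmean a f x\<bar>"
          using kb[of a] by (simp add: abs_mult ennreal_mult[symmetric] mult.assoc mult_left_mono mult_right_mono ennreal_leI)
      qed
      also have "\<dots> = (ennreal \<bar>g x\<bar> * ennreal B) * (\<integral>\<^sup>+a. ennreal \<bar>cmean a f x\<bar> \<partial>radial_area)"
        by (rule nn_integral_cmult) measurable
      also have "\<dots> \<le> (ennreal \<bar>g x\<bar> * ennreal B) * (\<integral>\<^sup>+y. ennreal \<bar>f y\<bar> \<partial>hyp_area)"
        by (intro mult_left_mono hyp_integral_polar(3)[OF x f k kb]) auto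
      finally show "(\<integral>\<^sup>+a. ennreal (norm (g x * (k a * cmean a f x))) \<partial>radial_area) \<le> ennreal \<bar>g x\<bar> * (ennreal B * (\<integral>\<^sup>+y. ennreal \<bar>f y\<bar> \<partial>hyp_area))"
        by (simp add: mult.assoc)
    qed
    also have "\<dots> = (\<integral>\<^sup>+x. ennreal \<bar>g x\<bar> \<partial>hyp_area) * (ennreal B * (\<integral>\<^sup>+y. ennreal \<bar>f y\<bar> \<partial>hyp_area))"
      by (rule nn_integral_multc) measurable
    also have "\<dots> < \<infinity>" using F by (simp add: ennreal_mult_less_top)
    finally show "(\<integral>\<^sup>+p. ennreal (norm (case p of (x, a) \<Rightarrow> g x * (k a * cmean a f x))) \<partial>(hyp_area \<Otimes>\<^sub>M radial_area)) < \<infinity>" .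
  qed
  have "(\<integral>x. g x * (\<integral>y. f y * k (sinh_hdist x y) \<partial>hyp_area) \<partial>hyp_area) = (\<integral>x. (\<integral>a. g x * (k a * cmean a f x) \<partial>radial_area) \<partial>hyp_area)"
    by (rule Bochner_Integration.integral_cong[OF refl]) (use hyp_integral_polar(2)[OF _ f k kb] in auto)
  also have "\<dots> = (\<integral>a. (\<integral>x. g x * (k a * cmean a f x) \<partial>hyp_area) \<partial>radial_area)"
    by (rule HA.Fubini_integral[symmetric, OF int])
  also have "\<dots> = (\<integral>a. k a * (\<integral>x. g x * cmean a f x \<partial>hyp_area) \<partial>radial_area)"
    by (simp add: mult.left_commute[of "g _"])
  finally show ?thesis .
qed

section \<open>Circle means and the area measure\<close>

lemma radial_area_integral:
  fixes u :: "real \<Rightarrow> real"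
  assumes u: "continuous_on {0..c} u"
  shows "(\<integral>a. indicator {0..c} a * u a \<partial>radial_area) = integral {0..c} (\<lambda>a. 8 * pi * a * u a)"
proof -
  define v where "v = (\<lambda>a. indicator {0..c} a *\<^sub>R u a)"
  have vm: "v \<in> borel_measurable borel"
    unfolding v_def using borel_measurable_continuous_on_indicator[OF _ u] by simp
  have si: "set_integrable lborel {0..c} (\<lambda>a. 8 * pi * a * u a)"
    unfolding set_integrable_def by (rule borel_integrable_compact) (auto intro!: continuous_intros u)
  have "ennreal (8 * pi * a) * indicator {0<..} a = ennreal (8 * pi * a * indicator {0<..} a)" for a by (auto simp: indicator_def)
  then have pa: "radial_area = density lborel (\<lambda>a. ennreal (8 * pi * a * indicator {0<..} a))"
    unfolding radial_area_def by presburger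
  have "(\<integral>a. v a \<partial>radial_area) = (\<integral>a. (8 * pi * a * indicator {0<..} a) *\<^sub>R v a \<partial>lborel)"
    unfolding pa by (rule integral_density) (use vm in \<open>auto simp: indicator_def\<close>)
  also have "(\<lambda>a. (8 * pi * a * indicator {0<..} a) *\<^sub>R v a) = (\<lambda>a. indicator {0..c} a *\<^sub>R (8 * pi * a * u a))"
    by (auto simp: v_def indicator_def fun_eq_iff)
  also have "(\<integral>a. indicator {0..c} a *\<^sub>R (8 * pi * a * u a) \<partial>lborel) = integral {0..c} (\<lambda>a. 8 * pi * a * u a)"
    using set_borel_integral_eq_integral(2)[OF si] by (simp add: set_lebesgue_integral_def)
  finally show ?thesis by (simp add: v_def)
qed

lemma continuous_zero_integrals:
  fixes u :: "real \<Rightarrow> real"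
  assumes u: "continuous_on {0..b} u" and z: "\<And>c. 0 \<le> c \<Longrightarrow> c \<le> b \<Longrightarrow> integral {0..c} u = 0" and a: "0 < a" "a < b"
  shows "u a = 0"
proof -
  have "((\<lambda>x. integral {0..x} u) has_real_derivative u a) (at a within {0..b})"
    by (rule integral_has_real_derivative[OF u]) (use a in auto)
  then have "((\<lambda>x. integral {0..x} u) has_real_derivative u a) (at a within {0<..<b})"
    by (rule DERIV_subset) auto
  then have "((\<lambda>x. integral {0..x} u) has_real_derivative u a) (at a)"
    using a by (subst (asm) at_within_open) auto
  moreover have "((\<lambda>x. integral {0..x} u) has_real_derivative 0) (at a)"
  proof (rule has_field_derivative_transform_within_open[OF DERIV_const])
    show "open {0<..<b}" "a \<in> {0<..<b}" using a by auto
    show "0 = integral {0..x} u" if "x \<in> {0<..<b}" for x using z[of x] that by simp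
  qed
  ultimately show ?thesis by (rule DERIV_unique)
qed

text \<open>By symmetry of the distance, the two sides have equal integrals over \<open>{0..c}\<close> with respect to
  \<open>radial_area\<close> for every \<open>c\<close>, and they are continuous in \<open>a\<close>.\<close>

lemma cmean_swap:
  assumes f: "cont_cpt f" and g: "continuous_on poincare_disk g" and a: "a > 0"
  shows "(\<integral>x. g x * cmean a f x \<partial>hyp_area) = (\<integral>x. f x * cmean a g x \<partial>hyp_area)"
proof -
  \<comment> \<open>The extra room makes \<open>a\<close> an interior point of the range of radii,
    so that one can differentiate there.\<close>
  define b where "b = a + 1"
  obtain \<delta> where d: "\<delta> > 0" "hsupp \<delta> f" "continuous_on poincare_disk f" using f by (auto simp: cont_cpt_def)
  obtain M where M: "M \<ge> 0" "\<And>z. norm z < 1 \<Longrightarrow> \<bar>f z\<bar> \<le> M" using cont_cpt_bounded[OF f] by blast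
  \<comment> \<open>For radii up to \<open>b\<close>, circles about points of height below
    \<open>\<eta>\<close> miss the support of \<open>f\<close>, and circles about points of the
    support stay above height \<open>\<eta>\<close>. So \<open>g\<close>, which need not be
    integrable, may be replaced by its truncation \<open>g'\<close>.\<close>
  define \<eta> where "\<eta> = \<delta> / (4 * (1 + b\<^sup>2))"
  have B: "1 + b\<^sup>2 > 0" by (rule one_plus_square_pos)
  have e: "\<eta> > 0" using d(1) B by (simp add: \<eta>_def)
  obtain L where L: "L \<ge> 0" "\<And>z. 1 - (norm z)\<^sup>2 \<ge> \<eta> \<Longrightarrow> \<bar>g z\<bar> \<le> L" using continuous_bounded_height[OF g e] by blast
  define g' where "g' = (\<lambda>x. if 1 - (norm x)\<^sup>2 \<ge> \<eta> then g x else 0)"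
  have gm: "g \<in> borel_measurable hyp_area" using continuous_on_disk_measurable[OF g] by (simp cong: measurable_cong_sets)
  have "g' = (\<lambda>x. indicator {z. 1 - (norm z)\<^sup>2 \<ge> \<eta>} x * g x)" by (auto simp: g'_def fun_eq_iff)
  then have g'm: "g' \<in> borel_measurable hyp_area" using gm sets_height[OF e] by simp
  have g'i: "integrable hyp_area g'"
    by (rule integrable_bounded_hsupp[OF g'm e, of L]) (use L in \<open>auto simp: hsupp_def g'_def\<close>)
  have fi: "integrable hyp_area f" by (rule cont_cpt_integrable[OF f])
  have scale: "4 * (1 + c\<^sup>2) * y < \<delta>" if "0 \<le> c" "c \<le> b" "y < \<eta>" "0 \<le> y" for c y :: real
  proof -
    have "c\<^sup>2 \<le> b\<^sup>2" using that by (intro power_mono) auto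
    then have "4 * (1 + c\<^sup>2) * y \<le> 4 * (1 + b\<^sup>2) * y" using that by (intro mult_right_mono) auto
    also have "\<dots> < \<delta>" using that(3) B by (simp add: \<eta>_def field_simps)
    finally show ?thesis .
  qed
  have f0: "f (hcirc x c t) = 0" if "norm x < 1" "0 \<le> c" "c \<le> b" "1 - (norm x)\<^sup>2 < \<eta>" for x c t
  proof -
    have "1 - (norm (hcirc x c t))\<^sup>2 < \<delta>"
      using hcirc_height(1)[OF that(1), of c t] scale[OF that(2,3,4)] one_minus_norm_sq_pos[OF that(1)] by linarith
    then show ?thesis using d(2) hcirc_in_disk[OF that(1)] by (auto simp: hsupp_def)
  qed
  have gin: "1 - (norm (hcirc x c t))\<^sup>2 \<ge> \<eta>" if "norm x < 1" "0 \<le> c" "c \<le> b" "f x \<noteq> 0" for x c t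
  proof (rule ccontr)
    assume n: "\<not> ?thesis"
    have "4 * (1 + c\<^sup>2) * (1 - (norm (hcirc x c t))\<^sup>2) < \<delta>"
      by (rule scale[OF that(2,3)]) (use n one_minus_norm_sq_pos[OF hcirc_in_disk[OF that(1)], of c t] in linarith)+
    then have "1 - (norm x)\<^sup>2 < \<delta>" using hcirc_height(2)[OF that(1), of c t] by linarith
    then show False using d(2) that by (auto simp: hsupp_def)
  qed
  define E1 where "E1 = (\<lambda>c. \<integral>x. g x * cmean c f x \<partial>hyp_area)"
  define E2 where "E2 = (\<lambda>c. \<integral>x. f x * cmean c g x \<partial>hyp_area)"
  have E1': "E1 c = (\<integral>x. g' x * cmean c f x \<partial>hyp_area)" if "0 \<le> c" "c \<le> b" for c
    unfolding E1_def
  proof (rule Bochner_Integration.integral_cong[OF refl])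
    fix x assume "x \<in> space hyp_area"
    then have "cmean c f x = 0" if "1 - (norm x)\<^sup>2 < \<eta>"
      using f0[of x c] \<open>0 \<le> c\<close> \<open>c \<le> b\<close> that by (simp add: cmean_def)
    then show "g x * cmean c f x = g' x * cmean c f x" by (auto simp: g'_def not_le)
  qed
  have E2': "E2 c = (\<integral>x. f x * cmean c g' x \<partial>hyp_area)" if "0 \<le> c" "c \<le> b" for c
    unfolding E2_def
  proof (rule Bochner_Integration.integral_cong[OF refl])
    fix x assume "x \<in> space hyp_area"
    then have "cmean c g x = cmean c g' x" if "f x \<noteq> 0"
      using gin[of x c] \<open>0 \<le> c\<close> \<open>c \<le> b\<close> that by (simp add: cmean_def g'_def)
    then show "f x * cmean c g x = f x * cmean c g' x" by (cases "f x = 0") auto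
  qed
  have c1: "continuous_on {0..b} E1"
  proof (rule continuous_on_eq)
    show "continuous_on {0..b} (\<lambda>c. \<integral>x. g' x * cmean c f x \<partial>hyp_area)"
      by (rule continuous_on_cmean_pairing[OF g'i d(3), of _ M]) (use M hcirc_in_disk in auto)
  qed (use E1' in auto)
  have c2: "continuous_on {0..b} E2"
    unfolding E2_def by (rule continuous_on_cmean_pairing[OF fi g, of _ L]) (use L gin in auto)
  have eq: "integral {0..c} (\<lambda>s. 8 * pi * s * (E1 s - E2 s)) = 0" if c: "0 \<le> c" "c \<le> b" for c
  proof -
    \<comment> \<open>The kernel of the disk of radius \<open>c\<close>. Its double integral against
      \<open>g'\<close> and \<open>f\<close> is symmetric since the distance is, which equates the
      two sides after integration over radii up to \<open>c\<close>.\<close>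
    define k :: "real \<Rightarrow> real" where "k = indicator {0..c}"
    have k: "k \<in> borel_measurable borel" "\<And>s. \<bar>k s\<bar> \<le> 1" by (auto simp: k_def indicator_def)
    have sm [measurable]: "(\<lambda>(x, y). k (sinh_hdist x y)) \<in> borel_measurable (hyp_area \<Otimes>\<^sub>M hyp_area)"
      using measurable_compose[OF sinh_hdist_measurable k(1)] by (simp add: split_beta')
    have gfm [measurable]: "f \<in> borel_measurable hyp_area" "g' \<in> borel_measurable hyp_area" using fi g'm by auto
    have int: "integrable (hyp_area \<Otimes>\<^sub>M hyp_area) (\<lambda>(x, y). g' x * (f y * k (sinh_hdist x y)))"
    proof (rule Bochner_Integration.integrable_bound)
      show "integrable (hyp_area \<Otimes>\<^sub>M hyp_area) (\<lambda>(x, y). g' x * f y)"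
        by (rule HH.Fubini_integrable) (use fi g'i in \<open>auto simp: abs_mult\<close>)
      show "AE p in hyp_area \<Otimes>\<^sub>M hyp_area. norm (case p of (x, y) \<Rightarrow> g' x * (f y * k (sinh_hdist x y))) \<le> norm (case p of (x, y) \<Rightarrow> g' x * f y)"
        by (rule AE_I2) (auto simp: abs_mult k_def indicator_def)
    qed measurable
    have "(\<integral>s. k s * (\<integral>x. g' x * cmean s f x \<partial>hyp_area) \<partial>radial_area) = (\<integral>x. g' x * (\<integral>y. f y * k (sinh_hdist x y) \<partial>hyp_area) \<partial>hyp_area)"
      by (rule hyp_kernel_fubini[symmetric, OF fi g'i k])
    also have "\<dots> = (\<integral>x. (\<integral>y. g' x * (f y * k (sinh_hdist x y)) \<partial>hyp_area) \<partial>hyp_area)" by simp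
    also have "\<dots> = (\<integral>y. (\<integral>x. g' x * (f y * k (sinh_hdist x y)) \<partial>hyp_area) \<partial>hyp_area)"
      by (rule HH.Fubini_integral[symmetric, OF int])
    also have "\<dots> = (\<integral>y. f y * (\<integral>x. g' x * k (sinh_hdist y x) \<partial>hyp_area) \<partial>hyp_area)"
      by (simp add: mult.left_commute[of "g' _"] sinh_hdist_commute)
    also have "\<dots> = (\<integral>s. k s * (\<integral>x. f x * cmean s g' x \<partial>hyp_area) \<partial>radial_area)"
      by (rule hyp_kernel_fubini[OF g'i fi k])
    finally have "(\<integral>s. k s * (\<integral>x. g' x * cmean s f x \<partial>hyp_area) \<partial>radial_area) = (\<integral>s. k s * (\<integral>x. f x * cmean s g' x \<partial>hyp_area) \<partial>radial_area)" .
    moreover have "(\<lambda>s. k s * (\<integral>x. g' x * cmean s f x \<partial>hyp_area)) = (\<lambda>s. indicator {0..c} s * E1 s)"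
      using E1' c by (auto simp: k_def indicator_def fun_eq_iff)
    moreover have "(\<lambda>s. k s * (\<integral>x. f x * cmean s g' x \<partial>hyp_area)) = (\<lambda>s. indicator {0..c} s * E2 s)"
      using E2' c by (auto simp: k_def indicator_def fun_eq_iff)
    ultimately have "(\<integral>s. indicator {0..c} s * E1 s \<partial>radial_area) = (\<integral>s. indicator {0..c} s * E2 s \<partial>radial_area)" by simp
    moreover have s1: "continuous_on {0..c} E1" "continuous_on {0..c} E2" using c by (auto intro: continuous_on_subset[OF c1] continuous_on_subset[OF c2])
    ultimately have "integral {0..c} (\<lambda>s. 8 * pi * s * E1 s) = integral {0..c} (\<lambda>s. 8 * pi * s * E2 s)"
      by (simp add: radial_area_integral)
    moreover have "integral {0..c} (\<lambda>s. 8 * pi * s * E1 s - 8 * pi * s * E2 s) = integral {0..c} (\<lambda>s. 8 * pi * s * E1 s) - integral {0..c} (\<lambda>s. 8 * pi * s * E2 s)"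
      by (intro Henstock_Kurzweil_Integration.integral_diff integrable_continuous_real continuous_intros s1)
    ultimately show ?thesis by (simp add: right_diff_distrib)
  qed
  have "8 * pi * a * (E1 a - E2 a) = 0"
    by (rule continuous_zero_integrals[OF _ eq]) (use a c1 c2 in \<open>auto simp: b_def intro!: continuous_intros\<close>)
  then show ?thesis using a by (simp add: E1_def E2_def)
qed

lemma cmean_integral:
  assumes f: "cont_cpt f" and a: "a > 0"
  shows "(\<integral>x. cmean a f x \<partial>hyp_area) = (\<integral>x. f x \<partial>hyp_area)"
proof -
  have "cmean a (\<lambda>_. 1) x = 1" for x using unif_angle.prob_space by (simp add: cmean_def)
  then show ?thesis using cmean_swap[OF f _ a, of "\<lambda>_. 1"] by simp
qed

section \<open>The map from centre and angle to the circle point preserves area\<close>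

lemma measurable_hcirc_pairs: "(\<lambda>(x, t). hcirc x a t) \<in> hyp_area \<Otimes>\<^sub>M unif_angle \<rightarrow>\<^sub>M hyp_area"
proof -
  have "(\<lambda>p. hcirc (fst p) a (snd p)) \<in> hyp_area \<Otimes>\<^sub>M unif_angle \<rightarrow>\<^sub>M disk_borel"
    by (rule hcirc_measurable) measurable
  then show ?thesis by (simp add: split_beta' sets_hyp_area cong: measurable_cong_sets)
qed

lemma nn_integral_cmean:
  assumes f: "cont_cpt f" and nn: "\<And>z. f z \<ge> 0" and a: "a > 0"
  shows "(\<integral>\<^sup>+p. ennreal (f (case p of (x, t) \<Rightarrow> hcirc x a t)) \<partial>(hyp_area \<Otimes>\<^sub>M unif_angle)) = (\<integral>\<^sup>+z. ennreal (f z) \<partial>hyp_area)"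
proof -
  have fc: "continuous_on poincare_disk f" using f by (simp add: cont_cpt_def)
  have fm: "f \<in> borel_measurable hyp_area" using cont_cpt_integrable[OF f] by simp
  obtain M where M: "M \<ge> 0" "\<And>z. norm z < 1 \<Longrightarrow> \<bar>f z\<bar> \<le> M" using cont_cpt_bounded[OF f] by blast
  have m: "(\<lambda>p. ennreal (f (case p of (x, t) \<Rightarrow> hcirc x a t))) \<in> borel_measurable (hyp_area \<Otimes>\<^sub>M unif_angle)"
    using measurable_compose[OF measurable_hcirc_pairs fm] by simp
  have "(\<integral>\<^sup>+p. ennreal (f (case p of (x, t) \<Rightarrow> hcirc x a t)) \<partial>(hyp_area \<Otimes>\<^sub>M unif_angle)) = (\<integral>\<^sup>+x. (\<integral>\<^sup>+t. ennreal (f (hcirc x a t)) \<partial>unif_angle) \<partial>hyp_area)"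
    using unif_angle.nn_integral_fst[OF m] by simp
  also have "\<dots> = (\<integral>\<^sup>+x. ennreal (cmean a f x) \<partial>hyp_area)"
  proof (rule nn_integral_cong)
    fix x assume "x \<in> space hyp_area"
    then have x: "norm x < 1" by simp
    have "continuous_on UNIV (\<lambda>t. f (hcirc x a t))"
      by (rule continuous_on_compose2[OF fc continuous_on_hcirc_t[OF x]]) (use hcirc_in_disk[OF x] in auto)
    then have [measurable]: "(\<lambda>t. f (hcirc x a t)) \<in> borel_measurable borel" by (rule borel_measurable_continuous_onI)
    have "integrable unif_angle (\<lambda>t. f (hcirc x a t))"
      by (rule unif_angle.integrable_const_bound[of _ M]) (use M hcirc_in_disk[OF x] in auto)
    then show "(\<integral>\<^sup>+t. ennreal (f (hcirc x a t)) \<partial>unif_angle) = ennreal (cmean a f x)"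
      unfolding cmean_def by (rule nn_integral_eq_integral) (use nn in auto)
  qed
  also have "\<dots> = ennreal (\<integral>x. cmean a f x \<partial>hyp_area)"
    by (rule nn_integral_eq_integral[OF cont_cpt_integrable[OF cont_cpt_cmean[OF f]]]) (auto simp: cmean_def nn intro!: AE_I2 integral_nonneg_AE)
  also have "\<dots> = ennreal (\<integral>x. f x \<partial>hyp_area)" unfolding cmean_integral[OF f a] ..
  also have "\<dots> = (\<integral>\<^sup>+z. ennreal (f z) \<partial>hyp_area)"
    by (rule nn_integral_eq_integral[symmetric, OF cont_cpt_integrable[OF f]]) (use nn in auto)
  finally show ?thesis .
qed

text \<open>Open sets at positive height generate the Borel sets, have finite area, and their
  indicators are monotone limits of functions satisfying \<open>cont_cpt\<close>: exactly what the
  uniqueness of measures in \<open>distr_hcirc_pairs\<close> asks for.\<close>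

lemma sigma_sets_disk:
  "sets disk_borel = sigma_sets poincare_disk {V. open V \<and> (\<exists>\<delta>>0. V \<subseteq> {z. 1 - (norm z)\<^sup>2 \<ge> \<delta>})}"
proof -
  let ?E = "{V. open V \<and> (\<exists>\<delta>>0. V \<subseteq> {z :: complex. 1 - (norm z)\<^sup>2 \<ge> \<delta>})}"
  have "sets disk_borel = (\<inter>) poincare_disk ` sigma_sets UNIV {S. open S}"
    by (simp add: sets_restrict_space borel_def)
  also have "\<dots> = sigma_sets poincare_disk ((\<inter>) poincare_disk ` {S. open S})"
    by (rule sigma_sets_Int) auto
  also have "\<dots> = sigma_sets poincare_disk ?E"
  proof (rule sigma_sets_eqI)
    fix V assume "V \<in> (\<inter>) poincare_disk ` {S. open S}"
    then have V: "open V" "V \<subseteq> poincare_disk" by (auto intro: open_Int)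
    define W where "W = (\<lambda>n::nat. V \<inter> {z. 1 - (norm z)\<^sup>2 > 1 / real (Suc n)})"
    have "W n \<in> ?E" for n
    proof -
      have "open {z :: complex. 1 - (norm z)\<^sup>2 > 1 / real (Suc n)}" by (intro open_Collect_less continuous_intros)
      then show ?thesis using V unfolding W_def by (auto intro!: open_Int exI[of _ "1 / real (Suc n)"])
    qed
    then have "(\<Union>n. W n) \<in> sigma_sets poincare_disk ?E" by (intro sigma_sets.Union sigma_sets.Basic)
    moreover have "(\<Union>n. W n) = V"
    proof (intro equalityI subsetI)
      fix z assume z: "z \<in> V"
      then have "0 < 1 - (norm z)\<^sup>2" using V one_minus_norm_sq_pos[of z] by auto
      then obtain n where "inverse (real (Suc n)) < 1 - (norm z)\<^sup>2" by (rule reals_Archimedean[THEN exE])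
      then show "z \<in> (\<Union>n. W n)" using z by (auto simp: W_def inverse_eq_divide)
    qed (auto simp: W_def)
    ultimately show "V \<in> sigma_sets poincare_disk ?E" by simp
  next
    fix V assume "V \<in> ?E"
    then have "open V" "V \<subseteq> poincare_disk" using height_subset_disk by auto
    then show "V \<in> sigma_sets poincare_disk ((\<inter>) poincare_disk ` {S. open S})"
      by (intro sigma_sets.Basic) (auto intro!: image_eqI[of _ _ V])
  qed
  finally show ?thesis .
qed

text \<open>The identity \<open>cmean_integral\<close> for continuous functions, extended to all
  Borel sets. It takes the place of an operator bound: both factors of \<open>avg_form\<close> are
  then square-integrable on the product space, with the norm of \<open>u\<close>.\<close>

lemma distr_hcirc_pairs:
  assumes a: "a > 0"
  shows "distr (hyp_area \<Otimes>\<^sub>M unif_angle) hyp_area (\<lambda>(x, t). hcirc x a t) = hyp_area"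
proof -
  let ?E = "{V. open V \<and> (\<exists>\<delta>>0. V \<subseteq> {z :: complex. 1 - (norm z)\<^sup>2 \<ge> \<delta>})}"
  let ?N = "distr (hyp_area \<Otimes>\<^sub>M unif_angle) hyp_area (\<lambda>(x, t). hcirc x a t)"
  have "hyp_area = ?N"
  proof (rule measure_eqI_generator_eq[of ?E poincare_disk _ _ "\<lambda>n. {z. 1 - (norm z)\<^sup>2 > 1 / real (Suc n)}"])
    show "Int_stable ?E" by (auto simp: Int_stable_def intro: open_Int)
    show "?E \<subseteq> Pow poincare_disk" using height_subset_disk by auto
    show "sets hyp_area = sigma_sets poincare_disk ?E" "sets ?N = sigma_sets poincare_disk ?E"
      using sigma_sets_disk by (simp_all add: sets_hyp_area)
    have op: "open {z :: complex. 1 - (norm z)\<^sup>2 > 1 / real (Suc n)}" for n by (intro open_Collect_less continuous_intros)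
    have "{z :: complex. 1 - (norm z)\<^sup>2 > 1 / real (Suc n)} \<in> ?E" for n
      using op[of n] by (auto intro!: exI[of _ "1 / real (Suc n)"])
    then show "range (\<lambda>n. {z. 1 - (norm z)\<^sup>2 > 1 / real (Suc n)}) \<subseteq> ?E"
      by (intro image_subsetI)
    show "(\<Union>n. {z :: complex. 1 - (norm z)\<^sup>2 > 1 / real (Suc n)}) = poincare_disk"
    proof (intro equalityI subsetI)
      fix z :: complex assume "z \<in> poincare_disk"
      then have "0 < 1 - (norm z)\<^sup>2" using one_minus_norm_sq_pos[of z] by auto
      then obtain n where "inverse (real (Suc n)) < 1 - (norm z)\<^sup>2" by (rule reals_Archimedean[THEN exE])
      then show "z \<in> (\<Union>n. {z. 1 - (norm z)\<^sup>2 > 1 / real (Suc n)})" by (auto simp: inverse_eq_divide)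
    next
      fix z :: complex assume "z \<in> (\<Union>n. {z. 1 - (norm z)\<^sup>2 > 1 / real (Suc n)})"
      then obtain n where "1 - (norm z)\<^sup>2 > 1 / real (Suc n)" by auto
      then have "z \<in> {z. 1 - (norm z)\<^sup>2 \<ge> 1 / real (Suc n)}" by simp
      then show "z \<in> poincare_disk" by (rule subsetD[OF height_subset_disk, rotated]) simp
    qed
    show "emeasure hyp_area {z. 1 - (norm z)\<^sup>2 > 1 / real (Suc n)} \<noteq> \<infinity>" for n
    proof -
      have "emeasure hyp_area {z. 1 - (norm z)\<^sup>2 > 1 / real (Suc n)} \<le> emeasure hyp_area {z. 1 - (norm z)\<^sup>2 \<ge> 1 / real (Suc n)}"
        by (rule emeasure_mono) (use sets_height[of "1 / real (Suc n)"] in auto)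
      also have "\<dots> < \<infinity>" by (rule emeasure_hyp_height) simp
      finally show ?thesis by simp
    qed
  next
    fix V assume "V \<in> ?E"
    then obtain \<delta> where V: "open V" "\<delta> > 0" "V \<subseteq> {z. 1 - (norm z)\<^sup>2 \<ge> \<delta>}" by auto
    have Vs: "V \<in> sets hyp_area" unfolding sets_hyp_area sigma_sets_disk by (rule sigma_sets.Basic) fact
    have Vd: "V \<subseteq> poincare_disk" using V height_subset_disk[OF V(2)] by auto
    then have ne: "- V \<noteq> {}"
    proof -
      have "(1 :: complex) \<notin> V" using Vd by auto
      then show ?thesis by auto
    qed
    \<comment> \<open>Continuous functions supported in \<open>V\<close> that increase to its
      indicator.\<close>
    define f where "f = (\<lambda>n z. min 1 (real n * infdist z (- V)))"
    have fz: "f n z = 0" if "z \<notin> V" for n z using that by (simp add: f_def)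
    have "hsupp \<delta> (f n)" for n unfolding hsupp_def using V(3) by (intro allI impI fz) auto
    moreover have "continuous_on poincare_disk (f n)" for n unfolding f_def by (intro continuous_intros)
    ultimately have fC: "cont_cpt (f n)" for n unfolding cont_cpt_def using V(2) by blast
    have f0: "f n z \<ge> 0" for n z by (simp add: f_def infdist_nonneg)
    have inc: "incseq (\<lambda>n. ennreal (f n z))" for z
      by (rule incseq_SucI) (auto simp: f_def intro!: ennreal_leI min.mono mult_right_mono infdist_nonneg)
    have lim: "(\<lambda>n. ennreal (f n z)) \<longlonglongrightarrow> indicator V z" for z
    proof (cases "z \<in> V")
      case True
      then have pos: "infdist z (- V) > 0" using V(1) ne by (intro infdist_pos_not_in_closed) auto
      obtain N :: nat where N: "1 / infdist z (- V) < real N" using reals_Archimedean2 by blast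
      have "f n z = 1" if "n \<ge> N" for n
      proof -
        have "1 / infdist z (- V) \<le> real n" using N that by linarith
        then show ?thesis using pos by (simp add: f_def field_simps)
      qed
      then have "\<forall>\<^sub>F n in sequentially. ennreal (f n z) = 1" by (auto simp: eventually_sequentially)
      then show ?thesis using True by (simp add: tendsto_eventually)
    qed (simp add: f_def)
    have fm: "(\<lambda>z. ennreal (f n z)) \<in> borel_measurable hyp_area" for n using cont_cpt_integrable[OF fC[of n]] by simp
    have "(\<lambda>n. \<integral>\<^sup>+z. ennreal (f n z) \<partial>hyp_area) \<longlonglongrightarrow> (\<integral>\<^sup>+z. indicator V z \<partial>hyp_area)"
      by (rule nn_integral_LIMSEQ) (use inc lim fm in \<open>auto simp: incseq_def le_fun_def\<close>)
    moreover have "(\<lambda>n. \<integral>\<^sup>+z. ennreal (f n z) \<partial>?N) \<longlonglongrightarrow> (\<integral>\<^sup>+z. indicator V z \<partial>?N)"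
      by (rule nn_integral_LIMSEQ) (use inc lim fm in \<open>auto simp: incseq_def le_fun_def\<close>)
    moreover have "(\<integral>\<^sup>+z. ennreal (f n z) \<partial>?N) = (\<integral>\<^sup>+z. ennreal (f n z) \<partial>hyp_area)" for n
      unfolding nn_integral_cmean[OF fC f0 a, symmetric]
      by (rule nn_integral_distr[OF measurable_hcirc_pairs]) (use fm in simp)
    ultimately have "(\<integral>\<^sup>+z. indicator V z \<partial>hyp_area) = (\<integral>\<^sup>+z. indicator V z \<partial>?N)"
      by (simp add: LIMSEQ_unique)
    then show "emeasure hyp_area V = emeasure ?N V" using Vs by simp
  qed
  then show ?thesis by simp
qed

section \<open>Plane waves\<close>

lemma poisson_pow_rotate: "poisson_pow l (of_real r * cis s) (cis t) = poisson_pow l (of_real r) (cis (t - s))"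
proof -
  have "complex_of_real r * cis s - cis t = cis s * (of_real r - cis (t - s))"
    by (simp add: right_diff_distrib cis_mult mult.commute)
  then have "norm (complex_of_real r * cis s - cis t) = norm (of_real r - cis (t - s))"
    by (simp only: norm_mult norm_cis mult_1)
  then show ?thesis by (simp add: poisson_pow_def poisson_def norm_mult)
qed

lemma tanh_arsinh: "tanh (arsinh a) = a / sqrt (1 + a\<^sup>2)" for a :: real
  by (simp add: tanh_def cosh_arsinh_real add.commute)

lemma poisson_pow_circle_even: "poisson_pow l (of_real (tanh (d / 2))) (cis (- t)) = poisson_pow l (of_real (tanh (d / 2))) (cis t)"
  by (simp add: poisson_pow_def poisson_circle)

lemma continuous_on_poisson_pow_circle: "continuous_on A (\<lambda>t. poisson_pow l (of_real (tanh (d / 2))) (cis t))"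
proof -
  have "cosh d \<noteq> sinh d * cos t" for t using cosh_sinh_cos_pos[of d t] by linarith
  then show ?thesis unfolding poisson_pow_def poisson_circle by (intro continuous_intros) auto
qed

lemma integral_poisson_pow_shift:
  assumes a: "a \<ge> 0"
  shows "integral {0..2 * pi} (\<lambda>t. poisson_pow l (of_real (a / sqrt (1 + a\<^sup>2))) (cis (t + \<beta>))) = of_real (2 * pi * spherical l a)"
proof -
  define d where "d = 2 * arsinh a"
  have th: "tanh (d / 2) = a / sqrt (1 + a\<^sup>2)" by (simp add: d_def tanh_arsinh)
  define v where "v = (\<lambda>t. poisson_pow l (of_real (tanh (d / 2))) (cis t))"
  have vc: "continuous_on A v" for A unfolding v_def by (rule continuous_on_poisson_pow_circle)
  have "arsinh a \<ge> 0" using a arsinh_real_neg_iff[of a] by linarith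
  then have d: "d \<ge> 0" by (simp add: d_def)
  have "integral {0..2 * pi} (\<lambda>t. v (t + \<beta>)) = integral {\<beta>..\<beta> + 2 * pi} v"
    using integral_shift[of 0 \<beta> "2 * pi" v] vc by (simp add: o_def add.commute)
  also have "\<dots> = integral {0..2 * pi} v"
  proof (rule integral_periodic_shift[OF vc])
    have "cis (t + 2 * pi) = cis t" for t by (simp add: complex_eq_iff)
    then show "v (t + 2 * pi) = v t" for t by (simp only: v_def)
  qed simp
  also have "\<dots> = of_real (2 * pi * spherical l a)"
    unfolding v_def using integral_poisson_pow[OF d, of l] by (simp add: d_def)
  finally show ?thesis unfolding v_def th .
qed

lemma norm_1_imp_cis: "norm b = 1 \<Longrightarrow> \<exists>\<beta>. b = cis \<beta>"
  by (metis cis_conv_exp mult_1 Arg2pi_eq of_real_1)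

text \<open>By the cocycle identity the circle about \<open>x\<close> becomes one about 0, the
  boundary point turns into some \<open>cis \<beta>\<close>, and a factor
  \<open>poisson_pow l x b\<close> splits off. What remains is an integral over a full period, in
  which \<open>\<beta>\<close> disappears.\<close>

lemma integral_poisson_pow_hcirc:
  assumes x: "norm x < 1" and b: "norm b = 1" and a: "a \<ge> 0"
  shows "integral {0..2 * pi} (\<lambda>t. poisson_pow l (hcirc x a t) b) = of_real (2 * pi * spherical l a) * poisson_pow l x b"
proof -
  obtain \<beta> where \<beta>: "Moebius_function 0 x b = cis \<beta>" using norm_1_imp_cis[OF Moebius_norm_1[OF x b]] by blast
  define d where "d = 2 * arsinh a"
  have th: "a / sqrt (1 + a\<^sup>2) = tanh (d / 2)" by (simp add: d_def tanh_arsinh)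
  have "poisson_pow l (hcirc x a t) b = poisson_pow l (of_real (a / sqrt (1 + a\<^sup>2))) (cis (t + (- \<beta>))) * poisson_pow l x b" for t
  proof -
    have "Moebius_function 0 x (hcirc x a t) = of_real (a / sqrt (1 + a\<^sup>2)) * cis t"
      unfolding hcirc_def by (rule Moebius_function_compose) (use x norm_rho_cis[of a t] in simp_all)
    then have "poisson_pow l (hcirc x a t) b = poisson_pow l (of_real (a / sqrt (1 + a\<^sup>2)) * cis t) (cis \<beta>) * poisson_pow l x b"
      using poisson_pow_mult[OF hcirc_in_disk[OF x] b x, of l a t] by (simp add: \<beta>)
    also have "poisson_pow l (of_real (a / sqrt (1 + a\<^sup>2)) * cis t) (cis \<beta>) = poisson_pow l (of_real (a / sqrt (1 + a\<^sup>2))) (cis (- (t + (- \<beta>))))"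
      unfolding poisson_pow_rotate by simp
    also have "\<dots> = poisson_pow l (of_real (a / sqrt (1 + a\<^sup>2))) (cis (t + (- \<beta>)))" unfolding th by (rule poisson_pow_circle_even)
    finally show ?thesis .
  qed
  then have "integral {0..2 * pi} (\<lambda>t. poisson_pow l (hcirc x a t) b)
    = integral {0..2 * pi} (\<lambda>t. poisson_pow l (of_real (a / sqrt (1 + a\<^sup>2))) (cis (t + (- \<beta>))) * poisson_pow l x b)" by presburger
  also have "\<dots> = integral {0..2 * pi} (\<lambda>t. poisson_pow l (of_real (a / sqrt (1 + a\<^sup>2))) (cis (t + (- \<beta>)))) * poisson_pow l x b"
    by (rule integral_mult_left)
  finally show ?thesis unfolding integral_poisson_pow_shift[OF a] .
qed

lemma continuous_on_poisson:
  assumes "continuous_on S X" "continuous_on S B" "\<And>s. s \<in> S \<Longrightarrow> norm (X s) < 1" "\<And>s. s \<in> S \<Longrightarrow> norm (B s) = 1"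
  shows "continuous_on S (\<lambda>s. poisson (X s) (B s))"
proof -
  have "norm (X s - B s) \<noteq> 0" if "s \<in> S" for s using assms(3,4)[OF that] by auto
  then show ?thesis unfolding poisson_def by (intro continuous_intros assms) auto
qed

lemma continuous_on_poisson_pow:
  assumes "continuous_on S X" "continuous_on S B" "\<And>s. s \<in> S \<Longrightarrow> norm (X s) < 1" "\<And>s. s \<in> S \<Longrightarrow> norm (B s) = 1"
  shows "continuous_on S (\<lambda>s. poisson_pow l (X s) (B s))"
  unfolding poisson_pow_def using poisson_pos[OF assms(3,4)]
  by (intro continuous_intros continuous_on_poisson assms) (auto simp: less_imp_neq[symmetric])

text \<open>The wave at \<open>y\<close> factors into the wave at
  \<open>Moebius_function 0 x y\<close> and the wave at \<open>x\<close>. Together with the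
  conjugate, the latter leaves \<open>poisson x\<close>, which is the Jacobian of the boundary
  substitution \<open>integral_circle_Moebius\<close>; so only the distance from \<open>x\<close> to
  \<open>y\<close> remains.\<close>

lemma integral_poisson_pow_product:
  assumes x: "norm x < 1" and y: "norm y < 1"
  shows "integral {0..2 * pi} (\<lambda>t. poisson_pow l y (cis t) * cnj (poisson_pow l x (cis t))) = of_real (2 * pi * spherical l (sinh_hdist x y))"
proof -
  define z where "z = Moebius_function 0 x y"
  define a where "a = sinh_hdist x y"
  have a: "a \<ge> 0" using x y one_minus_norm_sq_pos by (simp add: a_def sinh_hdist_def less_imp_le)
  have nz: "norm z = a / sqrt (1 + a\<^sup>2)" unfolding z_def a_def by (rule sinh_hdist_Moebius[OF x y])
  have z1: "norm z < 1" unfolding z_def by (rule Moebius_function_norm_lt_1[OF x y])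
  obtain \<gamma> where g: "z = of_real (norm z) * cis \<gamma>" using Arg2pi_eq[of z] by (auto simp: cis_conv_exp)
  have "poisson_pow l y (cis t) * cnj (poisson_pow l x (cis t)) = poisson x (cis t) *\<^sub>R poisson_pow l z (Moebius_function 0 x (cis t))" for t
  proof -
    have p: "poisson x (cis t) > 0" by (rule poisson_pos[OF x]) simp
    have "poisson_pow l x (cis t) * cnj (poisson_pow l x (cis t)) = of_real (poisson x (cis t))"
      using p by (simp add: poisson_pow_def cis_cnj mult.assoc cis_mult mult.left_commute[of "cis _"] flip: of_real_mult)
    then show ?thesis unfolding poisson_pow_mult[OF y _ x, of "cis t" l, simplified] z_def[symmetric]
      by (simp add: scaleR_conv_of_real mult.assoc mult.commute)
  qed
  then have "integral {0..2 * pi} (\<lambda>t. poisson_pow l y (cis t) * cnj (poisson_pow l x (cis t)))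
    = integral {0..2 * pi} (\<lambda>t. poisson x (cis t) *\<^sub>R poisson_pow l z (Moebius_function 0 x (cis t)))" by presburger
  also have "\<dots> = integral {0..2 * pi} (\<lambda>t. poisson_pow l z (cis t))"
    by (rule integral_circle_Moebius[OF x]) (auto intro!: continuous_on_poisson_pow continuous_intros z1)
  also have "\<dots> = integral {0..2 * pi} (\<lambda>t. poisson_pow l (of_real (a / sqrt (1 + a\<^sup>2))) (cis (t + (- \<gamma>))))"
  proof -
    have z': "z = of_real (a / sqrt (1 + a\<^sup>2)) * cis \<gamma>" using g unfolding nz .
    show ?thesis by (simp only: z' poisson_pow_rotate diff_conv_add_uminus)
  qed
  also have "\<dots> = of_real (2 * pi * spherical l a)" by (rule integral_poisson_pow_shift[OF a])
  finally show ?thesis by (simp add: a_def)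
qed

text \<open>The hyperbolic plane wave with boundary angle \<open>t\<close>, split by the flag into
  real and imaginary part so that circle means stay real-valued. Both parts are eigenfunctions
  because the eigenvalue is real.\<close>

definition plane_wave :: "bool \<Rightarrow> real \<Rightarrow> real \<Rightarrow> complex \<Rightarrow> real" where
  "plane_wave j l t x = (if j then Re (poisson_pow l x (cis t)) else Im (poisson_pow l x (cis t)))"

lemma continuous_on_plane_wave:
  assumes "continuous_on S T" "continuous_on S X" "\<And>s. s \<in> S \<Longrightarrow> norm (X s) < 1"
  shows "continuous_on S (\<lambda>s. plane_wave j l (T s) (X s))"
  unfolding plane_wave_def
  by (cases j) (auto intro!: continuous_intros continuous_on_poisson_pow assms)

lemma cmean_plane_wave:
  assumes x: "norm x < 1" and a: "a \<ge> 0"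
  shows "cmean a (plane_wave j l t) x = spherical l a * plane_wave j l t x"
proof -
  have c: "continuous_on poincare_disk (plane_wave j l t)"
    using continuous_on_plane_wave[of poincare_disk "\<lambda>_. t" "\<lambda>x. x" j l] by (simp add: eta_contract_eq)
  have hc: "continuous_on {0..2 * pi} (\<lambda>s. poisson_pow l (hcirc x a s) (cis t))"
    by (rule continuous_on_poisson_pow) (auto intro!: continuous_intros continuous_on_hcirc_t[OF x] hcirc_in_disk[OF x])
  have I: "(\<lambda>s. poisson_pow l (hcirc x a s) (cis t)) integrable_on {0..2 * pi}" by (rule integrable_continuous_real[OF hc])
  have "integral {0..2 * pi} (\<lambda>s. plane_wave j l t (hcirc x a s))
     = (if j then Re (integral {0..2 * pi} (\<lambda>s. poisson_pow l (hcirc x a s) (cis t))) else Im (integral {0..2 * pi} (\<lambda>s. poisson_pow l (hcirc x a s) (cis t))))"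
    using integral_linear[OF I bounded_linear_Re] integral_linear[OF I bounded_linear_Im] by (simp add: plane_wave_def o_def)
  also have "\<dots> = 2 * pi * spherical l a * plane_wave j l t x"
    unfolding integral_poisson_pow_hcirc[OF x norm_cis a] by (simp add: plane_wave_def)
  finally show ?thesis unfolding cmean_eq_integral[OF c x] by simp
qed

text \<open>The spherical kernel is a mean of products of one function of \<open>x\<close> and the
  same function of \<open>y\<close>, hence positive definite. This is the source of positivity in
  the proof.\<close>

lemma plane_wave_product_mean:
  assumes x: "norm x < 1" and y: "norm y < 1"
  shows "(\<integral>t. plane_wave True l t x * plane_wave True l t y + plane_wave False l t x * plane_wave False l t y \<partial>unif_angle) = spherical l (sinh_hdist x y)"
proof -
  have c: "continuous_on UNIV (\<lambda>t. poisson_pow l y (cis t) * cnj (poisson_pow l x (cis t)))"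
    by (intro continuous_intros continuous_on_poisson_pow) (use x y in auto)
  have I: "(\<lambda>t. poisson_pow l y (cis t) * cnj (poisson_pow l x (cis t))) integrable_on {0..2 * pi}"
    by (rule integrable_continuous_real[OF continuous_on_subset[OF c]]) simp
  have e: "plane_wave True l t x * plane_wave True l t y + plane_wave False l t x * plane_wave False l t y = Re (poisson_pow l y (cis t) * cnj (poisson_pow l x (cis t)))" for t
    by (simp add: plane_wave_def mult.commute)
  have "(\<integral>t. Re (poisson_pow l y (cis t) * cnj (poisson_pow l x (cis t))) \<partial>unif_angle) = integral {0..2 * pi} (\<lambda>t. Re (poisson_pow l y (cis t) * cnj (poisson_pow l x (cis t)))) /\<^sub>R (2 * pi)"
    by (rule unif_angle_integral) (intro continuous_intros c)
  also have "integral {0..2 * pi} (\<lambda>t. Re (poisson_pow l y (cis t) * cnj (poisson_pow l x (cis t)))) = 2 * pi * spherical l (sinh_hdist x y)"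
    using integral_linear[OF I bounded_linear_Re] unfolding integral_poisson_pow_product[OF x y] o_def by simp
  finally show ?thesis unfolding e by simp
qed

lemma plane_wave_bound:
  assumes x: "norm x < 1"
  shows "\<bar>plane_wave j l t x\<bar> \<le> 2 / sqrt (1 - (norm x)\<^sup>2)"
proof -
  have X: "1 - (norm x)\<^sup>2 > 0" using one_minus_norm_sq_pos[OF x] .
  have p: "poisson x (cis t) > 0" by (rule poisson_pos[OF x]) simp
  have n: "norm (poisson_pow l x (cis t)) = sqrt (poisson x (cis t))" using p by (simp add: poisson_pow_def norm_mult)
  have d: "1 - norm x \<le> norm (x - cis t)" using norm_triangle_ineq2[of "cis t" x] by (simp add: norm_minus_commute)
  have "poisson x (cis t) \<le> (1 - (norm x)\<^sup>2) / (1 - norm x)\<^sup>2"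
    unfolding poisson_def using x X d by (intro divide_left_mono power_mono mult_pos_pos zero_less_power) auto
  also have "\<dots> = (1 + norm x)\<^sup>2 / (1 - (norm x)\<^sup>2)"
  proof -
    have f: "1 - (norm x)\<^sup>2 = (1 - norm x) * (1 + norm x)" by (simp add: power2_eq_square algebra_simps)
    have "1 - norm x > 0" "1 + norm x > 0" using x by (auto intro: add_pos_nonneg)
    then show ?thesis unfolding f by (simp add: power2_eq_square)
  qed
  also have "\<dots> \<le> 2\<^sup>2 / (1 - (norm x)\<^sup>2)" using x X by (intro divide_right_mono power_mono) auto
  finally have "sqrt (poisson x (cis t)) \<le> sqrt (2\<^sup>2 / (1 - (norm x)\<^sup>2))" by (rule real_sqrt_le_mono)
  also have "\<dots> = 2 / sqrt (1 - (norm x)\<^sup>2)" by (simp only: real_sqrt_divide) simp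
  finally have "norm (poisson_pow l x (cis t)) \<le> 2 / sqrt (1 - (norm x)\<^sup>2)" unfolding n .
  then show ?thesis unfolding plane_wave_def
    using abs_Re_le_cmod[of "poisson_pow l x (cis t)"] abs_Im_le_cmod[of "poisson_pow l x (cis t)"] by (auto split: if_splits)
qed

lemma plane_wave_measurable: "(\<lambda>(x, t). plane_wave j l t x) \<in> borel_measurable (hyp_area \<Otimes>\<^sub>M unif_angle)"
proof -
  have [measurable]: "(\<lambda>x. x) \<in> disk_borel \<rightarrow>\<^sub>M borel" by (rule measurable_restrict_space1) simp
  have [measurable]: "fst \<in> disk_borel \<Otimes>\<^sub>M borel \<rightarrow>\<^sub>M borel"
    using measurable_compose[OF measurable_fst \<open>(\<lambda>x. x) \<in> disk_borel \<rightarrow>\<^sub>M borel\<close>] by simp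
  have "(\<lambda>(x, t). plane_wave j l t x) \<in> borel_measurable (disk_borel \<Otimes>\<^sub>M borel)"
    unfolding plane_wave_def poisson_pow_def poisson_def split_beta' by (cases j) (simp; measurable)+
  then show ?thesis by (simp cong: measurable_cong_sets)
qed

text \<open>Insertion of \<open>plane_wave_product_mean\<close> and exchange of integrals. For fixed
  \<open>t\<close> each summand factors into a transform of \<open>f\<close> times a transform of
  \<open>h\<close>.\<close>

lemma spherical_kernel_plane_waves:
  assumes f: "cont_cpt f" and h: "cont_cpt h"
  shows "(\<integral>x. f x * (\<integral>y. h y * spherical l (sinh_hdist x y) \<partial>hyp_area) \<partial>hyp_area)
    = (\<integral>t. (\<integral>x. f x * plane_wave True l t x \<partial>hyp_area) * (\<integral>x. h x * plane_wave True l t x \<partial>hyp_area)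
         + (\<integral>x. f x * plane_wave False l t x \<partial>hyp_area) * (\<integral>x. h x * plane_wave False l t x \<partial>hyp_area) \<partial>unif_angle)"
proof -
  obtain \<delta>1 \<delta>2 where d12: "\<delta>1 > 0" "hsupp \<delta>1 f" "\<delta>2 > 0" "hsupp \<delta>2 h" using f h by (auto simp: cont_cpt_def)
  define \<delta> where "\<delta> = min \<delta>1 \<delta>2"
  have d: "\<delta> > 0" "hsupp \<delta> f" "hsupp \<delta> h" using d12 by (auto simp: \<delta>_def hsupp_def)
  have fi: "integrable hyp_area f" and hi: "integrable hyp_area h" using f h by (auto intro: cont_cpt_integrable)
  have [measurable]: "f \<in> borel_measurable hyp_area" "h \<in> borel_measurable hyp_area" using fi hi by auto
  note plane_wave_measurable[measurable]
  have m1 [measurable]: "(\<lambda>p. plane_wave j l (snd p) (fst (fst p))) \<in> borel_measurable ((hyp_area \<Otimes>\<^sub>M hyp_area) \<Otimes>\<^sub>M unif_angle)" for j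
  proof -
    have "(\<lambda>p. (fst (fst p), snd p)) \<in> (hyp_area \<Otimes>\<^sub>M hyp_area) \<Otimes>\<^sub>M unif_angle \<rightarrow>\<^sub>M hyp_area \<Otimes>\<^sub>M unif_angle" by measurable
    from measurable_compose[OF this plane_wave_measurable] show ?thesis by simp
  qed
  have m2 [measurable]: "(\<lambda>p. plane_wave j l (snd p) (snd (fst p))) \<in> borel_measurable ((hyp_area \<Otimes>\<^sub>M hyp_area) \<Otimes>\<^sub>M unif_angle)" for j
  proof -
    have "(\<lambda>p. (snd (fst p), snd p)) \<in> (hyp_area \<Otimes>\<^sub>M hyp_area) \<Otimes>\<^sub>M unif_angle \<rightarrow>\<^sub>M hyp_area \<Otimes>\<^sub>M unif_angle" by measurable
    from measurable_compose[OF this plane_wave_measurable] show ?thesis by simp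
  qed
  interpret PP: pair_sigma_finite "hyp_area \<Otimes>\<^sub>M hyp_area" unif_angle
    by (intro pair_sigma_finite.intro HH.sigma_finite_measure_axioms unif_angle.sigma_finite_measure_axioms)
  define k where "k = (\<lambda>j x y t. (f x * plane_wave j l t x) * (h y * plane_wave j l t y))"
  \<comment> \<open>Plane waves grow like the inverse square root of the height, so on a support of
    height at least \<open>\<delta>\<close> they are bounded, uniformly in \<open>t\<close>; this is
    the domination for the exchange of integrals.\<close>
  have hb: "\<bar>g x * plane_wave j l t x\<bar> \<le> \<bar>g x\<bar> * (2 / sqrt \<delta>)" if "norm x < 1" "hsupp \<delta> g" for g j x t
  proof (cases "g x = 0")
    case False
    then have "\<delta> \<le> 1 - (norm x)\<^sup>2" using that by (auto simp: hsupp_def not_less[symmetric])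
    then have "2 / sqrt (1 - (norm x)\<^sup>2) \<le> 2 / sqrt \<delta>" using d(1) by (intro divide_left_mono) auto
    then have "\<bar>plane_wave j l t x\<bar> \<le> 2 / sqrt \<delta>" using plane_wave_bound[OF that(1), of j l t] by linarith
    then show ?thesis unfolding abs_mult by (rule mult_left_mono) simp
  qed simp
  define c where "c = 2 / sqrt \<delta>"
  have c0: "c \<ge> 0" using d(1) by (simp add: c_def)
  define W where "W = (\<lambda>x y. \<bar>f x\<bar> * c * (\<bar>h y\<bar> * c))"
  have ki: "integrable ((hyp_area \<Otimes>\<^sub>M hyp_area) \<Otimes>\<^sub>M unif_angle) (\<lambda>p. k j (fst (fst p)) (snd (fst p)) (snd p))" for j
  proof (rule Bochner_Integration.integrable_bound)
    have "integrable (hyp_area \<Otimes>\<^sub>M hyp_area) (\<lambda>p. W (fst p) (snd p))"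
      unfolding W_def by (rule HH.Fubini_integrable) (use fi hi c0 in \<open>auto simp: abs_mult\<close>)
    then show "integrable ((hyp_area \<Otimes>\<^sub>M hyp_area) \<Otimes>\<^sub>M unif_angle) (\<lambda>p. W (fst (fst p)) (snd (fst p)))"
      by (intro PP.Fubini_integrable) (auto simp: W_def)
    show "AE p in (hyp_area \<Otimes>\<^sub>M hyp_area) \<Otimes>\<^sub>M unif_angle. norm (k j (fst (fst p)) (snd (fst p)) (snd p)) \<le> norm (W (fst (fst p)) (snd (fst p)))"
    proof (rule AE_I2)
      fix p assume "p \<in> space ((hyp_area \<Otimes>\<^sub>M hyp_area) \<Otimes>\<^sub>M unif_angle)"
      then have p: "norm (fst (fst p)) < 1" "norm (snd (fst p)) < 1" by (auto simp: space_pair_measure)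
      have "\<bar>k j (fst (fst p)) (snd (fst p)) (snd p)\<bar> \<le> W (fst (fst p)) (snd (fst p))"
        unfolding k_def W_def abs_mult[of "f _ * _"] c_def by (intro mult_mono hb p d) (use d(1) in auto)
      then show "norm (k j (fst (fst p)) (snd (fst p)) (snd p)) \<le> norm (W (fst (fst p)) (snd (fst p)))" by simp
    qed
    show "(\<lambda>p. k j (fst (fst p)) (snd (fst p)) (snd p)) \<in> borel_measurable ((hyp_area \<Otimes>\<^sub>M hyp_area) \<Otimes>\<^sub>M unif_angle)"
      unfolding k_def by measurable
  qed
  have ks: "integrable ((hyp_area \<Otimes>\<^sub>M hyp_area) \<Otimes>\<^sub>M unif_angle) (\<lambda>(p, t). k True (fst p) (snd p) t + k False (fst p) (snd p) t)"
    using ki[of True] ki[of False] by (simp add: split_beta')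
  have xy: "(\<integral>t. k True x y t + k False x y t \<partial>unif_angle) = f x * (h y * spherical l (sinh_hdist x y))" if "norm x < 1" "norm y < 1" for x y
  proof -
    have "k True x y t + k False x y t = (f x * h y) * (plane_wave True l t x * plane_wave True l t y + plane_wave False l t x * plane_wave False l t y)" for t
      by (simp add: k_def algebra_simps)
    then show ?thesis by (simp add: plane_wave_product_mean[OF that])
  qed
  have i2: "integrable (hyp_area \<Otimes>\<^sub>M hyp_area) (\<lambda>p. \<integral>t. k True (fst p) (snd p) t + k False (fst p) (snd p) t \<partial>unif_angle)"
    using PP.integrable_fst'[OF ks] by simp
  have i2': "integrable (hyp_area \<Otimes>\<^sub>M hyp_area) (\<lambda>(x, y). f x * (h y * spherical l (sinh_hdist x y)))"
    using i2 by (rule Bochner_Integration.integrable_cong[OF refl, THEN iffD1, rotated]) (auto simp: space_pair_measure xy)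
  have "(\<integral>x. f x * (\<integral>y. h y * spherical l (sinh_hdist x y) \<partial>hyp_area) \<partial>hyp_area) = (\<integral>x. (\<integral>y. f x * (h y * spherical l (sinh_hdist x y)) \<partial>hyp_area) \<partial>hyp_area)" by simp
  also have "\<dots> = (\<integral>p. (case p of (x, y) \<Rightarrow> f x * (h y * spherical l (sinh_hdist x y))) \<partial>(hyp_area \<Otimes>\<^sub>M hyp_area))"
    using HH.integral_fst'[OF i2'] by simp
  also have "\<dots> = (\<integral>p. (\<integral>t. k True (fst p) (snd p) t + k False (fst p) (snd p) t \<partial>unif_angle) \<partial>(hyp_area \<Otimes>\<^sub>M hyp_area))"
    by (intro Bochner_Integration.integral_cong[OF refl]) (auto simp: space_pair_measure xy)
  also have "\<dots> = (\<integral>t. (\<integral>p. k True (fst p) (snd p) t + k False (fst p) (snd p) t \<partial>(hyp_area \<Otimes>\<^sub>M hyp_area)) \<partial>unif_angle)"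
    by (rule PP.Fubini_integral[symmetric]) (use ks in simp)
  also have "\<dots> = (\<integral>t. (\<integral>x. f x * plane_wave True l t x \<partial>hyp_area) * (\<integral>x. h x * plane_wave True l t x \<partial>hyp_area)
         + (\<integral>x. f x * plane_wave False l t x \<partial>hyp_area) * (\<integral>x. h x * plane_wave False l t x \<partial>hyp_area) \<partial>unif_angle)"
  proof (intro Bochner_Integration.integral_cong[OF refl])
    fix t
    have wm: "plane_wave j l t \<in> borel_measurable hyp_area" for j
      using measurable_compose[OF _ plane_wave_measurable[of j l], of "\<lambda>x. (x, t)" hyp_area] by simp
    have gi: "integrable hyp_area (\<lambda>x. g x * plane_wave j l t x)" if g: "integrable hyp_area g" "hsupp \<delta> g" for g j
    proof (rule Bochner_Integration.integrable_bound[of _ "\<lambda>x. \<bar>g x\<bar> * (2 / sqrt \<delta>)"])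
      show "AE x in hyp_area. norm (g x * plane_wave j l t x) \<le> norm (\<bar>g x\<bar> * (2 / sqrt \<delta>))"
      proof (rule AE_I2)
        fix x assume "x \<in> space hyp_area"
        then show "norm (g x * plane_wave j l t x) \<le> norm (\<bar>g x\<bar> * (2 / sqrt \<delta>))"
          using hb[of x g j t] g(2) d(1) by (simp add: abs_mult)
      qed
    qed (use g(1) wm in auto)
    have kk: "integrable (hyp_area \<Otimes>\<^sub>M hyp_area) (\<lambda>p. k j (fst p) (snd p) t)"
      "(\<integral>p. k j (fst p) (snd p) t \<partial>(hyp_area \<Otimes>\<^sub>M hyp_area)) = (\<integral>x. f x * plane_wave j l t x \<partial>hyp_area) * (\<integral>x. h x * plane_wave j l t x \<partial>hyp_area)" for j
    proof -
      have i: "integrable (hyp_area \<Otimes>\<^sub>M hyp_area) (\<lambda>(x, y). (f x * plane_wave j l t x) * (h y * plane_wave j l t y))"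
      proof (rule HH.Fubini_integrable)
        have "integrable hyp_area (\<lambda>x. \<bar>f x\<bar> * \<bar>plane_wave j l t x\<bar>)"
          using integrable_abs[OF gi[OF fi d(2), of j]] by (simp add: abs_mult)
        then show "integrable hyp_area (\<lambda>x. \<integral>y. norm (case (x, y) of (x, y) \<Rightarrow> (f x * plane_wave j l t x) * (h y * plane_wave j l t y)) \<partial>hyp_area)"
          by (simp add: abs_mult)
      qed (use gi[OF hi d(3), of j] wm in auto)
      then show "integrable (hyp_area \<Otimes>\<^sub>M hyp_area) (\<lambda>p. k j (fst p) (snd p) t)" by (simp add: k_def split_beta')
      show "(\<integral>p. k j (fst p) (snd p) t \<partial>(hyp_area \<Otimes>\<^sub>M hyp_area)) = (\<integral>x. f x * plane_wave j l t x \<partial>hyp_area) * (\<integral>x. h x * plane_wave j l t x \<partial>hyp_area)"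
        using HH.integral_fst'[OF i] by (simp add: k_def split_beta')
    qed
    show "(\<integral>p. k True (fst p) (snd p) t + k False (fst p) (snd p) t \<partial>(hyp_area \<Otimes>\<^sub>M hyp_area))
       = (\<integral>x. f x * plane_wave True l t x \<partial>hyp_area) * (\<integral>x. h x * plane_wave True l t x \<partial>hyp_area)
         + (\<integral>x. f x * plane_wave False l t x \<partial>hyp_area) * (\<integral>x. h x * plane_wave False l t x \<partial>hyp_area)"
      using kk[of True] kk[of False] by simp
  qed
  finally show ?thesis .
qed

lemma continuous_on_spherical: "continuous_on UNIV (spherical l)"
proof -
  have "continuous_on UNIV (\<lambda>a. integral (cbox 0 (2 * pi)) (\<lambda>t. cos (2 * l * arsinh (a * sin t)) / sqrt (1 + (a * sin t)\<^sup>2)))"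
  proof (rule integral_continuous_on_param)
    have nz: "1 + y\<^sup>2 \<noteq> 0" for y :: real using one_plus_square_pos[of y] by linarith
    show "continuous_on (UNIV \<times> cbox 0 (2 * pi)) (\<lambda>(a, t). cos (2 * l * arsinh (a * sin t)) / sqrt (1 + (a * sin t)\<^sup>2))"
    proof -
      have "continuous_on A (\<lambda>p. arsinh (fst p * sin (snd p)))" for A :: "(real \<times> real) set"
        by (rule continuous_on_compose2[OF continuous_on_arsinh[of UNIV]]) (auto intro!: continuous_intros)
      then show ?thesis unfolding split_beta' by (intro continuous_intros) (use nz in auto)
    qed
  qed
  then have "continuous_on UNIV (\<lambda>a. integral {0..2 * pi} (\<lambda>t. cos (2 * l * arsinh (a * sin t)) / sqrt (1 + (a * sin t)\<^sup>2)) / (2 * pi))"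
    by (intro continuous_intros) auto
  then show ?thesis by (simp add: spherical_def[abs_def])
qed

lemma spherical_le_1: "\<bar>spherical l a\<bar> \<le> 1"
proof -
  have "spherical 0 a \<le> integral {0..2 * pi} (\<lambda>t::real. 1 :: real) / (2 * pi)"
    unfolding spherical_def
  proof (intro divide_right_mono integral_le integrable_continuous_real continuous_on_spherical_integrand)
    show "cos (2 * 0 * arsinh (a * sin t)) / sqrt (1 + (a * sin t)\<^sup>2) \<le> 1" for t
      using one_plus_square_pos[of "a * sin t"] by simp
  qed (auto intro: continuous_intros)
  then show ?thesis using spherical_abs_le_0[of l a] by simp
qed

lemma hcirc_0: "hcirc x 0 t = x"
  by (simp add: hcirc_def Moebius_function_simple)

text \<open>For \<open>h = c1 * cmean s f + c2 * f\<close>, the pairing \<open>F a\<close> of \<open>f\<close> with \<open>cmean a h\<close> has spherical transform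
  \<open>(c1 * spherical l s + c2) * \<bar>f^\<bar>\<^sup>2\<close>, where \<open>f^\<close> is the transform of \<open>f\<close> by plane waves.
  So \<open>radial_nonneg_at_0\<close> applies to \<open>F\<close>.\<close>

lemma cmean_quadratic_form_nonneg:
  assumes f: "cont_cpt f" and s: "s > 0" and pos: "\<And>l. 0 \<le> c1 * spherical l s + c2"
  shows "0 \<le> c1 * (\<integral>x. f x * cmean s f x \<partial>hyp_area) + c2 * (\<integral>x. f x * f x \<partial>hyp_area)"
proof -
  define h where "h = (\<lambda>x. c1 * cmean s f x + c2 * f x)"
  have amC: "cont_cpt (cmean s f)" by (rule cont_cpt_cmean[OF f])
  have h: "cont_cpt h"
  proof -
    obtain \<delta>1 \<delta>2 where "\<delta>1 > 0" "hsupp \<delta>1 f" "\<delta>2 > 0" "hsupp \<delta>2 (cmean s f)" using f amC by (auto simp: cont_cpt_def)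
    then have "min \<delta>1 \<delta>2 > 0 \<and> hsupp (min \<delta>1 \<delta>2) h" by (auto simp: hsupp_def h_def)
    moreover have "continuous_on poincare_disk h"
      unfolding h_def using f amC by (auto simp: cont_cpt_def intro!: continuous_intros)
    ultimately show ?thesis unfolding cont_cpt_def by blast
  qed
  have fi: "integrable hyp_area f" and hi: "integrable hyp_area h" by (auto intro: cont_cpt_integrable f h)
  obtain \<delta>1 \<delta>2 where d12: "\<delta>1 > 0" "hsupp \<delta>1 f" "\<delta>2 > 0" "hsupp \<delta>2 h" using f h by (auto simp: cont_cpt_def)
  define \<delta> where "\<delta> = min \<delta>1 \<delta>2"
  have d: "\<delta> > 0" "hsupp \<delta> f" "hsupp \<delta> h" using d12 by (auto simp: \<delta>_def hsupp_def)
  obtain M where M: "M \<ge> 0" "\<And>z. norm z < 1 \<Longrightarrow> \<bar>h z\<bar> \<le> M" using cont_cpt_bounded[OF h] by blast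
  define F where "F = (\<lambda>a. \<integral>x. f x * cmean a h x \<partial>hyp_area)"
  have hc: "continuous_on poincare_disk h" using h by (simp add: cont_cpt_def)
  have Fc: "continuous_on UNIV F" unfolding F_def
    by (rule continuous_on_cmean_pairing[OF fi hc, of _ M]) (use M hcirc_in_disk in auto)
  \<comment> \<open>Two points of height at least \<open>\<delta>\<close> have Euclidean distance at
    most 2, hence \<open>sinh_hdist\<close> at most \<open>2 / \<delta>\<close>; a larger circle
    about a point of the support of \<open>f\<close> misses that of \<open>h\<close>.\<close>
  have F0: "F a = 0" if a: "a > 2 / \<delta>" for a
  proof -
    have "f x * cmean a h x = 0" if x: "norm x < 1" for x
    proof (cases "f x = 0")
      case False
      then have dx: "\<delta> \<le> 1 - (norm x)\<^sup>2" using d(2) x by (auto simp: hsupp_def not_less[symmetric])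
      have "h (hcirc x a t) = 0" for t
      proof (rule ccontr)
        assume n: "h (hcirc x a t) \<noteq> 0"
        define y where "y = hcirc x a t"
        have y: "norm y < 1" unfolding y_def by (rule hcirc_in_disk[OF x])
        have dy: "\<delta> \<le> 1 - (norm y)\<^sup>2" using d(3) y n by (auto simp: hsupp_def y_def not_less[symmetric])
        have "\<delta> * \<delta> \<le> (1 - (norm x)\<^sup>2) * (1 - (norm y)\<^sup>2)" using d(1) dx dy by (intro mult_mono) auto
        then have "\<delta> \<le> sqrt ((1 - (norm x)\<^sup>2) * (1 - (norm y)\<^sup>2))" by (intro real_le_rsqrt) (simp add: power2_eq_square)
        moreover have "norm (x - y) \<le> 2" using norm_triangle_ineq4[of x y] x y by simp
        ultimately have "sinh_hdist x y \<le> 2 / \<delta>" unfolding sinh_hdist_def using d(1) by (intro frac_le) auto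
        then show False using a sinh_hdist_hcirc[OF x, of a t] by (simp add: y_def)
      qed
      then show ?thesis by (simp add: cmean_def)
    qed simp
    then have "F a = (\<integral>x. 0 \<partial>hyp_area)" unfolding F_def by (intro Bochner_Integration.integral_cong refl) auto
    then show ?thesis by simp
  qed
  have spos: "0 \<le> (\<integral>a. spherical l a * F a \<partial>radial_area)" for l
  proof -
    have "(\<integral>a. spherical l a * F a \<partial>radial_area) = (\<integral>x. f x * (\<integral>y. h y * spherical l (sinh_hdist x y) \<partial>hyp_area) \<partial>hyp_area)"
      unfolding F_def
      by (rule hyp_kernel_fubini[symmetric, OF hi fi borel_measurable_continuous_onI[OF continuous_on_spherical] spherical_le_1])
    also have "\<dots> = (\<integral>t. (\<integral>x. f x * plane_wave True l t x \<partial>hyp_area) * (\<integral>x. h x * plane_wave True l t x \<partial>hyp_area)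
         + (\<integral>x. f x * plane_wave False l t x \<partial>hyp_area) * (\<integral>x. h x * plane_wave False l t x \<partial>hyp_area) \<partial>unif_angle)"
      by (rule spherical_kernel_plane_waves[OF f h])
    also have "\<dots> \<ge> 0"
    proof (intro integral_nonneg_AE AE_I2)
      fix t
      have wc: "continuous_on poincare_disk (plane_wave j l t)" for j
        using continuous_on_plane_wave[of poincare_disk "\<lambda>_. t" "\<lambda>x. x" j l] by (simp add: eta_contract_eq)
      \<comment> \<open>The averaging is moved from \<open>f\<close> to the plane wave by
        \<open>cmean_swap\<close> and acts there as the scalar \<open>spherical l s\<close>. So
        \<open>h\<close> has the transform of \<open>f\<close> times a nonnegative factor.\<close>
      have e: "(\<integral>x. h x * plane_wave j l t x \<partial>hyp_area) = (c1 * spherical l s + c2) * (\<integral>x. f x * plane_wave j l t x \<partial>hyp_area)" for j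
      proof -
        have i: "integrable hyp_area (\<lambda>x. plane_wave j l t x * cmean s f x)" "integrable hyp_area (\<lambda>x. f x * plane_wave j l t x)"
          by (auto intro: cont_cpt_integrable cont_cpt_mult amC f wc)
        have "(\<integral>x. h x * plane_wave j l t x \<partial>hyp_area) = (\<integral>x. c1 * (plane_wave j l t x * cmean s f x) + c2 * (f x * plane_wave j l t x) \<partial>hyp_area)"
          by (intro Bochner_Integration.integral_cong refl) (simp add: h_def algebra_simps)
        also have "\<dots> = c1 * (\<integral>x. plane_wave j l t x * cmean s f x \<partial>hyp_area) + c2 * (\<integral>x. f x * plane_wave j l t x \<partial>hyp_area)"
          using i by simp
        also have "(\<integral>x. plane_wave j l t x * cmean s f x \<partial>hyp_area) = (\<integral>x. f x * cmean s (plane_wave j l t) x \<partial>hyp_area)"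
          by (rule cmean_swap[OF f wc s])
        also have "\<dots> = (\<integral>x. spherical l s * (f x * plane_wave j l t x) \<partial>hyp_area)"
          by (intro Bochner_Integration.integral_cong refl) (use s in \<open>simp add: cmean_plane_wave\<close>)
        also have "\<dots> = spherical l s * (\<integral>x. f x * plane_wave j l t x \<partial>hyp_area)" by (rule integral_mult_right_zero)
        finally show ?thesis by (simp add: algebra_simps)
      qed
      have "0 \<le> (c1 * spherical l s + c2) * ((\<integral>x. f x * plane_wave True l t x \<partial>hyp_area)\<^sup>2 + (\<integral>x. f x * plane_wave False l t x \<partial>hyp_area)\<^sup>2)"
        using pos[of l] by (intro mult_nonneg_nonneg) auto
      then show "0 \<le> (\<integral>x. f x * plane_wave True l t x \<partial>hyp_area) * (\<integral>x. h x * plane_wave True l t x \<partial>hyp_area)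
         + (\<integral>x. f x * plane_wave False l t x \<partial>hyp_area) * (\<integral>x. h x * plane_wave False l t x \<partial>hyp_area)"
        unfolding e by (simp add: algebra_simps power2_eq_square)
    qed
    finally show ?thesis .
  qed
  have nonneg: "0 \<le> (\<integral>a. indicator {0<..} a * (a * F a * spherical l a) \<partial>lborel)" for l
  proof -
    have "ennreal (8 * pi * a) * indicator {0<..} a = ennreal (8 * pi * a * indicator {0<..} a)" for a by (auto simp: indicator_def)
    then have pa: "radial_area = density lborel (\<lambda>a. ennreal (8 * pi * a * indicator {0<..} a))"
      unfolding radial_area_def by presburger
    have [measurable]: "F \<in> borel_measurable borel" "spherical l \<in> borel_measurable borel"
      by (auto intro!: borel_measurable_continuous_onI Fc continuous_on_spherical)
    have "(\<integral>a. spherical l a * F a \<partial>radial_area) = (\<integral>a. (8 * pi * a * indicator {0<..} a) *\<^sub>R (spherical l a * F a) \<partial>lborel)"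
      unfolding pa by (rule integral_density) (auto simp: indicator_def)
    also have "\<dots> = (\<integral>a. (8 * pi) * (indicator {0<..} a * (a * F a * spherical l a)) \<partial>lborel)"
      by (intro Bochner_Integration.integral_cong refl) simp
    also have "\<dots> = (8 * pi) * (\<integral>a. indicator {0<..} a * (a * F a * spherical l a) \<partial>lborel)" by (rule integral_mult_right_zero)
    finally have "0 \<le> (8 * pi) * (\<integral>a. indicator {0<..} a * (a * F a * spherical l a) \<partial>lborel)" using spos[of l] by simp
    then have "\<not> (\<integral>a. indicator {0<..} a * (a * F a * spherical l a) \<partial>lborel) < 0"
      using mult_pos_neg[of "8 * pi"] pi_gt_zero by fastforce
    then show ?thesis by simp
  qed
  have "0 \<le> F 0"
    by (rule radial_nonneg_at_0[of F "2 / \<delta>"]) (use Fc F0 nonneg d(1) in auto)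
  also have "F 0 = (\<integral>x. c1 * (f x * cmean s f x) + c2 * (f x * f x) \<partial>hyp_area)"
    unfolding F_def
  proof (intro Bochner_Integration.integral_cong refl)
    fix x
    have "cmean 0 h x = h x" using unif_angle.prob_space by (simp add: cmean_def hcirc_0)
    then show "f x * cmean 0 h x = c1 * (f x * cmean s f x) + c2 * (f x * f x)" by (simp add: h_def algebra_simps)
  qed
  also have "\<dots> = c1 * (\<integral>x. f x * cmean s f x \<partial>hyp_area) + c2 * (\<integral>x. f x * f x \<partial>hyp_area)"
  proof -
    have fc: "continuous_on poincare_disk f" "continuous_on poincare_disk (cmean s f)" using f amC by (auto simp: cont_cpt_def)
    show ?thesis using cont_cpt_integrable[OF cont_cpt_mult(1)[OF f fc(2)]] cont_cpt_integrable[OF cont_cpt_mult(1)[OF f fc(1)]] by simp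
  qed
  finally show ?thesis .
qed

section \<open>Square-integrable functions\<close>

lemma integrable_mult_L2:
  fixes f g :: "'a \<Rightarrow> real"
  assumes [measurable]: "f \<in> borel_measurable M" "g \<in> borel_measurable M"
    and f: "integrable M (\<lambda>x. (f x)\<^sup>2)" and g: "integrable M (\<lambda>x. (g x)\<^sup>2)"
  shows "integrable M (\<lambda>x. f x * g x)"
proof (rule Bochner_Integration.integrable_bound[OF Bochner_Integration.integrable_add[OF f g]])
  show "AE x in M. norm (f x * g x) \<le> norm ((f x)\<^sup>2 + (g x)\<^sup>2)"
  proof (rule AE_I2)
    fix x
    have "0 \<le> (\<bar>f x\<bar> - \<bar>g x\<bar>)\<^sup>2" by simp
    then have "2 * (\<bar>f x\<bar> * \<bar>g x\<bar>) \<le> (f x)\<^sup>2 + (g x)\<^sup>2" by (simp add: power2_diff)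
    moreover have "0 \<le> \<bar>f x\<bar> * \<bar>g x\<bar>" by simp
    ultimately have "\<bar>f x\<bar> * \<bar>g x\<bar> \<le> (f x)\<^sup>2 + (g x)\<^sup>2" by linarith
    then show "norm (f x * g x) \<le> norm ((f x)\<^sup>2 + (g x)\<^sup>2)" by (simp add: abs_mult)
  qed
qed measurable

lemma Cauchy_Schwarz_integral:
  fixes f g :: "'a \<Rightarrow> real"
  assumes m: "f \<in> borel_measurable M" "g \<in> borel_measurable M"
    and f: "integrable M (\<lambda>x. (f x)\<^sup>2)" and g: "integrable M (\<lambda>x. (g x)\<^sup>2)"
  shows "\<bar>\<integral>x. f x * g x \<partial>M\<bar> \<le> sqrt (\<integral>x. (f x)\<^sup>2 \<partial>M) * sqrt (\<integral>x. (g x)\<^sup>2 \<partial>M)"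
proof -
  define A B C where "A = (\<integral>x. (f x)\<^sup>2 \<partial>M)" and "B = (\<integral>x. (g x)\<^sup>2 \<partial>M)" and "C = (\<integral>x. f x * g x \<partial>M)"
  have fg: "integrable M (\<lambda>x. f x * g x)" by (rule integrable_mult_L2[OF m f g])
  have AB: "A \<ge> 0" "B \<ge> 0" by (auto simp: A_def B_def intro: integral_nonneg_AE)
  have q: "0 \<le> A + 2 * t * C + t\<^sup>2 * B" for t
  proof -
    have "0 \<le> (\<integral>x. (f x + t * g x)\<^sup>2 \<partial>M)" by (intro integral_nonneg_AE) auto
    also have "\<dots> = (\<integral>x. (f x)\<^sup>2 + (2 * t * (f x * g x) + t\<^sup>2 * (g x)\<^sup>2) \<partial>M)"
      by (intro Bochner_Integration.integral_cong refl) (simp add: power2_eq_square algebra_simps)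
    also have "\<dots> = A + 2 * t * C + t\<^sup>2 * B"
      unfolding A_def B_def C_def using f g fg by simp
    finally show ?thesis .
  qed
  have "C\<^sup>2 \<le> A * B"
  proof (cases "B = 0")
    case True
    have "C = 0"
    proof (rule ccontr)
      assume "C \<noteq> 0"
      then have "A + 2 * (- (A + 1) / (2 * C)) * C = - 1" by (simp add: field_simps)
      then show False using q[of "- (A + 1) / (2 * C)"] True by simp
    qed
    then show ?thesis using True by simp
  next
    case False
    then have B: "B > 0" using AB by simp
    have "0 \<le> A + 2 * (- C / B) * C + (- C / B)\<^sup>2 * B" by (rule q)
    also have "\<dots> = A - C\<^sup>2 / B" using B by (simp add: power2_eq_square field_simps)
    finally show ?thesis using B by (simp add: field_simps)
  qed
  then have "sqrt (C\<^sup>2) \<le> sqrt (A * B)" by (rule real_sqrt_le_mono)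
  then show ?thesis by (simp add: real_sqrt_mult A_def B_def C_def)
qed

lemma integrable_L2_diff:
  fixes f g :: "'a \<Rightarrow> real"
  assumes m: "f \<in> borel_measurable M" "g \<in> borel_measurable M"
    and f: "integrable M (\<lambda>x. (f x)\<^sup>2)" and g: "integrable M (\<lambda>x. (g x)\<^sup>2)"
  shows "integrable M (\<lambda>x. (f x - g x)\<^sup>2)"
proof -
  have "(\<lambda>x. (f x - g x)\<^sup>2) = (\<lambda>x. (f x)\<^sup>2 + (g x)\<^sup>2 - 2 * (f x * g x))"
    by (auto simp: power2_diff)
  then show ?thesis using f g integrable_mult_L2[OF m f g] by simp
qed

lemma L2_tendsto_mult:
  fixes f g :: "'a \<Rightarrow> real"
  assumes m: "f \<in> borel_measurable M" "g \<in> borel_measurable M" "\<And>n. F n \<in> borel_measurable M" "\<And>n. G n \<in> borel_measurable M"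
    and i: "integrable M (\<lambda>x. (f x)\<^sup>2)" "integrable M (\<lambda>x. (g x)\<^sup>2)" "\<And>n. integrable M (\<lambda>x. (F n x)\<^sup>2)" "\<And>n. integrable M (\<lambda>x. (G n x)\<^sup>2)"
    and F: "(\<lambda>n. \<integral>x. (F n x - f x)\<^sup>2 \<partial>M) \<longlonglongrightarrow> 0" and G: "(\<lambda>n. \<integral>x. (G n x - g x)\<^sup>2 \<partial>M) \<longlonglongrightarrow> 0"
  shows "(\<lambda>n. \<integral>x. F n x * G n x \<partial>M) \<longlonglongrightarrow> (\<integral>x. f x * g x \<partial>M)"
proof -
  define \<alpha> where "\<alpha> = (\<lambda>n. sqrt (\<integral>x. (F n x - f x)\<^sup>2 \<partial>M))"
  define \<beta> where "\<beta> = (\<lambda>n. sqrt (\<integral>x. (G n x - g x)\<^sup>2 \<partial>M))"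
  define a b where "a = sqrt (\<integral>x. (f x)\<^sup>2 \<partial>M)" and "b = sqrt (\<integral>x. (g x)\<^sup>2 \<partial>M)"
  have lim: "(\<lambda>n. \<alpha> n * \<beta> n + \<alpha> n * b + a * \<beta> n) \<longlonglongrightarrow> 0"
  proof -
    have "\<alpha> \<longlonglongrightarrow> 0" "\<beta> \<longlonglongrightarrow> 0" unfolding \<alpha>_def \<beta>_def using tendsto_real_sqrt[OF F] tendsto_real_sqrt[OF G] by simp_all
    then have "(\<lambda>n. \<alpha> n * \<beta> n + \<alpha> n * b + a * \<beta> n) \<longlonglongrightarrow> 0 * 0 + 0 * b + a * 0" by (intro tendsto_intros)
    then show ?thesis by simp
  qed
  have "(\<lambda>n. (\<integral>x. F n x * G n x \<partial>M) - (\<integral>x. f x * g x \<partial>M)) \<longlonglongrightarrow> 0"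
  proof (rule Lim_null_comparison[OF always_eventually lim], rule allI)
    fix n
    define u v where "u = (\<lambda>x. F n x - f x)" and "v = (\<lambda>x. G n x - g x)"
    have um: "u \<in> borel_measurable M" "v \<in> borel_measurable M" using m by (auto simp: u_def v_def)
    have ui: "integrable M (\<lambda>x. (u x)\<^sup>2)" "integrable M (\<lambda>x. (v x)\<^sup>2)"
      unfolding u_def v_def by (intro integrable_L2_diff m i)+
    have "(\<integral>x. F n x * G n x \<partial>M) - (\<integral>x. f x * g x \<partial>M) = (\<integral>x. F n x * G n x - f x * g x \<partial>M)"
      by (rule Bochner_Integration.integral_diff[symmetric]) (intro integrable_mult_L2 m i)+
    also have "\<dots> = (\<integral>x. u x * v x + u x * g x + f x * v x \<partial>M)"
      by (intro Bochner_Integration.integral_cong refl) (simp add: u_def v_def algebra_simps)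
    also have "\<dots> = (\<integral>x. u x * v x \<partial>M) + (\<integral>x. u x * g x \<partial>M) + (\<integral>x. f x * v x \<partial>M)"
      using integrable_mult_L2[OF um ui] integrable_mult_L2[OF um(1) m(2) ui(1) i(2)] integrable_mult_L2[OF m(1) um(2) i(1) ui(2)] by simp
    finally have e: "(\<integral>x. F n x * G n x \<partial>M) - (\<integral>x. f x * g x \<partial>M) = (\<integral>x. u x * v x \<partial>M) + (\<integral>x. u x * g x \<partial>M) + (\<integral>x. f x * v x \<partial>M)" .
    show "norm ((\<integral>x. F n x * G n x \<partial>M) - (\<integral>x. f x * g x \<partial>M)) \<le> \<alpha> n * \<beta> n + \<alpha> n * b + a * \<beta> n"
      unfolding e \<alpha>_def \<beta>_def a_def b_def
      using Cauchy_Schwarz_integral[OF um ui] Cauchy_Schwarz_integral[OF um(1) m(2) ui(1) i(2)] Cauchy_Schwarz_integral[OF m(1) um(2) i(1) ui(2)]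
      unfolding u_def v_def real_norm_def by linarith
  qed
  then show ?thesis by (simp add: LIM_zero_iff)
qed

definition real_L2 :: "(complex \<Rightarrow> real) \<Rightarrow> bool" where
  "real_L2 u \<longleftrightarrow> u \<in> borel_measurable hyp_area \<and> integrable hyp_area (\<lambda>x. (u x)\<^sup>2)"

lemma cont_cpt_real_L2: "cont_cpt f \<Longrightarrow> real_L2 f"
  unfolding real_L2_def power2_eq_square
  using cont_cpt_integrable[of f] cont_cpt_integrable[OF cont_cpt_mult(1)[of f f]] by (auto simp: cont_cpt_def)

lemma AE_hyp_areaI:
  assumes "AE z in lborel. P z"
  shows "AE z in hyp_area. P z"
proof -
  have "AE z in restrict_space lborel poincare_disk. P z"
    using assms by (subst AE_restrict_space_iff) auto
  moreover have "(\<lambda>z. ennreal (4 / (1 - (cmod z)\<^sup>2)\<^sup>2)) \<in> borel_measurable (restrict_space lborel poincare_disk)"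
    by (rule measurable_restrict_space1) measurable
  ultimately show ?thesis unfolding hyp_area_def by (subst AE_density) auto
qed

text \<open>A measurable function is almost everywhere a limit of continuous ones; clamping to
  [- K, K] and cutting off near the boundary give a common dominating function without changing the
  limit.\<close>

lemma L2_approx_bounded:
  assumes v: "v \<in> borel_measurable hyp_area" and \<delta>: "\<delta> > 0" "hsupp \<delta> v" and bd: "\<And>z. \<bar>v z\<bar> \<le> K"
  shows "\<exists>F. (\<forall>n. cont_cpt (F n)) \<and> (\<lambda>n. \<integral>x. (F n x - v x)\<^sup>2 \<partial>hyp_area) \<longlonglongrightarrow> 0"
proof -
  have K: "K \<ge> 0" using bd[of 0] by linarith
  have "(\<lambda>z. if z \<in> poincare_disk then v z else 0) \<in> borel_measurable borel"
  proof -
    have "v \<in> borel_measurable disk_borel" using v by (simp cong: measurable_cong_sets add: sets_hyp_area)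
    then have "(\<lambda>z. indicator poincare_disk z *\<^sub>R v z) \<in> borel_measurable borel"
      by (subst (asm) borel_measurable_restrict_space_iff) auto
    moreover have "(\<lambda>z. if z \<in> poincare_disk then v z else 0) = (\<lambda>z. indicator poincare_disk z *\<^sub>R v z)" by auto
    ultimately show ?thesis by simp
  qed
  then have "(\<lambda>z. if z \<in> poincare_disk then v z else 0) \<in> borel_measurable lebesgue" by (intro measurable_completion) simp
  then have "(\<lambda>z. if z \<in> poincare_disk then v z else 0) measurable_on UNIV"
    by (subst measurable_on_iff_borel_measurable) auto
  then obtain N g where N: "negligible N" and gc: "\<And>n. continuous_on UNIV (g n)"
    and gl: "\<And>z. z \<notin> N \<Longrightarrow> (\<lambda>n. g n z) \<longlonglongrightarrow> (if z \<in> poincare_disk then v z else 0)"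
    unfolding measurable_on_def by auto
  \<comment> \<open>A continuous ramp in the height: 0 below \<open>\<delta> / 2\<close>, 1 from
    \<open>\<delta>\<close> on, so it equals 1 on the support of \<open>v\<close>.\<close>
  define cut where "cut = (\<lambda>z::complex. max 0 (min 1 ((1 - (norm z)\<^sup>2 - \<delta> / 2) * (2 / \<delta>))))"
  define F where "F = (\<lambda>n z. max (- K) (min K (g n z)) * cut z)"
  have chi01: "0 \<le> cut z" "cut z \<le> 1" for z by (auto simp: cut_def)
  have chi0: "cut z = 0" if "1 - (norm z)\<^sup>2 < \<delta> / 2" for z
  proof -
    have "(1 - (norm z)\<^sup>2 - \<delta> / 2) * (2 / \<delta>) \<le> 0" using that \<delta>(1) by (intro mult_nonpos_nonneg) auto
    then show ?thesis by (simp add: cut_def)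
  qed
  have chi1: "cut z = 1" if "1 - (norm z)\<^sup>2 \<ge> \<delta>" for z
  proof -
    have "(\<delta> / 2) * (2 / \<delta>) \<le> (1 - (norm z)\<^sup>2 - \<delta> / 2) * (2 / \<delta>)" using that \<delta>(1) by (intro mult_right_mono) auto
    then show ?thesis using \<delta>(1) by (simp add: cut_def)
  qed
  have FC: "cont_cpt (F n)" for n
  proof -
    have "hsupp (\<delta> / 2) (F n)" by (auto simp: hsupp_def F_def chi0)
    moreover have "continuous_on poincare_disk (F n)"
      unfolding F_def cut_def by (intro continuous_intros continuous_on_subset[OF gc]) auto
    ultimately show ?thesis unfolding cont_cpt_def using \<delta>(1) by (intro conjI exI[of _ "\<delta> / 2"]) auto
  qed
  have AEN: "AE z in hyp_area. z \<notin> N"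
  proof (rule AE_hyp_areaI)
    have "AE z in lebesgue. z \<notin> N" using N by (intro AE_not_in) (simp add: negligible_iff_null_sets)
    then show "AE z in lborel. z \<notin> N" by (simp add: AE_completion_iff)
  qed
  have lim: "(\<lambda>n. F n z) \<longlonglongrightarrow> v z" if "z \<notin> N" "norm z < 1" for z
  proof -
    have "(\<lambda>n. F n z) \<longlonglongrightarrow> max (- K) (min K (v z)) * cut z"
      unfolding F_def using gl[OF that(1)] that(2) by (intro tendsto_intros) auto
    moreover have "max (- K) (min K (v z)) = v z" using bd[of z] by (auto simp: max_def min_def abs_le_iff)
    moreover have "v z * cut z = v z"
      using chi1[of z] \<delta>(2) that(2) by (cases "1 - (norm z)\<^sup>2 \<ge> \<delta>") (auto simp: hsupp_def not_le)
    ultimately show ?thesis by simp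
  qed
  have Fb: "\<bar>F n z\<bar> \<le> K" for n z
  proof -
    have "\<bar>max (- K) (min K (g n z))\<bar> \<le> K" using K by auto
    then have "\<bar>max (- K) (min K (g n z))\<bar> * \<bar>cut z\<bar> \<le> K * 1" using chi01[of z] K by (intro mult_mono) auto
    then show ?thesis by (simp add: F_def abs_mult)
  qed
  have "(\<lambda>n. \<integral>x. (F n x - v x)\<^sup>2 \<partial>hyp_area) \<longlonglongrightarrow> (\<integral>x. 0 \<partial>hyp_area)"
  proof (rule integral_dominated_convergence[where w = "\<lambda>x. (2 * K)\<^sup>2 * indicator {z. 1 - (norm z)\<^sup>2 \<ge> \<delta> / 2} x"])
    have Fm: "F n \<in> borel_measurable hyp_area" for n using cont_cpt_integrable[OF FC] by simp
    show "(\<lambda>x. (F n x - v x)\<^sup>2) \<in> borel_measurable hyp_area" for n using Fm v by simp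
    show "integrable hyp_area (\<lambda>x. (2 * K)\<^sup>2 * indicator {z. 1 - (norm z)\<^sup>2 \<ge> \<delta> / 2} x)"
      using emeasure_hyp_height[of "\<delta> / 2"] sets_height[of "\<delta> / 2"] \<delta>(1) by (intro integrable_mult_right integrable_real_indicator) auto
    show "AE x in hyp_area. (\<lambda>n. (F n x - v x)\<^sup>2) \<longlonglongrightarrow> 0"
      using AEN AE_space
    proof eventually_elim
      case (elim x)
      then have "(\<lambda>n. (F n x - v x)\<^sup>2) \<longlonglongrightarrow> (v x - v x)\<^sup>2" by (intro tendsto_intros lim) auto
      then show ?case by simp
    qed
    show "AE x in hyp_area. norm ((F n x - v x)\<^sup>2) \<le> (2 * K)\<^sup>2 * indicator {z. 1 - (norm z)\<^sup>2 \<ge> \<delta> / 2} x" for n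
    proof (rule AE_I2)
      fix x assume "x \<in> space hyp_area"
      then have x: "norm x < 1" by simp
      show "norm ((F n x - v x)\<^sup>2) \<le> (2 * K)\<^sup>2 * indicator {z. 1 - (norm z)\<^sup>2 \<ge> \<delta> / 2} x"
      proof (cases "1 - (norm x)\<^sup>2 \<ge> \<delta> / 2")
        case True
        have "\<bar>F n x - v x\<bar> \<le> 2 * K" using Fb[of n x] bd[of x] by linarith
        then have "\<bar>F n x - v x\<bar>\<^sup>2 \<le> (2 * K)\<^sup>2" by (intro power_mono) auto
        then show ?thesis using True by simp
      next
        case False
        then have "1 - (norm x)\<^sup>2 < \<delta>" using \<delta>(1) by linarith
        then have "v x = 0" using \<delta>(2) x by (simp add: hsupp_def)
        then show ?thesis using False chi0[of x] by (simp add: F_def)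
      qed
    qed
  qed simp
  then show ?thesis using FC by auto
qed

text \<open>Truncation in height and in size reduces to the bounded case. The two bounds
  \<open>e / 4\<close> come from \<open>(x + y)^2 \<le> 2 * x^2 + 2 * y^2\<close>.\<close>

lemma real_L2_approx:
  assumes u: "real_L2 u"
  shows "\<exists>F. (\<forall>n. cont_cpt (F n)) \<and> (\<lambda>n. \<integral>x. (F n x - u x)\<^sup>2 \<partial>hyp_area) \<longlonglongrightarrow> 0"
proof -
  have um [measurable]: "u \<in> borel_measurable hyp_area" and ui: "integrable hyp_area (\<lambda>x. (u x)\<^sup>2)" using u by (auto simp: real_L2_def)
  define K where "K = (\<lambda>n::nat. {z :: complex. 1 - (norm z)\<^sup>2 \<ge> 1 / real (Suc n)})"
  define v where "v = (\<lambda>n z. if \<bar>u z\<bar> \<le> real n \<and> z \<in> K n then u z else 0)"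
  have Ks [measurable]: "K n \<in> sets hyp_area" for n unfolding K_def by (rule sets_height) simp
  have vm [measurable]: "v n \<in> borel_measurable hyp_area" for n unfolding v_def by measurable
  have vlim: "(\<lambda>n. \<integral>x. (v n x - u x)\<^sup>2 \<partial>hyp_area) \<longlonglongrightarrow> (\<integral>x. 0 \<partial>hyp_area)"
  proof (rule integral_dominated_convergence[where w = "\<lambda>x. (u x)\<^sup>2"])
    show "AE x in hyp_area. (\<lambda>n. (v n x - u x)\<^sup>2) \<longlonglongrightarrow> 0"
    proof (rule AE_I2)
      fix x assume "x \<in> space hyp_area"
      then have "0 < 1 - (norm x)\<^sup>2" using one_minus_norm_sq_pos by simp
      then obtain n1 where n1: "inverse (real (Suc n1)) < 1 - (norm x)\<^sup>2" by (rule reals_Archimedean[THEN exE])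
      obtain n2 :: nat where n2: "\<bar>u x\<bar> < real n2" using reals_Archimedean2 by blast
      have "(v n x - u x)\<^sup>2 = 0" if "n \<ge> max n1 n2" for n
      proof -
        have "1 / real (Suc n) \<le> 1 / real (Suc n1)" using that by (intro divide_left_mono) auto
        then have "x \<in> K n" using n1 by (simp add: K_def inverse_eq_divide)
        moreover have "\<bar>u x\<bar> \<le> real n" using n2 that by linarith
        ultimately show ?thesis by (simp add: v_def)
      qed
      then have "\<forall>\<^sub>F n in sequentially. (v n x - u x)\<^sup>2 = 0" unfolding eventually_sequentially by blast
      then show "(\<lambda>n. (v n x - u x)\<^sup>2) \<longlonglongrightarrow> 0" by (rule tendsto_eventually)
    qed
    show "AE x in hyp_area. norm ((v n x - u x)\<^sup>2) \<le> (u x)\<^sup>2" for n by (rule AE_I2) (auto simp: v_def)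
  qed (use ui in auto)
  have "\<exists>f. cont_cpt f \<and> (\<integral>x. (f x - u x)\<^sup>2 \<partial>hyp_area) < e" if e: "e > 0" for e
  proof -
    obtain n where n: "(\<integral>x. (v n x - u x)\<^sup>2 \<partial>hyp_area) < e / 4"
    proof -
      have "\<forall>\<^sub>F n in sequentially. (\<integral>x. (v n x - u x)\<^sup>2 \<partial>hyp_area) < e / 4"
        using order_tendstoD(2)[OF vlim, of "e / 4"] e by simp
      then show ?thesis using that by (auto simp: eventually_sequentially)
    qed
    have hs: "hsupp (1 / real (Suc n)) (v n)" by (auto simp: hsupp_def v_def K_def)
    have bd: "\<bar>v n z\<bar> \<le> real n" for z by (simp add: v_def)
    obtain F where F: "\<And>k. cont_cpt (F k)" "(\<lambda>k. \<integral>x. (F k x - v n x)\<^sup>2 \<partial>hyp_area) \<longlonglongrightarrow> 0"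
      using L2_approx_bounded[OF vm[of n] _ hs bd] by auto
    have "\<forall>\<^sub>F k in sequentially. (\<integral>x. (F k x - v n x)\<^sup>2 \<partial>hyp_area) < e / 4"
      using order_tendstoD(2)[OF F(2), of "e / 4"] e by simp
    then obtain k where k: "(\<integral>x. (F k x - v n x)\<^sup>2 \<partial>hyp_area) < e / 4" by (auto simp: eventually_sequentially)
    have Fk: "F k \<in> borel_measurable hyp_area" "integrable hyp_area (\<lambda>x. (F k x)\<^sup>2)" using cont_cpt_real_L2[OF F(1)[of k]] by (auto simp: real_L2_def)
    have vi: "integrable hyp_area (\<lambda>x. (v n x)\<^sup>2)"
      by (rule Bochner_Integration.integrable_bound[OF ui]) (auto simp: v_def)
    have i: "integrable hyp_area (\<lambda>x. (F k x - v n x)\<^sup>2)" "integrable hyp_area (\<lambda>x. (v n x - u x)\<^sup>2)" "integrable hyp_area (\<lambda>x. (F k x - u x)\<^sup>2)"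
      by (intro integrable_L2_diff Fk vi ui vm um)+
    have "(\<integral>x. (F k x - u x)\<^sup>2 \<partial>hyp_area) \<le> (\<integral>x. 2 * (F k x - v n x)\<^sup>2 + 2 * (v n x - u x)\<^sup>2 \<partial>hyp_area)"
    proof (rule integral_mono[OF i(3)])
      show "integrable hyp_area (\<lambda>x. 2 * (F k x - v n x)\<^sup>2 + 2 * (v n x - u x)\<^sup>2)" using i by simp
      fix x
      have "0 \<le> ((F k x - v n x) - (v n x - u x))\<^sup>2" by simp
      then show "(F k x - u x)\<^sup>2 \<le> 2 * (F k x - v n x)\<^sup>2 + 2 * (v n x - u x)\<^sup>2" by (simp add: power2_eq_square algebra_simps)
    qed
    also have "\<dots> = 2 * (\<integral>x. (F k x - v n x)\<^sup>2 \<partial>hyp_area) + 2 * (\<integral>x. (v n x - u x)\<^sup>2 \<partial>hyp_area)" using i by simp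
    also have "\<dots> < e" using n k by linarith
    finally show ?thesis using F(1) by blast
  qed
  then have "\<exists>F. \<forall>n::nat. cont_cpt (F n) \<and> (\<integral>x. (F n x - u x)\<^sup>2 \<partial>hyp_area) < 1 / real (Suc n)"
    by (intro choice allI) simp
  then obtain F where F: "\<And>n. cont_cpt (F n)" "\<And>n. (\<integral>x. (F n x - u x)\<^sup>2 \<partial>hyp_area) < 1 / real (Suc n)" by blast
  have "(\<lambda>n. \<integral>x. (F n x - u x)\<^sup>2 \<partial>hyp_area) \<longlonglongrightarrow> 0"
  proof (rule Lim_null_comparison[OF always_eventually LIMSEQ_Suc[OF lim_1_over_n]], rule allI)
    show "norm (\<integral>x. (F n x - u x)\<^sup>2 \<partial>hyp_area) \<le> 1 / real (Suc n)" for n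
      using F(2)[of n] Bochner_Integration.integral_nonneg[of hyp_area "\<lambda>x. (F n x - u x)\<^sup>2"] by simp
  qed
  then show ?thesis using F(1) by blast
qed

text \<open>The quadratic form of the averaging operator as one integral over centre and angle. On
  this product space it is an inner product of two square-integrable functions, so L^2 continuity
  follows without inspecting individual circles.\<close>

definition avg_form :: "real \<Rightarrow> (complex \<Rightarrow> real) \<Rightarrow> real" where
  "avg_form a u = (\<integral>p. u (hcirc (fst p) a (snd p)) * u (fst p) \<partial>(hyp_area \<Otimes>\<^sub>M unif_angle))"

lemma measurable_hcirc_fst_snd: "(\<lambda>p. hcirc (fst p) a (snd p)) \<in> hyp_area \<Otimes>\<^sub>M unif_angle \<rightarrow>\<^sub>M hyp_area"
  using measurable_hcirc_pairs[of a] by (simp add: split_beta')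

text \<open>The circle point and the centre both push the product measure to the area: the first by
  \<open>distr_hcirc_pairs\<close>, the second because the angle has total mass 1.\<close>

lemma
  fixes u :: "complex \<Rightarrow> 'b::{banach, second_countable_topology}"
  assumes u: "u \<in> borel_measurable hyp_area" and a: "a > 0"
  shows integral_hcirc_pairs: "(\<integral>p. u (hcirc (fst p) a (snd p)) \<partial>(hyp_area \<Otimes>\<^sub>M unif_angle)) = (\<integral>x. u x \<partial>hyp_area)"
    and integrable_hcirc_pairs: "integrable (hyp_area \<Otimes>\<^sub>M unif_angle) (\<lambda>p. u (hcirc (fst p) a (snd p))) \<longleftrightarrow> integrable hyp_area u"
    and integral_fst_pairs: "(\<integral>p. u (fst p) \<partial>(hyp_area \<Otimes>\<^sub>M unif_angle)) = (\<integral>x. u x \<partial>hyp_area)"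
    and integrable_fst_pairs: "integrable (hyp_area \<Otimes>\<^sub>M unif_angle) (\<lambda>p. u (fst p)) \<longleftrightarrow> integrable hyp_area u"
proof -
  have d: "distr (hyp_area \<Otimes>\<^sub>M unif_angle) hyp_area (\<lambda>p. hcirc (fst p) a (snd p)) = hyp_area"
    using distr_hcirc_pairs[OF a] by (simp add: split_beta')
  show "(\<integral>p. u (hcirc (fst p) a (snd p)) \<partial>(hyp_area \<Otimes>\<^sub>M unif_angle)) = (\<integral>x. u x \<partial>hyp_area)"
    using integral_distr[OF measurable_hcirc_fst_snd[of a] u] unfolding d by simp
  show "integrable (hyp_area \<Otimes>\<^sub>M unif_angle) (\<lambda>p. u (hcirc (fst p) a (snd p))) \<longleftrightarrow> integrable hyp_area u"
    using integrable_distr_eq[OF measurable_hcirc_fst_snd[of a] u] unfolding d by simp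
  show "(\<integral>p. u (fst p) \<partial>(hyp_area \<Otimes>\<^sub>M unif_angle)) = (\<integral>x. u x \<partial>hyp_area)"
    using integral_distr[OF measurable_fst u, of unif_angle] unfolding unif_angle.distr_pair_fst by simp
  show "integrable (hyp_area \<Otimes>\<^sub>M unif_angle) (\<lambda>p. u (fst p)) \<longleftrightarrow> integrable hyp_area u"
    using integrable_distr_eq[OF measurable_fst u, of unif_angle] unfolding unif_angle.distr_pair_fst by simp
qed

lemma real_L2_pairs:
  assumes u: "real_L2 u" and a: "a > 0"
  shows "(\<lambda>p. u (hcirc (fst p) a (snd p))) \<in> borel_measurable (hyp_area \<Otimes>\<^sub>M unif_angle)"
    and "(\<lambda>p. u (fst p)) \<in> borel_measurable (hyp_area \<Otimes>\<^sub>M unif_angle)"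
    and "integrable (hyp_area \<Otimes>\<^sub>M unif_angle) (\<lambda>p. (u (hcirc (fst p) a (snd p)))\<^sup>2)"
    and "integrable (hyp_area \<Otimes>\<^sub>M unif_angle) (\<lambda>p. (u (fst p))\<^sup>2)"
proof -
  have um: "u \<in> borel_measurable hyp_area" and u2: "(\<lambda>x. (u x)\<^sup>2) \<in> borel_measurable hyp_area"
    and ui: "integrable hyp_area (\<lambda>x. (u x)\<^sup>2)" using u by (auto simp: real_L2_def)
  show "(\<lambda>p. u (hcirc (fst p) a (snd p))) \<in> borel_measurable (hyp_area \<Otimes>\<^sub>M unif_angle)"
    by (rule measurable_compose[OF measurable_hcirc_fst_snd um])
  show "(\<lambda>p. u (fst p)) \<in> borel_measurable (hyp_area \<Otimes>\<^sub>M unif_angle)" by (rule measurable_compose[OF measurable_fst um])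
  show "integrable (hyp_area \<Otimes>\<^sub>M unif_angle) (\<lambda>p. (u (hcirc (fst p) a (snd p)))\<^sup>2)" using integrable_hcirc_pairs[OF u2 a] ui by simp
  show "integrable (hyp_area \<Otimes>\<^sub>M unif_angle) (\<lambda>p. (u (fst p))\<^sup>2)" using integrable_fst_pairs[OF u2 a] ui by simp
qed

lemma avg_form_eq_cmean:
  assumes "integrable (hyp_area \<Otimes>\<^sub>M unif_angle) (\<lambda>p. w (hcirc (fst p) a (snd p)) * u (fst p))"
  shows "(\<integral>p. w (hcirc (fst p) a (snd p)) * u (fst p) \<partial>(hyp_area \<Otimes>\<^sub>M unif_angle)) = (\<integral>x. u x * cmean a w x \<partial>hyp_area)"
  using HU.integral_fst'[OF assms] by (simp add: cmean_def mult.commute)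

lemma avg_form_approx:
  assumes F: "\<And>n. cont_cpt (F n)" and u: "real_L2 u" and a: "a > 0"
    and lim: "(\<lambda>n. \<integral>x. (F n x - u x)\<^sup>2 \<partial>hyp_area) \<longlonglongrightarrow> 0"
  shows "(\<lambda>n. \<integral>x. F n x * cmean a (F n) x \<partial>hyp_area) \<longlonglongrightarrow> avg_form a u"
    and "(\<lambda>n. \<integral>x. F n x * F n x \<partial>hyp_area) \<longlonglongrightarrow> (\<integral>x. (u x)\<^sup>2 \<partial>hyp_area)"
proof -
  have FL: "real_L2 (F n)" for n by (rule cont_cpt_real_L2[OF F])
  have dm: "(\<lambda>x. (F n x - u x)\<^sup>2) \<in> borel_measurable hyp_area" for n using FL[of n] u by (auto simp: real_L2_def)
  have "(\<lambda>n. \<integral>p. F n (hcirc (fst p) a (snd p)) * F n (fst p) \<partial>(hyp_area \<Otimes>\<^sub>M unif_angle)) \<longlonglongrightarrow> avg_form a u"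
    unfolding avg_form_def
    by (rule L2_tendsto_mult) (use real_L2_pairs[OF FL a] real_L2_pairs[OF u a] lim integral_hcirc_pairs[OF dm a] integral_fst_pairs[OF dm a] in simp_all)
  moreover have "(\<integral>p. F n (hcirc (fst p) a (snd p)) * F n (fst p) \<partial>(hyp_area \<Otimes>\<^sub>M unif_angle)) = (\<integral>x. F n x * cmean a (F n) x \<partial>hyp_area)" for n
    by (rule avg_form_eq_cmean) (intro integrable_mult_L2 real_L2_pairs[OF FL a])
  ultimately show "(\<lambda>n. \<integral>x. F n x * cmean a (F n) x \<partial>hyp_area) \<longlonglongrightarrow> avg_form a u" by simp
  show "(\<lambda>n. \<integral>x. F n x * F n x \<partial>hyp_area) \<longlonglongrightarrow> (\<integral>x. (u x)\<^sup>2 \<partial>hyp_area)"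
    unfolding power2_eq_square[of "u _"]
    by (rule L2_tendsto_mult) (use FL u lim in \<open>simp_all add: real_L2_def\<close>)
qed

text \<open>The averaging kernel is real and
  \<open>Re (z * cnj w) = Re z * Re w + Im z * Im w\<close>, so the form splits into the real and
  the imaginary part without cross terms.\<close>

lemma Re_hyp_inner_avg_op:
  assumes f: "f \<in> L2_hyp" and d: "d > 0"
  shows "real_L2 (\<lambda>x. Re (f x))" "real_L2 (\<lambda>x. Im (f x))"
    and "Re (hyp_inner (avg_op d f) f) = avg_form (sinh (d / 2)) (\<lambda>x. Re (f x)) + avg_form (sinh (d / 2)) (\<lambda>x. Im (f x))"
    and "(hyp_norm f)\<^sup>2 = (\<integral>x. (Re (f x))\<^sup>2 \<partial>hyp_area) + (\<integral>x. (Im (f x))\<^sup>2 \<partial>hyp_area)"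
proof -
  define a where "a = sinh (d / 2)"
  have a: "a > 0" using d by (simp add: a_def)
  have fm [measurable]: "f \<in> borel_measurable hyp_area" and fi: "integrable hyp_area (\<lambda>z. (norm (f z))\<^sup>2)"
    using f by (auto simp: L2_hyp_def)
  have fD: "f \<in> borel_measurable disk_borel" using fm by (simp cong: measurable_cong_sets add: sets_hyp_area)
  have Ri: "integrable hyp_area (\<lambda>x. (Re (f x))\<^sup>2)"
    by (rule Bochner_Integration.integrable_bound[OF fi]) (auto simp: cmod_power2)
  have Ii: "integrable hyp_area (\<lambda>x. (Im (f x))\<^sup>2)"
    by (rule Bochner_Integration.integrable_bound[OF fi]) (auto simp: cmod_power2)
  show R: "real_L2 (\<lambda>x. Re (f x))" and I: "real_L2 (\<lambda>x. Im (f x))" using Ri Ii by (auto simp: real_L2_def)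
  show "(hyp_norm f)\<^sup>2 = (\<integral>x. (Re (f x))\<^sup>2 \<partial>hyp_area) + (\<integral>x. (Im (f x))\<^sup>2 \<partial>hyp_area)"
    using Ri Ii by (simp add: hyp_norm_def cmod_power2 integral_nonneg_AE)
  have avg: "avg_op d f x = (\<integral>t. f (hcirc x a t) \<partial>unif_angle)" if x: "norm x < 1" for x
  proof -
    have "circle_param x d \<in> unif_angle \<rightarrow>\<^sub>M disk_borel" using circle_param_measurable[OF x, of d] by (simp cong: measurable_cong_sets)
    from integral_distr[OF this fD] show ?thesis
      by (simp add: avg_op_def circle_measure_def circle_param_eq_hcirc a_def)
  qed
  define k where "k = (\<lambda>p. f (hcirc (fst p) a (snd p)) * cnj (f (fst p)))"
  have ki: "integrable (hyp_area \<Otimes>\<^sub>M unif_angle) k"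
  proof (rule Bochner_Integration.integrable_bound)
    have nm: "(\<lambda>x. (norm (f x))\<^sup>2) \<in> borel_measurable hyp_area" by measurable
    show "integrable (hyp_area \<Otimes>\<^sub>M unif_angle) (\<lambda>p. (norm (f (hcirc (fst p) a (snd p))))\<^sup>2 + (norm (f (fst p)))\<^sup>2)"
      using integrable_hcirc_pairs[OF nm a] integrable_fst_pairs[OF nm a] fi by simp
    have [measurable]: "(\<lambda>p. f (hcirc (fst p) a (snd p))) \<in> borel_measurable (hyp_area \<Otimes>\<^sub>M unif_angle)"
      by (rule measurable_compose[OF measurable_hcirc_fst_snd fm])
    have [measurable]: "cnj \<in> borel_measurable borel" by (rule cnj_measurable)
    show "k \<in> borel_measurable (hyp_area \<Otimes>\<^sub>M unif_angle)" unfolding k_def by measurable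
    show "AE p in hyp_area \<Otimes>\<^sub>M unif_angle. norm (k p) \<le> norm ((norm (f (hcirc (fst p) a (snd p))))\<^sup>2 + (norm (f (fst p)))\<^sup>2)"
    proof (rule AE_I2)
      fix p
      define r s where "r = norm (f (hcirc (fst p) a (snd p)))" and "s = norm (f (fst p))"
      have "0 \<le> (r - s)\<^sup>2" "0 \<le> r * s" by (auto simp: r_def s_def)
      then have "r * s \<le> r\<^sup>2 + s\<^sup>2" by (simp add: power2_diff)
      then show "norm (k p) \<le> norm ((norm (f (hcirc (fst p) a (snd p))))\<^sup>2 + (norm (f (fst p)))\<^sup>2)"
        by (simp add: k_def norm_mult r_def s_def)
    qed
  qed
  have "hyp_inner (avg_op d f) f = (\<integral>x. (\<integral>t. k (x, t) \<partial>unif_angle) \<partial>hyp_area)"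
    unfolding hyp_inner_def by (intro Bochner_Integration.integral_cong refl) (simp add: avg k_def)
  also have "\<dots> = (\<integral>p. k p \<partial>(hyp_area \<Otimes>\<^sub>M unif_angle))" by (rule HU.integral_fst'[OF ki])
  finally have "Re (hyp_inner (avg_op d f) f) = Re (\<integral>p. k p \<partial>(hyp_area \<Otimes>\<^sub>M unif_angle))" by simp
  also have "\<dots> = (\<integral>p. Re (k p) \<partial>(hyp_area \<Otimes>\<^sub>M unif_angle))" using ki by (rule integral_Re[symmetric])
  also have "\<dots> = (\<integral>p. Re (f (hcirc (fst p) a (snd p))) * Re (f (fst p)) + Im (f (hcirc (fst p) a (snd p))) * Im (f (fst p)) \<partial>(hyp_area \<Otimes>\<^sub>M unif_angle))"
    by (simp add: k_def)
  also have "\<dots> = avg_form a (\<lambda>x. Re (f x)) + avg_form a (\<lambda>x. Im (f x))"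
    unfolding avg_form_def by (intro Bochner_Integration.integral_add integrable_mult_L2 real_L2_pairs[OF R a] real_L2_pairs[OF I a])
  finally show "Re (hyp_inner (avg_op d f) f) = avg_form (sinh (d / 2)) (\<lambda>x. Re (f x)) + avg_form (sinh (d / 2)) (\<lambda>x. Im (f x))"
    by (simp add: a_def)
qed

section \<open>Approximate eigenfunctions\<close>

text \<open>The inequality for continuous functions of compact support passes to L^2, since both
  terms are continuous in the L^2 norm and \<open>cont_cpt\<close> functions are dense.\<close>

lemma avg_form_nonneg:
  assumes u: "real_L2 u" and a: "a > 0" and pos: "\<And>l. 0 \<le> c1 * spherical l a + c2"
  shows "0 \<le> c1 * avg_form a u + c2 * (\<integral>x. (u x)\<^sup>2 \<partial>hyp_area)"
proof -
  obtain F where F: "\<And>n. cont_cpt (F n)" "(\<lambda>n. \<integral>x. (F n x - u x)\<^sup>2 \<partial>hyp_area) \<longlonglongrightarrow> 0"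
    using real_L2_approx[OF u] by auto
  have "(\<lambda>n. c1 * (\<integral>x. F n x * cmean a (F n) x \<partial>hyp_area) + c2 * (\<integral>x. F n x * F n x \<partial>hyp_area))
      \<longlonglongrightarrow> c1 * avg_form a u + c2 * (\<integral>x. (u x)\<^sup>2 \<partial>hyp_area)"
    by (intro tendsto_intros avg_form_approx[OF F(1) u a F(2)])
  then show ?thesis
    by (rule LIMSEQ_le_const) (use cmean_quadratic_form_nonneg[OF F(1) a pos] in blast)
qed

text \<open>The radial eigenfunction centred at 0, normalized to 1 there.\<close>

definition spherical_wave :: "real \<Rightarrow> complex \<Rightarrow> real" where
  "spherical_wave l x = spherical l (sinh_hdist 0 x)"

lemma continuous_on_spherical_wave: "continuous_on poincare_disk (spherical_wave l)"
proof -
  have "continuous_on poincare_disk (sinh_hdist 0)" unfolding sinh_hdist_def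
    by (intro continuous_intros) (use one_minus_norm_sq_pos in \<open>auto simp: less_imp_neq[symmetric]\<close>)
  from continuous_on_compose2[OF continuous_on_spherical this, of l] show ?thesis unfolding spherical_wave_def by simp
qed

lemma spherical_wave_eq_unif_angle_plane_wave:
  assumes x: "norm x < 1"
  shows "spherical_wave l x = (\<integral>t. plane_wave True l t x \<partial>unif_angle)"
proof -
  have "poisson_pow l 0 (cis t) = 1" for t by (simp add: poisson_pow_def poisson_def)
  then have h: "plane_wave True l t 0 = 1" "plane_wave False l t 0 = 0" for t by (simp_all add: plane_wave_def)
  show ?thesis using plane_wave_product_mean[OF x, of 0 l] unfolding spherical_wave_def sinh_hdist_commute[of 0] h by simp
qed

text \<open>The radial function is the mean of the plane waves over the boundary angle, and
  averaging over circles commutes with that mean.\<close>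

lemma cmean_spherical_wave:
  assumes x: "norm x < 1" and a: "a \<ge> 0"
  shows "cmean a (spherical_wave l) x = spherical l a * spherical_wave l x"
proof -
  have hc: "continuous_on UNIV (\<lambda>t. plane_wave True l t y)" if "norm y < 1" for y
    by (intro continuous_on_plane_wave continuous_intros) (use that in auto)
  have U: "spherical_wave l y = integral {0..2 * pi} (\<lambda>t. plane_wave True l t y) / (2 * pi)" if "norm y < 1" for y
    unfolding spherical_wave_eq_unif_angle_plane_wave[OF that] unif_angle_integral[OF hc[OF that]] by (simp add: inverse_eq_divide)
  have hD: "continuous_on poincare_disk (plane_wave True l t)" for t
    by (intro continuous_on_plane_wave continuous_intros) auto
  have "cmean a (spherical_wave l) x = integral {0..2 * pi} (\<lambda>s. spherical_wave l (hcirc x a s)) / (2 * pi)"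
    by (rule cmean_eq_integral[OF continuous_on_spherical_wave x])
  also have "\<dots> = integral {0..2 * pi} (\<lambda>s. integral {0..2 * pi} (\<lambda>t. plane_wave True l t (hcirc x a s))) / (2 * pi) / (2 * pi)"
    by (simp add: U[OF hcirc_in_disk[OF x]])
  also have "integral {0..2 * pi} (\<lambda>s. integral {0..2 * pi} (\<lambda>t. plane_wave True l t (hcirc x a s)))
      = integral {0..2 * pi} (\<lambda>t. integral {0..2 * pi} (\<lambda>s. plane_wave True l t (hcirc x a s)))"
  proof -
    have "continuous_on (cbox (0, 0) (2 * pi, 2 * pi)) (\<lambda>(s, t). plane_wave True l t (hcirc x a s))"
      unfolding split_beta'
      by (intro continuous_on_plane_wave continuous_on_hcirc continuous_intros) (use x hcirc_in_disk in auto)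
    from integral_swap_continuous[OF this] show ?thesis by (simp add: cbox_interval)
  qed
  also have "\<dots> / (2 * pi) / (2 * pi) = integral {0..2 * pi} (\<lambda>t. cmean a (plane_wave True l t) x) / (2 * pi)"
    by (simp add: cmean_eq_integral[OF hD x])
  also have "\<dots> = spherical l a * spherical_wave l x" unfolding cmean_plane_wave[OF x a] U[OF x] by simp
  finally show ?thesis .
qed

text \<open>A sharp cutoff is enough: the form is defined on all of L^2, so no continuity across the
  truncation circle is wanted.\<close>

definition wave_trunc :: "real \<Rightarrow> real \<Rightarrow> complex \<Rightarrow> real" where
  "wave_trunc l \<delta> x = (if 1 - (norm x)\<^sup>2 \<ge> \<delta> then spherical_wave l x else 0)"

definition trunc_mass :: "real \<Rightarrow> real \<Rightarrow> real" where
  "trunc_mass l \<delta> = (\<integral>x. (wave_trunc l \<delta> x)\<^sup>2 \<partial>hyp_area)"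

lemma spherical_wave_measurable: "spherical_wave l \<in> borel_measurable hyp_area"
  using continuous_on_disk_measurable[OF continuous_on_spherical_wave] by (simp cong: measurable_cong_sets add: sets_hyp_area)

lemma wave_trunc_bounded: "\<bar>wave_trunc l \<delta> x\<bar> \<le> 1"
  using spherical_le_1[of l "sinh_hdist 0 x"] by (simp add: wave_trunc_def spherical_wave_def)

lemma wave_trunc_integrable:
  assumes d: "\<delta> > 0"
  shows "wave_trunc l \<delta> \<in> borel_measurable hyp_area" and "integrable hyp_area (\<lambda>x. (wave_trunc l \<delta> x)\<^sup>2)" and "real_L2 (wave_trunc l \<delta>)"
proof -
  have "wave_trunc l \<delta> = (\<lambda>x. indicator {z. 1 - (norm z)\<^sup>2 \<ge> \<delta>} x * spherical_wave l x)" by (auto simp: wave_trunc_def fun_eq_iff)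
  then show m: "wave_trunc l \<delta> \<in> borel_measurable hyp_area"
    using sets_height[OF d] spherical_wave_measurable[of l] by (metis borel_measurable_times borel_measurable_indicator)
  show i: "integrable hyp_area (\<lambda>x. (wave_trunc l \<delta> x)\<^sup>2)"
  proof (rule integrable_bounded_hsupp[OF _ d])
    show "hsupp \<delta> (\<lambda>x. (wave_trunc l \<delta> x)\<^sup>2)" by (auto simp: hsupp_def wave_trunc_def)
    show "\<bar>(wave_trunc l \<delta> z)\<^sup>2\<bar> \<le> 1" for z using wave_trunc_bounded[of l \<delta> z] by (simp add: abs_square_le_1)
  qed (use m in simp)
  show "real_L2 (wave_trunc l \<delta>)" using m i by (simp add: real_L2_def)
qed

lemma height_hcirc_0: "1 - (norm (hcirc 0 a t))\<^sup>2 = 1 / (1 + a\<^sup>2)"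
proof -
  have "(norm (hcirc 0 a t))\<^sup>2 = a\<^sup>2 / (1 + a\<^sup>2)"
    by (simp add: hcirc_def Moebius_function_simple norm_mult norm_divide power_divide power_mult_distrib)
  then show ?thesis using one_plus_square_pos[of a] by (simp add: field_simps)
qed

text \<open>A point at radial coordinate \<open>a\<close> has height \<open>1 / (1 + a^2)\<close>,
  so height at least \<open>\<delta>\<close> means
  \<open>|a| \<le> sqrt (1 / \<delta> - 1)\<close>.\<close>

lemma trunc_mass_eq:
  assumes d: "0 < \<delta>" "\<delta> \<le> 1"
  shows "trunc_mass l \<delta> = integral {0..sqrt (1 / \<delta> - 1)} (\<lambda>a. 8 * pi * a * (spherical l a)\<^sup>2)"
proof -
  define c where "c = sqrt (1 / \<delta> - 1)"
  define f where "f = (\<lambda>x::complex. if 1 - (norm x)\<^sup>2 \<ge> \<delta> then 1 else 0 :: real)"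
  define k where "k = (\<lambda>a. indicator {0..} a * (spherical l a)\<^sup>2)"
  have f: "integrable hyp_area f"
  proof (rule integrable_bounded_hsupp[OF _ d(1), of _ 1])
    have "f = indicator {z. 1 - (norm z)\<^sup>2 \<ge> \<delta>}" by (auto simp: f_def fun_eq_iff)
    then show "f \<in> borel_measurable hyp_area" using sets_height[OF d(1)] by simp
  qed (auto simp: hsupp_def f_def)
  have [measurable]: "spherical l \<in> borel_measurable borel" by (rule borel_measurable_continuous_onI[OF continuous_on_spherical])
  have k: "k \<in> borel_measurable borel" unfolding k_def by measurable
  have kb: "\<bar>k a\<bar> \<le> 1" for a using spherical_le_1[of l a] by (auto simp: k_def abs_mult abs_square_le_1 split: split_indicator)
  have sd0: "sinh_hdist 0 x \<ge> 0" if "norm x < 1" for x using that one_minus_norm_sq_pos[OF that] by (simp add: sinh_hdist_def)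
  have cmean: "cmean a f 0 = (if \<bar>a\<bar> \<le> c then 1 else 0)" for a
  proof -
    have "\<delta> \<le> 1 / (1 + a\<^sup>2) \<longleftrightarrow> a\<^sup>2 \<le> 1 / \<delta> - 1" using one_plus_square_pos[of a] d by (simp add: field_simps)
    also have "\<dots> \<longleftrightarrow> sqrt (a\<^sup>2) \<le> c" unfolding c_def by (simp only: real_sqrt_le_iff)
    finally have "\<delta> \<le> 1 / (1 + a\<^sup>2) \<longleftrightarrow> \<bar>a\<bar> \<le> c" by simp
    then show ?thesis unfolding cmean_def f_def height_hcirc_0 by simp
  qed
  have "trunc_mass l \<delta> = (\<integral>y. f y * k (sinh_hdist 0 y) \<partial>hyp_area)"
    unfolding trunc_mass_def by (rule Bochner_Integration.integral_cong) (use sd0 in \<open>auto simp: wave_trunc_def f_def k_def spherical_wave_def\<close>)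
  also have "\<dots> = (\<integral>a. k a * cmean a f 0 \<partial>radial_area)" by (rule hyp_integral_polar(2)[OF _ f k kb]) simp
  also have "\<dots> = (\<integral>a. indicator {0..c} a * (spherical l a)\<^sup>2 \<partial>radial_area)"
    by (rule Bochner_Integration.integral_cong) (auto simp: k_def cmean split: split_indicator)
  also have "\<dots> = integral {0..c} (\<lambda>a. 8 * pi * a * (spherical l a)\<^sup>2)"
    by (rule radial_area_integral) (intro continuous_intros continuous_on_subset[OF continuous_on_spherical], simp)
  finally show ?thesis by (simp add: c_def)
qed

lemma arsinh_mono: "x \<le> y \<Longrightarrow> arsinh x \<le> arsinh (y :: real)"
  by (simp flip: not_less)

text \<open>Decay of order log a / a, uniform in \<open>l\<close>, because the case
  \<open>l = 0\<close> dominates. Its square is just not integrable against the density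
  \<open>8 * pi * a\<close>: the divergence is logarithmic in \<open>a\<close>.\<close>

lemma spherical_decay:
  assumes a: "0 \<le> a"
  shows "(1 + a) * \<bar>spherical l a\<bar> \<le> 2 + arsinh a"
proof (cases "a = 0")
  case True
  then show ?thesis using spherical_le_1[of l 0] by simp
next
  case False
  then have a: "a > 0" using a by simp
  have "spherical 0 a \<le> 2 * arsinh a / (pi * a) + 1 / a" using spherical_asymp[OF a, of 0] by (simp add: abs_le_iff)
  then have "a * spherical 0 a \<le> a * (2 * arsinh a / (pi * a) + 1 / a)" using a by (intro mult_left_mono) auto
  also have "\<dots> = arsinh a * (2 / pi) + 1" using a by (simp add: field_simps)
  also have "\<dots> \<le> arsinh a * 1 + 1"
    using a pi_ge_two by (intro add_mono mult_left_mono) (auto simp: arsinh_mono[of 0 a, simplified])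
  finally have "a * \<bar>spherical l a\<bar> \<le> arsinh a + 1"
    using mult_left_mono[OF spherical_abs_le_0[of l a], of a] a by linarith
  then show ?thesis using spherical_le_1[of l a] by (simp add: algebra_simps)
qed

text \<open>The squared decay contributes two logarithms and the integral of
  \<open>1 / (1 + a)\<close> a third. A cube of a logarithm of \<open>\<delta>\<close> is polynomial
  in the hyperbolic radius.\<close>

lemma trunc_mass_le:
  assumes d: "0 < \<delta>" "\<delta> \<le> 1"
  shows "trunc_mass l \<delta> \<le> 8 * pi * (3 + ln (1 + sqrt (1 / \<delta> - 1))) ^ 3"
proof -
  define c where "c = sqrt (1 / \<delta> - 1)"
  have c: "c \<ge> 0" using d by (simp add: c_def)
  define L where "L = arsinh c"
  define \<Lambda> where "\<Lambda> = ln (1 + c)"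
  have Lam: "\<Lambda> \<ge> 0" using c by (simp add: \<Lambda>_def)
  have L0: "L \<ge> 0" using arsinh_mono[OF c] by (simp add: L_def)
  have L: "L \<le> 1 + \<Lambda>"
  proof -
    have "sqrt (c\<^sup>2 + 1) \<le> sqrt ((1 + c)\<^sup>2)" using c by (intro real_sqrt_le_mono) (simp add: power2_sum)
    then have "c + sqrt (c\<^sup>2 + 1) \<le> 2 * (1 + c)" using c by simp
    moreover have "0 < c + sqrt (c\<^sup>2 + 1)" using c by (intro add_nonneg_pos) (auto intro: add_nonneg_pos)
    ultimately have "L \<le> ln (2 * (1 + c))" unfolding L_def arsinh_real_def by simp
    also have "\<dots> = ln 2 + \<Lambda>" using c ln_mult[of 2 "1 + c"] by (simp add: \<Lambda>_def)
    finally show ?thesis using ln_2_less_1 by simp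
  qed
  have "trunc_mass l \<delta> = integral {0..c} (\<lambda>a. 8 * pi * a * (spherical l a)\<^sup>2)" unfolding c_def by (rule trunc_mass_eq[OF d])
  also have "\<dots> \<le> 8 * pi * (2 + L)\<^sup>2 * \<Lambda>"
  proof (rule has_integral_le[OF integrable_integral])
    show "(\<lambda>a. 8 * pi * a * (spherical l a)\<^sup>2) integrable_on {0..c}"
      by (intro integrable_continuous_real continuous_intros continuous_on_subset[OF continuous_on_spherical]) simp
    have "((\<lambda>a. 1 / (1 + a)) has_integral (ln (1 + c) - ln (1 + 0))) {0..c}"
      by (rule fundamental_theorem_of_calculus[OF c])
        (auto intro!: derivative_eq_intros simp: has_real_derivative_iff_has_vector_derivative[symmetric])
    from has_integral_mult_right[OF this, of "8 * pi * (2 + L)\<^sup>2"]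
    show "((\<lambda>a. 8 * pi * (2 + L)\<^sup>2 * (1 / (1 + a))) has_integral (8 * pi * (2 + L)\<^sup>2 * \<Lambda>)) {0..c}" by (simp add: \<Lambda>_def)
    fix a assume a: "a \<in> {0..c}"
    have "(1 + a) * \<bar>spherical l a\<bar> \<le> 2 + L"
      using spherical_decay[of a l] a arsinh_mono[of a c] by (simp add: L_def)
    then have "((1 + a) * \<bar>spherical l a\<bar>)\<^sup>2 \<le> (2 + L)\<^sup>2" using a by (intro power_mono) auto
    then have "(1 + a) * ((1 + a) * (spherical l a)\<^sup>2) \<le> (2 + L)\<^sup>2" by (simp add: power_mult_distrib power2_eq_square mult_ac)
    then have "(1 + a) * (spherical l a)\<^sup>2 \<le> (2 + L)\<^sup>2 / (1 + a)" using a by (simp add: field_simps)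
    moreover have "a * (spherical l a)\<^sup>2 \<le> (1 + a) * (spherical l a)\<^sup>2" by (intro mult_right_mono) auto
    ultimately have "8 * pi * (a * (spherical l a)\<^sup>2) \<le> 8 * pi * ((2 + L)\<^sup>2 / (1 + a))" by (intro mult_left_mono) auto
    then show "8 * pi * a * (spherical l a)\<^sup>2 \<le> 8 * pi * (2 + L)\<^sup>2 * (1 / (1 + a))" by simp
  qed
  also have "\<dots> \<le> 8 * pi * (3 + \<Lambda>)\<^sup>2 * (3 + \<Lambda>)"
    using L L0 Lam by (intro mult_mono power_mono) auto
  finally show ?thesis by (simp add: \<Lambda>_def c_def power2_eq_square power3_eq_cube)
qed

text \<open>\<open>spherical l\<close> is continuous with value 1 at 0, so it cannot vanish on an
  interval to the right of 0.\<close>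

lemma trunc_mass_pos:
  assumes d: "0 < \<delta>" "\<delta> < 1"
  shows "trunc_mass l \<delta> > 0"
proof -
  define c where "c = sqrt (1 / \<delta> - 1)"
  have c: "c > 0" using d by (simp add: c_def)
  have e: "trunc_mass l \<delta> = integral ({0..c}) (\<lambda>a. 8 * pi * a * (spherical l a)\<^sup>2)"
    unfolding c_def using d by (intro trunc_mass_eq) auto
  have "trunc_mass l \<delta> \<noteq> 0"
  proof
    assume "trunc_mass l \<delta> = 0"
    then have z: "integral ({0..c}) (\<lambda>a. 8 * pi * a * (spherical l a)\<^sup>2) = 0" using e by simp
    have "\<forall>a\<in>{0..c}. 8 * pi * a * (spherical l a)\<^sup>2 = 0"
      using z by (subst (asm) integral_eq_0_iff)
        (use c in \<open>auto intro!: continuous_intros continuous_on_subset[OF continuous_on_spherical]\<close>)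
    then have z: "8 * pi * a * (spherical l a)\<^sup>2 = 0" if "0 < a" "a \<le> c" for a
      by (rule bspec) (use that in simp)
    have "spherical l a = 0" if "0 < a" "a \<le> c" for a using z[OF that] that(1) by simp
    then have "\<forall>\<^sub>F a in at_right 0. spherical l a = 0"
      using c unfolding eventually_at_right_field by (intro exI[of _ c]) auto
    then have 0: "(spherical l \<longlongrightarrow> 0) (at_right 0)" by (rule tendsto_eventually)
    have "(spherical l \<longlongrightarrow> spherical l 0) (at 0)"
      using continuous_on_spherical[of l] by (simp add: continuous_on_def)
    then have "(spherical l \<longlongrightarrow> spherical l 0) (at_right 0)" by (rule filterlim_mono) (auto simp: at_le)
    from tendsto_unique[OF trivial_limit_at_right_real this 0] have "spherical l 0 = 0" .
    then show False by (simp add: spherical_def)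
  qed
  moreover have "trunc_mass l \<delta> \<ge> 0" unfolding trunc_mass_def by simp
  ultimately show ?thesis by simp
qed

text \<open>The error lives on pairs of points on either side of the truncation circle, where
  \<open>hcirc_height\<close> keeps both heights within a factor \<open>C\<close> of \<open>\<delta>\<close>.\<close>

lemma avg_form_wave_trunc:
  assumes a: "a > 0" and d: "\<delta> > 0" and C: "C = 4 * (1 + a\<^sup>2)"
  shows "\<bar>avg_form a (wave_trunc l \<delta>) - spherical l a * trunc_mass l \<delta>\<bar> \<le> (trunc_mass l (\<delta> / C) - trunc_mass l (C * \<delta>)) / 2"
proof -
  have "4 * 1 \<le> C" unfolding C by (intro mult_left_mono) auto
  then have C0: "C > 1" "C > 0" by auto
  have dC: "\<delta> / C > 0" "C * \<delta> > 0" using d C0 by auto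
  have mono: "\<delta> / C \<le> \<delta>" "\<delta> \<le> C * \<delta>" using d C0 by (auto simp: field_simps)
  \<comment> \<open>Circles of radius \<open>a\<close> about the region of \<open>f\<close> stay in
    the region of \<open>g\<close>, and those about the region of \<open>e\<close> stay in that of
    \<open>f\<close>. So averaging \<open>g\<close> at a point of the region of \<open>f\<close>
    gives the exact eigenvalue, and only points of that region outside that of \<open>e\<close> see
    the cut.\<close>
  define f where "f = wave_trunc l \<delta>"
  define g where "g = wave_trunc l (\<delta> / C)"
  define e where "e = wave_trunc l (C * \<delta>)"
  note F = wave_trunc_integrable[OF d, of l, folded f_def] and G = wave_trunc_integrable[OF dC(1), of l, folded g_def]
    and E = wave_trunc_integrable[OF dC(2), of l, folded e_def]
  define P where "P = hyp_area \<Otimes>\<^sub>M unif_angle"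
  define X where "X = (\<lambda>p::complex \<times> real. hcirc (fst p) a (snd p))"
  have X: "hcirc (fst p) a (snd p) = X p" for p by (simp add: X_def)
  note FX = real_L2_pairs[OF F(3) a, folded P_def, unfolded X] and GX = real_L2_pairs[OF G(3) a, folded P_def, unfolded X]
  have ig: "integrable P (\<lambda>p. g (X p) * f (fst p))" and jf: "integrable P (\<lambda>p. f (X p) * f (fst p))"
    by (intro integrable_mult_L2 FX GX)+
  have "(\<integral>p. g (X p) * f (fst p) \<partial>P) = (\<integral>x. f x * cmean a g x \<partial>hyp_area)"
    unfolding P_def X_def by (rule avg_form_eq_cmean) (use ig in \<open>simp add: P_def X_def\<close>)
  also have "\<dots> = (\<integral>x. spherical l a * (f x)\<^sup>2 \<partial>hyp_area)"
  proof (rule Bochner_Integration.integral_cong[OF refl])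
    fix x assume "x \<in> space hyp_area"
    then have x: "norm x < 1" by simp
    show "f x * cmean a g x = spherical l a * (f x)\<^sup>2"
    proof (cases "1 - (norm x)\<^sup>2 \<ge> \<delta>")
      case True
      have "g (hcirc x a t) = spherical_wave l (hcirc x a t)" for t
      proof -
        have "\<delta> \<le> C * (1 - (norm (hcirc x a t))\<^sup>2)" using hcirc_height(2)[OF x, of a t] True by (simp add: C)
        then have "\<delta> / C \<le> 1 - (norm (hcirc x a t))\<^sup>2" using C0 by (simp add: field_simps)
        then show ?thesis by (simp add: g_def wave_trunc_def)
      qed
      then have "cmean a g x = spherical l a * spherical_wave l x" using cmean_spherical_wave[OF x, of a l] a by (simp add: cmean_def)
      moreover have "f x = spherical_wave l x" using True by (simp add: f_def wave_trunc_def)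
      ultimately show ?thesis by (simp add: power2_eq_square)
    qed (simp add: f_def wave_trunc_def)
  qed
  finally have 1: "(\<integral>p. g (X p) * f (fst p) \<partial>P) = spherical l a * trunc_mass l \<delta>" by (simp add: trunc_mass_def f_def)
  \<comment> \<open>\<open>D1\<close> and \<open>D2\<close> are the squared wave on the layers just
    outside and just inside the truncation circle. In the sum of their integrals the middle mass
    cancels.\<close>
  define D1 where "D1 = (\<lambda>x. (g x)\<^sup>2 - (f x)\<^sup>2)"
  define D2 where "D2 = (\<lambda>x. (f x)\<^sup>2 - (e x)\<^sup>2)"
  have D1: "integrable hyp_area D1" "D1 \<in> borel_measurable hyp_area" and D2: "integrable hyp_area D2" "D2 \<in> borel_measurable hyp_area"
    using F E G unfolding D1_def D2_def by auto
  have i1: "integrable P (\<lambda>p. D1 (X p))" and i2: "integrable P (\<lambda>p. D2 (fst p))"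
    unfolding P_def X_def integrable_hcirc_pairs[OF D1(2) a] integrable_fst_pairs[OF D2(2) a] using D1 D2 by auto
  have D1I: "(\<integral>p. D1 (X p) \<partial>P) = trunc_mass l (\<delta> / C) - trunc_mass l \<delta>"
    unfolding P_def X_def integral_hcirc_pairs[OF D1(2) a] using F G by (simp add: D1_def trunc_mass_def f_def g_def)
  have D2I: "(\<integral>p. D2 (fst p) \<partial>P) = trunc_mass l \<delta> - trunc_mass l (C * \<delta>)"
    unfolding P_def integral_fst_pairs[OF D2(2) a] using F E by (simp add: D2_def trunc_mass_def f_def e_def)
  have "\<bar>avg_form a f - spherical l a * trunc_mass l \<delta>\<bar> = \<bar>\<integral>p. f (X p) * f (fst p) - g (X p) * f (fst p) \<partial>P\<bar>"
    unfolding 1[symmetric] avg_form_def P_def[symmetric] using Bochner_Integration.integral_diff[OF jf ig] by (simp add: X_def)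
  also have "\<dots> \<le> (\<integral>p. \<bar>f (X p) * f (fst p) - g (X p) * f (fst p)\<bar> \<partial>P)" by (rule integral_abs_bound)
  also have "\<dots> \<le> (\<integral>p. (D1 (X p) + D2 (fst p)) / 2 \<partial>P)"
  proof (rule integral_mono)
    show "integrable P (\<lambda>p. \<bar>f (X p) * f (fst p) - g (X p) * f (fst p)\<bar>)"
      by (intro integrable_abs Bochner_Integration.integrable_diff jf ig)
    show "integrable P (\<lambda>p. (D1 (X p) + D2 (fst p)) / 2)" using i1 i2 by auto
    fix p assume "p \<in> space P"
    then have x: "norm (fst p) < 1" by (auto simp: P_def space_pair_measure)
    define h k where "h = 1 - (norm (X p))\<^sup>2" and "k = 1 - (norm (fst p))\<^sup>2"
    have hk: "k \<le> C * h" using hcirc_height(2)[OF x, of a "snd p"] by (simp add: C h_def k_def X_def)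
    have n1: "D1 (X p) \<ge> 0" and n2: "D2 (fst p) \<ge> 0"
      using mono by (auto simp: D1_def D2_def f_def g_def e_def wave_trunc_def)
    show "\<bar>f (X p) * f (fst p) - g (X p) * f (fst p)\<bar> \<le> (D1 (X p) + D2 (fst p)) / 2"
    proof (cases "\<delta> / C \<le> h \<and> h < \<delta> \<and> \<delta> \<le> k")
      case True
      then have "C * h < C * \<delta>" using C0 by simp
      then have "k < C * \<delta>" using hk by linarith
      then have "D1 (X p) = (spherical_wave l (X p))\<^sup>2" "D2 (fst p) = (spherical_wave l (fst p))\<^sup>2" "f (X p) = 0"
        "g (X p) = spherical_wave l (X p)" "f (fst p) = spherical_wave l (fst p)"
        using True by (auto simp: D1_def D2_def f_def g_def e_def wave_trunc_def h_def k_def)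
      moreover have "\<bar>u * v\<bar> \<le> (u\<^sup>2 + v\<^sup>2) / 2" for u v :: real
      proof -
        have "0 \<le> (\<bar>u\<bar> - \<bar>v\<bar>)\<^sup>2" by simp
        then show ?thesis by (simp add: power2_diff abs_mult)
      qed
      ultimately show ?thesis by simp
    next
      case False
      then have "f (X p) * f (fst p) - g (X p) * f (fst p) = 0"
        using mono by (auto simp: f_def g_def wave_trunc_def h_def k_def)
      then have z: "\<bar>f (X p) * f (fst p) - g (X p) * f (fst p)\<bar> = 0" by (simp only: abs_zero)
      show ?thesis unfolding z using n1 n2 by simp
    qed
  qed
  also have "\<dots> = (trunc_mass l (\<delta> / C) - trunc_mass l (C * \<delta>)) / 2"
    using i1 i2 by (simp add: D1I D2I)
  finally show ?thesis by (simp add: f_def)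
qed

text \<open>The truncated masses at heights \<open>C\<^bsup>-n\<^esup>\<close> are polynomially bounded in \<open>n\<close>, hence cannot grow by
  a fixed factor at every step; a height with small relative growth is used for the truncation.\<close>

lemma approximate_eigenfunction:
  assumes a: "a > 0" and e: "e > 0"
  shows "\<exists>u. real_L2 u \<and> (\<integral>x. (u x)\<^sup>2 \<partial>hyp_area) = 1 \<and> \<bar>avg_form a u - spherical l a\<bar> < e"
proof -
  define C where "C = 4 * (1 + a\<^sup>2)"
  have "4 * 1 \<le> C" unfolding C_def by (intro mult_left_mono) auto
  then have C: "C > 1" "C > 0" by auto
  \<comment> \<open>Dividing the height by \<open>C\<close> is one step outward by a full boundary
    layer. \<open>N 0\<close> belongs to height 1, that is to the centre alone, so positivity starts
    at index 1.\<close>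
  define N where "N = (\<lambda>n. trunc_mass l (1 / C ^ n))"
  have Npos: "N n > 0" if "n \<ge> 1" for n
    unfolding N_def using C that by (intro trunc_mass_pos) (auto intro: one_less_power)
  have Nle: "N n \<le> 8 * pi * (4 + real n * ln C) ^ 3" for n
  proof -
    have C1: "1 \<le> C ^ n" using C by simp
    have "N n \<le> 8 * pi * (3 + ln (1 + sqrt (1 / (1 / C ^ n) - 1))) ^ 3"
      unfolding N_def using C C1 by (intro trunc_mass_le) auto
    also have "\<dots> \<le> 8 * pi * (3 + (1 + real n * ln C)) ^ 3"
    proof (intro mult_left_mono power_mono add_left_mono)
      have "sqrt (C ^ n - 1) \<le> sqrt ((C ^ n)\<^sup>2)"
        using C1 self_le_power[OF C1, of 2] by (intro real_sqrt_le_mono) linarith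
      then have "1 + sqrt (C ^ n - 1) \<le> 2 * C ^ n" using C1 by simp
      moreover have "1 + sqrt (C ^ n - 1) > 0" using C1 by (intro add_pos_nonneg) auto
      ultimately have "ln (1 + sqrt (C ^ n - 1)) \<le> ln (2 * C ^ n)" by simp
      also have "\<dots> = ln 2 + real n * ln C" using C by (simp add: ln_mult ln_realpow)
      finally show "ln (1 + sqrt (1 / (1 / C ^ n) - 1)) \<le> 1 + real n * ln C" using ln_2_less_1 by simp
      show "0 \<le> 3 + ln (1 + sqrt (1 / (1 / C ^ n) - 1))" using C1 by (intro add_nonneg_nonneg) auto
    qed auto
    finally show ?thesis by (simp add: add.assoc[symmetric])
  qed
  have "\<exists>n. N (Suc (Suc n)) - N n < e * N (Suc n)"
  proof (rule ccontr)
    assume "\<nexists>n. N (Suc (Suc n)) - N n < e * N (Suc n)"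
    then have step: "N n + e * N (Suc n) \<le> N (Suc (Suc n))" for n by (metis add.commute le_diff_eq not_le)
    \<comment> \<open>Failure at every index, together with monotonicity of \<open>N\<close>, means
      growth by the factor \<open>1 + e\<close> in every two steps. The iteration starts at index 2
      and is compared with the positive \<open>N 1\<close>.\<close>
    have grow: "(1 + e) ^ k * N 1 \<le> N (2 * k + 2)" for k
    proof (induction k)
      case 0
      have "N 1 \<le> N 2"
      proof -
        have "1 / C\<^sup>2 \<le> 1 / C ^ 1" using C by (simp add: field_simps power2_eq_square)
        then show ?thesis unfolding N_def trunc_mass_def
          using wave_trunc_integrable(2)[of "1 / C ^ 1" l] wave_trunc_integrable(2)[of "1 / C\<^sup>2" l] C
          by (intro integral_mono) (auto simp: wave_trunc_def)
      qed
      then show ?case by (simp add: numeral_2_eq_2)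
    next
      case (Suc k)
      have m: "N (2 * k + 2) \<le> N (2 * k + 3)"
      proof -
        have "1 / C ^ (2 * k + 3) \<le> 1 / C ^ (2 * k + 2)" using C by (intro divide_left_mono power_increasing) auto
        then show ?thesis unfolding N_def trunc_mass_def
          using wave_trunc_integrable(2)[of "1 / C ^ (2 * k + 3)" l] wave_trunc_integrable(2)[of "1 / C ^ (2 * k + 2)" l] C
          by (intro integral_mono) (auto simp: wave_trunc_def)
      qed
      have "(1 + e) ^ Suc k * N 1 \<le> (1 + e) * N (2 * k + 2)" using Suc e by (simp add: mult.assoc)
      also have "\<dots> \<le> N (2 * k + 2) + e * N (2 * k + 3)" using m e by (simp add: algebra_simps)
      also have "\<dots> \<le> N (2 * Suc k + 2)" using step[of "2 * k + 2"] by (simp add: eval_nat_numeral)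
      finally show ?case .
    qed
    have lnC: "ln C > 0" using C by simp
    have "((\<lambda>k::nat. 8 * pi * (4 + (2 * real k + 2) * ln C) ^ 3 / (1 + e) ^ k) \<longlongrightarrow> 0) at_top"
      using lnC e by real_asymp
    from order_tendstoD(2)[OF this Npos[of 1]]
    obtain k where "8 * pi * (4 + (2 * real k + 2) * ln C) ^ 3 / (1 + e) ^ k < N 1"
      by (auto simp: eventually_sequentially)
    then have "8 * pi * (4 + (2 * real k + 2) * ln C) ^ 3 < (1 + e) ^ k * N 1" using e by (simp add: field_simps)
    also have "\<dots> \<le> 8 * pi * (4 + real (2 * k + 2) * ln C) ^ 3" using grow[of k] Nle[of "2 * k + 2"] by linarith
    finally show False by (simp add: add.commute)
  qed
  then obtain n where n: "N (Suc (Suc n)) - N n < e * N (Suc n)" by blast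
  define M where "M = N (Suc n)"
  have M: "M > 0" unfolding M_def by (rule Npos) simp
  define \<delta> where "\<delta> = 1 / C ^ Suc n"
  have d: "\<delta> > 0" using C by (simp add: \<delta>_def)
  have "\<bar>avg_form a (wave_trunc l \<delta>) - spherical l a * trunc_mass l \<delta>\<bar> \<le> (trunc_mass l (\<delta> / C) - trunc_mass l (C * \<delta>)) / 2"
    by (rule avg_form_wave_trunc[OF a d C_def])
  also have "trunc_mass l (\<delta> / C) = N (Suc (Suc n))" by (simp add: N_def \<delta>_def mult_ac)
  also have "trunc_mass l (C * \<delta>) = N n" using C by (simp add: N_def \<delta>_def)
  finally have b: "\<bar>avg_form a (wave_trunc l \<delta>) - spherical l a * M\<bar> < e * M"
    using n mult_pos_pos[OF e M] by (simp add: N_def \<delta>_def M_def)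
  define u where "u = (\<lambda>x. wave_trunc l \<delta> x / sqrt M)"
  have sq: "sqrt M * sqrt M = M" using M by simp
  have u2: "(u x)\<^sup>2 = (wave_trunc l \<delta> x)\<^sup>2 / M" for x using M by (simp add: u_def power_divide)
  have "real_L2 u" using wave_trunc_integrable[OF d, of l] unfolding real_L2_def u2 by (auto simp: u_def intro: borel_measurable_divide)
  moreover have "(\<integral>x. (u x)\<^sup>2 \<partial>hyp_area) = 1" unfolding u2 using M by (simp add: M_def N_def trunc_mass_def \<delta>_def)
  moreover have "\<bar>avg_form a u - spherical l a\<bar> < e"
  proof -
    have "avg_form a u = avg_form a (wave_trunc l \<delta>) / M"
      unfolding avg_form_def u_def using sq by (simp add: times_divide_times_eq)
    then have "avg_form a u - spherical l a = (avg_form a (wave_trunc l \<delta>) - spherical l a * M) / M" using M by (simp add: diff_divide_distrib)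
    then show ?thesis using b M by (simp add: abs_divide divide_less_eq)
  qed
  ultimately show ?thesis by blast
qed

section \<open>Supremum and infimum of the numerical range\<close>

lemma approximate_eigenfunction_avg_op:
  assumes d: "d > 0" and e: "e > 0"
  shows "\<exists>f\<in>{f \<in> L2_hyp. hyp_norm f = 1}. \<bar>Re (hyp_inner (avg_op d f) f) - spherical l (sinh (d / 2))\<bar> < e"
proof -
  have "sinh (d / 2) > 0" using d by simp
  then obtain u where u: "real_L2 u" "(\<integral>x. (u x)\<^sup>2 \<partial>hyp_area) = 1" "\<bar>avg_form (sinh (d / 2)) u - spherical l (sinh (d / 2))\<bar> < e"
    using approximate_eigenfunction[OF _ e] by blast
  define f where "f = (\<lambda>x. complex_of_real (u x))"
  have f: "f \<in> L2_hyp" using u(1) by (auto simp: L2_hyp_def real_L2_def f_def intro: borel_measurable_of_real)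
  moreover have "hyp_norm f = 1" using u(2) by (simp add: hyp_norm_def f_def)
  moreover have "Re (hyp_inner (avg_op d f) f) = avg_form (sinh (d / 2)) u"
    unfolding Re_hyp_inner_avg_op(3)[OF f d] by (simp add: f_def avg_form_def)
  ultimately show ?thesis using u(3) by (intro bexI[of _ f]) auto
qed

text \<open>An affine test of the numerical range: \<open>c1 = -1\<close> yields the upper bound by
  \<open>spherical 0\<close>, and \<open>c1 = 1\<close> the lower bound by the infimum over
  \<open>l\<close>.\<close>

lemma numerical_range_avg_op:
  assumes d: "d > 0" and f: "f \<in> L2_hyp" "hyp_norm f = 1" and pos: "\<And>l. 0 \<le> c1 * spherical l (sinh (d / 2)) + c2"
  shows "0 \<le> c1 * Re (hyp_inner (avg_op d f) f) + c2"
proof -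
  have a: "sinh (d / 2) > 0" using d by simp
  note R = Re_hyp_inner_avg_op[OF f(1) d]
  have "0 \<le> c1 * Re (hyp_inner (avg_op d f) f) + c2 * (hyp_norm f)\<^sup>2"
    using avg_form_nonneg[OF R(1) a pos] avg_form_nonneg[OF R(2) a pos] unfolding R(3,4) by (simp add: algebra_simps)
  then show ?thesis using f(2) by simp
qed

lemma num_sup_avg_op:
  assumes d: "d > 0"
  shows "num_sup (avg_op d) = spherical 0 (sinh (d / 2))"
proof -
  define S where "S = {f \<in> L2_hyp. hyp_norm f = 1}"
  have ub: "Re (hyp_inner (avg_op d f) f) \<le> spherical 0 (sinh (d / 2))" if "f \<in> S" for f
    using numerical_range_avg_op[OF d, of f "-1" "spherical 0 (sinh (d / 2))"] that spherical_abs_le_0[of _ "sinh (d / 2)"]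
    by (auto simp: S_def abs_le_iff)
  note ap = approximate_eigenfunction_avg_op[OF d, folded S_def]
  have ne: "S \<noteq> {}" using ap[of 1] by auto
  have bd: "bdd_above ((\<lambda>f. Re (hyp_inner (avg_op d f) f)) ` S)" using ub by (intro bdd_aboveI2)
  have "(SUP f\<in>S. Re (hyp_inner (avg_op d f) f)) = spherical 0 (sinh (d / 2))"
  proof (rule antisym)
    show "(SUP f\<in>S. Re (hyp_inner (avg_op d f) f)) \<le> spherical 0 (sinh (d / 2))" by (rule cSUP_least[OF ne ub])
    show "spherical 0 (sinh (d / 2)) \<le> (SUP f\<in>S. Re (hyp_inner (avg_op d f) f))"
    proof (rule field_le_epsilon)
      fix e :: real assume "e > 0"
      then obtain f where f: "f \<in> S" "\<bar>Re (hyp_inner (avg_op d f) f) - spherical 0 (sinh (d / 2))\<bar> < e" using ap by blast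
      then show "spherical 0 (sinh (d / 2)) \<le> (SUP f\<in>S. Re (hyp_inner (avg_op d f) f)) + e"
        using cSUP_upper[OF f(1) bd] by linarith
    qed
  qed
  then show ?thesis by (simp add: num_sup_def S_def)
qed

lemma num_inf_avg_op:
  assumes d: "d > 0"
  shows "num_inf (avg_op d) = (INF l. spherical l (sinh (d / 2)))"
proof -
  define S where "S = {f \<in> L2_hyp. hyp_norm f = 1}"
  define I where "I = (INF l. spherical l (sinh (d / 2)))"
  have I: "I \<le> spherical l (sinh (d / 2))" for l unfolding I_def by (rule cINF_lower[OF spherical_bdd_below]) simp
  have lb: "I \<le> Re (hyp_inner (avg_op d f) f)" if "f \<in> S" for f
    using numerical_range_avg_op[OF d, of f 1 "- I"] that I by (auto simp: S_def)
  note ap = approximate_eigenfunction_avg_op[OF d, folded S_def]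
  have ne: "S \<noteq> {}" using ap[of 1] by auto
  have bd: "bdd_below ((\<lambda>f. Re (hyp_inner (avg_op d f) f)) ` S)" using lb by (intro bdd_belowI2)
  have "(INF f\<in>S. Re (hyp_inner (avg_op d f) f)) = I"
  proof (rule antisym)
    show "I \<le> (INF f\<in>S. Re (hyp_inner (avg_op d f) f))" by (rule cINF_greatest[OF ne lb])
    have "(INF f\<in>S. Re (hyp_inner (avg_op d f) f)) \<le> spherical l (sinh (d / 2))" for l
    proof (rule field_le_epsilon)
      fix e :: real assume "e > 0"
      then obtain f where f: "f \<in> S" "\<bar>Re (hyp_inner (avg_op d f) f) - spherical l (sinh (d / 2))\<bar> < e" using ap by blast
      then show "(INF f\<in>S. Re (hyp_inner (avg_op d f) f)) \<le> spherical l (sinh (d / 2)) + e"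
        using cINF_lower[OF bd f(1)] by linarith
    qed
    then show "(INF f\<in>S. Re (hyp_inner (avg_op d f) f)) \<le> I" unfolding I_def by (intro cINF_greatest) auto
  qed
  then show ?thesis by (simp add: num_inf_def S_def I_def)
qed

theorem theorem6:
  shows "((\<lambda>d. 1 - num_sup (avg_op d) / num_inf (avg_op d)) \<longlongrightarrow> 1 - 1 / sinc_min) at_top
       \<and> \<bar>(1 - 1 / sinc_min) - 5.6\<bar> < 0.05"
proof
  have "sinc_min \<noteq> 0" using sinc_min_bounds by auto
  from spherical_ratio_limit[OF this]
  show "((\<lambda>d. 1 - num_sup (avg_op d) / num_inf (avg_op d)) \<longlongrightarrow> 1 - 1 / sinc_min) at_top"
  proof (rule Lim_transform_eventually)
    show "\<forall>\<^sub>F d in at_top. 1 - spherical 0 (sinh (d / 2)) / (INF l. spherical l (sinh (d / 2))) = 1 - num_sup (avg_op d) / num_inf (avg_op d)"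
      using eventually_gt_at_top[of 0] by eventually_elim (simp add: num_sup_avg_op num_inf_avg_op)
  qed
  show "\<bar>(1 - 1 / sinc_min) - 5.6\<bar> < 0.05" by (rule sinc_min_value)
qed

end
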